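(* Let $\Gamma$, $H$, $\mathcal{P}$, $v$, $N(p,X)$, $M(p,X)$ be as in the context, fix $p\in\mathcal{H}$ and set $E(p,X)=N(p,X)-M(p,X)$. Let $X>2$ and $X_1,\dots,X_R\in[X,2X]$ with $|X_k-X_l|>\epsilon>0$ for all $k\neq l$. Suppose $R\epsilon\gg X$ and $R>X^{2/3}$. Then \[\frac1R\sum_{k=1}^R|E(p,X_k)|^2\ll X^{2+2/3}\log X,\] and consequently \[\frac1X\int_X^{2X}|E(p,x)|^2\,dx\ll X^{2+2/3}\log X.\]
   Context: $\Gamma$ is a cocompact discrete subgroup of $\mathrm{PSL}_2(\mathbb{C})$ acting on the upper half-space $\mathcal{H}=\{(x_1,x_2,y):y>0\}$ (hyperbolic $3$-space, volume element $d\mu=dx_1dx_2dy/y^3$, Laplacian $\Delta=y^2(\partial_{x_1}^2+\partial_{x_2}^2+\partial_y^2)-y\partial_y$). $\mathcal{P}=\{x_2=0\}$, $H=\Gamma\cap\mathrm{Stab}_{\mathrm{PSL}_2(\mathbb{C})}(\mathcal{P})$, $v(p)=\arctan(x_2/y)$. $N(p,X)=\#\{\gamma\in H\backslash\Gamma:(\cos v(\gamma p))^{-1}\le X\}$. $\{u_j\}$ is a complete orthonormal system of real-valued eigenfunctions of $-\Delta$ on $L^2(\Gamma\backslash\mathcal{H})$ with eigenvalues $\lambda_j=s_j(2-s_j)$; with $x=x_1$, $u=\log\sqrt{x_2^2+y^2}$, $\hat u_j=\int_{H\backslash\mathcal{P}}u_j(x,u,0)e^{-u}\,du\,dx$ (integral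 over a fundamental domain of $H$ in $\mathcal{P}$). $M(p,X)=\frac{\mathrm{vol}(H\backslash\mathcal{P})}{\mathrm{vol}(\Gamma\backslash\mathcal{H})}X^2+\sum_{1<s_j<2}\frac{2^{s_j-1}}{s_j}\hat u_ju_j(p)X^{s_j}$. Implied constants depend on $\Gamma$, $p$ and the implied constant in $R\epsilon\gg X$. *)

theory Defs
  imports "HOL-Analysis.Analysis" "HOL-Algebra.Coset"
begin

definition SL2C :: "(complex^2^2) monoid" where
  "SL2C = \<lparr>carrier = {A. det A = 1}, mult = (**), one = mat 1\<rparr>"

definition PSL2C :: "(complex^2^2) set monoid" where
  "PSL2C = SL2C Mod {mat 1, - mat 1}"

type_synonym point = "real \<times> real \<times> real"

definition H3 :: "point set" where
  "H3 = {(x1, x2, y). y > 0}"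

text \<open>
  Poincare extension of \<open>z \<mapsto> (a z + b) / (c z + d)\<close> for a matrix of determinant 1, i.e. the map
  \<open>P \<mapsto> (a P + b) (c P + d)\<^sup>-\<^sup>1\<close> on quaternions \<open>P = x1 + x2 i + y j\<close>.
\<close>
definition moebius :: "complex^2^2 \<Rightarrow> point \<Rightarrow> point" where
  "moebius A = (\<lambda>(x1, x2, y).
     let a = A $ 1 $ 1; b = A $ 1 $ 2; c = A $ 2 $ 1; d = A $ 2 $ 2;
         z = Complex x1 x2;
         n = (cmod (c * z + d))\<^sup>2 + (cmod c)\<^sup>2 * y\<^sup>2;
         w = ((a * z + b) * cnj (c * z + d) + a * cnj c * of_real (y\<^sup>2)) / of_real n
     in (Re w, Im w, y / n))"

text \<open>Elements of \<open>PSL2C\<close> are sets \<open>{A, - A}\<close>, and \<open>A\<close> and \<open>- A\<close> act in the same way.\<close>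
definition act :: "(complex^2^2) set \<Rightarrow> point \<Rightarrow> point" where
  "act \<gamma> = moebius (SOME A. A \<in> \<gamma>)"

text \<open>
  Since \<open>SL\<^sub>2(\<complex>) \<rightarrow> PSL\<^sub>2(\<complex>)\<close> is a two-sheeted covering, a subset of \<open>PSL\<^sub>2(\<complex>)\<close> is discrete
  iff its preimage, as a set of matrices, is.
\<close>
definition discrete_subgroup :: "(complex^2^2) set set \<Rightarrow> bool" where
  "discrete_subgroup \<Gamma> \<longleftrightarrow> subgroup \<Gamma> PSL2C \<and> discrete (\<Union>\<Gamma>)"

definition cocompact :: "(complex^2^2) set set \<Rightarrow> bool" where
  "cocompact \<Gamma> \<longleftrightarrow> (\<exists>K. compact K \<and> K \<subseteq> H3 \<and> (\<Union>\<gamma>\<in>\<Gamma>. act \<gamma> ` K) = H3)"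

definition plane :: "point set" where
  "plane = {(x1, x2, y). x2 = 0 \<and> y > 0}"

definition plane_stab :: "(complex^2^2) set set \<Rightarrow> (complex^2^2) set set" where
  "plane_stab \<Gamma> = \<Gamma> \<inter> {\<gamma> \<in> carrier PSL2C. act \<gamma> ` plane = plane}"

definition angle :: "point \<Rightarrow> real" where
  "angle = (\<lambda>(x1, x2, y). arctan (x2 / y))"

definition count_N :: "(complex^2^2) set set \<Rightarrow> point \<Rightarrow> real \<Rightarrow> nat" where
  "count_N \<Gamma> p X =
     card {plane_stab \<Gamma> #>\<^bsub>PSL2C\<^esub> \<gamma> |\<gamma>. \<gamma> \<in> \<Gamma> \<and> inverse (cos (angle (act \<gamma> p))) \<le> X}"

definition hyp_vol :: "point measure" where
  "hyp_vol = density lborel (\<lambda>(x1, x2, y). if y > 0 then ennreal (1 / y ^ 3) else 0)"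

text \<open>
  The area measure \<open>e\<^sup>-\<^sup>u du dx\<close> of the plane, in the coordinates \<open>x = x1\<close>,
  \<open>u = log (sqrt (x2\<^sup>2 + y\<^sup>2))\<close>, \<open>v = 0\<close>; these coordinates belong to the point \<open>(x, 0, e\<^sup>u)\<close>.
\<close>
definition hyp_area :: "point measure" where
  "hyp_area = distr (density lborel (\<lambda>(x, u). ennreal (exp (- u)))) borel
                (\<lambda>(x::real, u::real). (x, 0, exp u))"

definition fundamental_domain ::
    "(complex^2^2) set set \<Rightarrow> point set \<Rightarrow> point measure \<Rightarrow> point set \<Rightarrow> bool" where
  "fundamental_domain G S \<mu> F \<longleftrightarrow>
     F \<in> sets \<mu> \<and> F \<subseteq> S \<and> (\<Union>\<gamma>\<in>G. act \<gamma> ` F) = S \<and>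
     (\<forall>\<gamma>\<in>G. \<gamma> \<noteq> \<one>\<^bsub>PSL2C\<^esub> \<longrightarrow> F \<inter> act \<gamma> ` F \<in> null_sets \<mu>)"

definition partial :: "point \<Rightarrow> (point \<Rightarrow> real) \<Rightarrow> point \<Rightarrow> real" where
  "partial e f q = frechet_derivative f (at q) e"

definition C2_on :: "point set \<Rightarrow> (point \<Rightarrow> real) \<Rightarrow> bool" where
  "C2_on S f \<longleftrightarrow> f differentiable_on S \<and>
     (\<forall>e\<in>Basis. partial e f differentiable_on S \<and>
        (\<forall>e'\<in>Basis. continuous_on S (partial e' (partial e f))))"

definition laplacian :: "(point \<Rightarrow> real) \<Rightarrow> point \<Rightarrow> real" where
  "laplacian f = (\<lambda>(x1, x2, y).
     y\<^sup>2 * (partial (1, 0, 0) (partial (1, 0, 0) f) (x1, x2, y)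
          + partial (0, 1, 0) (partial (0, 1, 0) f) (x1, x2, y)
          + partial (0, 0, 1) (partial (0, 0, 1) f) (x1, x2, y))
     - y * partial (0, 0, 1) f (x1, x2, y))"

definition invariant :: "(complex^2^2) set set \<Rightarrow> (point \<Rightarrow> real) \<Rightarrow> bool" where
  "invariant \<Gamma> f \<longleftrightarrow> (\<forall>\<gamma>\<in>\<Gamma>. \<forall>q\<in>H3. f (act \<gamma> q) = f q)"

definition eigenfunction :: "(complex^2^2) set set \<Rightarrow> real \<Rightarrow> (point \<Rightarrow> real) \<Rightarrow> bool" where
  "eigenfunction \<Gamma> lam f \<longleftrightarrow>
     invariant \<Gamma> f \<and> C2_on H3 f \<and> (\<forall>q\<in>H3. - laplacian f q = lam * f q)"

text \<open>
  \<open>L\<^sup>2(\<Gamma>\<setminus>H3)\<close> consists of the invariant functions that are square integrable over a fundamental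
  domain \<open>F\<close>. As the \<open>u j\<close> are real-valued, completeness need only be tested on real functions.
  The parameter \<open>s j\<close> is normalised by \<open>Re (s j) \<ge> 1\<close>, so \<open>s j\<close> lies on \<open>[1, 2]\<close> or on the
  line \<open>Re (s j) = 1\<close>.
\<close>
definition eigen_system ::
    "(complex^2^2) set set \<Rightarrow> point set \<Rightarrow> (nat \<Rightarrow> point \<Rightarrow> real) \<Rightarrow> (nat \<Rightarrow> real) \<Rightarrow>
     (nat \<Rightarrow> complex) \<Rightarrow> bool" where
  "eigen_system \<Gamma> F u lam s \<longleftrightarrow>
     (\<forall>j. eigenfunction \<Gamma> (lam j) (u j)) \<and>
     (\<forall>j. complex_of_real (lam j) = s j * (2 - s j) \<and> Re (s j) \<ge> 1) \<and>
     (\<forall>i j. (LINT q:F|hyp_vol. u i q * u j q) = (if i = j then 1 else 0)) \<and>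
     (\<forall>f. f \<in> borel_measurable hyp_vol \<and> invariant \<Gamma> f \<and>
          set_integrable hyp_vol F (\<lambda>q. (f q)\<^sup>2) \<and>
          (\<forall>j. (LINT q:F|hyp_vol. f q * u j q) = 0)
        \<longrightarrow> (AE q in hyp_vol. f q = 0))"

definition period :: "point set \<Rightarrow> (point \<Rightarrow> real) \<Rightarrow> real" where
  "period D f = (LINT q:D|hyp_area. f q)"

text \<open>\<open>F\<close> and \<open>D\<close> are fundamental domains of \<open>\<Gamma>\<close> in \<open>H3\<close> and of \<open>plane_stab \<Gamma>\<close> in \<open>plane\<close>.\<close>
definition main_M ::
    "point set \<Rightarrow> point set \<Rightarrow> (nat \<Rightarrow> point \<Rightarrow> real) \<Rightarrow> (nat \<Rightarrow> complex) \<Rightarrow> point \<Rightarrow> real \<Rightarrow> real" where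
  "main_M F D u s p X =
     measure hyp_area D / measure hyp_vol F * X\<^sup>2
     + (\<Sum>j | s j \<in> \<real> \<and> 1 < Re (s j) \<and> Re (s j) < 2.
          2 powr (Re (s j) - 1) / Re (s j) * period D (u j) * u j p * X powr Re (s j))"

definition err_E ::
    "(complex^2^2) set set \<Rightarrow> point set \<Rightarrow> point set \<Rightarrow> (nat \<Rightarrow> point \<Rightarrow> real) \<Rightarrow>
     (nat \<Rightarrow> complex) \<Rightarrow> point \<Rightarrow> real \<Rightarrow> real" where
  "err_E \<Gamma> F D u s p X = real (count_N \<Gamma> p X) - main_M F D u s p X"

end

theory Submission
  imports Defs
begin

text \<open>
  The plane meets the ball \<open>wd z q \<le> W\<close> in area \<open>2 \<pi> (W / tau q - 1)\<close>. Hence integrals of automorphic ball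
  kernels over \<open>D\<close> are sums over the cosets of \<open>H\<close>, and a combination of two of them lies between the counts at
  \<open>Y\<close> and \<open>Y + \<delta>\<close>. A ball of radius \<open>\<eta>\<close> around \<open>p\<close> smooths it further, and Parseval's identity expands the result,
  because the mean of an eigenfunction over a ball depends only on the eigenvalue and the value at the centre.
  With \<open>\<delta> \<approx> X\<^sup>1\<^sup>/\<^sup>3\<close> and \<open>\<eta> \<approx> X\<^sup>-\<^sup>2\<^sup>/\<^sup>3\<close> the small eigenvalues give the main term up to
  \<open>O(X\<^sup>4\<^sup>/\<^sup>3)\<close>. The others, \<open>lam j = 1 + t\<^sub>j\<^sup>2\<close>, form a trigonometric sum in \<open>arcosh Y\<close>; its mean square is
  controlled by the local bound \<open>n\<^sup>2\<close> for the sum of \<open>u j p\<^sup>2\<close> over \<open>n \<le> t\<^sub>j < n + 1\<close> and by Bessel's inequality for the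
  periods. As the count is monotone, the error at \<open>x\<close> is bounded by the sum at every point of a short interval to
  the right or to the left of \<open>x\<close>, and for separated \<open>x\<close> these intervals are disjoint.
\<close>

text \<open>The exponent is a balance. Averaging moves the radius by about
  \<open>\<delta> + X \<eta>\<close>, hence the main term by \<open>X\<close> times that; the
  oscillating part has mean square about \<open>X^2 / \<eta>\<close>. With
  \<open>\<eta> = \<delta> / X\<close> the two squares agree for \<open>\<delta> = X^(1/3)\<close>,
  at \<open>X^(8/3)\<close>, and neither loses a logarithm. The ball around \<open>p\<close> is more
  than a smoothing: completeness of the \<open>u j\<close> yields an identity for a pairing of two
  functions, not convergence at a point, and its radius also makes the weighted sum of squared
  periods finite, at the cost \<open>1 / \<eta>\<close>. Beyond completeness no theory of the
  Laplacian is taken for granted. That eigenvalues are non-negative, that 0 is simple, that few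
  eigenvalues are small and that values at a point are bounded on average all come from the ball
  means, applied to suitable combinations of balls. The constant has to serve all choices of
  \<open>F\<close>, \<open>D\<close>, \<open>u\<close> at once. Hence the bounds are phrased through
  orbit counts of \<open>Ga\<close>, uniform by cocompactness, and through the area of
  \<open>D\<close>, which is shown not to depend on \<open>D\<close>.\<close>

lemmas integral_cong' = Bochner_Integration.integral_cong[OF refl]
lemmas real_vector_deriv = has_real_derivative_iff_has_vector_derivative
lemmas ftc = fundamental_theorem_of_calculus

abbreviation ginv :: "(complex^2^2) set => (complex^2^2) set" where
 "ginv == m_inv PSL2C"

section \<open>Hyperbolic space and the action of \<open>PSL\<^sub>2(\<complex>)\<close>\<close>

text \<open>The hyperbolic cosine of the distance. Keeping the cosine instead of the distance makes
  balls, isometries and derivatives rational in the coordinates.\<close>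

definition wd :: "point => point => real" where
 "wd = (%(a1, a2, b) (x1, x2, y). ((x1 - a1)^2 + (x2 - a2)^2 + b^2 + y^2) / (2 * b * y))"

abbreviation ht :: "point => real" where
 "ht q \<equiv> snd (snd q)"

lemma H3_iff: "q : H3 \<longleftrightarrow> ht q > 0" by (auto simp: H3_def split: prod.splits)

lemma open_H3: "open H3" proof -
 have "H3 = {q. 0 < ht q}" using H3_iff by auto
 moreover have "open {q::point. 0 < ht q}" by (intro open_Collect_less continuous_intros)
 ultimately show ?thesis by simp
qed

lemma norm_point: "(norm (q::point))^2 = (fst q)^2 + (fst (snd q))^2 + (ht q)^2" by (cases q) (auto simp: norm_Pair)

lemma wd_eq:
 assumes "p : H3" "q : H3" shows "wd p q = 1 + (norm (p - q))^2 / (2 * ht p * ht q)" proof -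
 obtain a1 a2 b where p: "p = (a1, a2, b)" by (cases p)
 obtain x1 x2 y where q: "q = (x1, x2, y)" by (cases q)
 have pos: "b > 0" "y > 0" using assms by (auto simp: p q H3_def)
 have n: "(norm (p - q))^2 = (a1 - x1)^2 + (a2 - x2)^2 + (b - y)^2" by (subst norm_point) (simp add: p q)
 show ?thesis unfolding n using pos by (simp add: p q wd_def field_simps power2_eq_square)
qed

lemma norm_diff_wd:
 assumes "p : H3" "q : H3" shows "(norm (p - q))^2 = 2 * ht p * ht q * (wd p q - 1)"
 using assms by (simp add: wd_eq H3_iff)

lemma wd_ge_1: "p : H3 ==> q : H3 ==> 1 <= wd p q" by (simp add: wd_eq H3_iff)

lemma wd_commute: "wd p q = wd q p" by (cases p; cases q) (auto simp: wd_def power2_commute algebra_simps)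

lemma wd_self: "p : H3 ==> wd p p = 1" by (simp add: wd_eq)

lemma ht_le_wd:
 assumes "p : H3" "q : H3" shows "ht p <= 2 * wd p q * ht q" proof -
 obtain a1 a2 b where p: "p = (a1, a2, b)" by (cases p)
 obtain x1 x2 y where q: "q = (x1, x2, y)" by (cases q)
 have pos: "b > 0" "y > 0" using assms by (auto simp: p q H3_def)
 have "b^2 <= (x1 - a1)^2 + (x2 - a2)^2 + b^2 + y^2" by simp
 hence "b * b <= (2 * b * y) * wd p q" using pos by (simp add: wd_def p q power2_eq_square)
 thus ?thesis using pos by (simp add: p q mult.assoc mult.commute mult.left_commute)
qed

text \<open>The Euclidean triangle inequality through \<open>norm_diff_wd\<close>, with heights
  compared by \<open>ht_le_wd\<close>. The lossy factor 8 is harmless: the bound only serves to see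
  that bounded distances compose to bounded distances.\<close>

lemma wd_quasi_triangle:
 assumes "p : H3" "q : H3" "r : H3" shows "wd p r <= 8 * wd p q * wd q r" proof -
 have pos: "ht p > 0" "ht q > 0" "ht r > 0" using assms by (auto simp: H3_iff)
 define A where "A = wd p q"
 define B where "B = wd q r"
 have A: "A >= 1" and B: "B >= 1" using assms wd_ge_1 by (auto simp: A_def B_def)
 have "norm (p - r) <= norm (p - q) + norm (q - r)" using norm_triangle_ineq[of "p - q" "q - r"] by simp
 hence "(norm (p - r))^2 <= (norm (p - q) + norm (q - r))^2" by (simp add: power_mono)
 also have "... <= 2 * (norm (p - q))^2 + 2 * (norm (q - r))^2"
  using sum_squares_bound[of "norm (p - q)" "norm (q - r)"] by (simp add: power2_sum)
 also have "... = 4 * ht q * (ht p * (A - 1) + ht r * (B - 1))"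
  using assms by (simp add: norm_diff_wd A_def B_def algebra_simps)
 finally have 1: "2 * ht p * ht r * (wd p r - 1) <= 4 * ht q * (ht p * (A - 1) + ht r * (B - 1))"
  using assms by (simp add: norm_diff_wd)
 have qr: "ht q <= 2 * B * ht r" and qp: "ht q <= 2 * A * ht p"
  using ht_le_wd[of q r] ht_le_wd[of q p] assms by (auto simp: A_def B_def wd_commute)
 have "ht q * (ht p * (A - 1)) <= (2 * B * ht r) * (ht p * (A - 1))" using qr A pos by (intro mult_right_mono) auto
 moreover have "ht q * (ht r * (B - 1)) <= (2 * A * ht p) * (ht r * (B - 1))"
  using qp B pos by (intro mult_right_mono) auto
 ultimately have "2 * ht p * ht r * (wd p r - 1) \<le>
  4 * ((2 * B * ht r) * (ht p * (A - 1)) + (2 * A * ht p) * (ht r * (B - 1)))" using 1 by (simp add: algebra_simps)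
 also have "... = (2 * ht p * ht r) * (4 * B * (A - 1) + 4 * A * (B - 1))" by (simp add: algebra_simps)
 finally have "wd p r - 1 <= 4 * B * (A - 1) + 4 * A * (B - 1)" using pos by (simp add: mult_le_cancel_left_pos)
 also have "... <= 8 * A * B - 1" using A B by (simp add: algebra_simps)
 finally show ?thesis by (simp add: A_def B_def)
qed

text \<open>The Hermitian matrix \<open>[[qa q, qb q], [cnj (qb q), qc q]]\<close> of determinant 1 represents \<open>q\<close>;
 \<open>A\<close> acts on it by \<open>Q \<mapsto> A Q A\<^sup>*\<close>, and \<open>wd\<close> is the polarised determinant.\<close>

definition qb :: "point => complex" where
 "qb = (%(x1, x2, y). Complex x1 x2 / of_real y)"
definition qc :: "point => complex" where
 "qc = (%(x1, x2, y). 1 / of_real y)"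
definition qa :: "point => complex" where
 "qa = (%(x1, x2, y). of_real ((x1^2 + x2^2 + y^2) / y))"

text \<open>Polarised multiplicativity of the determinant of a triple matrix product. The conjugate
  entries are independent variables \<open>a'\<close>, \<open>b'\<close>, and so on, which makes it
  a polynomial identity over any commutative ring.\<close>

lemma herm_det_polar:
 fixes a b c d :: "'a::comm_ring_1" shows "(a*al*a'+a*be*b'+b*be'*a'+b*ga*b')*(c*al2*c'+c*be2*d'+d*be2'*c'+d*ga2*d')
  + (a*al2*a'+a*be2*b'+b*be2'*a'+b*ga2*b')*(c*al*c'+c*be*d'+d*be'*c'+d*ga*d')
  - (a*al*c'+a*be*d'+b*be'*c'+b*ga*d')*(c*al2*a'+c*be2*b'+d*be2'*a'+d*ga2*b')
  - (a*al2*c'+a*be2*d'+b*be2'*c'+b*ga2*d')*(c*al*a'+c*be*b'+d*be'*a'+d*ga*b')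
 = (a*d-b*c)*(a'*d'-b'*c')*(al*ga2+al2*ga-be*be2'-be2*be')" by (simp add: algebra_simps)

lemma herm_det:
 fixes a b c d :: "'a::comm_ring_1" shows "(a*al*a'+a*be*b'+b*be'*a'+b*ga*b')*(c*al*c'+c*be*d'+d*be'*c'+d*ga*d')
  - (a*al*c'+a*be*d'+b*be'*c'+b*ga*d')*(c*al*a'+c*be*b'+d*be'*a'+d*ga*b')
 = (a*d-b*c)*(a'*d'-b'*c')*(al*ga-be*be')" by (simp add: algebra_simps)

lemma q_det: "q : H3 ==> qa q * qc q - qb q * cnj (qb q) = 1"
 by (cases q) (auto simp: qa_def qb_def qc_def H3_def complex_eq_iff power2_eq_square field_simps)

lemma qc_nz: "q : H3 ==> qc q ~= 0" by (cases q) (auto simp: qc_def H3_def)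

lemma cnj_qac: "cnj (qa q) = qa q" "cnj (qc q) = qc q" by (cases q; auto simp: qa_def qc_def)+

lemma wd_q:
 assumes "p : H3" "q : H3"
 shows "complex_of_real (2 * wd p q) = qa p * qc q + qa q * qc p - qb p * cnj (qb q) - qb q * cnj (qb p)" using assms
 by (cases p; cases q)
  (auto simp: qa_def qb_def qc_def H3_def wd_def complex_eq_iff power2_eq_square field_simps)

lemma q_eqI:
 assumes "p : H3" "q : H3" "qb p = qb q" "qc p = qc q" shows "p = q"
 using assms by (cases p; cases q) (auto simp: qb_def qc_def H3_def complex_eq_iff)

definition SL2 :: "(complex^2^2) set" where
 "SL2 = {A. det A = 1}"

lemma SL2_det: "A : SL2 ==> A$1$1 * A$2$2 - A$1$2 * A$2$1 = 1" by (simp add: SL2_def det_2)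

lemma moebius_coords:
 fixes A :: "complex^2^2" assumes A: "A : SL2" and q: "q : H3"
 defines "a \<equiv> A$1$1" and "b \<equiv> A$1$2" and "c \<equiv> A$2$1" and "d \<equiv> A$2$2"
 shows "moebius A q : H3"
  and "qc (moebius A q) = c * qa q * cnj c + c * qb q * cnj d + d * cnj (qb q) * cnj c + d * qc q * cnj d"
  and "qb (moebius A q) = a * qa q * cnj c + a * qb q * cnj d + b * cnj (qb q) * cnj c + b * qc q * cnj d"
  and "qa (moebius A q) = a * qa q * cnj a + a * qb q * cnj b + b * cnj (qb q) * cnj a + b * qc q * cnj b" proof -
 obtain x1 x2 y where qe: "q = (x1, x2, y)" by (cases q)
 have y: "y > 0" using q by (simp add: qe H3_def)
 define z where "z = Complex x1 x2"
 define n where "n = (cmod (c * z + d))^2 + (cmod c)^2 * y^2"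
 define w where "w = ((a * z + b) * cnj (c * z + d) + a * cnj c * of_real (y^2)) / of_real n"
 have det: "a * d - b * c = 1" using SL2_det[OF A] by (simp add: a_def b_def c_def d_def)
 have n: "n > 0" proof (cases "c = 0")
  case True
  hence "d ~= 0" using det by auto
  thus ?thesis using True by (simp add: n_def)
 next
  case False
  thus ?thesis using y by (simp add: n_def add_nonneg_pos)
 qed
 have m: "moebius A q = (Re w, Im w, y / n)"
  by (simp add: moebius_def qe Let_def a_def b_def c_def d_def z_def n_def w_def)
 show H: "moebius A q : H3" using y n by (simp add: m H3_def)
 have nc: "complex_of_real n = (c * z + d) * cnj (c * z + d) + c * cnj c * of_real y * of_real y"
  unfolding n_def of_real_add of_real_mult complex_norm_square by (simp add: power2_eq_square)
 have qaq: "qa q = (z * cnj z + of_real y * of_real y) / of_real y"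
  by (simp add: qa_def qe z_def complex_eq_iff power2_eq_square)
 have qbq: "qb q = z / of_real y" and qcq: "qc q = 1 / of_real y" by (simp_all add: qb_def qc_def qe z_def)
 have qcm: "qc (moebius A q) = of_real n / of_real y" by (simp add: m qc_def)
 have qbm: "qb (moebius A q) = ((a * z + b) * cnj (c * z + d) + a * cnj c * of_real y * of_real y) / of_real y"
 proof -
  have "qb (moebius A q) = w * of_real n / of_real y" using n y by (simp add: m qb_def)
  moreover have "w * of_real n = (a * z + b) * cnj (c * z + d) + a * cnj c * of_real y * of_real y"
  using n by (simp add: w_def power2_eq_square)
  ultimately show ?thesis by simp
 qed
 have yc: "complex_of_real y ~= 0" using y by simp
 show C: "qc (moebius A q) = c * qa q * cnj c + c * qb q * cnj d + d * cnj (qb q) * cnj c + d * qc q * cnj d"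
  unfolding qcm nc qaq qbq qcq using yc by (simp add: field_simps)
 show B: "qb (moebius A q) = a * qa q * cnj c + a * qb q * cnj d + b * cnj (qb q) * cnj c + b * qc q * cnj d"
  unfolding qbm qaq qbq qcq using yc by (simp add: field_simps)
 have Bc: "cnj (qb (moebius A q)) = c * qa q * cnj a + c * qb q * cnj b + d * cnj (qb q) * cnj a + d * qc q * cnj b"
  unfolding B by (simp add: cnj_qac algebra_simps)
 \<comment> \<open>\<open>R\<close> is the expected upper left entry. It satisfies the same
   determinant relation as \<open>qa (moebius A q)\<close>, and \<open>qc\<close> does not vanish,
   so the two agree without an expansion of \<open>qa\<close>.\<close>
 define R where "R = a * qa q * cnj a + a * qb q * cnj b + b * cnj (qb q) * cnj a + b * qc q * cnj b"
 have det': "cnj a * cnj d - cnj b * cnj c = 1" using arg_cong[OF det, of cnj] by simp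
 have "R * qc (moebius A q) - qb (moebius A q) * cnj (qb (moebius A q)) = 1" unfolding R_def Bc unfolding B C
  using herm_det[of a "qa q" "cnj a" "qb q" "cnj b" b "cnj (qb q)" "qc q" c "cnj c" "cnj d" d]
  by (simp add: det det' q_det[OF q])
 hence "R * qc (moebius A q) = qa (moebius A q) * qc (moebius A q)" using q_det[OF H] by (simp add: algebra_simps)
 thus "qa (moebius A q) = a * qa q * cnj a + a * qb q * cnj b + b * cnj (qb q) * cnj a + b * qc q * cnj b"
  using qc_nz[OF H] by (simp add: R_def)
qed

lemma moebius_wd:
 assumes A: "A : SL2" and p: "p : H3" and q: "q : H3" shows "wd (moebius A p) (moebius A q) = wd p q" proof -
 note cp = moebius_coords[OF A p] and cq = moebius_coords[OF A q]
 let ?a = "A$1$1" and ?b = "A$1$2" and ?c = "A$2$1" and ?d = "A$2$2"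
 have det: "?a * ?d - ?b * ?c = 1" by (rule SL2_det[OF A])
 have det': "cnj ?a * cnj ?d - cnj ?b * cnj ?c = 1" using arg_cong[OF det, of cnj] by simp
 have B: "cnj (qb (moebius A q)) = ?c * qa q * cnj ?a + ?c * qb q * cnj ?b + ?d * cnj (qb q) * cnj ?a + ?d * qc q * cnj ?b"
  if "q : H3" for q unfolding moebius_coords(3)[OF A that] by (simp add: cnj_qac algebra_simps)
 have "complex_of_real (2 * wd (moebius A p) (moebius A q)) = complex_of_real (2 * wd p q)"
  unfolding wd_q[OF cp(1) cq(1)] wd_q[OF p q] unfolding B[OF p] B[OF q] unfolding cp(2-4) cq(2-4)
  using herm_det_polar[of ?a "qa p" "cnj ?a" "qb p" "cnj ?b" ?b "cnj (qb p)" "qc p" ?c "qa q" "cnj ?c"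
  "qb q" "cnj ?d" ?d "cnj (qb q)" "qc q"] by (simp add: det det')
 thus ?thesis by (simp only: of_real_eq_iff mult_cancel_left) simp
qed

lemma SL2_mult: "A : SL2 ==> B : SL2 ==> A ** B : SL2" by (simp add: SL2_def det_mul)

text \<open>\<open>qb\<close> and \<open>qc\<close> determine a point, so it is enough to compare
  these two entries of the Hermitian matrices, where both sides are the same matrix product.\<close>

lemma moebius_mult:
 assumes A: "A : SL2" and B: "B : SL2" and q: "q : H3" shows "moebius (A ** B) q = moebius A (moebius B q)" proof -
 note AB = SL2_mult[OF A B]
 note cb = moebius_coords[OF B q]
 note ca = moebius_coords[OF A cb(1)]
 note cab = moebius_coords[OF AB q]
 have BB: "cnj (qb (moebius B q)) = B$2$1 * qa q * cnj (B$1$1) + B$2$1 * qb q * cnj (B$1$2)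
  + B$2$2 * cnj (qb q) * cnj (B$1$1) + B$2$2 * qc q * cnj (B$1$2)"
  unfolding cb(3) by (simp add: cnj_qac algebra_simps)
 show ?thesis proof (rule q_eqI[OF cab(1) ca(1)])
  show "qb (moebius (A ** B) q) = qb (moebius A (moebius B q))" unfolding cab(3) ca(3) BB unfolding cb(2-4)
  by (simp add: matrix_matrix_mult_def sum_2 algebra_simps)
  show "qc (moebius (A ** B) q) = qc (moebius A (moebius B q))" unfolding cab(2) ca(2) BB unfolding cb(2-4)
  by (simp add: matrix_matrix_mult_def sum_2 algebra_simps)
 qed
qed

lemma uminus_SL2: "A : SL2 ==> - A : SL2" by (simp add: SL2_def det_2)

lemma moebius_mat1: "q : H3 ==> moebius (mat 1) q = q" by (cases q) (simp add: moebius_def mat_def)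

lemma moebius_uminus: "moebius (- A) q = moebius A q" proof -
 have "cmod (- (A$2$1 * z) - A$2$2) = cmod (A$2$1 * z + A$2$2)" for z
  by (metis minus_add_distrib norm_minus_cancel diff_conv_add_uminus)
 moreover have "(- (A$1$1 * z) - A$1$2) * (- (cnj (A$2$1) * w) - cnj (A$2$2))
  = (A$1$1 * z + A$1$2) * (cnj (A$2$1) * w + cnj (A$2$2))" for z w by (simp add: algebra_simps)
 ultimately show ?thesis by (cases q) (simp add: moebius_def Let_def, simp add: algebra_simps)
qed

lemma SL2_inverse:
 assumes "A : SL2"
 obtains B where "B : SL2" "A ** B = mat 1" "B ** A = mat 1" proof -
 have "invertible A" using assms by (simp add: SL2_def invertible_det_nz)
 then obtain B where B: "A ** B = mat 1" "B ** A = mat 1" unfolding invertible_def by blast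
 have "det A * det B = 1" using B by (metis det_I det_mul)
 hence "B : SL2" using assms by (simp add: SL2_def)
 thus ?thesis using that B by blast
qed

text \<open>The right-hand side is the squared Hilbert-Schmidt norm, so a bound on the orbit of the
  origin is a bound on the matrices. \<open>finite_origin\<close> rests on this.\<close>

lemma moebius_wd_origin:
 assumes A: "A : SL2" shows "2 * wd (0, 0, 1) (moebius A (0, 0, 1)) =
  (cmod (A$1$1))^2 + (cmod (A$1$2))^2 + (cmod (A$2$1))^2 + (cmod (A$2$2))^2" proof -
 have o: "(0, 0, 1) : H3" by (simp add: H3_def)
 note c = moebius_coords[OF A o]
 have "complex_of_real (2 * wd (0, 0, 1) (moebius A (0, 0, 1))) =
  complex_of_real ((cmod (A$1$1))^2 + (cmod (A$1$2))^2 + (cmod (A$2$1))^2 + (cmod (A$2$2))^2)"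
  unfolding wd_q[OF o c(1)] c(2-4) by (simp add: qa_def qb_def qc_def complex_norm_square zero_complex.code[symmetric]
  algebra_simps del: of_real_power)
 thus ?thesis by (simp only: of_real_eq_iff)
qed

section \<open>The group \<open>PSL\<^sub>2(\<complex>)\<close>\<close>

lemma matrix_mult_uminus: "(- A) ** B = - (A ** (B::complex^2^2))" "A ** (- B) = - (A ** B)"
 by (simp_all add: vec_eq_iff matrix_matrix_mult_def sum_negf)

lemma group_SL2C: "group SL2C" proof (rule groupI)
 fix x assume "x : carrier SL2C"
 hence "x : SL2" by (simp add: SL2C_def SL2_def)
 then obtain B where "B : SL2" "B ** x = mat 1" by (rule SL2_inverse)
 thus "EX y:carrier SL2C. y \<otimes>\<^bsub>SL2C\<^esub> x = \<one>\<^bsub>SL2C\<^esub>"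
  by (auto simp: SL2C_def SL2_def)
qed (auto simp: SL2C_def det_mul matrix_mul_assoc)

lemma normal_SL2C: "{mat 1, - mat 1} \<lhd> SL2C" proof -
 interpret group SL2C by (rule group_SL2C)
 have d: "det (- mat 1 :: complex^2^2) = 1" by (simp add: det_2 mat_def)
 have inv: "inv\<^bsub>SL2C\<^esub> (- mat 1) = - mat 1"
  by (rule inv_equality) (auto simp: SL2C_def d matrix_mult_uminus)
 have inv1: "inv\<^bsub>SL2C\<^esub> (mat 1) = mat 1" by (rule inv_equality) (auto simp: SL2C_def)
 have sub: "subgroup {mat 1, - mat 1} SL2C" proof (rule subgroupI)
  show "{mat 1, - mat 1} \<subseteq> carrier SL2C" by (auto simp: SL2C_def d)
 next
  fix a assume "a : {mat 1, - mat 1 :: complex^2^2}"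
  thus "inv\<^bsub>SL2C\<^esub> a : {mat 1, - mat 1}" using inv inv1 by auto
 qed (auto simp: SL2C_def matrix_mult_uminus)
 show ?thesis unfolding normal_inv_iff proof (intro conjI ballI sub)
  fix x h assume x: "x : carrier SL2C" and h: "h : {mat 1, - mat 1 :: complex^2^2}"
  have c: "x \<otimes>\<^bsub>SL2C\<^esub> h = h \<otimes>\<^bsub>SL2C\<^esub> x" and hc: "h : carrier SL2C"
  using h by (auto simp: SL2C_def matrix_mult_uminus d)
  have "x \<otimes>\<^bsub>SL2C\<^esub> h \<otimes>\<^bsub>SL2C\<^esub> inv\<^bsub>SL2C\<^esub> x = h"
  unfolding c using x hc by (simp add: m_assoc)
  thus "x \<otimes>\<^bsub>SL2C\<^esub> h \<otimes>\<^bsub>SL2C\<^esub> inv\<^bsub>SL2C\<^esub> x : {mat 1, - mat 1}" using h by simp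
 qed
qed

lemma group_PSL2C: "group PSL2C" unfolding PSL2C_def by (rule normal.factorgroup_is_group[OF normal_SL2C])

lemma SL2C_r_coset: "{mat 1, - mat 1} #>\<^bsub>SL2C\<^esub> A = {A, - A}"
 by (auto simp: r_coset_def SL2C_def matrix_mult_uminus)

lemma carrier_PSL2C: "carrier PSL2C = (%A. {A, - A}) ` SL2" unfolding PSL2C_def FactGroup_def RCOSETS_def
 by (auto simp: SL2C_r_coset) (auto simp: SL2C_def SL2_def)

lemma PSL2C_mult: "{A, - A} \<otimes>\<^bsub>PSL2C\<^esub> {B, - B} = {A ** B, - (A ** B)}"
 unfolding PSL2C_def FactGroup_def set_mult_def by (auto simp: SL2C_def matrix_mult_uminus)

lemma PSL2C_one: "\<one>\<^bsub>PSL2C\<^esub> = {mat 1, - mat 1}" by (simp add: PSL2C_def FactGroup_def)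

lemma act_pm: "act {A, - A} = moebius A" proof -
 have "(SOME B. B : {A, - A}) : {A, - A}" by (rule someI[of _ A]) simp
 thus ?thesis unfolding act_def using moebius_uminus by auto
qed

lemma act_one: "q : H3 ==> act \<one>\<^bsub>PSL2C\<^esub> q = q" by (simp add: PSL2C_one act_pm moebius_mat1)

lemma act_H3: "ga : carrier PSL2C ==> q : H3 ==> act ga q : H3" by (auto simp: carrier_PSL2C act_pm moebius_coords(1))

lemma act_wd: "ga : carrier PSL2C ==> p : H3 ==> q : H3 ==> wd (act ga p) (act ga q) = wd p q"
 by (auto simp: carrier_PSL2C act_pm moebius_wd)

lemma act_mult: "ga : carrier PSL2C ==> de : carrier PSL2C ==> q : H3 ==>
  act (ga \<otimes>\<^bsub>PSL2C\<^esub> de) q = act ga (act de q)"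
 by (auto simp: carrier_PSL2C act_pm PSL2C_mult moebius_mult)

lemma act_inv:
 assumes "ga : carrier PSL2C" "q : H3" shows "act (ginv ga) (act ga q) = q" "act ga (act (ginv ga) q) = q" proof -
 interpret group PSL2C by (rule group_PSL2C)
 show "act (ginv ga) (act ga q) = q" using act_mult[of "ginv ga" ga q] assms by (simp add: act_one)
 show "act ga (act (ginv ga) q) = q" using act_mult[of ga "ginv ga" q] assms by (simp add: act_one)
qed

section \<open>Green's identity\<close>

text \<open>By translation invariance every difference quotient of \<open>V\<close> has integral
  zero, and dominated convergence carries this over to the derivative. No iterated integrals are
  involved.\<close>

lemma integral_directional_derivative_zero:
 fixes V D :: "'a::euclidean_space => real"
 assumes der: "!!q. ((%s. V (q + s *\<^sub>R e)) has_real_derivative D q) (at 0)"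
  and cV: "continuous_on UNIV V" and cD: "continuous_on UNIV D"
  and K: "compact K" and zV: "!!q. q ~: K ==> V q = 0" and zD: "!!q. q ~: K ==> D q = 0"
 shows "integral\<^sup>L lborel D = 0" proof -
 have der': "((%s. V (q + s *\<^sub>R e)) has_real_derivative D (q + s0 *\<^sub>R e)) (at s0)" for q s0 proof -
  have "((%s. V ((q + s0 *\<^sub>R e) + s *\<^sub>R e)) has_real_derivative D (q + s0 *\<^sub>R e)) (at 0)" by (rule der)
  hence "((%s. V (q + (s0 + s) *\<^sub>R e)) has_real_derivative D (q + s0 *\<^sub>R e)) (at 0)"
  by (simp add: algebra_simps)
  thus ?thesis using DERIV_at_within_shift[of "%s. V (q + s *\<^sub>R e)" "D (q + s0 *\<^sub>R e)" s0 0 UNIV]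
  by (simp add: add.commute)
 qed
 obtain Bd where Bd: "!!q. \<bar>D q\<bar> <= Bd" and Bd0: "Bd >= 0" proof -
  have "bounded (D ` K)" using K cD by (meson compact_continuous_image compact_imp_bounded continuous_on_subset subset_UNIV)
  then obtain b where "ALL x:K. \<bar>D x\<bar> <= b" by (auto simp: bounded_iff)
  hence "\<bar>D q\<bar> <= max b 0" for q using zD[of q] by (cases "q : K") auto
  thus ?thesis using that[of "max b 0"] by auto
 qed
 define h where "h n = 1 / real (Suc n)" for n
 have h: "h n > 0" "h n <= 1" for n by (auto simp: h_def)
 have h0: "h \<longlonglongrightarrow> 0" unfolding h_def by (rule LIMSEQ_Suc[OF lim_1_over_n])
 \<comment> \<open>The sweep of \<open>K\<close> against the direction \<open>e\<close> for times in
   \<open>[0, 1]\<close>. All difference quotients with step \<open>h n \<le> 1\<close> vanish off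
   it, and by the mean value theorem they are bounded by the bound for \<open>D\<close>.\<close>
 define K' where "K' = (%(x, s). x - s *\<^sub>R e) ` (K \<times> {0..1::real})"
 have K': "compact K'" unfolding K'_def by (intro compact_continuous_image compact_Times K compact_Icc)
  (auto intro!: continuous_intros simp: split_beta)
 define F where "F n q = (V (q + h n *\<^sub>R e) - V q) / h n" for n q
 have iV: "integrable lborel V" proof -
  have "integrable lborel (%x. indicator K x *\<^sub>R V x)"
  by (rule borel_integrable_compact[OF K continuous_on_subset[OF cV]]) simp
  moreover have "(%x. indicator K x *\<^sub>R V x) = V" using zV by (auto simp: indicator_def fun_eq_iff)
  ultimately show ?thesis by simp
 qed
 have iVh: "integrable lborel (%q. V (q + c))" "integral\<^sup>L lborel (%q. V (q + c)) = integral\<^sup>L lborel V" for c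
 proof -
  have e: "lborel = distr lborel borel (%x::'a. c + x)" by (simp add: lborel_distr_plus)
  have Vm: "V : borel_measurable borel" using cV by (rule borel_measurable_continuous_onI)
  have "integrable (distr lborel borel (%x::'a. c + x)) V" using iV e by metis
  hence "integrable lborel (%x. V (c + x))" by (subst (asm) integrable_distr_eq) (use Vm in auto)
  thus "integrable lborel (%q. V (q + c))" by (simp add: add.commute)
  have "integral\<^sup>L lborel V = integral\<^sup>L (distr lborel borel (%x::'a. c + x)) V" using e by metis
  also have "... = integral\<^sup>L lborel (%x. V (c + x))" by (subst integral_distr) (use Vm in auto)
  finally show "integral\<^sup>L lborel (%q. V (q + c)) = integral\<^sup>L lborel V" by (simp add: add.commute)
 qed
 have F0: "integral\<^sup>L lborel (F n) = 0" for n unfolding F_def using iVh iV by simp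
 have lim: "(%n. integral\<^sup>L lborel (F n)) \<longlonglongrightarrow> integral\<^sup>L lborel D"
 proof (rule integral_dominated_convergence)
  show "D : borel_measurable lborel" using cD by (simp add: borel_measurable_continuous_onI)
  show "F n : borel_measurable lborel" for n
  unfolding F_def using iVh(1) iV by (intro borel_measurable_integrable integrable_divide Bochner_Integration.integrable_diff)
  show "integrable lborel (%x. Bd * indicator K' x)"
  using K' emeasure_compact_finite[OF K'] by (intro integrable_mult_right integrable_real_indicator)
  (auto simp: compact_imp_closed borel_closed)
  show "AE x in lborel. (%i. F i x) \<longlonglongrightarrow> D x" proof (rule AE_I2)
  fix q
  have "((%s. (V (q + s *\<^sub>R e) - V q) / s) \<longlongrightarrow> D q) (at 0)"
  using der[of q] by (simp add: has_field_derivative_iff)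
  thus "(%i. F i q) \<longlonglongrightarrow> D q" unfolding F_def
  by (rule filterlim_compose) (use h h0 in "auto simp: filterlim_at eventually_sequentially intro!: exI[of _ 0]; metis less_irrefl")
  qed
  show "AE x in lborel. norm (F i x) <= Bd * indicator K' x" for i proof (rule AE_I2)
  fix q
  have "\<exists>z>0. z < h i & V (q + h i *\<^sub>R e) - V (q + 0 *\<^sub>R e) = (h i - 0) * D (q + z *\<^sub>R e)"
  by (rule MVT2) (use h der' in auto)
  then obtain z where z: "z > 0" "z < h i" "V (q + h i *\<^sub>R e) - V q = h i * D (q + z *\<^sub>R e)" by auto
  have Fq: "F i q = D (q + z *\<^sub>R e)" using z h[of i] by (simp add: F_def)
  show "norm (F i q) <= Bd * indicator K' q" proof (cases "q + z *\<^sub>R e : K")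
  case True
  have "q = (%(x, s). x - s *\<^sub>R e) (q + z *\<^sub>R e, z)" by simp
  moreover have "(q + z *\<^sub>R e, z) : K \<times> {0..1}" using True z h[of i] by auto
  ultimately have "q : K'" unfolding K'_def by blast
  thus ?thesis using Bd Fq by simp
  next
  case False
  thus ?thesis using zD Fq Bd0 by (simp add: indicator_def)
  qed
  qed
 qed
 thus ?thesis using F0 by (simp add: LIMSEQ_const_iff)
qed

text \<open>The restriction to \<open>H3\<close> makes every \<open>act ga\<close> a measurable map
  of the space to itself; the group laws for \<open>act\<close> hold on \<open>H3\<close>.\<close>

definition hv :: "point measure" where
 "hv = restrict_space hyp_vol H3"

lemma H3_borel [measurable]: "H3 : sets borel" using open_H3 by simp

lemma sets_hyp_vol [simp, measurable_cong]: "sets hyp_vol = sets borel" by (simp add: hyp_vol_def)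

lemma space_hyp_vol [simp]: "space hyp_vol = UNIV" by (simp add: hyp_vol_def)

lemma space_hv [simp]: "space hv = H3" by (simp add: hv_def space_restrict_space)

lemma sets_hv: "sets hv = sets (restrict_space borel H3)" unfolding hv_def by (rule sets_restrict_space_cong) simp

lemma hyp_vol_density: "hyp_vol = density lborel (%q. indicator H3 q * ennreal (1 / (ht q)^3))"
 unfolding hyp_vol_def by (rule arg_cong[where f = "density lborel"])
  (auto simp: fun_eq_iff H3_def indicator_def split: prod.splits)

lemma measurable_hv_eq: "borel_measurable hv = borel_measurable (restrict_space borel H3)"
 by (rule measurable_cong_sets) (simp_all add: sets_hv)

lemma hv_measurableI_continuous: "continuous_on H3 f ==> f : borel_measurable hv"
 unfolding measurable_hv_eq by (rule borel_measurable_continuous_on_restrict)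

lemma hv_measurableI_borel: "f : borel_measurable borel ==> f : borel_measurable hv"
 unfolding measurable_hv_eq by (rule measurable_restrict_space1)

lemma ht_borel [measurable]: "ht : borel_measurable borel"
 by (intro borel_measurable_continuous_onI continuous_intros)

lemma hv_integral:
 fixes f :: "point => real" assumes "f : borel_measurable hv"
 shows "integral\<^sup>L hv f = integral\<^sup>L lborel (%q. indicator H3 q * (f q / (ht q)^3))"
  and "integrable hv f \<longleftrightarrow> integrable lborel (%q. indicator H3 q * (f q / (ht q)^3))" proof -
 have m: "(%q. indicator H3 q * f q) : borel_measurable borel" using assms unfolding measurable_hv_eq
  by (subst (asm) borel_measurable_restrict_space_iff) (auto simp: mult.commute)
 have d: "hyp_vol = density lborel (%q. ennreal (indicator H3 q / (ht q)^3))"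
  unfolding hyp_vol_density by (rule arg_cong[where f = "density lborel"])
  (auto simp: fun_eq_iff indicator_def)
 have nn: "indicator H3 q / (ht q)^3 >= (0::real)" for q by (auto simp: indicator_def H3_iff)
 have e: "(%q. indicator H3 q / ht q ^ 3 * (indicator H3 q * f q)) = (%q. indicator H3 q * (f q / ht q ^ 3))"
  by (auto simp: indicator_def fun_eq_iff)
 show "integral\<^sup>L hv f = integral\<^sup>L lborel (%q. indicator H3 q * (f q / (ht q)^3))"
  unfolding hv_def by (subst integral_restrict_space) (simp_all add: d integral_real_density m nn e del: times_divide_eq_left)
 show "integrable hv f \<longleftrightarrow> integrable lborel (%q. indicator H3 q * (f q / (ht q)^3))"
  unfolding hv_def by (subst integrable_restrict_space) (simp_all add: d integrable_real_density m nn e del: times_divide_eq_left)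
qed

lemma open_sublevel:
 fixes f :: "'a::topological_space => real" shows "open S ==> continuous_on S f ==> open {q : S. f q < c}"
 using continuous_on_open_vimage[of S f] by (auto simp: vimage_def Int_def conj_commute dest!: spec[of _ "{..<c}"])

section \<open>Hyperbolic balls\<close>

definition hball :: "point => real => point set" where
 "hball p W = {q : H3. wd p q <= W}"

text \<open>With \<open>W = cosh r\<close> the Euclidean centre rises to height
  \<open>b cosh r\<close> and the radius is \<open>b sinh r\<close>. Compactness, measurability and
  the volume for small radii come from here.\<close>

lemma hball_cball:
 assumes "(a1, a2, b) : H3" "W >= 1" shows "hball (a1, a2, b) W = cball (a1, a2, W * b) (b * sqrt (W^2 - 1))" proof -
 have b: "b > 0" using assms by (simp add: H3_def)
 have sq: "(b * sqrt (W^2 - 1))^2 = b^2 * (W^2 - 1)" using assms by (simp add: power_mult_distrib)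
 have "(x1, x2, y) : hball (a1, a2, b) W \<longleftrightarrow> (x1, x2, y) : cball (a1, a2, W * b) (b * sqrt (W^2 - 1))" for x1 x2 y
 proof -
  let ?S = "(x1 - a1)^2 + (x2 - a2)^2 + b^2 + y^2"
  have "(x1, x2, y) : cball (a1, a2, W * b) (b * sqrt (W^2 - 1)) \<longleftrightarrow>
  norm ((a1, a2, W * b) - (x1, x2, y)) <= b * sqrt (W^2 - 1)" by (simp only: mem_cball dist_norm)
  also have "... \<longleftrightarrow> (norm ((a1, a2, W * b) - (x1, x2, y)))^2 <= (b * sqrt (W^2 - 1))^2"
  using b assms abs_le_square_iff[of "norm ((a1, a2, W * b) - (x1, x2, y))" "b * sqrt (W^2 - 1)"] by simp
  also have "... \<longleftrightarrow> ?S <= 2 * W * b * y"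
  unfolding sq by (subst norm_point) (simp add: power2_eq_square algebra_simps)
  finally have 1: "(x1, x2, y) : cball (a1, a2, W * b) (b * sqrt (W^2 - 1)) \<longleftrightarrow> ?S <= 2 * W * b * y" .
  have 2: "y > 0" if "?S <= 2 * W * b * y" proof -
  have "0 < ?S" using b by (intro add_nonneg_pos add_pos_nonneg) (auto intro: add_nonneg_pos)
  hence "0 < (2 * W * b) * y" using that by linarith
  moreover have "0 < 2 * W * b" using b assms by simp
  ultimately show ?thesis by (rule zero_less_mult_pos)
  qed
  show ?thesis unfolding 1 using 2 b by (auto simp: hball_def H3_def wd_def field_simps)
 qed
 thus ?thesis by auto
qed

lemma hball_cball':
 assumes "p : H3" "W >= 1" shows "\<exists>c r. hball p W = cball c r" "compact (hball p W)" proof -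
 obtain a1 a2 b where p: "p = (a1, a2, b)" by (cases p)
 show 1: "\<exists>c r. hball p W = cball c r" using hball_cball[of a1 a2 b W] assms p by blast
 thus "compact (hball p W)" using compact_cball by metis
qed

lemma hball_empty: "p : H3 ==> W < 1 ==> hball p W = {}" using wd_ge_1 by (fastforce simp: hball_def)

lemma compact_hball: "p : H3 ==> compact (hball p W)" by (cases "W >= 1") (auto simp: hball_cball' hball_empty)

lemma hball_subset: "hball p W \<subseteq> H3" by (auto simp: hball_def)

lemma wd_borel [measurable]: "(%q. wd p q) : borel_measurable borel" proof -
 have [measurable]: "fst : borel_measurable (borel :: point measure)"
  "(%q. fst (snd q)) : borel_measurable (borel :: point measure)"
  by (intro borel_measurable_continuous_onI continuous_intros)+
 show ?thesis by (cases p) (simp add: wd_def split_beta)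
qed

lemma continuous_on_wd: "p : H3 ==> continuous_on H3 (wd p)"
 by (cases p) (auto simp: wd_def split_beta H3_iff intro!: continuous_intros)

lemma hball_borel [measurable]: "p : H3 ==> hball p W : sets borel"
 using compact_hball compact_imp_closed borel_closed by blast

lemma hball_hv [measurable]: "p : H3 ==> hball p W : sets hv"
 unfolding sets_hv sets_restrict_space using hball_borel[of p W] hball_subset[of p W] by blast

lemma hball_finite:
 assumes "p : H3" shows "emeasure hv (hball p W) < \<infinity>" proof -
 have "integrable hv (indicator (hball p W) :: point => real)" proof (subst hv_integral(2))
  show "indicator (hball p W) : borel_measurable hv" using assms by simp
  have c: "continuous_on (hball p W) (%q. 1 / (ht q)^3)" by (intro continuous_intros) (auto simp: hball_def H3_iff)
  have "(%q. indicator H3 q * (indicator (hball p W) q / ht q ^ 3)) = (%q. indicator (hball p W) q *\<^sub>R (1 / (ht q)^3))"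
  by (auto simp: fun_eq_iff indicator_def hball_def)
  thus "integrable lborel (%q. indicator H3 q * (indicator (hball p W) q / ht q ^ 3))"
  using borel_integrable_compact[OF compact_hball[OF assms] c] by simp
 qed
 moreover have "hball p W \<inter> H3 = hball p W" using hball_subset by blast
 ultimately show ?thesis using assms by (simp add: integrable_indicator_iff)
qed

lemma integrable_hv_hball:
 fixes g :: "point => real" assumes p: "p : H3" and g: "g : borel_measurable hv"
  and b: "!!q. q : hball p W ==> \<bar>g q\<bar> <= B" and z: "!!q. q : H3 ==> q ~: hball p W ==> g q = 0"
 shows "integrable hv g"
proof (rule Bochner_Integration.integrable_bound[where f = "%q. \<bar>B\<bar> * indicator (hball p W) q"])
 show "integrable hv (%q. \<bar>B\<bar> * indicator (hball p W) q)"
  using hball_finite[OF p, of W] p by (intro integrable_mult_right integrable_real_indicator) auto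
 show "AE x in hv. norm (g x) <= norm (\<bar>B\<bar> * indicator (hball p W) x)"
  using b z by (intro AE_I2) (force simp: indicator_def)
qed fact

lemma C2_on_H3_partial:
 assumes u: "C2_on H3 u" and e: "e : Basis" and q: "q : H3"
 shows "((%s. u (q + s *\<^sub>R e)) has_real_derivative partial e u q) (at 0)"
  and "((%s. partial e u (q + s *\<^sub>R e)) has_real_derivative partial e (partial e u) q) (at 0)" proof -
 have gen: "((%s. f (q + s *\<^sub>R e)) has_real_derivative partial e f q) (at 0)" if "f differentiable_on H3" for f
 proof -
  have "f differentiable (at q)" using that q open_H3 by (auto simp: differentiable_on_eq_differentiable_at)
  hence fd: "(f has_derivative frechet_derivative f (at q)) (at q)" by (simp add: frechet_derivative_works)
  hence lin: "linear (frechet_derivative f (at q))" by (rule has_derivative_linear)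
  have "((%s. q + s *\<^sub>R e) has_derivative (%s. s *\<^sub>R e)) (at 0)" by (auto intro!: derivative_eq_intros)
  from diff_chain_at[OF this] fd
  have "((f \<circ> (%s. q + s *\<^sub>R e)) has_derivative (frechet_derivative f (at q) \<circ> (%s. s *\<^sub>R e))) (at 0)"
  by simp
  moreover have "frechet_derivative f (at q) \<circ> (%s. s *\<^sub>R e) = (*) (partial e f q)"
  using linear_scale[OF lin] by (auto simp: partial_def fun_eq_iff)
  ultimately show ?thesis by (simp add: has_field_derivative_def o_def)
 qed
 show "((%s. u (q + s *\<^sub>R e)) has_real_derivative partial e u q) (at 0)"
  and "((%s. partial e u (q + s *\<^sub>R e)) has_real_derivative partial e (partial e u) q) (at 0)"
  using u e by (auto simp: C2_on_def intro!: gen)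
qed

section \<open>Green's identity against an eigenfunction\<close>

abbreviation e1 :: point where "e1 \<equiv> (1, 0, 0)"
abbreviation e2 :: point where "e2 \<equiv> (0, 1, 0)"
abbreviation e3 :: point where "e3 \<equiv> (0, 0, 1)"

lemma e_Basis: "e1 : Basis" "e2 : Basis" "e3 : Basis" by (auto simp: Basis_prod_def zero_prod_def[symmetric])

lemma continuous_on_extend_zero:
 fixes f :: "'a::topological_space => real"
 assumes "open S" "continuous_on S f" "closed K" "K \<subseteq> S" "!!q. q : S ==> q ~: K ==> f q = 0"
 shows "continuous_on UNIV (%q. if q : S then f q else 0)" proof -
 have "continuous_on (S \<union> - K) (%q. if q : S then f q else 0)" proof (rule continuous_on_open_Un[OF assms(1)])
  show "open (- K)" using assms by auto
  show "continuous_on S (%q. if q : S then f q else 0)" using assms(2) by (subst continuous_on_cong[OF refl, of _ _ f]) auto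
  show "continuous_on (- K) (%q. if q : S then f q else 0)"
  using assms by (subst continuous_on_cong[OF refl, of _ _ "%_. 0"]) auto
 qed
 moreover have "S \<union> - K = UNIV" using assms by auto
 ultimately show ?thesis by simp
qed

text \<open>The Laplacian is \<open>y^3\<close> times the divergence of \<open>1/y\<close> times the
  gradient, and the volume element cancels \<open>y^3\<close>. Hence the flux \<open>V\<close> with
  weight \<open>1/ht\<close>, whose derivative along \<open>e\<close> is \<open>D\<close>. The test
  function enters only through its derivatives along lines.\<close>

lemma green_component:
 assumes u: "C2_on H3 u" and e: "e : Basis"
  and f1: "!!q. q : H3 ==> ((%s. f (q + s *\<^sub>R e)) has_real_derivative f1 q) (at 0)"
  and f2: "!!q. q : H3 ==> ((%s. f1 (q + s *\<^sub>R e)) has_real_derivative f2 q) (at 0)"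
  and c: "continuous_on H3 f" "continuous_on H3 f1" "continuous_on H3 f2" and K: "compact K" "K \<subseteq> H3"
  and z: "!!q. q : H3 ==> q ~: K ==> f q = 0 & f1 q = 0 & f2 q = 0"
 defines "D \<equiv> %q. if q : H3 then (u q * f2 q - f q * partial e (partial e u) q) / ht q
  - ht e * (u q * f1 q - f q * partial e u q) / (ht q)^2 else 0"
 shows "integral\<^sup>L lborel D = 0" "integrable lborel D" proof -
 define V where "V q = (if q : H3 then (u q * f1 q - f q * partial e u q) / ht q else 0)" for q
 have cl: "closed K" using K compact_imp_closed by blast
 have cu: "continuous_on H3 u" "continuous_on H3 (partial e u)" "continuous_on H3 (partial e (partial e u))"
  using u e by (auto simp: C2_on_def intro: differentiable_imp_continuous_on)
 have ch: "continuous_on H3 (%q. u q)" "continuous_on H3 (%q. partial e u q)"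
  "continuous_on H3 (%q. partial e (partial e u) q)" using cu by auto
 have cV: "continuous_on UNIV V" unfolding V_def by (rule continuous_on_extend_zero[OF open_H3 _ cl K(2)])
  (auto simp: z H3_iff intro!: continuous_intros ch c)
 have cD: "continuous_on UNIV D" unfolding D_def by (rule continuous_on_extend_zero[OF open_H3 _ cl K(2)])
  (auto simp: z H3_iff intro!: continuous_intros ch c)
 have zz: "V q = 0" "D q = 0" if "q ~: K" for q using that z by (auto simp: V_def D_def)
 have der: "((%s. V (q + s *\<^sub>R e)) has_real_derivative D q) (at 0)" for q proof (cases "q : H3")
  case True
  have ev: "\<forall>\<^sub>F s in nhds 0. q + s *\<^sub>R e : H3" proof -
  have "((%s. q + s *\<^sub>R e) \<longlongrightarrow> q + 0 *\<^sub>R e) (nhds (0::real))"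
  by (intro tendsto_intros filterlim_ident)
  thus ?thesis using topological_tendstoD[OF _ open_H3] True by fastforce
  qed
  have hq: "ht q > 0" using True by (simp add: H3_iff)
  have "((%s. (u (q + s *\<^sub>R e) * f1 (q + s *\<^sub>R e) - f (q + s *\<^sub>R e) * partial e u (q + s *\<^sub>R e)) / (ht q + s * ht e))
  has_real_derivative D q) (at 0)" proof -
  have "((%s. u (q + s *\<^sub>R e) * f1 (q + s *\<^sub>R e) - f (q + s *\<^sub>R e) * partial e u (q + s *\<^sub>R e))
  has_real_derivative u q * f2 q - f q * partial e (partial e u) q) (at 0)"
  by (rule DERIV_cong[OF DERIV_diff[OF DERIV_mult[OF C2_on_H3_partial(1)[OF u e True] f2[OF True]]
  DERIV_mult[OF f1[OF True] C2_on_H3_partial(2)[OF u e True]]]]) (simp add: mult.commute)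
  moreover have "((%s. ht q + s * ht e) has_real_derivative ht e) (at 0)" by (auto intro!: derivative_eq_intros)
  ultimately show ?thesis by (rule DERIV_cong[OF DERIV_divide])
  (use True hq in "simp_all add: D_def diff_divide_distrib power2_eq_square")
  qed
  thus ?thesis by (rule DERIV_cong_ev[THEN iffD1, rotated -1])
  (use ev in "auto elim!: eventually_mono simp: V_def")
 next
  case False
  have ev: "\<forall>\<^sub>F s in nhds 0. q + s *\<^sub>R e : - K" proof -
  have "((%s. q + s *\<^sub>R e) \<longlongrightarrow> q + 0 *\<^sub>R e) (nhds (0::real))"
  by (intro tendsto_intros filterlim_ident)
  moreover have "open (- K)" "q + 0 *\<^sub>R e : - K" using cl K False by auto
  ultimately show ?thesis by (metis topological_tendstoD)
  qed
  have "((%s. 0) has_real_derivative D q) (at 0)" using False by (simp add: D_def)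
  moreover have "\<forall>\<^sub>F s in nhds 0. 0 = V (q + s *\<^sub>R e)"
  using ev by (rule eventually_mono) (simp add: zz(1))
  ultimately show ?thesis using DERIV_cong_ev[of 0 0 "%s. 0" "%s. V (q + s *\<^sub>R e)" "D q" "D q"] by simp
 qed
 show "integral\<^sup>L lborel D = 0"
  by (rule integral_directional_derivative_zero[OF der cV cD K(1)]) (use zz in auto)
 have "integrable lborel (%x. indicator K x *\<^sub>R D x)"
  by (rule borel_integrable_compact[OF K(1) continuous_on_subset[OF cD]]) simp
 moreover have "(%x. indicator K x *\<^sub>R D x) = D" using zz by (auto simp: indicator_def fun_eq_iff)
 ultimately show "integrable lborel D" by simp
qed

lemma green:
 assumes u: "C2_on H3 u" and lam: "!!q. q : H3 ==> - laplacian u q = lam * u q"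
  and f1: "!!q e. q : H3 ==> e : {e1, e2, e3} ==> ((%s. f (q + s *\<^sub>R e)) has_real_derivative f1 e q) (at 0)"
  and f2: "!!q e. q : H3 ==> e : {e1, e2, e3} ==> ((%s. f1 e (q + s *\<^sub>R e)) has_real_derivative f2 e q) (at 0)"
  and c: "continuous_on H3 f" "!!e. e : {e1, e2, e3} ==> continuous_on H3 (f1 e)"
  "!!e. e : {e1, e2, e3} ==> continuous_on H3 (f2 e)" and K: "compact K" "K \<subseteq> H3"
  and z: "!!q e. q : H3 ==> q ~: K ==> f q = 0 & f1 e q = 0 & f2 e q = 0"
  and L: "!!q. q : H3 ==> (ht q)^2 * (f2 e1 q + f2 e2 q + f2 e3 q) - ht q * f1 e3 q = Lf q"
 shows "integral\<^sup>L hv (%q. u q * (Lf q + lam * f q)) = 0" proof -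
 define D where "D e = (%q. if q : H3 then (u q * f2 e q - f q * partial e (partial e u) q) / ht q
  - ht e * (u q * f1 e q - f q * partial e u q) / (ht q)^2 else 0)" for e
 have D: "integral\<^sup>L lborel (D e) = 0 & integrable lborel (D e)" if "e : {e1, e2, e3}" for e proof -
  have eb: "e : Basis" using that e_Basis by auto
  show ?thesis unfolding D_def
  using green_component[OF u eb f1[OF _ that] f2[OF _ that] c(1) c(2)[OF that] c(3)[OF that] K z] by blast
 qed
 have cu: "continuous_on H3 u" using u by (auto simp: C2_on_def intro: differentiable_imp_continuous_on)
 have cL: "continuous_on H3 Lf" by (subst continuous_on_cong[OF refl L[symmetric]]) (auto intro!: continuous_intros c)
 have m: "(%q. u q * (Lf q + lam * f q)) : borel_measurable hv"
  by (intro hv_measurableI_continuous continuous_intros cu cL c)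
 have "integral\<^sup>L hv (%q. u q * (Lf q + lam * f q)) = integral\<^sup>L lborel (%q. D e1 q + D e2 q + D e3 q)"
  unfolding hv_integral(1)[OF m] proof (rule arg_cong[where f = "integral\<^sup>L lborel"], rule ext)
  fix q
  show "indicator H3 q * (u q * (Lf q + lam * f q) / ht q ^ 3) = D e1 q + D e2 q + D e3 q" proof (cases "q : H3")
  case True
  hence y: "ht q > 0" by (simp add: H3_iff)
  have lu: "(ht q)^2 * (partial e1 (partial e1 u) q + partial e2 (partial e2 u) q + partial e3 (partial e3 u) q)
  - ht q * partial e3 u q = - lam * u q" using lam[OF True] by (cases q) (simp add: laplacian_def)
  have "u q * (Lf q + lam * f q) = u q * Lf q - f q * (- lam * u q)" by (simp add: algebra_simps)
  also have "... = (D e1 q + D e2 q + D e3 q) * ht q ^ 3" unfolding L[OF True, symmetric] lu[symmetric] using True y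
  by (simp add: D_def field_simps power2_eq_square power3_eq_cube)
  finally show ?thesis using True y by simp
  qed (simp add: D_def)
 qed
 also have "... = 0" using D[of e1] D[of e2] D[of e3] by simp
 finally show ?thesis .
qed

section \<open>Means of eigenfunctions over balls\<close>

text \<open>The truncated powers, each the derivative of the next. \<open>tp 3\<close> is the first
  one that is twice continuously differentiable, as a test function in Green's identity must
  be.\<close>

definition tp :: "nat => real => real" where
 "tp k x = (max x 0) ^ k / fact k"

lemma tp_quot_2: "\<bar>tp 2 (x + h) - tp 2 x - h * tp 1 x\<bar> <= h^2" proof -
 consider "x >= 0" "x + h >= 0" | "x >= 0" "x + h < 0" | "x < 0" "x + h >= 0" | "x < 0" "x + h < 0" by linarith
 thus ?thesis proof cases
  case 1 thus ?thesis by (simp add: tp_def max_def power2_eq_square numeral_2_eq_2 field_simps)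
 next
  case 2
  have "x * x <= - (h * x)" using 2 mult_right_mono[of x "-h" x] by simp
  moreover have "- (h * x) <= h * h" using 2 mult_left_mono[of x "-h" "-h"] by simp
  moreover have "x * x >= 0" by simp
  moreover have eq: "tp 2 (x + h) - tp 2 x - h * tp 1 x = (- (x * x) - 2 * (h * x)) / 2"
  using 2 by (simp add: tp_def max_def power2_eq_square numeral_2_eq_2 field_simps)
  moreover have "h * h >= 0" by simp
  ultimately have "(- (x * x) - 2 * (h * x)) / 2 <= h * h & - ((- (x * x) - 2 * (h * x)) / 2) <= h * h" by argo
  thus ?thesis unfolding eq power2_eq_square abs_le_iff .
 next
  case 3
  have "(x + h)^2 <= \<bar>h\<bar>^2" using 3 by (intro power_mono) auto
  moreover have "(x + h)^2 >= 0" by simp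
  moreover have eq: "tp 2 (x + h) - tp 2 x - h * tp 1 x = (x + h)^2 / 2" using 3 by (simp add: tp_def max_def)
  moreover have "h^2 >= 0" by simp
  ultimately show ?thesis unfolding eq power2_abs by linarith
 next
  case 4 thus ?thesis by (simp add: tp_def max_def)
 qed
qed

lemma tp_quot_3:
 assumes "\<bar>x\<bar> <= B" "\<bar>h\<bar> <= 1"
 shows "\<bar>tp 3 (x + h) - tp 3 x - h * tp 2 x\<bar> <= (B + 1) * h^2" proof -
 have B: "B >= 0" using assms by linarith
 have hh: "h^2 >= 0" by simp
 have t3: "tp 3 z = z ^ 3 / 6" "tp 2 z = z^2 / 2" if "z >= 0" for z
  using that by (auto simp: tp_def max_def fact_numeral)
 have t3': "tp 3 z = 0" "tp 2 z = 0" if "z < 0" for z using that by (auto simp: tp_def max_def)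
 have h3: "\<bar>h\<bar> ^ 3 <= h^2" using assms(2) power_decreasing[of 2 3 "\<bar>h\<bar>"] by simp
 consider "x >= 0" "x + h >= 0" | "x >= 0" "x + h < 0" | "x < 0" "x + h >= 0" | "x < 0" "x + h < 0" by linarith
 thus ?thesis proof cases
  case 1
  have "tp 3 (x + h) - tp 3 x - h * tp 2 x = h^2 * (3 * x + h) / 6"
  using 1 by (simp add: t3 power2_eq_square power3_eq_cube field_simps)
  also have "\<bar>...\<bar> = h^2 * \<bar>3 * x + h\<bar> / 6" by (simp add: abs_mult)
  also have "... <= h^2 * (6 * (B + 1)) / 6" using assms by (intro divide_right_mono mult_left_mono) auto
  finally show ?thesis by (simp add: algebra_simps)
 next
  case 2
  have "tp 3 (x + h) - tp 3 x - h * tp 2 x = x^2 * (- x - 3 * h) / 6"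
  using 2 by (simp add: t3 t3' power2_eq_square power3_eq_cube field_simps)
  also have "\<bar>...\<bar> = x^2 * \<bar>- x - 3 * h\<bar> / 6" by (simp add: abs_mult)
  also have "... <= h^2 * (6 * (B + 1)) / 6"
  using assms 2 by (intro divide_right_mono mult_mono) (auto simp: abs_le_square_iff[symmetric])
  finally show ?thesis by (simp add: algebra_simps)
 next
  case 3
  have eq: "tp 3 (x + h) - tp 3 x - h * tp 2 x = (x + h) ^ 3 / 6" using 3 by (simp add: t3 t3')
  have "(x + h) ^ 3 <= \<bar>h\<bar> ^ 3" using 3 by (intro power_mono) auto
  moreover have "0 <= (x + h) ^ 3" using 3 by (intro zero_le_power) auto
  ultimately have "\<bar>tp 3 (x + h) - tp 3 x - h * tp 2 x\<bar> <= h^2" unfolding eq using h3 hh by linarith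
  also have "... <= (B + 1) * h^2" using B mult_right_mono[of 1 "B + 1" "h^2"] by simp
  finally show ?thesis .
 next
  case 4 thus ?thesis using B by (simp add: t3')
 qed
qed

lemma DERIV_quadratic_error:
 fixes F :: "real => real" assumes "!!h. \<bar>h\<bar> <= 1 ==> \<bar>F (x + h) - F x - h * D\<bar> <= C * h^2"
 shows "(F has_real_derivative D) (at x)" unfolding DERIV_def proof (rule LIM_zero_cancel, rule Lim_null_comparison)
 have "\<bar>(F (x + h) - F x) / h - D\<bar> <= C * \<bar>h\<bar>" if "h ~= 0" "\<bar>h\<bar> < 1" for h proof -
  have "(F (x + h) - F x) / h - D = (F (x + h) - F x - h * D) / h" using that by (simp add: field_simps)
  also have "\<bar>...\<bar> <= C * h^2 / \<bar>h\<bar>" using assms[of h] that by (simp add: divide_right_mono)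
  also have "... = C * \<bar>h\<bar>" using that by (simp add: power2_eq_square field_simps abs_if)
  finally show ?thesis .
 qed
 hence "eventually (%h. \<bar>(F (x + h) - F x) / h - D\<bar> <= C * \<bar>h\<bar>) (at 0)"
  unfolding eventually_at by (intro exI[of _ 1]) (auto simp: dist_real_def)
 thus "eventually (%h. norm ((F (x + h) - F x) / h - D) <= C * \<bar>h\<bar>) (at 0)" by simp
 show "((%h. C * \<bar>h\<bar>) \<longlongrightarrow> 0) (at 0)" by (auto intro!: tendsto_eq_intros)
qed

lemma DERIV_tp: "(tp 3 has_real_derivative tp 2 x) (at x)" "(tp 2 has_real_derivative tp 1 x) (at x)" proof -
 show "(tp 3 has_real_derivative tp 2 x) (at x)"
  by (rule DERIV_quadratic_error[where C = "\<bar>x\<bar> + 1"]) (rule tp_quot_3, auto)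
 show "(tp 2 has_real_derivative tp 1 x) (at x)" by (rule DERIV_quadratic_error[where C = 1]) (use tp_quot_2 in auto)
qed

lemma tp_neg: "k > 0 ==> x <= 0 ==> tp k x = 0" by (simp add: tp_def max_def)

lemma continuous_on_tp: "continuous_on A (tp k)" unfolding tp_def[abs_def] by (intro continuous_intros) auto

lemma tp_mult: "x * tp 1 x = 2 * tp 2 x" "x * tp 2 x = 3 * tp 3 x"
 by (auto simp: tp_def max_def fact_numeral power2_eq_square power3_eq_cube)

text \<open>\<open>Sf\<close> and \<open>Cf\<close> solve \<open>y'' = (1 - lam) y\<close> with
  initial values \<open>(0, 1)\<close> and \<open>(1, 0)\<close>; the cases are the hyperbolic, the
  degenerate and the trigonometric one. \<open>Sf lam r / sinh r\<close> is the spherical function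
  of hyperbolic 3-space.\<close>

definition Sf :: "real => real => real" where
 "Sf lam r = (if lam < 1 then sinh (sqrt (1 - lam) * r) / sqrt (1 - lam)
  else if lam = 1 then r else sin (sqrt (lam - 1) * r) / sqrt (lam - 1))"

definition Cf :: "real => real => real" where
 "Cf lam r = (if lam < 1 then cosh (sqrt (1 - lam) * r)
  else if lam = 1 then 1 else cos (sqrt (lam - 1) * r))"

lemma DERIV_Sf: "(Sf lam has_real_derivative Cf lam r) (at r)" proof -
 have h: "((%r. sinh (a * r) / a) has_real_derivative cosh (a * r)) (at r)"
  "((%r. sin (a * r) / a) has_real_derivative cos (a * r)) (at r)" if "a > 0" for a :: real
  using that by (auto intro!: derivative_eq_intros)
 consider "lam < 1" | "lam = 1" | "lam > 1" by linarith
 thus ?thesis proof cases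
  case 1 thus ?thesis using h(1)[of "sqrt (1 - lam)"] unfolding Sf_def[abs_def] Cf_def by simp
 next
  case 2 thus ?thesis unfolding Sf_def[abs_def] Cf_def by (auto intro!: derivative_eq_intros)
 next
  case 3 thus ?thesis using h(2)[of "sqrt (lam - 1)"] unfolding Sf_def[abs_def] Cf_def by simp
 qed
qed

lemma DERIV_Cf: "(Cf lam has_real_derivative (1 - lam) * Sf lam r) (at r)" proof -
 have h: "((%r. cosh (a * r)) has_real_derivative a^2 * (sinh (a * r) / a)) (at r)"
  "((%r. cos (a * r)) has_real_derivative - (a^2) * (sin (a * r) / a)) (at r)" if "a > 0" for a :: real
  using that by (auto intro!: derivative_eq_intros simp: power2_eq_square)
 consider "lam < 1" | "lam = 1" | "lam > 1" by linarith
 thus ?thesis proof cases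
  case 1 thus ?thesis using h(1)[of "sqrt (1 - lam)"] unfolding Sf_def Cf_def[abs_def] by simp
 next
  case 2 thus ?thesis unfolding Sf_def Cf_def[abs_def] by (auto intro!: derivative_eq_intros)
 next
  case 3 thus ?thesis using h(2)[of "sqrt (lam - 1)"] unfolding Sf_def Cf_def[abs_def] by simp
 qed
qed

lemma Sf_Cf_0 [simp]: "Sf lam 0 = 0" "Cf lam 0 = 1" by (auto simp: Sf_def Cf_def)

lemma Cf_Sf_square: "(Cf lam r)^2 - (1 - lam) * (Sf lam r)^2 = 1" proof -
 consider "lam < 1" | "lam = 1" | "lam > 1" by linarith
 thus ?thesis proof cases
  case 1 thus ?thesis using cosh_square_eq[of "sqrt (1 - lam) * r"] by (simp add: Sf_def Cf_def power_divide)
 next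
  case 2 thus ?thesis by (simp add: Sf_def Cf_def)
 next
  case 3
  have "(1 - lam) * (x / (lam - 1)) = - x" for x using 3 by (simp add: field_simps)
  thus ?thesis using 3 sin_cos_squared_add2[of "sqrt (lam - 1) * r"] by (simp add: Sf_def Cf_def power_divide)
 qed
qed

lemma continuous_on_Sf [continuous_intros]: "continuous_on A f ==> continuous_on A (%x. Sf lam (f x))"
 using DERIV_continuous_on[of UNIV "Sf lam" "Cf lam", OF has_field_derivative_at_within[OF DERIV_Sf]] continuous_on_compose2[of UNIV "Sf lam"] by blast
lemma continuous_on_Cf [continuous_intros]: "continuous_on A f ==> continuous_on A (%x. Cf lam (f x))"
 using DERIV_continuous_on[of UNIV "Cf lam" "%r. (1 - lam) * Sf lam r", OF has_field_derivative_at_within[OF DERIV_Cf]] continuous_on_compose2[of UNIV "Cf lam"] by blast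

text \<open>Uniqueness for \<open>Y'' = (1 - lam) Y\<close>: the two combinations below are constants of motion.\<close>

lemma oscillator_solution:
 assumes Y: "!!r. r > 0 ==> (Y has_real_derivative Z r) (at r)"
  and Z: "!!r. r > 0 ==> (Z has_real_derivative (1 - lam) * Y r) (at r)"
 shows "\<exists>c1 c2. \<forall>r>0. Y r = c1 * Cf lam r + c2 * Sf lam r" proof -
 define f where "f r = Y r * Cf lam r - Z r * Sf lam r" for r
 define g where "g r = Z r * Cf lam r - (1 - lam) * Y r * Sf lam r" for r
 have "(f has_real_derivative 0) (at r within {0<..})" if "r : {0<..}" for r proof -
  have r: "r > 0" using that by simp
  have "(f has_real_derivative 0) (at r)" unfolding f_def[abs_def]
  by (rule DERIV_cong[OF DERIV_diff[OF DERIV_mult[OF Y[OF r] DERIV_Cf[of lam r]] DERIV_mult[OF Z[OF r] DERIV_Sf[of lam r]]]])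
  (simp add: algebra_simps)
  thus ?thesis by (rule has_field_derivative_at_within)
 qed
 then obtain c1 where c1: "!!r. r > 0 ==> f r = c1" using has_field_derivative_zero_constant[of "{0<..}" f] by auto
 have "(g has_real_derivative 0) (at r within {0<..})" if "r : {0<..}" for r proof -
  have r: "r > 0" using that by simp
  have "(g has_real_derivative 0) (at r)" unfolding g_def[abs_def]
  by (rule DERIV_cong[OF DERIV_diff[OF DERIV_mult[OF Z[OF r] DERIV_Cf[of lam r]]
  DERIV_mult[OF DERIV_cmult[OF Y[OF r], of "1 - lam"] DERIV_Sf[of lam r]]]])
  (simp add: algebra_simps)
  thus ?thesis by (rule has_field_derivative_at_within)
 qed
 then obtain c2 where c2: "!!r. r > 0 ==> g r = c2" using has_field_derivative_zero_constant[of "{0<..}" g] by auto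
 have "Y r = c1 * Cf lam r + c2 * Sf lam r" if "r > 0" for r proof -
  have "c1 * Cf lam r + c2 * Sf lam r = Y r * ((Cf lam r)^2 - (1 - lam) * (Sf lam r)^2)"
  unfolding c1[OF that, symmetric] c2[OF that, symmetric] f_def g_def by (simp add: power2_eq_square algebra_simps)
  thus ?thesis by (simp add: Cf_Sf_square)
 qed
 thus ?thesis by blast
qed

lemma wd_lines:
 fixes a1 a2 b :: real assumes b: "b > 0" and q: "q : H3"
 defines "p \<equiv> (a1, a2, b)"
 defines "S \<equiv> %q::point. (fst q - a1)^2 + (fst (snd q) - a2)^2 + b^2"
 shows "((%s. wd p (q + s *\<^sub>R e1)) has_real_derivative (fst q - a1) / (b * ht q)) (at 0)"
  and "((%s. wd p (q + s *\<^sub>R e2)) has_real_derivative (fst (snd q) - a2) / (b * ht q)) (at 0)"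
  and "((%s. wd p (q + s *\<^sub>R e3)) has_real_derivative ((ht q)^2 - S q) / (2 * b * (ht q)^2)) (at 0)"
  and "((%s. (fst (q + s *\<^sub>R e1) - a1) / (b * ht (q + s *\<^sub>R e1))) has_real_derivative 1 / (b * ht q)) (at 0)"
  and "((%s. (fst (snd (q + s *\<^sub>R e2)) - a2) / (b * ht (q + s *\<^sub>R e2))) has_real_derivative 1 / (b * ht q)) (at 0)"
  and "((%s. ((ht (q + s *\<^sub>R e3))^2 - S (q + s *\<^sub>R e3)) / (2 * b * (ht (q + s *\<^sub>R e3))^2))
  has_real_derivative S q / (b * (ht q) ^ 3)) (at 0)" proof -
 obtain x1 x2 y where qe: "q = (x1, x2, y)" by (cases q)
 have y: "y > 0" using q by (simp add: qe H3_def)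
 note [derivative_intros] = DERIV_power
 show "((%s. wd p (q + s *\<^sub>R e1)) has_real_derivative (fst q - a1) / (b * ht q)) (at 0)"
  unfolding qe p_def wd_def using b y by (auto intro!: derivative_eq_intros simp: field_simps)
 show "((%s. wd p (q + s *\<^sub>R e2)) has_real_derivative (fst (snd q) - a2) / (b * ht q)) (at 0)"
  unfolding qe p_def wd_def using b y by (auto intro!: derivative_eq_intros simp: field_simps)
 show "((%s. wd p (q + s *\<^sub>R e3)) has_real_derivative ((ht q)^2 - S q) / (2 * b * (ht q)^2)) (at 0)"
  unfolding qe p_def wd_def S_def using b y by (auto intro!: derivative_eq_intros simp: field_simps power2_eq_square)
 show "((%s. (fst (q + s *\<^sub>R e1) - a1) / (b * ht (q + s *\<^sub>R e1))) has_real_derivative 1 / (b * ht q)) (at 0)"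
  unfolding qe using b y by (auto intro!: derivative_eq_intros simp: field_simps)
 show "((%s. (fst (snd (q + s *\<^sub>R e2)) - a2) / (b * ht (q + s *\<^sub>R e2))) has_real_derivative 1 / (b * ht q)) (at 0)"
  unfolding qe using b y by (auto intro!: derivative_eq_intros simp: field_simps)
 show "((%s. ((ht (q + s *\<^sub>R e3))^2 - S (q + s *\<^sub>R e3)) / (2 * b * (ht (q + s *\<^sub>R e3))^2))
  has_real_derivative S q / (b * (ht q) ^ 3)) (at 0)" unfolding qe S_def using b y
  by (auto intro!: derivative_eq_intros simp: field_simps power2_eq_square power3_eq_cube)
qed

section \<open>Integrals of an eigenfunction against radial kernels\<close>

locale eig_at =
 fixes u :: "point => real" and lam :: real and p :: point
 assumes u: "C2_on H3 u" and lam: "!!q. q : H3 ==> - laplacian u q = lam * u q" and p: "p : H3"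
begin

lemma cu: "continuous_on H3 u" using u by (auto simp: C2_on_def intro: differentiable_imp_continuous_on)

lemma um [measurable]: "u : borel_measurable hv" by (rule hv_measurableI_continuous[OF cu])

lemma u_bdd: "\<exists>B\<ge>0. ALL q:hball p W. \<bar>u q\<bar> <= B" proof -
 have "compact (u ` hball p W)"
  using compact_hball[OF p] cu by (meson compact_continuous_image continuous_on_subset hball_subset)
 hence "bounded (u ` hball p W)" by (rule compact_imp_bounded)
 then obtain B where "ALL x:hball p W. \<bar>u x\<bar> <= B" by (auto simp: bounded_iff)
 thus ?thesis by (intro exI[of _ "max B 0"]) auto
qed

lemma wdm [measurable]: "(%q. wd p q) : borel_measurable hv" by (intro hv_measurableI_borel wd_borel)

lemma hbm [measurable]: "hball p W : sets hv" using p by simp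

lemma integ:
 assumes "G : borel_measurable borel" and "!!w. w > W ==> G w = 0" and B: "!!w. 1 <= w ==> w <= W ==> \<bar>G w\<bar> <= B"
 shows "integrable hv (%q. G (wd p q) * u q)" proof -
 obtain C where C: "C >= 0" "ALL q:hball p W. \<bar>u q\<bar> <= C" using u_bdd by blast
 note [measurable] = assms(1)
 show ?thesis proof (rule integrable_hv_hball[OF p, of _ W "\<bar>B\<bar> * C"])
  show "(%q. G (wd p q) * u q) : borel_measurable hv" by measurable
  show "\<bar>G (wd p q) * u q\<bar> <= \<bar>B\<bar> * C" if "q : hball p W" for q unfolding abs_mult
  proof (rule mult_mono)
  show "\<bar>G (wd p q)\<bar> <= \<bar>B\<bar>" using that B[of "wd p q"] wd_ge_1[OF p] by (auto simp: hball_def)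
  qed (use that C in auto)
  show "G (wd p q) * u q = 0" if "q : H3" "q ~: hball p W" for q
  using that assms(2)[of "wd p q"] by (auto simp: hball_def)
 qed
qed

text \<open>A \<open>k\<close>-fold antiderivative of the ball integral \<open>MM\<close> in the
  variable \<open>W\<close>. The differential equation is found for \<open>Phi\<close> first,
  because the indicator of a ball is not differentiable.\<close>

definition Phi :: "nat => real => real" where
 "Phi k W = (LINT q|hv. tp k (W - wd p q) * u q)"

definition MM :: "real => real" where
 "MM W = (LINT q|hv. indicator (hball p W) q * u q)"

lemma tp_borel [measurable]: "tp k : borel_measurable borel"
 by (intro borel_measurable_continuous_onI continuous_on_tp)

lemma tp_bdd: "0 <= w ==> \<bar>tp k (W - w)\<bar> <= \<bar>W\<bar> ^ k" proof -
 assume "0 <= w"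
 hence "(max (W - w) 0) ^ k <= \<bar>W\<bar> ^ k" by (intro power_mono) auto
 moreover have "(max (W - w) 0) ^ k / fact k <= (max (W - w) 0) ^ k" by (simp add: divide_le_eq mult_le_cancel_left1)
 ultimately show ?thesis by (simp add: tp_def abs_mult)
qed

lemma integ_tp: "k > 0 ==> integrable hv (%q. tp k (W - wd p q) * u q)"
 by (rule integ[where G = "%w. tp k (W - w)" and W = W and B = "\<bar>W\<bar> ^ k"],
  measurable, simp add: tp_neg, rule tp_bdd, simp)

lemma integ_abs: "integrable hv (%q. indicator (hball p W) q * \<bar>u q\<bar>)" proof -
 have "integrable hv (%q. indicator {..W} (wd p q) * u q)" by (rule integ[where W = W and B = 1]) auto
 hence "integrable hv (%q. \<bar>indicator {..W} (wd p q) * u q\<bar>)" by (rule integrable_abs)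
 thus ?thesis by (rule Bochner_Integration.integrable_cong[THEN iffD1, rotated -1])
  (auto simp: hball_def indicator_def)
qed

text \<open>The quadratic error of \<open>tp\<close> is uniform on the ball that contains all
  supports for \<open>\<bar>h\<bar> \<le> 1\<close>, so it survives integration against
  \<open>u\<close>.\<close>

lemma Phi_deriv_gen:
 assumes k: "k > 0" and tq: "!!x h B. \<bar>x\<bar> <= B ==> \<bar>h\<bar> <= 1 ==> \<bar>tp (Suc k) (x + h) - tp (Suc k) x - h * tp k x\<bar> <= (B + 1) * h^2"
 shows "(Phi (Suc k) has_real_derivative Phi k W) (at W)" proof (rule DERIV_quadratic_error)
 fix h :: real assume h: "\<bar>h\<bar> <= 1"
 define W1 where "W1 = \<bar>W\<bar> + 1"
 have eq: "Phi (Suc k) (W + h) - Phi (Suc k) W - h * Phi k W =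
  (LINT q|hv. tp (Suc k) (W + h - wd p q) * u q - tp (Suc k) (W - wd p q) * u q - h * (tp k (W - wd p q) * u q))"
  unfolding Phi_def using k by (simp add: integ_tp)
 have "\<bar>Phi (Suc k) (W + h) - Phi (Suc k) W - h * Phi k W\<bar> <= (LINT q|hv. ((2 * W1 + 1) * h^2) * (indicator (hball p W1) q * \<bar>u q\<bar>))"
  unfolding eq proof (rule integral_abs_bound[THEN order_trans], rule integral_mono)
  show "integrable hv (%q. \<bar>tp (Suc k) (W + h - wd p q) * u q - tp (Suc k) (W - wd p q) * u q - h * (tp k (W - wd p q) * u q)\<bar>)"
  using k by (intro integrable_abs Bochner_Integration.integrable_diff integrable_mult_right integ_tp) auto
  show "integrable hv (%q. ((2 * W1 + 1) * h^2) * (indicator (hball p W1) q * \<bar>u q\<bar>))"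
  by (intro integrable_mult_right integ_abs)
  fix q assume "q : space hv"
  hence q: "q : H3" by simp
  have w1: "wd p q >= 1" using wd_ge_1[OF p q] .
  have e: "tp (Suc k) (W + h - wd p q) * u q - tp (Suc k) (W - wd p q) * u q - h * (tp k (W - wd p q) * u q)
  = (tp (Suc k) ((W - wd p q) + h) - tp (Suc k) (W - wd p q) - h * tp k (W - wd p q)) * u q"
  by (simp add: algebra_simps)
  show "\<bar>tp (Suc k) (W + h - wd p q) * u q - tp (Suc k) (W - wd p q) * u q - h * (tp k (W - wd p q) * u q)\<bar>
  <= ((2 * W1 + 1) * h^2) * (indicator (hball p W1) q * \<bar>u q\<bar>)" proof (cases "wd p q <= W1")
  case True
  have "\<bar>tp (Suc k) ((W - wd p q) + h) - tp (Suc k) (W - wd p q) - h * tp k (W - wd p q)\<bar> <= (2 * W1 + 1) * h^2"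
  by (rule tq[OF _ h]) (use True w1 in "auto simp: W1_def")
  thus ?thesis unfolding e abs_mult using True q by (simp add: hball_def mult_right_mono)
  next
  case False
  hence "W + h - wd p q <= 0" "W - wd p q <= 0" using h by (auto simp: W1_def)
  thus ?thesis using False k by (simp add: tp_neg hball_def)
  qed
 qed
 also have "... = ((2 * W1 + 1) * (LINT q|hv. indicator (hball p W1) q * \<bar>u q\<bar>)) * h^2" by simp
 finally show "\<bar>Phi (Suc k) (W + h) - Phi (Suc k) W - h * Phi k W\<bar> \<le>
  ((2 * (\<bar>W\<bar> + 1) + 1) * (LINT q|hv. indicator (hball p (\<bar>W\<bar> + 1)) q * \<bar>u q\<bar>)) * h^2" by (simp add: W1_def)
qed

lemma Phi_deriv: "(Phi 3 has_real_derivative Phi 2 W) (at W)" "(Phi 2 has_real_derivative Phi 1 W) (at W)" proof -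
 show "(Phi 3 has_real_derivative Phi 2 W) (at W)"
  using Phi_deriv_gen[of 2 W] tp_quot_3 by (simp add: numeral_3_eq_3 numeral_2_eq_2)
 have "\<bar>tp 2 (x + h) - tp 2 x - h * tp 1 x\<bar> <= (B + 1) * h^2" if "\<bar>x\<bar> <= B" for x h B :: real
 proof -
  have "1 * h^2 <= (B + 1) * h^2" using that by (intro mult_right_mono) auto
  thus ?thesis using tp_quot_2[of x h] by simp
 qed
 thus "(Phi 2 has_real_derivative Phi 1 W) (at W)" using Phi_deriv_gen[of 1 W] by (simp add: numeral_2_eq_2)
qed

text \<open>Only quotients from the right are taken: they tend to the indicator of the closed ball
  at every point, so spheres need no separate treatment. That a derivative exists is supplied by
  \<open>Phi_ode\<close> in \<open>Phi_1_deriv\<close>.\<close>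

lemma Phi_1_deriv_eq:
 assumes "(Phi 1 has_real_derivative D) (at W)" shows "D = MM W" proof -
 define h where "h n = 1 / real (Suc n)" for n
 have h: "h n > 0" "h n <= 1" for n by (auto simp: h_def)
 have h0: "h \<longlonglongrightarrow> 0" unfolding h_def by (rule LIMSEQ_Suc[OF lim_1_over_n])
 have "((%s. (Phi 1 (W + s) - Phi 1 W) / s) \<longlongrightarrow> D) (at 0)" using assms by (simp add: DERIV_def)
 hence 1: "(%n. (Phi 1 (W + h n) - Phi 1 W) / h n) \<longlonglongrightarrow> D" by (rule filterlim_compose)
  (use h h0 in "auto simp: filterlim_at eventually_sequentially intro!: exI[of _ 0]; metis less_irrefl")
 have "(%n. (LINT q|hv. (tp 1 (W + h n - wd p q) * u q - tp 1 (W - wd p q) * u q) / h n)) \<longlonglongrightarrow> MM W"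
  unfolding MM_def proof (rule integral_dominated_convergence)
  show "integrable hv (%q. indicator (hball p (W + 1)) q * \<bar>u q\<bar>)" by (rule integ_abs)
  show "AE q in hv. (%n. (tp 1 (W + h n - wd p q) * u q - tp 1 (W - wd p q) * u q) / h n) \<longlonglongrightarrow> indicator (hball p W) q * u q"
  proof (rule AE_I2)
  fix q assume "q : space hv"
  hence q: "q : H3" by simp
  show "(%n. (tp 1 (W + h n - wd p q) * u q - tp 1 (W - wd p q) * u q) / h n) \<longlonglongrightarrow> indicator (hball p W) q * u q"
  proof (cases "wd p q <= W")
  case True
  have "(tp 1 (W + h n - wd p q) * u q - tp 1 (W - wd p q) * u q) / h n = u q" for n
  using True h[of n] by (simp add: tp_def field_simps)
  thus ?thesis using True q by (simp add: hball_def)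
  next
  case False
  hence "eventually (%n. h n < wd p q - W) sequentially" using order_tendstoD(2)[OF h0, of "wd p q - W"] by simp
  hence "eventually (%n. (tp 1 (W + h n - wd p q) * u q - tp 1 (W - wd p q) * u q) / h n = 0) sequentially"
  by eventually_elim (use False in "simp add: tp_neg")
  thus ?thesis using False by (simp add: hball_def tendsto_eventually)
  qed
  qed
  show "AE q in hv. norm ((tp 1 (W + h n - wd p q) * u q - tp 1 (W - wd p q) * u q) / h n) <= indicator (hball p (W + 1)) q * \<bar>u q\<bar>" for n
  proof (rule AE_I2)
  fix q assume "q : space hv"
  hence q: "q : H3" by simp
  have e: "(tp 1 (W + h n - wd p q) * u q - tp 1 (W - wd p q) * u q) / h n = ((tp 1 (W + h n - wd p q) - tp 1 (W - wd p q)) / h n) * u q"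
  by (simp add: field_simps)
  show "norm ((tp 1 (W + h n - wd p q) * u q - tp 1 (W - wd p q) * u q) / h n) <= indicator (hball p (W + 1)) q * \<bar>u q\<bar>"
  proof (cases "wd p q <= W + 1")
  case True
  have l: "\<bar>(tp 1 (W + h n - wd p q) - tp 1 (W - wd p q)) / h n\<bar> <= 1"
  using h[of n] by (auto simp: tp_def max_def field_simps)
  have "norm ((tp 1 (W + h n - wd p q) * u q - tp 1 (W - wd p q) * u q) / h n)
  = \<bar>(tp 1 (W + h n - wd p q) - tp 1 (W - wd p q)) / h n\<bar> * \<bar>u q\<bar>"
  unfolding e by (simp only: real_norm_def abs_mult)
  also have "... <= 1 * \<bar>u q\<bar>" by (rule mult_right_mono[OF l]) simp
  finally show ?thesis using True q by (simp add: hball_def)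
  next
  case False
  thus ?thesis using h[of n] by (simp add: tp_neg hball_def)
  qed
  qed
 qed measurable
 moreover have "(%n. (LINT q|hv. (tp 1 (W + h n - wd p q) * u q - tp 1 (W - wd p q) * u q) / h n)) =
  (%n. (Phi 1 (W + h n) - Phi 1 W) / h n)" unfolding Phi_def by (simp add: integ_tp)
 ultimately have "(%n. (Phi 1 (W + h n) - Phi 1 W) / h n) \<longlonglongrightarrow> MM W" by (simp only:)
 thus ?thesis using 1 LIMSEQ_unique by blast
qed

text \<open>Green's identity for the truncated power \<open>tp 3 (W - wd p q)\<close>.\<close>

lemma Phi_ode: "(W^2 - 1) * Phi 1 W - 7 * W * Phi 2 W + (15 + lam) * Phi 3 W = 0" proof -
 obtain a1 a2 b where pe: "p = (a1, a2, b)" by (cases p)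
 have b: "b > 0" using p by (simp add: pe H3_def)
 define S where "S q = (fst q - a1)^2 + (fst (snd q) - a2)^2 + b^2" for q :: point
 define we where "we e q = (if e = e1 then (fst q - a1) / (b * ht q) else if e = e2 then (fst (snd q) - a2) / (b * ht q)
  else ((ht q)^2 - S q) / (2 * b * (ht q)^2))" for e q
 define wee where "wee e q = (if e = e3 then S q / (b * (ht q) ^ 3) else 1 / (b * ht q))" for e q
 have ht0: "ht q ~= 0" if "q : H3" for q using that by (auto simp: H3_iff)
 have we: "we e1 = (%q. (fst q - a1) / (b * ht q))" "we e2 = (%q. (fst (snd q) - a2) / (b * ht q))"
  "we e3 = (%q. ((ht q)^2 - S q) / (2 * b * (ht q)^2))"
  and wee: "wee e1 = (%q. 1 / (b * ht q))" "wee e2 = (%q. 1 / (b * ht q))"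
  "wee e3 = (%q. S q / (b * (ht q) ^ 3))" by (simp_all add: we_def wee_def fun_eq_iff)
 have dw': "((%s. wd p (q + s *\<^sub>R e)) has_real_derivative we e q) (at 0) &
  ((%s. we e (q + s *\<^sub>R e)) has_real_derivative wee e q) (at 0)" if q: "q : H3" and e: "e : {e1, e2, e3}" for q e
 proof -
  note L = wd_lines[OF b q]
  consider "e = e1" | "e = e2" | "e = e3" using e by blast
  thus ?thesis proof cases
  case 1 show ?thesis unfolding 1 we wee pe by (rule conjI L)+
  next
  case 2 show ?thesis unfolding 2 we wee pe by (rule conjI L)+
  next
  case 3 show ?thesis unfolding 3 we wee pe S_def by (rule conjI L)+
  qed
 qed
 hence dw: "((%s. wd p (q + s *\<^sub>R e)) has_real_derivative we e q) (at 0)"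
  "((%s. we e (q + s *\<^sub>R e)) has_real_derivative wee e q) (at 0)" if "q : H3" "e : {e1, e2, e3}" for q e
  using that by blast+
 have cwe: "continuous_on H3 (we e)" "continuous_on H3 (wee e)" if "e : {e1, e2, e3}" for e
  using b ht0 that unfolding we_def wee_def S_def by (auto intro!: continuous_intros)
 define f where "f q = tp 3 (W - wd p q)" for q
 define f1 where "f1 e q = - tp 2 (W - wd p q) * we e q" for e q
 define f2 where "f2 e q = tp 1 (W - wd p q) * (we e q)^2 - tp 2 (W - wd p q) * wee e q" for e q
 define Lf where "Lf q = ((wd p q)^2 - 1) * tp 1 (W - wd p q) - 3 * wd p q * tp 2 (W - wd p q)" for q
 have ctp: "continuous_on H3 (%q. tp k (W - wd p q))" for k
  by (rule continuous_on_compose2[OF continuous_on_tp[of UNIV k]]) (auto intro!: continuous_intros continuous_on_wd[OF p])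
 have "integral\<^sup>L hv (%q. u q * (Lf q + lam * f q)) = 0" proof (rule green[OF u lam, where K = "hball p W"])
  fix q e assume q: "q : H3" and e: "e : {e1, e2, e3}"
  have dm: "((%s. W - wd p (q + s *\<^sub>R e)) has_real_derivative - we e q) (at 0)"
  by (rule DERIV_cong[OF DERIV_diff[OF DERIV_const dw(1)[OF q e]]]) simp
  have dt: "((%s. tp 3 (W - wd p (q + s *\<^sub>R e))) has_real_derivative tp 2 (W - wd p q) * - we e q) (at 0)"
  "((%s. tp 2 (W - wd p (q + s *\<^sub>R e))) has_real_derivative tp 1 (W - wd p q) * - we e q) (at 0)"
  using DERIV_chain2[OF DERIV_tp(1) dm] DERIV_chain2[OF DERIV_tp(2) dm] by simp_all
  show "((%s. f (q + s *\<^sub>R e)) has_real_derivative f1 e q) (at 0)" unfolding f_def f1_def using dt(1) by simp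
  show "((%s. f1 e (q + s *\<^sub>R e)) has_real_derivative f2 e q) (at 0)" unfolding f1_def f2_def
  by (rule DERIV_cong[OF DERIV_mult[OF DERIV_minus[OF dt(2)] dw(2)[OF q e]]])
  (simp add: power2_eq_square algebra_simps)
 next
  show "continuous_on H3 f" unfolding f_def by (rule ctp)
  fix e assume e: "e : {e1, e2, e3}"
  show "continuous_on H3 (f1 e)" "continuous_on H3 (f2 e)" unfolding f1_def f2_def
  using cwe[OF e] by (auto intro!: continuous_intros ctp)
 next
  show "compact (hball p W)" "hball p W \<subseteq> H3" using compact_hball[OF p] hball_subset by auto
  fix q e assume "q : H3" "q ~: hball p W"
  hence "W - wd p q <= 0" by (auto simp: hball_def)
  thus "f q = 0 & f1 e q = 0 & f2 e q = 0" by (simp add: f_def f1_def f2_def tp_neg)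
 next
  fix q assume q: "q : H3"
  hence y: "ht q > 0" by (simp add: H3_iff)
  have wq: "wd p q = (S q + (ht q)^2) / (2 * b * ht q)" by (cases q) (simp add: pe wd_def S_def)
  have ne: "e1 ~= e3" "e2 ~= e3" "e1 ~= e2" "e2 ~= e1" "e3 ~= e1" "e3 ~= e2" by auto
  \<comment> \<open>The squared hyperbolic gradient of \<open>w = wd p\<close> is
    \<open>w^2 - 1\<close>, and its Laplacian, computed next, is \<open>3 w\<close>. So the
    Laplacian of a function \<open>f\<close> of \<open>w\<close> is
    \<open>(w^2 - 1) f'' + 3 w f'\<close>.\<close>
  have A: "(ht q)^2 * ((we e1 q)^2 + (we e2 q)^2 + (we e3 q)^2) = (wd p q)^2 - 1" proof -
  have s12: "(we e1 q)^2 + (we e2 q)^2 = (S q - b^2) / (b * ht q)^2"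
  by (simp add: we_def S_def power_divide add_divide_distrib)
  show ?thesis unfolding s12 we(3) wq using y b by (simp add: field_simps power2_eq_square)
  qed
  have B: "(ht q)^2 * (wee e1 q + wee e2 q + wee e3 q) - ht q * we e3 q = 3 * wd p q"
  using y b by (simp add: we_def wee_def wq field_simps power2_eq_square power3_eq_cube)
  have "(ht q)^2 * (f2 e1 q + f2 e2 q + f2 e3 q) - ht q * f1 e3 q =
  tp 1 (W - wd p q) * ((ht q)^2 * ((we e1 q)^2 + (we e2 q)^2 + (we e3 q)^2))
  - tp 2 (W - wd p q) * ((ht q)^2 * (wee e1 q + wee e2 q + wee e3 q) - ht q * we e3 q)"
  unfolding f1_def f2_def by (simp add: algebra_simps)
  thus "(ht q)^2 * (f2 e1 q + f2 e2 q + f2 e3 q) - ht q * f1 e3 q = Lf q" unfolding A B Lf_def by simp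
 qed
 moreover have "u q * (Lf q + lam * f q) = (W^2 - 1) * (tp 1 (W - wd p q) * u q) - 7 * W * (tp 2 (W - wd p q) * u q)
  + (15 + lam) * (tp 3 (W - wd p q) * u q)" for q proof -
  \<comment> \<open>In powers of \<open>x\<close> the coefficients can be absorbed:
    \<open>tp_mult\<close> turns each factor \<open>x\<close> into the next truncated power, and
    only coefficients in \<open>W\<close> remain.\<close>
  define x where "x = W - wd p q"
  have w: "wd p q = W - x" by (simp add: x_def)
  have x2: "x^2 * tp 1 x = 6 * tp 3 x" using tp_mult[of x] by (simp add: power2_eq_square mult.assoc)
  have "Lf q = (W^2 - 1) * tp 1 x - 2 * W * (x * tp 1 x) + x^2 * tp 1 x - 3 * W * tp 2 x + 3 * (x * tp 2 x)"
  unfolding Lf_def x_def[symmetric] unfolding w by (simp add: power2_eq_square algebra_simps)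
  hence L: "Lf q = (W^2 - 1) * tp 1 x - 7 * W * tp 2 x + 15 * tp 3 x" unfolding tp_mult x2 by simp
  show ?thesis unfolding L f_def x_def[symmetric] by (simp add: algebra_simps)
 qed
 ultimately show ?thesis by (simp add: Phi_def integ_tp)
qed

end

lemma sq_gt_1: "(W::real) > 1 ==> W^2 - 1 > 0" using power_strict_mono[of 1 W 2] by simp

lemma cosh_gt_1: "r > 0 ==> cosh (r::real) > 1" by (metis cosh_0 cosh_real_strict_mono less_irrefl order_refl)

context eig_at
begin

text \<open>For \<open>W > 1\<close> the equation \<open>Phi_ode\<close> expresses
  \<open>Phi 1\<close> through \<open>Phi 2\<close> and \<open>Phi 3\<close>, which are already
  known to be differentiable. The same gain of one derivative is repeated for \<open>MM\<close> and
  \<open>M1\<close>.\<close>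

lemma Phi_1_deriv:
 assumes W: "W > 1" shows "(Phi 1 has_real_derivative MM W) (at W)" proof -
 have ne: "x^2 - 1 > 0" if "x > 1" for x :: real using power_strict_mono[of 1 x 2] that by simp
 define F where "F x = (7 * x * Phi 2 x - (15 + lam) * Phi 3 x) / (x^2 - 1)" for x
 have F: "Phi 1 x = F x" if "x > 1" for x using Phi_ode[of x] ne[OF that] by (simp add: F_def field_simps)
 have "\<exists>D. (F has_real_derivative D) (at W)" unfolding F_def[abs_def]
  by (rule exI, rule DERIV_divide[OF DERIV_diff[OF DERIV_mult[OF DERIV_cmult[OF DERIV_ident] Phi_deriv(2)] DERIV_cmult[OF Phi_deriv(1)]]
  DERIV_diff[OF DERIV_power[OF DERIV_ident] DERIV_const]]) (use ne[OF W] in simp)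
 then obtain D where D: "(F has_real_derivative D) (at W)" by blast
 have "eventually (%x. x > 1) (nhds W)" using W by (simp add: eventually_gt_at_top order_tendstoD(1)[OF filterlim_ident])
 hence "eventually (%x. F x = Phi 1 x) (nhds W)" by eventually_elim (simp add: F del: One_nat_def)
 hence "(Phi 1 has_real_derivative D) (at W)" using D DERIV_cong_ev[of W W F "Phi 1" D D] by simp
 thus ?thesis using Phi_1_deriv_eq by blast
qed

lemma MM_eq:
 assumes W: "W > 1" shows "(W^2 - 1) * MM W = 5 * W * Phi 1 W - (8 + lam) * Phi 2 W" proof -
 have "((%W. (W^2 - 1) * Phi 1 W - 7 * W * Phi 2 W + (15 + lam) * Phi 3 W) has_real_derivative
  (2 * W) * Phi 1 W + MM W * (W^2 - 1) - (7 * Phi 2 W + Phi 1 W * (7 * W)) + (15 + lam) * Phi 2 W) (at W)"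
  by (rule DERIV_cong[OF DERIV_add[OF DERIV_diff[OF DERIV_mult[OF DERIV_diff[OF DERIV_power[OF DERIV_ident, of 2] DERIV_const] Phi_1_deriv[OF W]]
  DERIV_mult[OF DERIV_cmult[OF DERIV_ident, of 7] Phi_deriv(2)]] DERIV_cmult[OF Phi_deriv(1)]]]) simp
 moreover have "((%W. (W^2 - 1) * Phi 1 W - 7 * W * Phi 2 W + (15 + lam) * Phi 3 W) has_real_derivative 0) (at W)"
  unfolding Phi_ode by simp
 ultimately have "(2 * W) * Phi 1 W + MM W * (W^2 - 1) - (7 * Phi 2 W + Phi 1 W * (7 * W)) + (15 + lam) * Phi 2 W = 0"
  by (rule DERIV_unique)
 thus ?thesis by (simp add: algebra_simps)
qed

lemma DERIV_over_sq:
 assumes W: "W > 1" and N: "(N has_real_derivative N') (at W)" and f: "!!x. x > 1 ==> (x^2 - 1) * f x = N x"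
 shows "(f has_real_derivative (N' - 2 * W * f W) / (W^2 - 1)) (at W)" proof -
 have fN: "f x = N x / (x^2 - 1)" if "x > 1" for x using f[OF that] sq_gt_1[OF that] by (simp add: field_simps)
 have "((%x. N x / (x^2 - 1)) has_real_derivative (N' - 2 * W * f W) / (W^2 - 1)) (at W)" proof -
  have d: "((%x. x^2 - 1) has_real_derivative 2 * W) (at W)" by (auto intro!: derivative_eq_intros)
  have e: "(N' * D - D * f W * (2 * W)) / (D * D) = (N' - 2 * W * f W) / D" if "D > 0" for D
  using that by (simp add: field_simps)
  have "((%x. N x / (x^2 - 1)) has_real_derivative (N' * (W^2 - 1) - N W * (2 * W)) / ((W^2 - 1) * (W^2 - 1))) (at W)"
  by (rule DERIV_divide[OF N d]) (use sq_gt_1[OF W] in simp)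
  thus ?thesis unfolding f[OF W, symmetric] e[OF sq_gt_1[OF W]] .
 qed
 moreover have "eventually (%x. x > 1) (nhds W)" using W by (simp add: order_tendstoD(1)[OF filterlim_ident])
 hence "eventually (%x. N x / (x^2 - 1) = f x) (nhds W)" by eventually_elim (simp add: fN)
 ultimately show ?thesis using DERIV_cong_ev[of W W "%x. N x / (x^2 - 1)" f] by simp
qed

text \<open>The derivative of \<open>MM\<close>, as found by differentiating the equation once more.
  At \<open>W = cosh r\<close> it is the integral over the sphere of radius \<open>r\<close> divided
  by \<open>sinh r\<close>, and in \<open>r\<close> it obeys the equation of
  \<open>oscillator_solution\<close>.\<close>

definition M1 :: "real => real" where
 "M1 W = (3 * W * MM W - (3 + lam) * Phi 1 W) / (W^2 - 1)"

lemma MM_deriv: "W > 1 ==> (MM has_real_derivative M1 W) (at W)" proof -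
 assume W: "W > 1"
 have "((%W. 5 * W * Phi 1 W - (8 + lam) * Phi 2 W) has_real_derivative 5 * Phi 1 W + MM W * (5 * W) - (8 + lam) * Phi 1 W) (at W)"
  by (rule DERIV_cong[OF DERIV_diff[OF DERIV_mult[OF DERIV_cmult[OF DERIV_ident, of 5] Phi_1_deriv[OF W]] DERIV_cmult[OF Phi_deriv(2)]]]) simp
 from DERIV_over_sq[OF W this, of MM] MM_eq
 have "(MM has_real_derivative (5 * Phi 1 W + MM W * (5 * W) - (8 + lam) * Phi 1 W - 2 * W * MM W) / (W^2 - 1)) (at W)" by blast
 thus ?thesis unfolding M1_def by (rule DERIV_cong) (simp add: algebra_simps)
qed

lemma M1_deriv: "W > 1 ==> (M1 has_real_derivative (W * M1 W - lam * MM W) / (W^2 - 1)) (at W)" proof -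
 assume W: "W > 1"
 have "((%W. 3 * W * MM W - (3 + lam) * Phi 1 W) has_real_derivative 3 * MM W + M1 W * (3 * W) - (3 + lam) * MM W) (at W)"
  by (rule DERIV_cong[OF DERIV_diff[OF DERIV_mult[OF DERIV_cmult[OF DERIV_ident, of 3] MM_deriv[OF W]] DERIV_cmult[OF Phi_1_deriv[OF W]]]]) simp
 moreover have "(x^2 - 1) * M1 x = 3 * x * MM x - (3 + lam) * Phi 1 x" if "x > 1" for x
  unfolding M1_def using sq_gt_1[OF that] by simp
 ultimately have "(M1 has_real_derivative (3 * MM W + M1 W * (3 * W) - (3 + lam) * MM W - 2 * W * M1 W) / (W^2 - 1)) (at W)"
  using DERIV_over_sq[OF W, of "%W. 3 * W * MM W - (3 + lam) * Phi 1 W" _ M1] by blast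
 thus ?thesis by (rule DERIV_cong) (simp add: algebra_simps)
qed

lemma M1_form: "\<exists>c1 c2. \<forall>r>0. M1 (cosh r) = c1 * Cf lam r + c2 * Sf lam r"
proof (rule oscillator_solution)
 let ?Z = "%r. (cosh r * M1 (cosh r) - lam * MM (cosh r)) / sinh r"
 fix r :: real assume r: "r > 0"
 have s: "sinh r > 0" using r by simp
 have cs: "(cosh r)^2 - 1 = (sinh r)^2" by (simp add: cosh_square_eq)
 have dc: "(cosh has_real_derivative sinh r) (at r)" by (auto intro!: derivative_eq_intros)
 have ds: "(sinh has_real_derivative cosh r) (at r)" by (auto intro!: derivative_eq_intros)
 have 1: "((%r. M1 (cosh r)) has_real_derivative ?Z r) (at r)"
 proof (rule DERIV_cong[OF DERIV_chain2[OF M1_deriv[OF cosh_gt_1[OF r]] dc]])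
  show "(cosh r * M1 (cosh r) - lam * MM (cosh r)) / ((cosh r)^2 - 1) * sinh r = ?Z r"
  unfolding cs using s by (simp add: power2_eq_square)
 qed
 thus "((%r. M1 (cosh r)) has_real_derivative ?Z r) (at r)" .
 have 2: "((%r. MM (cosh r)) has_real_derivative M1 (cosh r) * sinh r) (at r)"
  by (rule DERIV_chain2[OF MM_deriv[OF cosh_gt_1[OF r]] dc])
 define m Z where "m = M1 (cosh r)" and "Z = ?Z r"
 have Zs: "cosh r * m - lam * MM (cosh r) = Z * sinh r" using s by (simp add: Z_def m_def)
 show "(?Z has_real_derivative (1 - lam) * M1 (cosh r)) (at r)"
 proof (rule DERIV_cong[OF DERIV_divide[OF DERIV_diff[OF DERIV_mult[OF dc 1] DERIV_cmult[OF 2]] ds]])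
  show "((sinh r * M1 (cosh r) + ?Z r * cosh r - lam * (M1 (cosh r) * sinh r)) * sinh r
  - (cosh r * M1 (cosh r) - lam * MM (cosh r)) * cosh r) / (sinh r * sinh r) = (1 - lam) * M1 (cosh r)"
  unfolding m_def[symmetric] Zs unfolding Z_def[symmetric] using s by (simp add: field_simps)
 qed (use s in simp)
qed

text \<open>Near \<open>p\<close> the ball is a Euclidean ball of volume
  \<open>4/3 \<pi> (b sinh r)^3\<close> and the density is close to \<open>1 / b^3\<close>. This
  initial behaviour fixes the two constants left open by \<open>M1_form\<close>.\<close>

lemma MM_cosh_asymp: "((%r. MM (cosh r) / (sinh r) ^ 3) \<longlongrightarrow> 4 / 3 * pi * u p) (at_right 0)" proof -
 obtain a1 a2 b where pe: "p = (a1, a2, b)" by (cases p)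
 have b: "b > 0" using p by (simp add: pe H3_def)
 define h where "h q = u q / (ht q) ^ 3" for q
 have ch: "continuous_on H3 h" unfolding h_def by (intro continuous_intros cu) (auto simp: H3_iff)
 have hp: "h p = u p / b ^ 3" by (simp add: h_def pe)
 have vol: "measure lborel (hball p (cosh r)) = 4 / 3 * pi * b ^ 3 * (sinh r) ^ 3" if "r > 0" for r proof -
  have "hball p (cosh r) = cball (a1, a2, cosh r * b) (b * sqrt ((cosh r)^2 - 1))"
  unfolding pe by (rule hball_cball) (use p pe in "auto simp: cosh_real_ge_1")
  also have "sqrt ((cosh r)^2 - 1) = sinh r" using that by (simp add: cosh_square_eq)
  finally have "measure lborel (hball p (cosh r)) = unit_ball_vol (real DIM(point)) * (b * sinh r) ^ DIM(point)"
  using b that by (simp add: content_cball)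
  thus ?thesis by (simp add: unit_ball_vol_3 power3_eq_cube mult_ac)
 qed
 have MMl: "MM W = (LINT q|lborel. indicator (hball p W) q * h q)" for W proof -
  have m: "(%q. indicator (hball p W) q * u q) : borel_measurable hv" by measurable
  have "(%q. indicator H3 q * (indicator (hball p W) q * u q / ht q ^ 3)) = (%q. indicator (hball p W) q * h q)"
  by (auto simp: fun_eq_iff indicator_def h_def hball_def)
  thus ?thesis unfolding MM_def hv_integral(1)[OF m] by simp
 qed
 have ic: "integrable lborel (%q. indicator (hball p W) q * g q)" if "continuous_on H3 g" for g :: "point => real" and W
  using borel_integrable_compact[OF compact_hball[OF p] continuous_on_subset[OF that hball_subset], of W] by simp
 show ?thesis proof (rule tendstoI)
  fix e :: real assume e: "e > 0"
  define e' where "e' = e / (4 / 3 * pi * b ^ 3) / 2"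
  have e': "e' > 0" using e b by (simp add: e'_def)
  have "continuous (at p) h" using ch p open_H3 by (simp add: continuous_on_eq_continuous_at)
  then obtain d where d: "d > 0" "!!q. dist q p < d ==> \<bar>h q - h p\<bar> < e'"
  using e' unfolding continuous_at_eps_delta by (auto simp: dist_real_def)
  have "((%r. 4 * b^2 * cosh r * (cosh r - 1)) \<longlongrightarrow> 4 * b^2 * cosh 0 * (cosh 0 - 1)) (at_right (0::real))"
  by (intro tendsto_intros)
  hence "eventually (%r. 4 * b^2 * cosh r * (cosh r - 1) < d^2) (at_right (0::real))"
  using d by (intro order_tendstoD(2)) auto
  moreover have "eventually (%r. r > 0) (at_right (0::real))" by (simp add: eventually_at_right_less)
  ultimately show "eventually (%r. dist (MM (cosh r) / (sinh r) ^ 3) (4 / 3 * pi * u p) < e) (at_right 0)"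
  proof eventually_elim
  case (elim r)
  have r: "r > 0" using elim by simp
  have close: "\<bar>h q - h p\<bar> < e'" if "q : hball p (cosh r)" for q proof (rule d(2))
  have q: "q : H3" "wd p q <= cosh r" using that by (auto simp: hball_def)
  have y: "ht q > 0" using q by (simp add: H3_iff)
  have "ht q <= 2 * wd p q * b" using ht_le_wd[OF q(1) p] by (simp add: wd_commute pe)
  also have "... <= 2 * cosh r * b" using q b by simp
  finally have hq: "ht q <= 2 * cosh r * b" .
  have "(norm (p - q))^2 = 2 * b * ht q * (wd p q - 1)" using norm_diff_wd[OF p q(1)] by (simp add: pe)
  also have "... <= 2 * b * (2 * cosh r * b) * (cosh r - 1)"
  using hq q b y wd_ge_1[OF p q(1)] by (intro mult_mono) auto
  also have "... = 4 * b^2 * cosh r * (cosh r - 1)" by (simp add: power2_eq_square)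
  also have "... < d^2" using elim by simp
  finally have "norm (p - q) < d" using d by (simp add: power2_less_imp_less)
  thus "dist q p < d" by (simp add: dist_norm norm_minus_commute)
  qed
  let ?B = "hball p (cosh r)"
  have vB: "measure lborel ?B = (LINT q|lborel. indicator ?B q)" using p by simp
  have "MM (cosh r) - h p * measure lborel ?B = (LINT q|lborel. indicator ?B q * (h q - h p))"
  unfolding MMl vB using ic[OF ch] ic[of "%_. 1"] by (simp add: right_diff_distrib)
  also have "\<bar>...\<bar> <= (LINT q|lborel. indicator ?B q * e')"
  proof (rule integral_abs_bound[THEN order_trans], rule integral_mono)
  show "integrable lborel (%q. \<bar>indicator ?B q * (h q - h p)\<bar>)"
  by (intro integrable_abs ic continuous_intros ch)
  show "integrable lborel (%q. indicator ?B q * e')" by (rule ic) simp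
  show "\<bar>indicator ?B q * (h q - h p)\<bar> <= indicator ?B q * e'" for q
  using close[of q] by (auto simp: indicator_def)
  qed
  also have "... = e' * measure lborel ?B" unfolding vB by simp
  finally have "\<bar>MM (cosh r) - h p * measure lborel ?B\<bar> <= e' * measure lborel ?B" .
  also have "e' * measure lborel ?B = e / 2 * (sinh r) ^ 3" unfolding vol[OF r] e'_def using b by simp
  also have "h p * measure lborel ?B = 4 / 3 * pi * u p * (sinh r) ^ 3" unfolding vol[OF r] hp using b by simp
  finally have le: "\<bar>MM (cosh r) - 4 / 3 * pi * u p * (sinh r) ^ 3\<bar> <= e / 2 * (sinh r) ^ 3" .
  have s: "(sinh r) ^ 3 > 0" using r by simp
  have "\<bar>MM (cosh r) / (sinh r) ^ 3 - 4 / 3 * pi * u p\<bar> = \<bar>MM (cosh r) - 4 / 3 * pi * u p * (sinh r) ^ 3\<bar> / (sinh r) ^ 3"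
  using s by (simp add: abs_if field_simps)
  also have "... <= e / 2" using le s by (simp add: field_simps)
  also have "... < e" using e by simp
  finally show ?case by (simp add: dist_real_def)
  qed
 qed
qed

end

lemma DERIV_integral_upper:
 fixes f :: "real => real" assumes "continuous_on UNIV f" "r > 0"
 shows "((%r. integral {0..r} f) has_real_derivative f r) (at r)" proof -
 have "((%r. integral {0..r} f) has_vector_derivative f r) (at r within {0..r + 1})"
  by (rule integral_has_vector_derivative) (use assms continuous_on_subset in auto)
 thus ?thesis using assms by (simp add: real_vector_deriv at_within_Icc_at)
qed

lemma integral_upper_tendsto_0:
 fixes f :: "real => real" assumes "continuous_on UNIV f"
 shows "((%r. integral {0..r} f) \<longlongrightarrow> 0) (at_right 0)" proof -
 have "continuous_on {0..1} (%r. integral {0..r} f)"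
  by (rule indefinite_integral_continuous_1) (intro integrable_continuous_real continuous_on_subset[OF assms] subset_UNIV)
 hence "((%r. integral {0..r} f) \<longlongrightarrow> integral {0..0} f) (at 0 within {0..1})"
  unfolding continuous_on_def by (metis atLeastAtMost_iff order_refl zero_le_one)
 thus ?thesis by (simp add: at_within_Icc_at_right)
qed

context eig_at
begin

text \<open>The differential equation leaves \<open>c1\<close> and \<open>c2\<close>. Because the
  ball integral is of order \<open>r^3\<close>, L'Hopital's rule at order 2 gives
  \<open>c1 = 0\<close>, and at order 3 it gives \<open>c2 = 4 \<pi> u p\<close>.\<close>

theorem ball_mean:
 assumes r: "r > 0" shows "MM (cosh r) = 4 * pi * u p * integral {0..r} (%s. Sf lam s * sinh s)" proof -
 obtain c1 c2 where c: "!!r. r > 0 ==> M1 (cosh r) = c1 * Cf lam r + c2 * Sf lam r" using M1_form by blast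
 define f where "f s = (c1 * Cf lam s + c2 * Sf lam s) * sinh s" for s
 have cf: "continuous_on UNIV f" unfolding f_def by (intro continuous_intros)
 define J where "J r = integral {0..r} f" for r
 have dJ: "(J has_real_derivative f r) (at r)" if "r > 0" for r
  unfolding J_def[abs_def] by (rule DERIV_integral_upper[OF cf that])
 have J0: "(J \<longlongrightarrow> 0) (at_right 0)" unfolding J_def[abs_def] by (rule integral_upper_tendsto_0[OF cf])
 have dM: "((%r. MM (cosh r)) has_real_derivative f r) (at r)" if "r > 0" for r
  by (rule DERIV_cong[OF DERIV_chain2[of MM "M1 (cosh r)" cosh r "sinh r" UNIV, OF MM_deriv[OF cosh_gt_1[OF that]]]])
  (auto simp: f_def c[OF that] intro!: derivative_eq_intros)
 have sr: "((%r. sinh r / r) \<longlongrightarrow> 1) (at_right (0::real))" proof -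
  have "(sinh has_real_derivative 1) (at 0)" by (auto intro!: derivative_eq_intros)
  hence "((%r. sinh r / r) \<longlongrightarrow> 1) (at (0::real))" by (simp add: DERIV_def)
  thus ?thesis by (rule filterlim_mono) (auto simp: at_le)
 qed
 have Mr: "((%r. MM (cosh r) / r ^ 3) \<longlongrightarrow> 4 / 3 * pi * u p) (at_right 0)"
 proof (rule Lim_transform_eventually)
  show "((%r. MM (cosh r) / (sinh r) ^ 3 * (sinh r / r) ^ 3) \<longlongrightarrow> 4 / 3 * pi * u p) (at_right 0)"
  using tendsto_mult[OF MM_cosh_asymp tendsto_power[OF sr, of 3]] by simp
  show "eventually (%r. MM (cosh r) / (sinh r) ^ 3 * (sinh r / r) ^ 3 = MM (cosh r) / r ^ 3) (at_right 0)"
  using eventually_at_right_less[of "0::real"] by eventually_elim (simp add: power_divide)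
 qed
 have M0: "((%r. MM (cosh r)) \<longlongrightarrow> 0) (at_right 0)" proof (rule Lim_transform_eventually)
  show "((%r. MM (cosh r) / r ^ 3 * r ^ 3) \<longlongrightarrow> 0) (at_right 0)"
  using tendsto_mult[OF Mr tendsto_power[OF tendsto_ident_at, of 3]] by simp
  show "eventually (%r. MM (cosh r) / r ^ 3 * r ^ 3 = MM (cosh r)) (at_right 0)"
  using eventually_at_right_less[of "0::real"] by eventually_elim simp
 qed
 have MJ: "MM (cosh r) = J r" if r: "r > 0" for r proof -
  have "((%r. MM (cosh r) - J r) has_real_derivative 0) (at r within {0<..})" if "r : {0<..}" for r
  using DERIV_diff[OF dM[of r] dJ[of r]] that by (auto intro: has_field_derivative_at_within)
  then obtain k where k: "!!r. r > 0 ==> MM (cosh r) - J r = k"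
  using has_field_derivative_zero_constant[of "{0<..}" "%r. MM (cosh r) - J r"] by auto
  have "((%r. MM (cosh r) - J r) \<longlongrightarrow> 0) (at_right 0)" using tendsto_diff[OF M0 J0] by simp
  moreover have "((%r. MM (cosh r) - J r) \<longlongrightarrow> k) (at_right 0)"
  by (rule Lim_transform_eventually[OF tendsto_const])
  (use eventually_at_right_less[of "0::real"] k in "auto elim!: eventually_mono")
  ultimately have "k = 0" by (metis tendsto_unique trivial_limit_at_right_real)
  thus ?thesis using k[OF r] by simp
 qed
 have Jr: "((%r. J r / r ^ 3) \<longlongrightarrow> 4 / 3 * pi * u p) (at_right 0)"
  by (rule Lim_transform_eventually[OF Mr])
  (use eventually_at_right_less[of "0::real"] MJ in "auto elim!: eventually_mono")
 have fl: "((%r. f r / (2 * r)) \<longlongrightarrow> c1 / 2) (at_right 0)" proof (rule Lim_transform_eventually)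
  have "continuous_on UNIV (%r. c1 * Cf lam r + c2 * Sf lam r)" by (intro continuous_intros)
  hence "((%r. c1 * Cf lam r + c2 * Sf lam r) \<longlongrightarrow> c1 * Cf lam 0 + c2 * Sf lam 0) (at 0)"
  by (simp add: continuous_on_eq_continuous_at isCont_def del: Sf_Cf_0)
  hence "((%r. c1 * Cf lam r + c2 * Sf lam r) \<longlongrightarrow> c1) (at_right 0)"
  by (auto intro: filterlim_mono at_le)
  from tendsto_divide[OF tendsto_mult[OF this sr] tendsto_const[of 2]]
  show "((%r. (c1 * Cf lam r + c2 * Sf lam r) * (sinh r / r) / 2) \<longlongrightarrow> c1 / 2) (at_right 0)" by simp
  show "eventually (%r. (c1 * Cf lam r + c2 * Sf lam r) * (sinh r / r) / 2 = f r / (2 * r)) (at_right 0)"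
  by (simp add: f_def)
 qed
 have evd: "eventually (%r. (J has_real_derivative f r) (at r)) (at_right 0)"
  using eventually_at_right_less[of "0::real"] by eventually_elim (rule dJ)
 have ev0: "eventually (%r::real. r ^ n ~= 0) (at_right 0)" for n
  using eventually_at_right_less[of "0::real"] by eventually_elim simp
 have p0: "((%r::real. r ^ n) \<longlongrightarrow> 0) (at_right 0)" if "n > 0" for n proof -
  have "((%r::real. r ^ n) \<longlongrightarrow> 0 ^ n) (at_right 0)" by (intro tendsto_intros)
  thus ?thesis using that by (simp add: zero_power)
 qed
 have "((%r. J r / r^2) \<longlongrightarrow> c1 / 2) (at_right 0)" proof (rule lhopital_right_0[OF J0])
  show "eventually (%r. ((%r. r^2) has_real_derivative 2 * r) (at r)) (at_right 0)"
  by (intro always_eventually allI) (auto intro!: derivative_eq_intros)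
  show "eventually (%r::real. 2 * r ~= 0) (at_right 0)" using ev0[of 1] by simp
 qed (use p0[of 2] ev0[of 2] fl evd in auto)
 moreover have "((%r. J r / r ^ 3 * r) \<longlongrightarrow> 0) (at_right 0)"
  using tendsto_mult[OF Jr tendsto_ident_at] by simp
 hence "((%r. J r / r^2) \<longlongrightarrow> 0) (at_right 0)" by (rule Lim_transform_eventually)
  (use eventually_at_right_less[of "0::real"] in "auto elim!: eventually_mono simp: power2_eq_square power3_eq_cube")
 ultimately have c1: "c1 = 0" using tendsto_unique[OF trivial_limit_at_right_real] by fastforce
 have Sr: "((%r. Sf lam r / r) \<longlongrightarrow> 1) (at_right 0)" proof -
  have "((%r. Sf lam r / r) \<longlongrightarrow> 1) (at 0)" using DERIV_Sf[of lam 0] by (simp add: DERIV_def)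
  thus ?thesis by (rule filterlim_mono) (auto simp: at_le)
 qed
 have fl3: "((%r. f r / (3 * r^2)) \<longlongrightarrow> c2 / 3) (at_right 0)" proof (rule Lim_transform_eventually)
  show "((%r. c2 / 3 * ((Sf lam r / r) * (sinh r / r))) \<longlongrightarrow> c2 / 3) (at_right 0)"
  using tendsto_mult[OF tendsto_const[of "c2 / 3"] tendsto_mult[OF Sr sr]] by simp
  show "eventually (%r. c2 / 3 * ((Sf lam r / r) * (sinh r / r)) = f r / (3 * r^2)) (at_right 0)"
  by (simp add: f_def c1 power2_eq_square)
 qed
 have "((%r. J r / r ^ 3) \<longlongrightarrow> c2 / 3) (at_right 0)" proof (rule lhopital_right_0[OF J0])
  show "eventually (%r. ((%r. r ^ 3) has_real_derivative 3 * r^2) (at r)) (at_right 0)"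
  by (intro always_eventually allI) (auto intro!: derivative_eq_intros)
  show "eventually (%r::real. 3 * r^2 ~= 0) (at_right 0)" using ev0[of 2] by simp
 qed (use p0[of 3] ev0[of 3] fl3 evd in auto)
 hence c2: "c2 = 4 * pi * u p" using tendsto_unique[OF trivial_limit_at_right_real _ Jr] by fastforce
 show ?thesis unfolding MJ[OF r] J_def f_def c1 c2 by (simp add: mult.assoc)
qed

end

section \<open>Isometries preserve volume and area\<close>

text \<open>By Vitali's covering theorem a homeomorphism that preserves the measure of all small balls,
 and null sets, preserves the measure.\<close>

lemma vitali_measure_preserving:
 fixes T T' :: "'a::euclidean_space => 'a" assumes S: "open S" and T: "T ` S \<subseteq> S" "T' ` S \<subseteq> S"
  and inv: "!!x. x : S ==> T' (T x) = x" "!!x. x : S ==> T (T' x) = x"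
  and cont: "continuous_on S T" "continuous_on S T'"
  and lip: "!!x. x : S ==> \<exists>V B. open V & x : V & (ALL y:S \<inter> V. norm (T y - T x) <= B * norm (y - x))"
  and sets_M: "sets M = sets borel" and ac: "!!N. N : null_sets lborel ==> N : null_sets M"
  and balls: "!!c r. r > 0 ==> cball c r \<subseteq> S ==> emeasure M (T ` cball c r) = emeasure M (cball c r)"
  and exh: "!!n::nat. open (A n) & A n \<subseteq> S & emeasure M (A n) ~= \<infinity>" "(\<Union>n. A n) = S"
 shows "distr (restrict_space M S) (restrict_space M S) T' = restrict_space M S" proof -
 let ?r = "restrict_space M S"
 have SB: "S : sets M" using S by (simp add: sets_M)
 have sp: "space M = UNIV" using sets_eq_imp_space_eq[OF sets_M] by simp
 have sets_r: "sets ?r = sets (restrict_space borel S)" by (rule sets_restrict_space_cong[OF sets_M])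
 have spr: "space ?r = S" by (simp add: space_restrict_space sp)
 have T'm: "T' : measurable ?r ?r" proof (rule measurable_restrict_space2)
  show "T' : space ?r \<rightarrow> S" using T spr by auto
  have "T' : borel_measurable (restrict_space borel S)" by (rule borel_measurable_continuous_on_restrict[OF cont(2)])
  thus "T' : measurable ?r M" by (simp add: measurable_cong_sets[OF sets_r sets_M])
 qed
 have rs: "X : sets ?r \<longleftrightarrow> X : sets borel & X \<subseteq> S" for X
  unfolding sets_r using S by (subst sets_restrict_space_iff) auto
 have inj: "inj_on T S" by (rule inj_on_inverseI[of S T' T]) (rule inv(1))
 have TT: "T ` U = {y : S. T' y : U}" if "U \<subseteq> S" for U proof (intro equalityI subsetI)
  fix y assume "y : T ` U"
  then obtain x where x: "x : U" "y = T x" by blast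
  hence "x : S" using that by blast
  thus "y : {y : S. T' y : U}" using x T(1) inv(1)[of x] by auto
 next
  fix y assume "y : {y : S. T' y : U}"
  hence "y = T (T' y)" "T' y : U" using inv(2)[of y] by auto
  thus "y : T ` U" by (rule image_eqI)
 qed
 have Tborel: "T ` U : sets borel" if "U : sets borel" "U \<subseteq> S" for U proof -
  have "T' -` U \<inter> space ?r : sets ?r" by (rule measurable_sets[OF T'm]) (use that rs in blast)
  moreover have "T' -` U \<inter> space ?r = T ` U" using TT[OF that(2)] spr by auto
  ultimately show ?thesis using rs by simp
 qed
 have open_eq: "emeasure M (T ` U) = emeasure M U" if U: "open U" "U \<subseteq> S" for U proof -
  define K where "K = {(c, r). r > 0 & cball c r \<subseteq> U}"
  obtain C where C: "countable C" "C \<subseteq> K"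
  "pairwise (%i j. disjnt (cball (fst i) (snd i)) (cball (fst j) (snd j))) C"
  "negligible (U - (\<Union>i\<in>C. cball (fst i) (snd i)))"
  proof (rule Vitali_covering_theorem_cballs[of K snd U fst])
  show "0 < snd i" if "i : K" for i using that by (auto simp: K_def)
  fix x and d :: real assume "x : U" "0 < d"
  then obtain e where e: "e > 0" "cball x e \<subseteq> U" using U open_contains_cball by blast
  show "\<exists>i. i : K & x : cball (fst i) (snd i) & snd i < d"
  by (rule exI[of _ "(x, min e (d / 2))"]) (use e \<open>0 < d\<close> in "auto simp: K_def")
  qed blast
  define B where "B i = cball (fst i) (snd i)" for i :: "'a \<times> real"
  have BU: "B i \<subseteq> U" "B i \<subseteq> S" "B i : sets borel" if "i : C" for i proof -
  have "i : K" using that C(2) by blast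
  thus "B i \<subseteq> U" by (auto simp: K_def B_def)
  thus "B i \<subseteq> S" using U(2) by blast
  show "B i : sets borel" by (simp add: B_def)
  qed
  have disj: "disjoint_family_on B C" using C(3) by (auto simp: disjoint_family_on_def pairwise_def disjnt_def B_def)
  define N where "N = U - (\<Union>i\<in>C. B i)"
  have UB: "(\<Union>i\<in>C. B i) : sets borel" using C(1) BU by (intro sets.countable_UN') auto
  have Nb: "N : sets borel" using UB U by (auto simp: N_def)
  have Nneg: "negligible N" using C(4) by (simp add: N_def B_def)
  have nullM: "emeasure M L = 0" if "L : sets borel" "negligible L" for L proof -
  have "L : null_sets lborel" using that by (simp add: negligible_iff_null_sets null_sets_def)
  thus ?thesis using ac by blast
  qed
  have TN: "T ` N : sets borel" by (rule Tborel[OF Nb]) (use U in "auto simp: N_def")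
  have TNneg: "negligible (T ` N)" proof (rule negligible_locally_Lipschitz_image[OF _ Nneg])
  fix x assume "x : N"
  hence "x : S" using U by (auto simp: N_def)
  from lip[OF this] obtain V B where "open V" "x : V" "ALL y:S \<inter> V. norm (T y - T x) <= B * norm (y - x)" by blast
  thus "\<exists>V B. open V & x : V & (ALL y:N \<inter> V. norm (T y - T x) <= B * norm (y - x))"
  using U by (intro exI[of _ V] exI[of _ B]) (auto simp: N_def)
  qed simp
  have dec: "emeasure M (L \<union> P) = emeasure M P" if "L : sets borel" "P : sets borel" "emeasure M L = 0" for L P
  proof -
  have "L : null_sets M" using that by (simp add: null_sets_def sets_M)
  thus ?thesis using emeasure_Un_null_set[of P M L] that by (simp add: sets_M Un_commute)
  qed
  have Ueq: "U = N \<union> (\<Union>i\<in>C. B i)" using BU by (auto simp: N_def)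
  hence 1: "emeasure M U = (nn_integral (count_space C) (%i. emeasure M (B i)))"
  using dec[OF Nb UB nullM[OF Nb Nneg]] emeasure_UN_countable[of C B M] BU C(1) disj by (simp add: sets_M)
  have TB: "T ` B i : sets borel" if "i : C" for i using Tborel BU[OF that] by blast
  have Tdisj: "disjoint_family_on (%i. T ` B i) C" unfolding disjoint_family_on_def proof (intro ballI impI)
  fix i j assume "i : C" "j : C" "i ~= j"
  hence "B i \<inter> B j = {}" using disj by (auto simp: disjoint_family_on_def)
  thus "T ` B i \<inter> T ` B j = {}"
  using inj_on_image_Int[OF inj BU(2)[OF \<open>i : C\<close>] BU(2)[OF \<open>j : C\<close>]] by simp
  qed
  have UTB: "(\<Union>i\<in>C. T ` B i) : sets borel" using C(1) TB by (intro sets.countable_UN') auto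
  have "T ` U = T ` N \<union> (\<Union>i\<in>C. T ` B i)" by (subst Ueq) (simp only: image_Un image_UN)
  hence "emeasure M (T ` U) = (nn_integral (count_space C) (%i. emeasure M (T ` B i)))"
  using dec[OF TN UTB nullM[OF TN TNneg]] emeasure_UN_countable[of C "%i. T ` B i" M] TB C(1) Tdisj
  by (simp add: sets_M)
  also have "... = (nn_integral (count_space C) (%i. emeasure M (B i)))" proof (rule nn_integral_cong)
  fix i assume "i : space (count_space C)"
  hence i: "i : C" by simp
  hence "snd i > 0" using C(2) by (auto simp: K_def)
  thus "emeasure M (T ` B i) = emeasure M (B i)" using balls[of "snd i" "fst i"] BU[OF i] by (simp add: B_def)
  qed
  finally show ?thesis using 1 by simp
 qed
 let ?E = "{U. open U & U \<subseteq> S}"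
 have sig: "sets (restrict_space borel S) = sigma_sets S ?E" proof -
  have sb: "sets (borel :: 'a measure) = sigma_sets UNIV {U. open U}" by (simp add: borel_def)
  have "sets (restrict_space borel S) = (\<inter>) S ` sigma_sets UNIV {U. open U}"
  by (simp add: sets_restrict_space sb)
  also have "... = sigma_sets S ((\<inter>) S ` {U. open U})" by (rule sigma_sets_Int) (use S sb in auto)
  also have "(\<inter>) S ` {U. open U} = ?E" proof (intro equalityI subsetI)
  fix U assume "U : ?E"
  hence "U = S \<inter> U" "open U" by auto
  thus "U : (\<inter>) S ` {U. open U}" by blast
  qed (use S in auto)
  finally show ?thesis .
 qed
 have dE: "emeasure (distr ?r ?r T') X = emeasure M (T ` X)" if "X : sets borel" "X \<subseteq> S" for X proof -
  have "emeasure (distr ?r ?r T') X = emeasure ?r (T' -` X \<inter> S)"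
  using emeasure_distr[OF T'm, of X] that rs spr by simp
  also have "T' -` X \<inter> S = T ` X" using TT[OF that(2)] by auto
  also have "emeasure ?r (T ` X) = emeasure M (T ` X)" proof (rule emeasure_restrict_space)
  show "T ` X \<subseteq> S" using T(1) that(2) by blast
  qed (use SB sp in simp)
  finally show ?thesis .
 qed
 show ?thesis proof (rule measure_eqI_generator_eq[where E = ?E and \<Omega> = S and A = A])
  show "Int_stable ?E" by (auto simp: Int_stable_def)
  show "sets (distr ?r ?r T') = sigma_sets S ?E" using sets_r sig by simp
  show "sets ?r = sigma_sets S ?E" using sets_r sig by simp
  show "emeasure (distr ?r ?r T') X = emeasure ?r X" if "X : ?E" for X
  using that dE[of X] open_eq[of X] SB sp by (auto simp: emeasure_restrict_space)
  show "emeasure (distr ?r ?r T') (A i) ~= \<infinity>" for i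
  using exh(1)[of i] dE[of "A i"] open_eq[of "A i"] by auto
 qed (use exh in auto)
qed

text \<open>\<open>act\<close> preserves \<open>wd\<close>, and \<open>norm_diff_wd\<close> turns
  \<open>wd\<close> into Euclidean distance at the price of the heights, which vary by a factor of
  at most 4 where \<open>wd x q < 2\<close>.\<close>

lemma act_lipschitz:
 assumes g: "ga : carrier PSL2C" and x: "x : H3"
 shows "\<exists>V B. open V & x : V & (ALL y:H3 \<inter> V. norm (act ga y - act ga x) <= B * norm (y - x))" proof -
 let ?V = "{q : H3. wd x q < 2}"
 let ?B = "4 * ht (act ga x) / ht x"
 have ox: "open ?V" by (rule open_sublevel[OF open_H3 continuous_on_wd[OF x]])
 have xV: "x : ?V" using x by (simp add: wd_self)
 have hx: "ht x > 0" "ht (act ga x) > 0" using x act_H3[OF g x] by (auto simp: H3_iff)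
 have "norm (act ga y - act ga x) <= ?B * norm (y - x)" if y: "y : H3 \<inter> ?V" for y proof -
  have yH: "y : H3" and w: "wd x y < 2" using y by auto
  have hy: "ht y > 0" "ht (act ga y) > 0" using yH act_H3[OF g yH] by (auto simp: H3_iff)
  have w2: "wd (act ga x) (act ga y) < 2" using act_wd[OF g x yH] w by simp
  have 1: "ht (act ga y) <= 4 * ht (act ga x)" proof -
  have "ht (act ga y) <= 2 * wd (act ga y) (act ga x) * ht (act ga x)"
  by (rule ht_le_wd) (use act_H3[OF g] x yH in auto)
  also have "... <= 4 * ht (act ga x)" using w2 hx by (simp add: wd_commute)
  finally show ?thesis .
  qed
  have 2: "ht x <= 4 * ht y" proof -
  have "ht x <= 2 * wd x y * ht y" by (rule ht_le_wd) (use x yH in auto)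
  also have "... <= 4 * ht y" using w hy by simp
  finally show ?thesis .
  qed
  define m where "m = wd x y - 1"
  have m: "m >= 0" using wd_ge_1[OF x yH] by (simp add: m_def)
  have "(norm (act ga y - act ga x))^2 = 2 * ht (act ga y) * ht (act ga x) * m"
  using norm_diff_wd[OF act_H3[OF g yH] act_H3[OF g x]] act_wd[OF g yH x] by (simp add: m_def wd_commute)
  also have "... <= 2 * (4 * ht (act ga x)) * ht (act ga x) * m"
  using 1 hx m by (intro mult_right_mono mult_left_mono) auto
  finally have a: "(norm (act ga y - act ga x))^2 <= 8 * (ht (act ga x))^2 * m" by (simp add: power2_eq_square)
  have "ht x * (ht x / 4) * 2 * m <= 2 * ht y * ht x * m"
  using 2 hx m mult_right_mono[of "ht x / 4" "ht y" "ht x * 2 * m"] by (simp add: algebra_simps)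
  also have "... = (norm (y - x))^2" using norm_diff_wd[OF yH x] by (simp add: m_def wd_commute)
  finally have b: "(ht x)^2 * m <= 2 * (norm (y - x))^2" by (simp add: power2_eq_square)
  have "(norm (act ga y - act ga x))^2 * (ht x)^2 <= 8 * (ht (act ga x))^2 * ((ht x)^2 * m)"
  using mult_right_mono[OF a, of "(ht x)^2"] by (simp add: mult_ac)
  also have "... <= 8 * (ht (act ga x))^2 * (2 * (norm (y - x))^2)" by (intro mult_left_mono b) auto
  also have "... = (4 * ht (act ga x) * norm (y - x))^2" by (simp add: power2_eq_square)
  finally have "(norm (act ga y - act ga x) * ht x)^2 <= (4 * ht (act ga x) * norm (y - x))^2"
  by (simp add: power_mult_distrib)
  hence "norm (act ga y - act ga x) * ht x <= 4 * ht (act ga x) * norm (y - x)"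
  by (rule power2_le_imp_le) (use hx in auto)
  thus ?thesis using hx by (simp add: field_simps)
 qed
 thus ?thesis using ox xV by blast
qed

lemma act_continuous_on:
 assumes g: "ga : carrier PSL2C" shows "continuous_on H3 (act ga)"
 unfolding continuous_on_eq_continuous_at[OF open_H3] proof
 fix x assume x: "x : H3"
 obtain V B where V: "open V" "x : V" "!!y. y : H3 \<inter> V ==> norm (act ga y - act ga x) <= B * norm (y - x)"
  using act_lipschitz[OF g x] by blast
 have "eventually (%y. y : H3 \<inter> V) (at x)" using V x open_H3 by (intro eventually_at_in_open') auto
 hence ev: "eventually (%y. norm (act ga y - act ga x) <= B * norm (y - x)) (at x)" by eventually_elim (rule V(3))
 have "((%y. B * norm (y - x)) \<longlongrightarrow> B * norm (x - x)) (at x)" by (intro tendsto_intros)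
 hence "((%y. B * norm (y - x)) \<longlongrightarrow> 0) (at x)" by simp
 with ev have "((%y. act ga y - act ga x) \<longlongrightarrow> 0) (at x)" by (rule Lim_null_comparison)
 thus "isCont (act ga) x" unfolding isCont_def by (rule LIM_zero_cancel)
qed

lemma act_hball:
 assumes g: "ga : carrier PSL2C" and p: "p : H3" shows "act ga ` hball p W = hball (act ga p) W" proof -
 interpret group PSL2C by (rule group_PSL2C)
 have gi: "ginv ga : carrier PSL2C" using g by simp
 show ?thesis proof (intro equalityI subsetI)
  fix q assume "q : act ga ` hball p W"
  thus "q : hball (act ga p) W" using act_H3[OF g] act_wd[OF g p] by (auto simp: hball_def)
 next
  fix q assume q: "q : hball (act ga p) W"
  hence qH: "q : H3" by (simp add: hball_def)
  let ?r = "act (ginv ga) q"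
  have r: "?r : H3" "act ga ?r = q" using act_H3[OF gi qH] act_inv[OF g qH] by auto
  hence "?r : hball p W" using q act_wd[OF g p r(1)] by (simp add: hball_def)
  thus "q : act ga ` hball p W" using r by (metis imageI)
 qed
qed

section \<open>Volumes of balls and invariance of the volume\<close>

lemma frechet_derivative_const': "frechet_derivative (%_. c) (at q) = (%_. 0)" by (rule frechet_derivative_const)

text \<open>With the constant function \<open>ball_mean\<close> becomes the formula for the volume
  of a ball.\<close>

lemma eig_at_const:
 assumes "p : H3" shows "eig_at (%_. 1) 0 p" proof -
 have pc: "partial e (%_. c) = (%_. 0)" for e and c :: real by (auto simp: partial_def fun_eq_iff)
 show ?thesis proof
  show "C2_on H3 (%_. 1)" by (simp add: C2_on_def pc)
  show "- laplacian (%_. 1) q = 0 * 1" for q by (cases q) (simp add: laplacian_def pc)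
 qed fact
qed

definition hvol :: "real => real" where
 "hvol R = 4 * pi * integral {0..R} (%s. (sinh s)^2)"

lemma measure_hball:
 assumes p: "p : H3" and R: "R > 0" shows "measure hv (hball p (cosh R)) = hvol R" proof -
 interpret eig_at "%_. 1" 0 p by (rule eig_at_const[OF p])
 have "Sf 0 s * sinh s = (sinh s)^2" for s by (simp add: Sf_def power2_eq_square)
 hence "MM (cosh R) = hvol R" using ball_mean[OF R] by (simp add: hvol_def)
 moreover have "hball p (cosh R) \<inter> H3 = hball p (cosh R)" using hball_subset by blast
 ultimately show ?thesis by (simp add: MM_def)
qed

lemma emeasure_hball:
 assumes p: "p : H3" and R: "R > 0" shows "emeasure hv (hball p (cosh R)) = ennreal (hvol R)"
 using hball_finite[OF p] measure_hball[OF p R]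
 by (metis emeasure_eq_ennreal_measure infinity_ennreal_def less_irrefl)

lemma emeasure_hv: "A \<subseteq> H3 ==> emeasure hv A = emeasure hyp_vol A"
 unfolding hv_def by (rule emeasure_restrict_space) auto

text \<open>Converse of \<open>hball_cball\<close>: a Euclidean ball of centre height
  \<open>h\<close> and radius \<open>r\<close> has its hyperbolic centre at height
  \<open>sqrt (h^2 - r^2)\<close>. So the balls of a Vitali covering are hyperbolic balls.\<close>

lemma cball_in_H3:
 assumes r: "r > 0" and c: "cball c r \<subseteq> H3"
 obtains p R where "p : H3" "R > 0" "cball c r = hball p (cosh R)" proof -
 obtain c1 c2 h where ce: "c = (c1, c2, h)" by (cases c)
 have "(c1, c2, h - r) : cball c r" using r by (simp add: ce dist_prod_def dist_real_def)
 hence hr: "h > r" using c by (auto simp: H3_def)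
 define b where "b = sqrt (h^2 - r^2)"
 have hr2: "r^2 < h^2" using hr r by (intro power_strict_mono) auto
 have b: "b > 0" "b^2 = h^2 - r^2" using hr2 by (auto simp: b_def)
 have bh: "b < h" using b r hr by (intro power2_less_imp_less[of b h]) auto
 define W where "W = h / b"
 have W: "W > 1" using b bh by (simp add: W_def)
 have p: "(c1, c2, b) : H3" using b by (simp add: H3_def)
 have "b^2 * W^2 = h^2" using b(1) by (simp add: W_def power_divide)
 hence "b^2 * (W^2 - 1) = r^2" using b(2) by (simp add: right_diff_distrib)
 hence "(b * sqrt (W^2 - 1))^2 = r^2" using sq_gt_1[OF W] by (simp add: power_mult_distrib)
 hence "b * sqrt (W^2 - 1) = r" by (rule power2_eq_imp_eq) (use b r sq_gt_1[OF W] in auto)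
 hence "cball c r = hball (c1, c2, b) W" using hball_cball[OF p, of W] W b by (simp add: ce W_def)
 moreover have "W = cosh (arcosh W)" "arcosh W > 0" using W by auto
 ultimately show ?thesis using that[OF p] by metis
qed

text \<open>No Jacobian is computed: an isometry takes a ball to a ball of equal radius, and the
  volume of a ball does not depend on its centre.\<close>

theorem act_preserves_volume:
 assumes g: "ga : carrier PSL2C" shows "act ga : measurable hv hv" "distr hv hv (act ga) = hv" proof -
 interpret group PSL2C by (rule group_PSL2C)
 have gi: "ginv ga : carrier PSL2C" using g by simp
 let ?o = "(0, 0, 1) :: point"
 have o: "?o : H3" by (simp add: H3_def)
 show "distr hv hv (act ga) = hv" unfolding hv_def
 proof (rule vitali_measure_preserving[where T = "act (ginv ga)" and A = "%n. {q : H3. wd ?o q < real n}"])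
  show "act (ginv ga) ` H3 \<subseteq> H3" "act ga ` H3 \<subseteq> H3" using act_H3[OF g] act_H3[OF gi] by auto
  show "act ga (act (ginv ga) x) = x" "act (ginv ga) (act ga x) = x" if "x : H3" for x
  using act_inv[OF g that] by auto
  show "continuous_on H3 (act (ginv ga))" "continuous_on H3 (act ga)" by (rule act_continuous_on; fact)+
  show "N : null_sets hyp_vol" if "N : null_sets lborel" for N proof -
  have "AE x in lborel. x ~: N" using AE_not_in[OF that] .
  moreover have "N : sets borel" using that by auto
  ultimately show ?thesis unfolding hyp_vol_density by (subst null_sets_density_iff) (auto elim: eventually_mono)
  qed
  show "emeasure hyp_vol (act (ginv ga) ` cball c r) = emeasure hyp_vol (cball c r)" if rc: "r > 0" "cball c r \<subseteq> H3" for c r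
  proof -
  obtain p R where p: "p : H3" and R: "R > 0" and e: "cball c r = hball p (cosh R)" using cball_in_H3[OF rc] .
  show ?thesis unfolding e act_hball[OF gi p] using emeasure_hball[OF p R] emeasure_hball[OF act_H3[OF gi p] R]
  by (simp add: emeasure_hv[OF hball_subset])
  qed
  show "open {q : H3. wd ?o q < real n} & {q : H3. wd ?o q < real n} \<subseteq> H3 & emeasure hyp_vol {q : H3. wd ?o q < real n} ~= \<infinity>" for n
  proof (intro conjI)
  show op: "open {q : H3. wd ?o q < real n}" by (rule open_sublevel[OF open_H3 continuous_on_wd[OF o]])
  have "emeasure hyp_vol {q : H3. wd ?o q < real n} <= emeasure hyp_vol (hball ?o (real n))"
  by (rule emeasure_mono) (use hball_borel[OF o] in "auto simp: hball_def")
  also have "... < \<infinity>" using hball_finite[OF o] by (simp add: emeasure_hv[OF hball_subset])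
  finally show "emeasure hyp_vol {q : H3. wd ?o q < real n} ~= \<infinity>" by simp
  qed auto
  show "(\<Union>n. {q : H3. wd ?o q < real n}) = H3" using reals_Archimedean2 by fastforce
 qed (use open_H3 act_lipschitz[OF gi] in auto)
 have "act ga : borel_measurable (restrict_space borel H3)"
  by (rule borel_measurable_continuous_on_restrict[OF act_continuous_on[OF g]])
 hence "act ga : measurable hv hyp_vol" using measurable_cong_sets[OF sets_hv sets_hyp_vol] by blast
 hence "act ga : measurable hv (restrict_space hyp_vol H3)"
  by (rule measurable_restrict_space2[rotated]) (use act_H3[OF g] in auto)
 thus "act ga : measurable hv hv" by (simp only: hv_def)
qed

section \<open>Area in the plane\<close>

definition S2 :: "(real \<times> real) set" where
 "S2 = {z. snd z > 0}"

definition ha2 :: "(real \<times> real) measure" where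
 "ha2 = density lborel (%z. if snd z > 0 then ennreal (1 / (snd z)^2) else 0)"

definition iota :: "real \<times> real => point" where
 "iota z = (fst z, 0, snd z)"

text \<open>\<open>tau q\<close> is the hyperbolic cosine of the distance from \<open>q\<close> to the plane.\<close>

definition tau :: "point => real" where
 "tau q = sqrt ((fst (snd q))^2 + (ht q)^2) / ht q"

lemma tau_ge_1: "q : H3 ==> tau q >= 1" by (auto simp: tau_def H3_iff intro: real_le_rsqrt)

lemma iota_H3: "z : S2 \<longleftrightarrow> iota z : H3" by (simp add: iota_def S2_def H3_iff)

lemma iota_plane: "iota ` S2 = plane" by (auto simp: iota_def S2_def plane_def image_iff split: prod.splits)

lemma plane_H3: "plane \<subseteq> H3" by (auto simp: plane_def H3_def)

lemma continuous_on_iota [continuous_intros]: "continuous_on A iota" unfolding iota_def by (intro continuous_intros)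

lemma iota_borel [measurable]: "iota : borel_measurable borel"
 by (rule borel_measurable_continuous_onI) (rule continuous_on_iota)

lemma norm_iota: "norm (iota z - iota w) = norm (z - w)" by (cases z; cases w) (simp add: iota_def norm_Pair)

lemma tau_iota: "z : S2 ==> tau (iota z) = 1" by (simp add: tau_def iota_def S2_def)

lemma fst_snd_borel2 [measurable]:
 "fst : borel_measurable (borel :: (real \<times> real) measure)"
 "snd : borel_measurable (borel :: (real \<times> real) measure)"
 by (intro borel_measurable_continuous_onI continuous_intros)+

lemma ha2_density_measurable [measurable]:
 "(%z::real \<times> real. if snd z > 0 then ennreal (1 / (snd z)^2) else 0) : borel_measurable borel" by measurable

lemma sets_ha2 [simp, measurable_cong]: "sets ha2 = sets borel" by (simp add: ha2_def)

lemma open_S2: "open S2" unfolding S2_def by (intro open_Collect_less continuous_intros)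

text \<open>The area with density \<open>1 / y^2\<close> of a Euclidean disc of centre height
  \<open>c\<close> and radius \<open>ro\<close>, cut into horizontal chords.\<close>

lemma sqrt_cap_integral:
 fixes c ro :: real assumes r: "0 < ro" "ro < c"
 defines "k \<equiv> sqrt (c^2 - ro^2)"
 shows "((%y. 2 * sqrt (ro^2 - (y - c)^2) / y^2) has_integral 2 * pi * (c / k - 1)) {c - ro..c + ro}" proof -
 have rc: "ro^2 < c^2" using r by (intro power_strict_mono) auto
 have k: "k > 0" "k^2 = c^2 - ro^2" using rc by (auto simp: k_def)
 \<comment> \<open>Affine in \<open>1 / y\<close>, with values \<open>-1\<close> and
   \<open>1\<close> at the ends of the interval. The choice makes \<open>1 - g^2\<close> a multiple
   of \<open>R^2 / y^2\<close>, so that \<open>arcsin (g y)\<close> supplies the term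
   \<open>1 / (y R y)\<close>.\<close>
 define g where "g y = c / ro - k^2 / (ro * y)" for y
 define R where "R y = sqrt (ro^2 - (y - c)^2)" for y
 define F where "F y = 2 * (- (R y / y) - arcsin ((y - c) / ro) + c / k * arcsin (g y))" for y
 have g1: "1 - (g y)^2 = k^2 * (ro^2 - (y - c)^2) / (ro * y)^2" if "y > 0" for y proof -
  have "(1 - (g y)^2) * (ro * y)^2 = (ro * y)^2 - (c * y - k^2)^2"
  using that r by (simp add: g_def field_simps power2_eq_square)
  also have "... = k^2 * (ro^2 - (y - c)^2)" unfolding k(2) by (simp add: power2_eq_square algebra_simps)
  finally show ?thesis using that r by (simp add: field_simps)
 qed
 have dom: "y > 0" "ro^2 - (y - c)^2 >= 0" "\<bar>(y - c) / ro\<bar> <= 1" "\<bar>g y\<bar> <= 1" if "y : {c - ro..c + ro}" for y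
 proof -
  show y: "y > 0" using that r by auto
  have a: "\<bar>y - c\<bar> <= ro" using that by auto
  hence "(y - c)^2 <= ro^2" using r by (metis abs_le_square_iff abs_of_pos)
  thus b: "ro^2 - (y - c)^2 >= 0" by simp
  show "\<bar>(y - c) / ro\<bar> <= 1" using a r by simp
  have "1 - (g y)^2 >= 0" unfolding g1[OF y] using b by simp
  thus "\<bar>g y\<bar> <= 1" by (simp add: abs_square_le_1[symmetric])
 qed
 have idom: "ro^2 - (y - c)^2 > 0" "\<bar>(y - c) / ro\<bar> < 1" "\<bar>g y\<bar> < 1" if "y : {c - ro<..<c + ro}" for y
 proof -
  have y: "y > 0" using that r by auto
  have a: "\<bar>y - c\<bar> < ro" using that by auto
  hence "(y - c)^2 < ro^2" using r power_strict_mono[of "\<bar>y - c\<bar>" ro 2] by simp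
  thus b: "ro^2 - (y - c)^2 > 0" by simp
  show "\<bar>(y - c) / ro\<bar> < 1" using a r by simp
  have "1 - (g y)^2 > 0" unfolding g1[OF y] by (intro divide_pos_pos mult_pos_pos zero_less_power b k(1) r(1) y)
  thus "\<bar>g y\<bar> < 1" by (simp add: abs_square_less_1[symmetric])
 qed
 \<comment> \<open>The derivative is taken in the interior only, since \<open>R\<close> and the
   arcsines have vertical tangents at the ends.\<close>
 have "((%y. 2 * R y / y^2) has_integral F (c + ro) - F (c - ro)) {c - ro..c + ro}"
 proof (rule fundamental_theorem_of_calculus_interior)
  show "c - ro <= c + ro" using r by simp
  have ne: "ALL y:{c - ro..c + ro}. y ~= 0" "ALL y:{c - ro..c + ro}. ro * y ~= 0" "ro ~= 0"
  using dom(1) r by fastforce+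
  have cg: "continuous_on {c - ro..c + ro} g" unfolding g_def by (intro continuous_intros) (use ne in auto)
  have ca: "continuous_on {c - ro..c + ro} (%y. arcsin (g y))"
  using dom(4) cg by (intro continuous_on_arcsin) (auto simp: abs_le_iff minus_le_iff)
  have cb: "continuous_on {c - ro..c + ro} (%y. arcsin ((y - c) / ro))" proof (rule continuous_on_arcsin)
  show "continuous_on {c - ro..c + ro} (%y. (y - c) / ro)" using ne by (intro continuous_intros) auto
  show "ALL x:{c - ro..c + ro}. - 1 <= (x - c) / ro & (x - c) / ro <= 1" using dom(3) unfolding abs_le_iff by force
  qed
  show "continuous_on {c - ro..c + ro} F" proof -
  have cR: "continuous_on {c - ro..c + ro} (%y. sqrt (ro^2 - (y - c)^2) / y)"
  by (intro continuous_intros) (use ne in auto)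
  show ?thesis unfolding F_def R_def
  by (intro continuous_on_mult continuous_on_const continuous_on_add continuous_on_diff continuous_on_minus cR ca cb)
  qed
  fix y assume y: "y : {c - ro<..<c + ro}"
  hence y': "y > 0" using r by auto
  have Rp: "R y > 0" "(R y)^2 = ro^2 - (y - c)^2" using idom(1)[OF y] by (auto simp: R_def)
  have dR: "(R has_real_derivative - (y - c) / R y) (at y)" proof -
  have "((%y. ro^2 - (y - c)^2) has_real_derivative - 2 * (y - c)) (at y)" by (auto intro!: derivative_eq_intros)
  from DERIV_chain2[OF DERIV_real_sqrt[OF idom(1)[OF y]] this] show ?thesis
  unfolding R_def[abs_def] by (rule DERIV_cong) (use Rp(1) in "simp add: R_def field_simps")
  qed
  have d1: "((%y. arcsin ((y - c) / ro)) has_real_derivative 1 / R y) (at y)" proof -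
  have dd: "((%y. (y - c) / ro) has_real_derivative 1 / ro) (at y)" using r by (auto intro!: derivative_eq_intros)
  have "1 - ((y - c) / ro)^2 = (R y / ro)^2" using r Rp(2) by (simp add: power_divide field_simps)
  hence s: "sqrt (1 - ((y - c) / ro)^2) = R y / ro" using r Rp(1) by simp
  have "- 1 < (y - c) / ro" "(y - c) / ro < 1" using idom(2)[OF y] by linarith+
  from DERIV_chain2[OF DERIV_arcsin[OF this] dd] show ?thesis by (rule DERIV_cong, unfold s) (use r Rp(1) in simp)
  qed
  have d2: "((%y. arcsin (g y)) has_real_derivative k / (y * R y)) (at y)" proof -
  have dd: "(g has_real_derivative k^2 / (ro * y^2)) (at y)" unfolding g_def[abs_def] using r y'
  by (auto intro!: derivative_eq_intros simp: field_simps power2_eq_square)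
  have "1 - (g y)^2 = (k * R y / (ro * y))^2" unfolding g1[OF y'] Rp(2)[symmetric]
  by (simp add: power_divide power_mult_distrib)
  hence s: "sqrt (1 - (g y)^2) = k * R y / (ro * y)" using r y' Rp(1) k by simp
  have "- 1 < g y" "g y < 1" using idom(3)[OF y] by linarith+
  from DERIV_chain2[OF DERIV_arcsin[OF this] dd] show ?thesis
  by (rule DERIV_cong, unfold s) (use r y' Rp(1) k(1) in "simp add: field_simps power2_eq_square")
  qed
  have "(F has_real_derivative 2 * (- ((- (y - c) / R y * y - R y * 1) / (y * y)) - 1 / R y + c / k * (k / (y * R y)))) (at y)"
  unfolding F_def[abs_def]
  by (rule DERIV_cmult DERIV_add DERIV_diff DERIV_minus DERIV_divide dR d1 d2 DERIV_ident | use y' in simp)+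
  moreover have "2 * (- ((- (y - c) / R y * y - R y * 1) / (y * y)) - 1 / R y + c / k * (k / (y * R y))) = 2 * R y / y^2"
  using Rp(1) y' k(1) by (simp add: field_simps power2_eq_square)
  ultimately show "(F has_vector_derivative 2 * R y / y^2) (at y)" by (simp add: real_vector_deriv)
 qed
 moreover have "F (c + ro) - F (c - ro) = 2 * pi * (c / k - 1)" proof -
  have k3: "k^2 = (c - ro) * (c + ro)" unfolding k(2) by (simp add: power2_eq_square algebra_simps)
  have "k^2 / (ro * (c + ro)) = (c - ro) / ro" "k^2 / (ro * (c - ro)) = (c + ro) / ro"
  unfolding k3 using r by simp_all
  hence "g (c + ro) = 1" "g (c - ro) = - 1" using r by (simp_all add: g_def diff_divide_distrib add_divide_distrib)
  thus ?thesis using r by (simp add: F_def R_def algebra_simps)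
 qed
 ultimately show ?thesis by (simp add: R_def)
qed

lemma emeasure_ha2_cball:
 assumes r: "0 < ro" "ro < c" shows "emeasure ha2 (cball (a, c) ro) = ennreal (2 * pi * (c / sqrt (c^2 - ro^2) - 1))"
proof -
 let ?h = "%y. sqrt (ro^2 - (y - c)^2)"
 define g where "g y = (if y : {c - ro..c + ro} then 2 * ?h y / y^2 else 0)" for y
 have cb: "cball (a, c) ro : sets borel" by simp
 have sl: "(x, y) : cball (a, c) ro \<longleftrightarrow> y : {c - ro..c + ro} & x : {a - ?h y..a + ?h y}" for x y
 proof -
  have "(x, y) : cball (a, c) ro \<longleftrightarrow> sqrt ((a - x)^2 + (c - y)^2) <= ro"
  by (simp add: dist_prod_def dist_real_def)
  also have "... \<longleftrightarrow> (a - x)^2 + (c - y)^2 <= ro^2"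
  using r by (metis abs_le_square_iff abs_of_pos real_sqrt_abs real_sqrt_ge_zero real_sqrt_le_iff real_sqrt_pow2_iff sum_power2_ge_zero)
  also have "... \<longleftrightarrow> \<bar>y - c\<bar> <= ro & \<bar>x - a\<bar> <= ?h y" proof
  assume l: "(a - x)^2 + (c - y)^2 <= ro^2"
  hence "(y - c)^2 <= ro^2" using zero_le_power2[of "a - x"] power2_commute[of y c] by linarith
  hence 1: "\<bar>y - c\<bar> <= ro" using r by (metis abs_le_square_iff abs_of_pos)
  have "\<bar>x - a\<bar>^2 <= ro^2 - (y - c)^2" using l by (simp add: power2_commute)
  hence "\<bar>x - a\<bar> <= ?h y" by (rule real_le_rsqrt)
  thus "\<bar>y - c\<bar> <= ro & \<bar>x - a\<bar> <= ?h y" using 1 by simp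
  next
  assume l: "\<bar>y - c\<bar> <= ro & \<bar>x - a\<bar> <= ?h y"
  have "(y - c)^2 <= ro^2" using l r by (metis abs_le_square_iff abs_of_pos)
  hence "(?h y)^2 = ro^2 - (y - c)^2" by simp
  moreover have "\<bar>x - a\<bar>^2 <= (?h y)^2" using l by (intro power_mono) auto
  ultimately show "(a - x)^2 + (c - y)^2 <= ro^2" by (simp add: power2_commute)
  qed
  also have "... \<longleftrightarrow> y : {c - ro..c + ro} & x : {a - ?h y..a + ?h y}" by auto
  finally show ?thesis .
 qed
 have inner: "(nn_integral lborel (%x. (if y > 0 then ennreal (1 / y^2) else 0) * indicator (cball (a, c) ro) (x, y))) = ennreal (g y)" for y
 proof (cases "y : {c - ro..c + ro}")
  case True
  hence y: "y > 0" using r by auto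
  have sq: "ro^2 - (y - c)^2 >= 0" proof -
  have "\<bar>y - c\<bar> <= ro" using True by auto
  thus ?thesis using r by (metis abs_le_square_iff abs_of_pos diff_ge_0_iff_ge)
  qed
  have "(nn_integral lborel (%x. (if y > 0 then ennreal (1 / y^2) else 0) * indicator (cball (a, c) ro) (x, y))) =
  (nn_integral lborel (%x. ennreal (1 / y^2) * indicator {a - ?h y..a + ?h y} x))"
  by (rule nn_integral_cong) (use True y in "simp add: indicator_def sl del: mem_cball")
  also have "... = ennreal (1 / y^2) * ennreal (2 * ?h y)" using sq by (subst nn_integral_cmult_indicator) auto
  also have "... = ennreal (g y)" using True sq by (simp add: g_def ennreal_mult[symmetric])
  finally show ?thesis .
 next
  case False
  hence nm: "(x, y) ~: cball (a, c) ro" for x using sl by blast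
  have "(nn_integral lborel (%x. (if y > 0 then ennreal (1 / y^2) else 0) * indicator (cball (a, c) ro) (x, y))) = (\<integral>\<^sup>+(x::real). 0 \<partial>lborel)"
  by (rule nn_integral_cong) (simp add: nm indicator_def del: mem_cball)
  moreover have "g y = 0" unfolding g_def using False by (rule if_not_P)
  ultimately show ?thesis by simp
 qed
 let ?f = "%z::real \<times> real. (if snd z > 0 then ennreal (1 / (snd z)^2) else 0) * indicator (cball (a, c) ro) z"
 have fm: "?f : borel_measurable (lborel \<Otimes>\<^sub>M lborel)" unfolding lborel_prod using cb by measurable
 have "emeasure ha2 (cball (a, c) ro) = (nn_integral lborel (%z. ?f z))"
  unfolding ha2_def by (subst emeasure_density) auto
 also have "... = (nn_integral (lborel \<Otimes>\<^sub>M lborel) (%z. ?f z))" by (simp add: lborel_prod)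
 also have "... = (nn_integral lborel (%y. (nn_integral lborel (%x. ?f (x, y)))))"
  by (rule lborel_pair.nn_integral_snd[symmetric]) (rule fm)
 also have "... = (nn_integral lborel (%y. ennreal (g y)))" by (rule nn_integral_cong) (simp only: inner snd_conv)
 also have "... = ennreal (2 * pi * (c / sqrt (c^2 - ro^2) - 1))" proof (rule nn_integral_has_integral_lborel)
  show "g : borel_measurable borel" unfolding g_def by measurable
  have "ro^2 - (y - c)^2 >= 0" if "y : {c - ro..c + ro}" for y proof -
  have "\<bar>y - c\<bar> <= ro" using that by auto
  thus ?thesis using r by (metis abs_le_square_iff abs_of_pos diff_ge_0_iff_ge)
  qed
  thus "0 <= g y" for y by (simp add: g_def)
  show "(g has_integral 2 * pi * (c / sqrt (c^2 - ro^2) - 1)) UNIV"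
  unfolding g_def[abs_def] has_integral_restrict_UNIV by (rule sqrt_cap_integral[OF r])
 qed
 finally show ?thesis .
qed

section \<open>Discs cut out of the plane\<close>

definition pball :: "point => real => (real \<times> real) set" where
 "pball q W = {z : S2. wd q (iota z) <= W}"

lemma pball_cball:
 assumes q: "(x1, x2, y0) : H3" and W: "W >= tau (x1, x2, y0)"
 shows "pball (x1, x2, y0) W = cball (x1, W * y0) (y0 * sqrt (W^2 - (tau (x1, x2, y0))^2))" proof -
 let ?t = "tau (x1, x2, y0)"
 have y0: "y0 > 0" using q by (simp add: H3_def)
 have t1: "?t >= 1" by (rule tau_ge_1[OF q])
 have ty: "y0^2 * ?t^2 = x2^2 + y0^2" using y0 by (simp add: tau_def power_divide)
 have Wt: "W^2 - ?t^2 >= 0" using W t1 by (simp add: power_mono)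
 have sq: "(y0 * sqrt (W^2 - ?t^2))^2 = y0^2 * W^2 - x2^2 - y0^2"
  using Wt ty by (simp add: power_mult_distrib algebra_simps)
 have "(x, y) : pball (x1, x2, y0) W \<longleftrightarrow> (x, y) : cball (x1, W * y0) (y0 * sqrt (W^2 - ?t^2))" for x y
 proof -
  have "(x, y) : cball (x1, W * y0) (y0 * sqrt (W^2 - ?t^2)) \<longleftrightarrow> sqrt ((x1 - x)^2 + (W * y0 - y)^2) <= y0 * sqrt (W^2 - ?t^2)"
  by (simp add: dist_prod_def dist_real_def)
  also have "... \<longleftrightarrow> (sqrt ((x1 - x)^2 + (W * y0 - y)^2))^2 <= (y0 * sqrt (W^2 - ?t^2))^2"
  using y0 Wt abs_le_square_iff[of "sqrt ((x1 - x)^2 + (W * y0 - y)^2)" "y0 * sqrt (W^2 - ?t^2)"]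
  by (simp add: abs_mult)
  also have "... \<longleftrightarrow> (x1 - x)^2 + (W * y0 - y)^2 <= y0^2 * W^2 - x2^2 - y0^2" unfolding sq by simp
  also have "... \<longleftrightarrow> (x - x1)^2 + x2^2 + y0^2 + y^2 <= 2 * W * y0 * y"
  by (simp add: power2_eq_square algebra_simps)
  finally have 1: "(x, y) : cball (x1, W * y0) (y0 * sqrt (W^2 - ?t^2)) \<longleftrightarrow> (x - x1)^2 + x2^2 + y0^2 + y^2 <= 2 * W * y0 * y" .
  have 2: "y > 0" if "(x - x1)^2 + x2^2 + y0^2 + y^2 <= 2 * W * y0 * y" proof -
  have "0 < (x - x1)^2 + x2^2 + y0^2 + y^2" using y0 by (simp add: add_nonneg_pos add_pos_nonneg)
  hence "0 < (2 * W * y0) * y" using that by linarith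
  moreover have "0 < 2 * W * y0" using y0 W t1 by simp
  ultimately show ?thesis by (rule zero_less_mult_pos)
  qed
  show ?thesis unfolding 1 using 2 y0 by (auto simp: pball_def S2_def iota_def wd_def field_simps)
 qed
 thus ?thesis by auto
qed

text \<open>The arithmetic-geometric mean inequality. Equality at height \<open>s\<close> above the
  same \<open>x1\<close> makes \<open>tau q\<close> a minimum, as \<open>tau_invariant\<close>
  uses.\<close>

lemma wd_ge_tau:
 assumes q: "q : H3" and z: "z : S2" shows "tau q <= wd q (iota z)" proof -
 obtain x1 x2 y0 where qe: "q = (x1, x2, y0)" by (cases q)
 obtain x y where ze: "z = (x, y)" by (cases z)
 have y: "y0 > 0" "y > 0" using q z by (auto simp: qe ze H3_def S2_def)
 define s where "s = sqrt (x2^2 + y0^2)"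
 have s2: "s^2 = x2^2 + y0^2" by (simp add: s_def)
 have "2 * s * y <= (x - x1)^2 + s^2 + y^2" using sum_squares_bound[of s y] by (smt (verit) zero_le_power2)
 hence "s / y0 <= ((x - x1)^2 + s^2 + y^2) / (2 * y0 * y)" using y by (simp add: field_simps)
 thus ?thesis unfolding s2 by (simp add: qe ze tau_def wd_def iota_def s_def add.assoc)
qed

text \<open>The disc has centre height \<open>W y0\<close> and radius
  \<open>y0 sqrt (W^2 - tau^2)\<close>, so \<open>sqrt (c^2 - ro^2)\<close> is
  \<open>y0 tau q\<close> and the area comes out affine in \<open>W\<close>. This is what makes the
  combination \<open>NN\<close> possible.\<close>

lemma emeasure_pball:
 assumes q: "q : H3" shows "emeasure ha2 (pball q W) = ennreal (2 * pi * max 0 (W / tau q - 1))" proof -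
 obtain x1 x2 y0 where qe: "q = (x1, x2, y0)" by (cases q)
 have y0: "y0 > 0" using q by (simp add: qe H3_def)
 have t1: "tau q >= 1" by (rule tau_ge_1[OF q])
 consider "W > tau q" | "W = tau q" | "W < tau q" by linarith
 thus ?thesis proof cases
  case 1
  define ro where "ro = y0 * sqrt (W^2 - (tau q)^2)"
  have Wt: "W^2 - (tau q)^2 > 0" using 1 t1 by (simp add: power_strict_mono)
  have ro: "ro > 0" using y0 Wt by (simp add: ro_def)
  have ro2: "ro^2 = y0^2 * (W^2 - (tau q)^2)" using Wt by (simp add: ro_def power_mult_distrib)
  have e: "(W * y0)^2 - ro^2 = (y0 * tau q)^2" unfolding ro2 by (simp add: power2_eq_square algebra_simps)
  have "ro^2 < (W * y0)^2" using e y0 t1 by (smt (verit) zero_less_power mult_pos_pos)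
  hence lt: "ro < W * y0" by (rule power2_less_imp_less) (use 1 t1 y0 in simp)
  have "emeasure ha2 (pball q W) = ennreal (2 * pi * (W * y0 / sqrt ((W * y0)^2 - ro^2) - 1))"
  unfolding qe pball_cball[OF q[unfolded qe] less_imp_le[OF 1[unfolded qe]]] ro_def[unfolded qe, symmetric]
  using emeasure_ha2_cball[OF ro lt] by (simp add: ro_def qe)
  also have "W * y0 / sqrt ((W * y0)^2 - ro^2) = W / tau q" unfolding e using y0 t1 by simp
  finally show ?thesis using 1 t1 by (simp add: max_def field_simps)
 next
  case 2
  have "pball q W = {(x1, W * y0)}" unfolding qe using pball_cball[OF q[unfolded qe], of W] 2 by (simp add: qe)
  moreover have "emeasure ha2 {z} = 0" for z unfolding ha2_def by (subst emeasure_density) auto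
  ultimately show ?thesis using 2 t1 by simp
 next
  case 3
  hence "pball q W = {}" using wd_ge_tau[OF q] by (fastforce simp: pball_def)
  thus ?thesis using 3 t1 by (simp add: max_def field_simps)
 qed
qed

text \<open>The substitution \<open>y = exp u\<close> on growing compact intervals, then a monotone
  limit of both sides.\<close>

lemma exp_substitution:
 fixes h :: "real => ennreal" assumes [measurable]: "h : borel_measurable borel"
 shows "(nn_integral lborel (%u. ennreal (exp (- u)) * h (exp u))) =
  (nn_integral lborel (%y. (if y > 0 then ennreal (1 / y^2) else 0) * h y))" proof -
 define f where "f y = (if y > 0 then ennreal (1 / y^2) else 0) * h y" for y
 have fm [measurable]: "f : borel_measurable borel" unfolding f_def by measurable
 have step: "(nn_integral lborel (%y. f y * indicator {exp (- real (Suc n))..exp (real (Suc n))} y)) =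
  (nn_integral lborel (%u. ennreal (exp (- u)) * h (exp u) * indicator {- real (Suc n)..real (Suc n)} u))" for n
 proof -
  have "(nn_integral lborel (%y. f y * indicator {exp (- real (Suc n))..exp (real (Suc n))} y)) =
  (nn_integral lborel (%u. f (exp u) * ennreal (exp u) * indicator {- real (Suc n)..real (Suc n)} u))"
  by (rule nn_integral_substitution_aux) (auto intro!: derivative_eq_intros continuous_intros)
  also have "... = (nn_integral lborel (%u. ennreal (exp (- u)) * h (exp u) * indicator {- real (Suc n)..real (Suc n)} u))"
  proof (rule nn_integral_cong)
  fix u :: real
  have "f (exp u) * ennreal (exp u) = (ennreal (1 / (exp u)^2) * ennreal (exp u)) * h (exp u)"
  by (simp add: f_def mult_ac)
  also have "ennreal (1 / (exp u)^2) * ennreal (exp u) = ennreal (exp (- u))"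
  by (subst ennreal_mult[symmetric]) (auto simp: exp_minus power2_eq_square field_simps)
  finally show "f (exp u) * ennreal (exp u) * indicator {- real (Suc n)..real (Suc n)} u =
  ennreal (exp (- u)) * h (exp u) * indicator {- real (Suc n)..real (Suc n)} u" by simp
  qed
  finally show ?thesis .
 qed
 have mem1: "\<exists>N. \<forall>n\<ge>N. u : {- real (Suc n)..real (Suc n)}" for u proof -
  obtain N where "\<bar>u\<bar> < real N" using reals_Archimedean2 by blast
  thus ?thesis by (intro exI[of _ N]) auto
 qed
 have A: "(%n. \<integral>\<^sup>+u. ennreal (exp (- u)) * h (exp u) * indicator {- real (Suc n)..real (Suc n)} u \<partial>lborel)
  \<longlonglongrightarrow> (nn_integral lborel (%u. ennreal (exp (- u)) * h (exp u)))"
 proof (rule nn_integral_LIMSEQ)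
  show "incseq (%n u. ennreal (exp (- u)) * h (exp u) * indicator {- real (Suc n)..real (Suc n)} u)"
  by (auto simp: incseq_def le_fun_def indicator_def intro!: mult_left_mono)
  fix u :: real
  obtain N where N: "\<forall>n\<ge>N. u : {- real (Suc n)..real (Suc n)}" using mem1 by blast
  hence "eventually (%n. ennreal (exp (- u)) * h (exp u) * indicator {- real (Suc n)..real (Suc n)} u = ennreal (exp (- u)) * h (exp u)) sequentially"
  unfolding eventually_sequentially by (intro exI[of _ N] allI impI) (simp add: indicator_def)
  thus "(%n. ennreal (exp (- u)) * h (exp u) * indicator {- real (Suc n)..real (Suc n)} u) \<longlonglongrightarrow> ennreal (exp (- u)) * h (exp u)"
  by (rule tendsto_eventually)
 qed measurable
 have B: "(%n. \<integral>\<^sup>+y. f y * indicator {exp (- real (Suc n))..exp (real (Suc n))} y \<partial>lborel) \<longlonglongrightarrow> (nn_integral lborel (%y. f y))"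
 proof (rule nn_integral_LIMSEQ)
  show "incseq (%n y. f y * indicator {exp (- real (Suc n))..exp (real (Suc n))} y)" unfolding incseq_def le_fun_def
  proof (intro allI impI mult_left_mono)
  fix m n :: nat and y assume "m <= n"
  hence "real (Suc m) <= real (Suc n)" by simp
  hence "exp (- real (Suc n)) <= exp (- real (Suc m))" "exp (real (Suc m)) <= exp (real (Suc n))"
  by (simp_all only: exp_le_cancel_iff neg_le_iff_le)
  hence "{exp (- real (Suc m))..exp (real (Suc m))} \<subseteq> {exp (- real (Suc n))..exp (real (Suc n))}"
  by (simp only: atLeastatMost_subset_iff simp_thms)
  thus "indicator {exp (- real (Suc m))..exp (real (Suc m))} y <= (indicator {exp (- real (Suc n))..exp (real (Suc n))} y :: ennreal)"
  by (intro indicator_leI) (erule subsetD)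
  qed auto
  fix y :: real
  have "eventually (%n. f y * indicator {exp (- real (Suc n))..exp (real (Suc n))} y = f y) sequentially"
  proof (cases "y > 0")
  case True
  obtain N where N: "\<forall>n\<ge>N. ln y : {- real (Suc n)..real (Suc n)}" using mem1 by blast
  have "y : {exp (- real (Suc n))..exp (real (Suc n))}" if "n >= N" for n
  using N[rule_format, OF that] True by (simp only: atLeastAtMost_iff) (metis exp_le_cancel_iff exp_ln)
  thus ?thesis unfolding eventually_sequentially by (intro exI[of _ N] allI impI) (simp add: indicator_def)
  qed (simp add: f_def)
  thus "(%n. f y * indicator {exp (- real (Suc n))..exp (real (Suc n))} y) \<longlonglongrightarrow> f y"
  by (rule tendsto_eventually)
 qed measurable
 show ?thesis using LIMSEQ_unique[OF A B[unfolded step]] unfolding f_def .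
qed

lemma hyp_area_eq: "hyp_area = distr ha2 borel iota" proof (rule measure_eqI)
 show "sets hyp_area = sets (distr ha2 borel iota)" by (simp add: hyp_area_def)
 fix A assume "A : sets hyp_area"
 hence A [measurable]: "A : sets borel" by (simp add: hyp_area_def)
 have em: "(%(x::real, u::real). (x, 0::real, exp u)) : borel_measurable borel"
  by (auto intro!: borel_measurable_continuous_onI continuous_intros simp: split_beta)
 have m1: "(%(x::real, u::real). ennreal (exp (- u))) : borel_measurable borel"
  by (auto intro!: borel_measurable_continuous_onI continuous_intros simp: split_beta)
 have m2: "(%(x::real, u::real). ennreal (exp (- u)) * indicator A (x, 0::real, exp u)) : borel_measurable (lborel \<Otimes>\<^sub>M lborel)"
 proof -
  have "(%z. (%(x::real, u::real). ennreal (exp (- u))) z * indicator A ((%(x::real, u::real). (x, 0::real, exp u)) z)) : borel_measurable borel"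
  using m1 em by measurable
  moreover have "sets (lborel \<Otimes>\<^sub>M lborel :: (real \<times> real) measure) = sets borel" by (simp only: lborel_prod sets_lborel)
  ultimately show ?thesis by (simp add: split_beta cong: measurable_cong_sets)
 qed
 have m3: "(%z::real \<times> real. (if snd z > 0 then ennreal (1 / (snd z)^2) else 0) * indicator A (iota z)) : borel_measurable (lborel \<Otimes>\<^sub>M lborel)"
  unfolding lborel_prod by measurable
 have "emeasure hyp_area A = (nn_integral lborel (%z. (%(x::real, u::real). ennreal (exp (- u)) * indicator A (x, 0::real, exp u)) z))"
 proof -
  have "emeasure hyp_area A = emeasure (density lborel (%(x::real, u::real). ennreal (exp (- u)))) ((%(x::real, u::real). (x, 0::real, exp u)) -` A)"
  unfolding hyp_area_def by (subst emeasure_distr) (use em A in auto)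
  also have "... = (nn_integral lborel (%z. (%(x::real, u::real). ennreal (exp (- u))) z * indicator ((%(x::real, u::real). (x, 0::real, exp u)) -` A) z))"
  by (rule emeasure_density) (use m1 em A measurable_sets[OF em A] in auto)
  finally show ?thesis by (simp add: split_beta indicator_def vimage_def)
 qed
 also have "... = (nn_integral lborel (%x. \<integral>\<^sup>+u. ennreal (exp (- u)) * indicator A (x, 0::real, exp u) \<partial>lborel))"
  unfolding lborel_prod[symmetric] using lborel.nn_integral_fst[OF m2] by simp
 also have "... = (nn_integral lborel (%x. \<integral>\<^sup>+y. (if y > 0 then ennreal (1 / y^2) else 0) * indicator A (iota (x, y)) \<partial>lborel))"
 proof (rule nn_integral_cong)
  fix x :: real
  have "(%y. iota (x, y)) : borel_measurable borel"
  unfolding iota_def by (auto intro!: borel_measurable_continuous_onI continuous_intros)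
  hence "(%y. indicator A (iota (x, y)) :: ennreal) : borel_measurable borel" by measurable
  from exp_substitution[OF this]
  show "(nn_integral lborel (%u. ennreal (exp (- u)) * indicator A (x, 0::real, exp u))) =
  (nn_integral lborel (%y. (if y > 0 then ennreal (1 / y^2) else 0) * indicator A (iota (x, y))))"
  by (simp add: iota_def)
 qed
 also have "... = (nn_integral lborel (%z. (if snd z > 0 then ennreal (1 / (snd z)^2) else 0) * indicator A (iota z)))"
  unfolding lborel_prod[symmetric] using lborel.nn_integral_fst[OF m3] by (simp only: snd_conv)
 also have "... = emeasure ha2 (iota -` A)" proof -
  have "iota -` A : sets borel" using measurable_sets[OF iota_borel A] by simp
  hence "emeasure ha2 (iota -` A) = (nn_integral lborel (%z. (if snd z > 0 then ennreal (1 / (snd z)^2) else 0) * indicator (iota -` A) z))"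
  unfolding ha2_def by (subst emeasure_density) auto
  thus ?thesis by (simp add: indicator_def vimage_def)
 qed
 also have "... = emeasure (distr ha2 borel iota) A" by (subst emeasure_distr) (auto simp: ha2_def)
 finally show "emeasure hyp_area A = emeasure (distr ha2 borel iota) A" .
qed

section \<open>The area measure of the plane and its invariance\<close>

lemma plane_borel [measurable]: "plane : sets borel" proof -
 have "plane = H3 \<inter> {q. fst (snd q) = 0}" by (auto simp: plane_def H3_def)
 moreover have "closed {q::point. fst (snd q) = 0}" by (intro closed_Collect_eq continuous_intros)
 ultimately show ?thesis by (metis H3_borel borel_closed sets.Int)
qed

definition har :: "point measure" where
 "har = restrict_space hyp_area plane"

lemma sets_hyp_area [simp, measurable_cong]: "sets hyp_area = sets borel" by (simp add: hyp_area_def)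

lemma space_hyp_area [simp]: "space hyp_area = UNIV" by (simp add: hyp_area_def)

lemma space_har [simp]: "space har = plane" by (simp add: har_def space_restrict_space)

lemma sets_har: "sets har = sets (restrict_space borel plane)"
 unfolding har_def by (rule sets_restrict_space_cong) simp

lemma in_sets_har: "A : sets har \<longleftrightarrow> A : sets borel & A \<subseteq> plane"
 unfolding sets_har by (subst sets_restrict_space_iff) auto

lemma in_sets_hv: "A : sets hv \<longleftrightarrow> A : sets borel & A \<subseteq> H3"
 unfolding sets_hv by (subst sets_restrict_space_iff) auto

lemma emeasure_har: "A : sets har ==> emeasure har A = emeasure ha2 (iota -` A)" proof -
 assume "A : sets har"
 hence A: "A : sets borel" "A \<subseteq> plane" by (auto simp: in_sets_har)
 have "emeasure har A = emeasure hyp_area A" unfolding har_def by (rule emeasure_restrict_space) (use A in auto)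
 also have "... = emeasure ha2 (iota -` A)"
  unfolding hyp_area_eq by (subst emeasure_distr) (use A in "auto simp: ha2_def")
 finally show ?thesis .
qed

lemma emeasure_har_hball:
 assumes q: "q : H3" shows "emeasure har (hball q W \<inter> plane) = ennreal (2 * pi * max 0 (W / tau q - 1))"
proof -
 have "hball q W \<inter> plane : sets har" using hball_borel[OF q] by (simp add: in_sets_har)
 hence "emeasure har (hball q W \<inter> plane) = emeasure ha2 (iota -` (hball q W \<inter> plane))" by (rule emeasure_har)
 also have "iota -` (hball q W \<inter> plane) = pball q W"
  by (auto simp: hball_def pball_def iota_H3 iota_plane[symmetric])
 finally show ?thesis using emeasure_pball[OF q] by simp
qed

definition stab_plane :: "(complex^2^2) set set" where
 "stab_plane = {ga : carrier PSL2C. act ga ` plane = plane}"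

lemma cball_in_S2:
 assumes r: "r > 0" and c: "cball c r \<subseteq> S2"
 obtains z W where "z : S2" "W > 1" "cball c r = pball (iota z) W" proof -
 obtain c1 h where ce: "c = (c1, h)" by (cases c)
 have "(c1, h - r) : cball c r" using r by (simp add: ce dist_prod_def dist_real_def)
 hence hr: "h > r" using c by (auto simp: S2_def)
 define b where "b = sqrt (h^2 - r^2)"
 have hr2: "r^2 < h^2" using hr r by (intro power_strict_mono) auto
 have b: "b > 0" "b^2 = h^2 - r^2" using hr2 by (auto simp: b_def)
 have bh: "b < h" using b r hr by (intro power2_less_imp_less[of b h]) auto
 define W where "W = h / b"
 have W: "W > 1" using b bh by (simp add: W_def)
 have z: "(c1, b) : S2" using b by (simp add: S2_def)
 have t: "tau (c1, 0, b) = 1" using tau_iota[OF z] by (simp add: iota_def)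
 have "b^2 * W^2 = h^2" using b(1) by (simp add: W_def power_divide)
 hence "b^2 * (W^2 - 1) = r^2" using b(2) by (simp add: right_diff_distrib)
 hence "(b * sqrt (W^2 - 1))^2 = r^2" using sq_gt_1[OF W] by (simp add: power_mult_distrib)
 hence "b * sqrt (W^2 - 1) = r" by (rule power2_eq_imp_eq) (use b r sq_gt_1[OF W] in auto)
 hence "cball c r = pball (iota (c1, b)) W"
  using pball_cball[of c1 0 b W] z W b t by (simp add: ce W_def iota_H3 iota_def)
 thus ?thesis using that[OF z W] by blast
qed

lemma stab_plane_inv: "ga : stab_plane ==> ginv ga : stab_plane" proof -
 interpret group PSL2C by (rule group_PSL2C)
 assume g: "ga : stab_plane"
 hence gc: "ga : carrier PSL2C" "act ga ` plane = plane" by (auto simp: stab_plane_def)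
 have "act (ginv ga) ` plane = act (ginv ga) ` act ga ` plane" using gc by simp
 also have "... = plane" using act_inv(1)[OF gc(1)] plane_H3 by (force simp: image_image)
 finally show ?thesis using gc by (simp add: stab_plane_def)
qed

text \<open>The covering argument of \<open>act_preserves_volume\<close> in the half-plane
  \<open>S2\<close>, with \<open>U\<close> the action read through \<open>iota\<close>. All centres
  have \<open>tau = 1\<close> here, so discs of equal hyperbolic radius have equal area.\<close>

theorem act_preserves_area:
 assumes g: "ga : stab_plane" shows "act ga : measurable har har" "distr har har (act ga) = har" proof -
 interpret group PSL2C by (rule group_PSL2C)
 define P :: "point => real \<times> real" where "P q = (fst q, ht q)" for q
 define U where "U de z = P (act de (iota z))" for de z
 have Pi: "P (iota z) = z" for z by (simp add: P_def iota_def)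
 have iP: "iota (P q) = q" if "q : plane" for q using that by (auto simp: P_def iota_def plane_def)
 have ip: "iota z : plane" if "z : S2" for z using iota_plane that by blast
 have iU: "iota (U de z) = act de (iota z)" "U de z : S2" if "de : stab_plane" "z : S2" for de z proof -
  have "act de (iota z) : act de ` plane" using ip[OF that(2)] by (rule imageI)
  hence "act de (iota z) : plane" using that(1) by (simp add: stab_plane_def)
  thus "iota (U de z) = act de (iota z)" "U de z : S2" unfolding U_def using iP by (auto simp: P_def S2_def plane_def)
 qed
 have cU: "continuous_on S2 (U de)" if "de : stab_plane" for de proof -
  have "continuous_on S2 (%z. act de (iota z))"
  by (rule continuous_on_compose2[OF act_continuous_on continuous_on_iota])
  (use that iota_H3 in "auto simp: stab_plane_def")
  thus ?thesis unfolding U_def P_def by (intro continuous_intros)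
 qed
 have ball: "U de ` pball (iota z) W = pball (iota (U de z)) W" if d: "de : stab_plane" and z: "z : S2" for de z W
 proof -
  have dc: "de : carrier PSL2C" using d by (simp add: stab_plane_def)
  have sub: "U de ` pball (iota z) W \<subseteq> pball (iota (U de z)) W" if d: "de : stab_plane" and z: "z : S2" for de z
  proof (rule image_subsetI)
  fix w assume w: "w : pball (iota z) W"
  have "wd (act de (iota z)) (act de (iota w)) = wd (iota z) (iota w)"
  by (rule act_wd) (use d z w iota_H3 in "auto simp: stab_plane_def pball_def")
  thus "U de w : pball (iota (U de z)) W" using iU[OF d z] iU[OF d, of w] w by (simp add: pball_def)
  qed
  have inv: "U de (U (ginv de) w) = w" "U (ginv de) (U de w) = w" if "w : S2" for w
  using iU[OF d that] iU[OF stab_plane_inv[OF d] that] act_inv[OF dc iota_H3[THEN iffD1, OF that]] Pi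
  unfolding U_def by metis+
  show ?thesis proof (rule equalityI[OF sub[OF d z]], rule subsetI)
  fix w assume w: "w : pball (iota (U de z)) W"
  hence "w : S2" by (simp add: pball_def)
  have "U (ginv de) w : pball (iota (U (ginv de) (U de z))) W"
  using sub[OF stab_plane_inv[OF d] iU(2)[OF d z]] w by blast
  hence "U (ginv de) w : pball (iota z) W" using inv[OF z] by simp
  thus "w : U de ` pball (iota z) W" using inv(1)[OF \<open>w : S2\<close>] by (metis imageI)
  qed
 qed
 have gi: "ginv ga : stab_plane" by (rule stab_plane_inv[OF g])
 have gc: "ga : carrier PSL2C" "ginv ga : carrier PSL2C" using g by (auto simp: stab_plane_def)
 have oS: "(0, 1) : S2" by (simp add: S2_def)
 let ?A = "%n. {z : S2. wd (iota (0, 1)) (iota z) < real n}"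
 have main: "distr (restrict_space ha2 S2) (restrict_space ha2 S2) (U ga) = restrict_space ha2 S2"
 proof (rule vitali_measure_preserving[where T = "U (ginv ga)" and A = ?A])
  show "U (ginv ga) ` S2 \<subseteq> S2" "U ga ` S2 \<subseteq> S2" using iU g gi by auto
  show "U ga (U (ginv ga) x) = x" "U (ginv ga) (U ga x) = x" if "x : S2" for x
  using iU[OF g that] iU[OF gi that] act_inv[OF gc(1) iota_H3[THEN iffD1, OF that]] Pi unfolding U_def by metis+
  show "\<exists>V B. open V & x : V & (ALL y:S2 \<inter> V. norm (U (ginv ga) y - U (ginv ga) x) <= B * norm (y - x))" if "x : S2" for x
  proof -
  obtain V B where V: "open V" "iota x : V"
  "ALL y:H3 \<inter> V. norm (act (ginv ga) y - act (ginv ga) (iota x)) <= B * norm (y - iota x)"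
  using act_lipschitz[OF gc(2) iota_H3[THEN iffD1, OF \<open>x : S2\<close>]] by blast
  have "open (iota -` V)" using V(1) continuous_on_iota[of UNIV] by (simp add: continuous_on_open_vimage)
  moreover have "norm (U (ginv ga) y - U (ginv ga) x) <= B * norm (y - x)" if y: "y : S2 \<inter> iota -` V" for y
  proof -
  have "norm (act (ginv ga) (iota y) - act (ginv ga) (iota x)) <= B * norm (iota y - iota x)"
  using V(3) y iota_H3 by blast
  thus ?thesis using iU(1)[OF gi \<open>x : S2\<close>] iU(1)[OF gi, of y] y norm_iota by (metis IntD1)
  qed
  ultimately show ?thesis using V(2) by (intro exI[of _ "iota -` V"] exI[of _ B]) auto
  qed
  show "N : null_sets ha2" if "N : null_sets lborel" for N proof -
  have "AE x in lborel. x ~: N" using AE_not_in[OF that] .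
  moreover have "N : sets borel" using that by auto
  ultimately show ?thesis unfolding ha2_def by (subst null_sets_density_iff) (auto elim: eventually_mono)
  qed
  show "emeasure ha2 (U (ginv ga) ` cball c r) = emeasure ha2 (cball c r)" if rc: "r > 0" "cball c r \<subseteq> S2" for c r
  proof -
  obtain z W where z: "z : S2" and W: "W > 1" and e: "cball c r = pball (iota z) W" using cball_in_S2[OF rc] .
  show ?thesis unfolding e ball[OF gi z]
  using emeasure_pball[of "iota z" W] emeasure_pball[of "iota (U (ginv ga) z)" W]
  iU(2)[OF gi z] z by (simp add: iota_H3 tau_iota)
  qed
  have cw: "continuous_on S2 (%z. wd (iota (0, 1)) (iota z))"
  by (rule continuous_on_compose2[OF continuous_on_wd continuous_on_iota]) (use iota_H3 oS in auto)
  show "open (?A n) & ?A n \<subseteq> S2 & emeasure ha2 (?A n) ~= \<infinity>" for n proof (intro conjI)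
  show op: "open (?A n)" by (rule open_sublevel[OF open_S2 cw])
  have "pball (iota (0, 1)) (real n) : sets borel" proof -
  have e: "pball (iota (0, 1)) (real n) = iota -` (hball (iota (0, 1)) (real n) \<inter> plane)"
  by (auto simp: hball_def pball_def iota_H3 iota_plane[symmetric])
  have "hball (iota (0, 1)) (real n) \<inter> plane : sets borel" using hball_borel oS by (simp add: iota_H3)
  from measurable_sets[OF iota_borel this] show ?thesis unfolding e by simp
  qed
  hence "emeasure ha2 (?A n) <= emeasure ha2 (pball (iota (0, 1)) (real n))"
  by (intro emeasure_mono) (auto simp: pball_def)
  also have "... < \<infinity>" using emeasure_pball[of "iota (0, 1)"] oS by (simp add: iota_H3)
  finally show "emeasure ha2 (?A n) ~= \<infinity>" by simp
  qed auto
  show "(\<Union>n. ?A n) = S2" using reals_Archimedean2 by fastforce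
 qed (use open_S2 cU[OF g] cU[OF gi] in auto)
 have "act ga : borel_measurable (restrict_space borel plane)"
  by (rule borel_measurable_continuous_on_restrict[OF continuous_on_subset[OF act_continuous_on[OF gc(1)] plane_H3]])
 hence "act ga : measurable har hyp_area" using measurable_cong_sets[OF sets_har sets_hyp_area] by blast
 hence "act ga : measurable har (restrict_space hyp_area plane)"
  by (rule measurable_restrict_space2[rotated]) (use g in "auto simp: stab_plane_def")
 thus am: "act ga : measurable har har" by (simp only: har_def)
 have spU: "space (restrict_space ha2 S2) = S2" by (simp add: space_restrict_space ha2_def)
 have S2b: "S2 : sets borel" using open_S2 by simp
 have Um: "U ga : measurable (restrict_space ha2 S2) (restrict_space ha2 S2)" proof (rule measurable_restrict_space2)
  show "U ga : space (restrict_space ha2 S2) \<rightarrow> S2" using iU[OF g] spU by auto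
  have "U ga : borel_measurable (restrict_space borel S2)"
  by (rule borel_measurable_continuous_on_restrict[OF cU[OF g]])
  thus "U ga : measurable (restrict_space ha2 S2) ha2"
  using measurable_cong_sets[OF sets_restrict_space_cong[OF sets_ha2] sets_ha2] by blast
 qed
 show "distr har har (act ga) = har" proof (rule measure_eqI)
  fix A assume "A : sets (distr har har (act ga))"
  hence A: "A : sets har" by simp
  have iS: "iota -` B \<subseteq> S2" if "B \<subseteq> plane" for B using that by (auto simp: iota_def S2_def plane_def)
  have B: "act ga -` A \<inter> plane : sets har" using measurable_sets[OF am A] by simp
  have iA: "iota -` A : sets (restrict_space ha2 S2)"
  using A measurable_sets[OF iota_borel, of A] iS[of A] S2b by (subst sets_restrict_space_iff) (auto simp: in_sets_har)
  have "emeasure (distr har har (act ga)) A = emeasure har (act ga -` A \<inter> plane)"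
  using emeasure_distr[OF am A] by simp
  also have "... = emeasure ha2 (iota -` (act ga -` A \<inter> plane))" by (rule emeasure_har[OF B])
  also have "iota -` (act ga -` A \<inter> plane) = U ga -` (iota -` A) \<inter> S2" proof (intro equalityI subsetI)
  fix z assume z: "z : iota -` (act ga -` A \<inter> plane)"
  hence "z : S2" using iS[of plane] by blast
  with z show "z : U ga -` (iota -` A) \<inter> S2" using iU(1)[OF g, of z] by simp
  next
  fix z assume z: "z : U ga -` (iota -` A) \<inter> S2"
  thus "z : iota -` (act ga -` A \<inter> plane)" using iU(1)[OF g, of z] ip[of z] by simp
  qed
  also have "emeasure ha2 (U ga -` (iota -` A) \<inter> S2) = emeasure (restrict_space ha2 S2) (U ga -` (iota -` A) \<inter> S2)"
  by (rule emeasure_restrict_space[symmetric]) (use S2b in "auto simp: ha2_def")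
  also have "... = emeasure (distr (restrict_space ha2 S2) (restrict_space ha2 S2) (U ga)) (iota -` A)"
  using emeasure_distr[OF Um iA] spU by simp
  also have "... = emeasure ha2 (iota -` A)"
  unfolding main by (rule emeasure_restrict_space) (use S2b iS A in "auto simp: ha2_def in_sets_har")
  also have "... = emeasure har A" by (rule emeasure_har[OF A, symmetric])
  finally show "emeasure (distr har har (act ga)) A = emeasure har A" .
 qed simp
qed

section \<open>Unfolding\<close>

text \<open>Invariance moves the group element from the argument of \<open>f\<close> to the domain
  \<open>F\<close>. Then almost every point is counted once, because the translates cover and their
  overlaps are null.\<close>

lemma nn_integral_unfold:
 assumes G: "subgroup G PSL2C" "countable G" and S: "space mu \<subseteq> H3"
  and meas: "!!ga. ga : G ==> act ga : measurable mu mu" and inv: "!!ga. ga : G ==> distr mu mu (act ga) = mu"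
  and F: "F : sets mu" "(\<Union>ga\<in>G. act ga ` F) = space mu"
  and null: "!!ga. ga : G ==> ga ~= \<one>\<^bsub>PSL2C\<^esub> ==> F \<inter> act ga ` F : null_sets mu"
  and f: "f : borel_measurable mu"
 shows "(nn_integral (restrict_space mu F) (%x. (nn_integral (count_space G) (%ga. f (act ga x))))) = (nn_integral mu (%x. f x))"
proof -
 interpret P: group PSL2C by (rule group_PSL2C)
 interpret G: subgroup G PSL2C by fact
 have gc: "ga : carrier PSL2C" if "ga : G" for ga using that by (rule G.mem_carrier)
 have FS: "F \<subseteq> space mu" using F(1) by (rule sets.sets_into_space)
 have FH: "F \<subseteq> H3" using FS S by blast
 have m1: "(%x. f (act ga x)) : borel_measurable mu" if "ga : G" for ga using measurable_compose[OF meas[OF that] f] .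
 have ai: "act (ginv ga) (act ga x) = x" "act ga (act (ginv ga) x) = x" if "ga : G" "x : space mu" for ga x proof -
  have xH: "x : H3" using that(2) S by blast
  show "act (ginv ga) (act ga x) = x" "act ga (act (ginv ga) x) = x" by (rule act_inv[OF gc[OF that(1)] xH])+
 qed
 have shift: "(nn_integral mu (%x. indicator F x * f (act ga x))) = (nn_integral mu (%x. indicator F (act (ginv ga) x) * f x))" if g: "ga : G" for ga
 proof -
  have gi: "ginv ga : G" using g by simp
  note [measurable] = meas[OF gi] meas[OF g] f F(1)
  have "(nn_integral mu (%x. indicator F x * f (act ga x))) = (nn_integral (distr mu mu (act (ginv ga))) (%x. indicator F x * f (act ga x)))"
  by (simp add: inv[OF gi])
  also have "... = (nn_integral mu (%x. indicator F (act (ginv ga) x) * f (act ga (act (ginv ga) x))))"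
  by (rule nn_integral_distr) measurable
  also have "... = (nn_integral mu (%x. indicator F (act (ginv ga) x) * f x))"
  by (rule nn_integral_cong) (simp add: ai[OF g])
  finally show ?thesis .
 qed
 have mi: "(%x. indicator F (act (ginv ga) x) * f x) : borel_measurable mu" if "ga : G" for ga proof -
  have gi: "ginv ga : G" using that by simp
  note [measurable] = meas[OF gi] f F(1)
  show ?thesis by measurable
 qed
 \<comment> \<open>The translates by \<open>ga\<close> and \<open>de\<close> meet in the image under
   \<open>ga\<close> of the overlap of \<open>F\<close> with its translate by
   \<open>et = ga^-1 de\<close>. That overlap is null, and there are countably many pairs.\<close>
 have N: "(\<Union>(ga, de)\<in>{(ga, de) : G \<times> G. ga ~= de}. {x : space mu. act (ginv ga) x : F & act (ginv de) x : F}) : null_sets mu"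
 proof (rule null_sets_UN')
  show "countable {(ga, de) : G \<times> G. ga ~= de}" by (rule countable_subset[of _ "G \<times> G"]) (use G(2) in auto)
  fix gd assume "gd : {(ga, de) : G \<times> G. ga ~= de}"
  then obtain ga de where gd: "gd = (ga, de)" and g: "ga : G" and d: "de : G" and ne: "ga ~= de" by auto
  have gi: "ginv ga : G" using g by simp
  define et where "et = ginv ga \<otimes>\<^bsub>PSL2C\<^esub> de"
  have eG: "et : G" using gi d by (simp add: et_def)
  have e1: "et ~= \<one>\<^bsub>PSL2C\<^esub>" proof
  assume "et = \<one>\<^bsub>PSL2C\<^esub>"
  hence "ga \<otimes>\<^bsub>PSL2C\<^esub> et = ga" using gc[OF g] by simp
  moreover have "ga \<otimes>\<^bsub>PSL2C\<^esub> et = de" using gc[OF g] gc[OF d] by (simp add: et_def P.m_assoc[symmetric])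
  ultimately show False using ne by simp
  qed
  have nl: "F \<inter> act et ` F : null_sets mu" by (rule null[OF eG e1])
  have "act (ginv ga) -` (F \<inter> act et ` F) \<inter> space mu : null_sets mu" proof -
  have "emeasure mu (act (ginv ga) -` (F \<inter> act et ` F) \<inter> space mu) = emeasure (distr mu mu (act (ginv ga))) (F \<inter> act et ` F)"
  using emeasure_distr[OF meas[OF gi], of "F \<inter> act et ` F"] nl by auto
  also have "... = 0" using nl by (simp add: inv[OF gi] null_setsD1)
  finally show ?thesis using measurable_sets[OF meas[OF gi], of "F \<inter> act et ` F"] nl by auto
  qed
  moreover have "{x : space mu. act (ginv ga) x : F & act (ginv de) x : F} \<subseteq>
  act (ginv ga) -` (F \<inter> act et ` F) \<inter> space mu" proof
  fix x assume x: "x : {x : space mu. act (ginv ga) x : F & act (ginv de) x : F}"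
  let ?y = "act (ginv de) x"
  have "act et ?y = act (ginv ga) (act de ?y)"
  unfolding et_def by (rule act_mult) (use gc[OF gi] gc[OF d] x FH in auto)
  also have "... = act (ginv ga) x" using ai(2)[OF d] x by simp
  finally have "act (ginv ga) x : act et ` F" using x by (metis (no_types, lifting) image_eqI mem_Collect_eq)
  thus "x : act (ginv ga) -` (F \<inter> act et ` F) \<inter> space mu" using x by auto
  qed
  moreover have "{x : space mu. act (ginv ga) x : F & act (ginv de) x : F} : sets mu" proof -
  have di: "ginv de : G" using d by simp
  note [measurable] = meas[OF gi] meas[OF di] F(1)
  show ?thesis by measurable
  qed
  ultimately show "(case gd of (ga, de) => {x : space mu. act (ginv ga) x : F & act (ginv de) x : F}) : null_sets mu"
  unfolding gd prod.case using null_sets_subset by blast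
 qed
 have one: "(nn_integral (count_space G) (%ga. indicator F (act (ginv ga) x) * f x)) = f x"
  if x: "x : space mu" and xN: "x ~: (\<Union>(ga, de)\<in>{(ga, de) : G \<times> G. ga ~= de}. {x : space mu. act (ginv ga) x : F & act (ginv de) x : F})" for x
 proof -
  obtain ga y where g: "ga : G" and y: "y : F" "x = act ga y" using F(2) x by blast
  have gy: "act (ginv ga) x : F" using ai(1)[OF g subsetD[OF FS y(1)]] y by simp
  have "(indicator F (act (ginv de) x) :: ennreal) * f x = f x * indicator {ga} de" if "de : G" for de
  proof (cases "de = ga")
  case False
  hence "act (ginv de) x ~: F" using xN x gy g that by blast
  thus ?thesis using False by simp
  qed (use gy in simp)
  hence "(nn_integral (count_space G) (%ga. indicator F (act (ginv ga) x) * f x)) = (nn_integral (count_space G) (%de. f x * indicator {ga} de))"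
  by (intro nn_integral_cong) auto
  also have "... = f x * emeasure (count_space G) {ga}" by (rule nn_integral_cmult_indicator) (use g in auto)
  also have "... = f x" using g by (simp add: emeasure_count_space_finite)
  finally show ?thesis .
 qed
 have "(nn_integral (restrict_space mu F) (%x. (nn_integral (count_space G) (%ga. f (act ga x)))))
  = (nn_integral mu (%x. (nn_integral (count_space G) (%ga. f (act ga x))) * indicator F x))"
  by (rule nn_integral_restrict_space) (use F FS in "simp add: Int_absorb2")
 also have "... = (nn_integral mu (%x. (nn_integral (count_space G) (%ga. indicator F x * f (act ga x)))))"
  by (rule nn_integral_cong) (simp add: nn_integral_cmult mult.commute)
 also have "... = (nn_integral (count_space G) (%ga. (nn_integral mu (%x. indicator F x * f (act ga x)))))"
  by (rule nn_integral_count_space_nn_integral[OF G(2)]) (use m1 F(1) in measurable)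
 also have "... = (nn_integral (count_space G) (%ga. (nn_integral mu (%x. indicator F (act (ginv ga) x) * f x))))"
  by (rule nn_integral_cong) (simp add: shift)
 also have "... = (nn_integral mu (%x. (nn_integral (count_space G) (%ga. indicator F (act (ginv ga) x) * f x))))"
  by (rule nn_integral_count_space_nn_integral[OF G(2), symmetric]) (rule mi)
 also have "... = (nn_integral mu (%x. f x))" proof (rule nn_integral_cong_AE)
  show "AE x in mu. (nn_integral (count_space G) (%ga. indicator F (act (ginv ga) x) * f x)) = f x"
  using AE_not_in[OF N] AE_space by eventually_elim (rule one)
 qed
 finally show ?thesis .
qed

text \<open>The non-negative case, applied to indicators, says that the action pushes the product of
  counting measure and \<open>mu\<close> on \<open>F\<close> forward to \<open>mu\<close>. Fubini's
  theorem then treats integrable functions.\<close>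

lemma integral_unfold:
 fixes f :: "point => real" assumes G: "subgroup G PSL2C" "countable G" and S: "space mu \<subseteq> H3"
  and meas: "!!ga. ga : G ==> act ga : measurable mu mu" and inv: "!!ga. ga : G ==> distr mu mu (act ga) = mu"
  and F: "F : sets mu" "(\<Union>ga\<in>G. act ga ` F) = space mu"
  and null: "!!ga. ga : G ==> ga ~= \<one>\<^bsub>PSL2C\<^esub> ==> F \<inter> act ga ` F : null_sets mu"
  and fin: "emeasure mu F < \<infinity>" and f: "integrable mu f"
 shows "(\<integral>x. (\<integral>ga. f (act ga x) \<partial>count_space G) \<partial>restrict_space mu F) = (LINT x|mu. f x)"
  and "integrable (restrict_space mu F) (%x. \<integral>ga. f (act ga x) \<partial>count_space G)" proof -
 let ?F = "restrict_space mu F" and ?C = "count_space G"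
 have FS: "F \<subseteq> space mu" using F(1) by (rule sets.sets_into_space)
 have spF: "space ?F = F" using FS by (auto simp: space_restrict_space)
 interpret C: sigma_finite_measure ?C by (rule sigma_finite_measure_count_space_countable[OF G(2)])
 interpret F: finite_measure ?F proof
  have "emeasure ?F (space ?F) = emeasure mu F" unfolding spF by (rule emeasure_restrict_space) (use F(1) in auto)
  thus "emeasure ?F (space ?F) ~= \<infinity>" using fin by simp
 qed
 interpret pair_sigma_finite ?C ?F ..
 have am: "(%(ga, x). act ga x) : measurable (?C \<Otimes>\<^sub>M ?F) mu"
  by (rule measurable_pair_measure_countable1[OF G(2)])
  (simp, rule measurable_restrict_space1, rule meas)
 have d: "distr (?C \<Otimes>\<^sub>M ?F) mu (%(ga, x). act ga x) = mu" proof (rule measure_eqI)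
  fix A assume "A : sets (distr (?C \<Otimes>\<^sub>M ?F) mu (%(ga, x). act ga x))"
  hence A [measurable]: "A : sets mu" by simp
  have im: "(%z. indicator A (case z of (ga, x) => act ga x) :: ennreal) : borel_measurable (?C \<Otimes>\<^sub>M ?F)"
  using measurable_compose[OF am borel_measurable_indicator[OF A]] .
  have "emeasure (distr (?C \<Otimes>\<^sub>M ?F) mu (%(ga, x). act ga x)) A =
  (nn_integral (distr (?C \<Otimes>\<^sub>M ?F) mu (%(ga, x). act ga x)) (%z. indicator A z))" by simp
  also have "... = (nn_integral (?C \<Otimes>\<^sub>M ?F) (%z. indicator A (case z of (ga, x) => act ga x)))"
  by (rule nn_integral_distr[OF am]) (use A in measurable)
  also have "... = (nn_integral (?F) (%x. (nn_integral (?C) (%ga. indicator A (act ga x)))))"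
  using nn_integral_snd[OF im] by simp
  also have "... = (nn_integral mu (%x. indicator A x))"
  by (rule nn_integral_unfold[OF G S meas inv F null]) (use A in auto)
  finally show "emeasure (distr (?C \<Otimes>\<^sub>M ?F) mu (%(ga, x). act ga x)) A = emeasure mu A" by simp
 qed simp
 have fm: "f : borel_measurable mu" using f by simp
 have "integrable (distr (?C \<Otimes>\<^sub>M ?F) mu (%(ga, x). act ga x)) f" using f d by simp
 hence i: "integrable (?C \<Otimes>\<^sub>M ?F) (%(ga, x). f (act ga x))"
  by (subst (asm) integrable_distr_eq[OF am fm]) (simp add: case_prod_unfold)
 show "integrable ?F (%x. \<integral>ga. f (act ga x) \<partial>?C)" using integrable_snd[OF i] .
 have "(LINT x|mu. f x) = (\<integral>x. f x \<partial>distr (?C \<Otimes>\<^sub>M ?F) mu (%(ga, x). act ga x))" by (simp add: d)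
 also have "... = (\<integral>z. f (case z of (ga, x) => act ga x) \<partial>(?C \<Otimes>\<^sub>M ?F))"
  by (rule integral_distr[OF am fm])
 also have "... = (\<integral>(ga, x). f (act ga x) \<partial>(?C \<Otimes>\<^sub>M ?F))" by (simp add: case_prod_unfold)
 also have "... = (\<integral>x. (\<integral>ga. f (act ga x) \<partial>?C) \<partial>?F)" using integral_snd[OF i] by simp
 finally show "(\<integral>x. (\<integral>ga. f (act ga x) \<partial>?C) \<partial>?F) = (LINT x|mu. f x)" ..
qed

section \<open>Discrete cocompact groups\<close>

text \<open>The adjugate: the inverse for determinant 1, yet polynomial in the entries and so
  continuous on all matrices.\<close>

definition adj2 :: "complex^2^2 => complex^2^2" where
 "adj2 A = (\<chi> i j. if i = 1 then (if j = 1 then A$2$2 else - A$1$2) else (if j = 1 then - A$2$1 else A$1$1))"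

lemma adj2_nth: "adj2 A $1$1 = A$2$2" "adj2 A $1$2 = - A$1$2" "adj2 A $2$1 = - A$2$1" "adj2 A $2$2 = A$1$1"
 by (simp_all add: adj2_def)

lemma adj2_mult: "A ** adj2 A = mat (det A)"
 by (simp add: vec_eq_iff forall_2 matrix_matrix_mult_def sum_2 adj2_nth mat_def det_2 algebra_simps)

lemma continuous_mat_entries:
 fixes f :: "'a::t2_space => complex^2^2"
 assumes "continuous F (%x. f x $1$1)" "continuous F (%x. f x $1$2)" "continuous F (%x. f x $2$1)" "continuous F (%x. f x $2$2)"
 shows "continuous F f" unfolding continuous_def proof (rule vec_tendstoI, rule vec_tendstoI)
 fix i j :: 2
 have "((%x. f x $ i $ j) \<longlongrightarrow> f (netlimit F) $ i $ j) F"
  using assms exhaust_2[of i] exhaust_2[of j] unfolding continuous_def by auto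
 thus "((%x. f x $ i $ j) \<longlongrightarrow> f (Lim F (%x. x)) $ i $ j) F" .
qed

locale cocompact_group =
 fixes Ga :: "(complex^2^2) set set" assumes discrete: "discrete_subgroup Ga" and cocompact: "cocompact Ga"
begin

sublocale P: group PSL2C by (rule group_PSL2C)

lemma subG: "subgroup Ga PSL2C" using discrete by (simp add: discrete_subgroup_def)

sublocale G: subgroup Ga PSL2C by (rule subG)

lemma gc: "ga : Ga ==> ga : carrier PSL2C" by (rule G.mem_carrier)

lemma carrier_rep: "ga : carrier PSL2C ==> A : ga ==> A : SL2 & ga = {A, - A}"
 by (auto simp: carrier_PSL2C uminus_SL2)

abbreviation og :: point where "og \<equiv> (0, 0, 1)"

lemma og: "og : H3" by (simp add: H3_def)

lemma adj2_in: "A : \<Union>Ga ==> B : \<Union>Ga ==> A ** adj2 B : \<Union>Ga" proof -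
 assume A: "A : \<Union>Ga" and B: "B : \<Union>Ga"
 obtain ga de where g: "ga : Ga" "A : ga" and d: "de : Ga" "B : de" using A B by blast
 have ge: "A : SL2" "ga = {A, - A}" and de: "B : SL2" "de = {B, - B}" using carrier_rep gc g d by blast+
 have di: "ginv de : Ga" using d by simp
 obtain C where C: "C : ginv de" using gc[OF di] by (auto simp: carrier_PSL2C)
 have Ce: "C : SL2" "ginv de = {C, - C}" using carrier_rep[OF gc[OF di] C] by blast+
 have adjSL: "B ** adj2 B = mat 1" using de by (simp add: adj2_mult SL2_def)
 hence adjSL': "adj2 B ** B = mat 1" by (simp add: matrix_left_right_inverse)
 have "ginv de \<otimes>\<^bsub>PSL2C\<^esub> de = \<one>\<^bsub>PSL2C\<^esub>" using gc[OF d(1)] by simp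
 hence "{C, - C} \<otimes>\<^bsub>PSL2C\<^esub> {B, - B} = \<one>\<^bsub>PSL2C\<^esub>" by (simp only: Ce(2)[symmetric] de(2)[symmetric])
 hence "{C ** B, - (C ** B)} = {mat 1, - mat 1}" by (simp only: PSL2C_mult PSL2C_one)
 hence "C ** B = mat 1 \<or> C ** B = - mat 1" by blast
 hence "C = adj2 B \<or> C = - adj2 B" proof
  assume "C ** B = mat 1"
  hence "C ** B ** adj2 B = adj2 B" by simp
  thus ?thesis by (simp add: matrix_mul_assoc[symmetric] adjSL)
 next
  assume "C ** B = - mat 1"
  hence "C ** B ** adj2 B = - adj2 B" by (simp add: matrix_mult_uminus)
  thus ?thesis by (simp add: matrix_mul_assoc[symmetric] adjSL)
 qed
 hence ie: "ginv de = {adj2 B, - adj2 B}" unfolding Ce(2) by (elim disjE) (simp_all add: insert_commute)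
 have "ga \<otimes>\<^bsub>PSL2C\<^esub> ginv de = {A ** adj2 B, - (A ** adj2 B)}"
  unfolding ie unfolding ge(2) by (rule PSL2C_mult)
 moreover have "ga \<otimes>\<^bsub>PSL2C\<^esub> ginv de : Ga" using g di by simp
 ultimately show ?thesis by (metis UnionI insertI1)
qed

text \<open>Infinitely many elements would give infinitely many matrices in a compact set, and a
  limit point \<open>x\<close> of determinant 1. For two of them close to \<open>x\<close> the
  quotient is close to the identity, which is isolated in the group, so they coincide.\<close>

lemma finite_origin: "finite {ga : Ga. wd og (act ga og) <= R}" proof (rule ccontr)
 assume inf: "infinite {ga : Ga. wd og (act ga og) <= R}"
 define rep where "rep ga = (SOME A. A : ga)" for ga :: "(complex^2^2) set"
 have rep: "rep ga : SL2" "ga = {rep ga, - rep ga}" "rep ga : ga" if "ga : Ga" for ga proof -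
  have "\<exists>A. A : ga" using gc[OF that] by (auto simp: carrier_PSL2C)
  thus r: "rep ga : ga" unfolding rep_def by (rule someI_ex)
  show "rep ga : SL2" "ga = {rep ga, - rep ga}" using carrier_rep[OF gc[OF that] r] by blast+
 qed
 define T where "T = rep ` {ga : Ga. wd og (act ga og) <= R}"
 have "inj_on rep {ga : Ga. wd og (act ga og) <= R}"
  by (rule inj_onI) (metis (no_types, lifting) mem_Collect_eq rep(2))
 hence infT: "infinite T" using inf finite_imageD unfolding T_def by blast
 have TG: "T \<subseteq> \<Union>Ga" using rep(3) by (auto simp: T_def)
 have TSL: "T \<subseteq> SL2" using rep(1) by (auto simp: T_def)
 have bnd: "norm A <= 4 * sqrt (2 * R)" if AT: "A : T" for A proof -
  obtain ga where g: "ga : Ga" "wd og (act ga og) <= R" "A = rep ga" using AT unfolding T_def by blast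
  have "act ga = moebius A" using rep(2)[OF g(1)] act_pm g(3) by metis
  hence "(cmod (A$1$1))^2 + (cmod (A$1$2))^2 + (cmod (A$2$1))^2 + (cmod (A$2$2))^2 <= 2 * R"
  using moebius_wd_origin[of A] rep(1)[OF g(1)] g by simp
  hence "(cmod (A$1$1))^2 <= 2 * R" "(cmod (A$1$2))^2 <= 2 * R" "(cmod (A$2$1))^2 <= 2 * R" "(cmod (A$2$2))^2 <= 2 * R"
  by (smt (verit) zero_le_power2)+
  hence c: "cmod (A$1$1) <= sqrt (2 * R)" "cmod (A$1$2) <= sqrt (2 * R)" "cmod (A$2$1) <= sqrt (2 * R)" "cmod (A$2$2) <= sqrt (2 * R)"
  by (auto intro: real_le_rsqrt)
  have row: "norm v <= norm (v$1) + norm (v$2)" for v :: "('c::real_normed_vector)^2"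
  using L2_set_le_sum[of UNIV "%i. norm (v$i)"] by (simp add: norm_vec_def sum_2)
  have "norm A <= norm (A$1) + norm (A$2)" by (rule row)
  also have "... <= (cmod (A$1$1) + cmod (A$1$2)) + (cmod (A$2$1) + cmod (A$2$2))" by (intro add_mono row)
  also have "... <= 4 * sqrt (2 * R)" using c by simp
  finally show ?thesis .
 qed
 hence "T \<subseteq> cball 0 (4 * sqrt (2 * R))" by auto
 moreover have "compact (cball (0 :: complex^2^2) (4 * sqrt (2 * R)))" by simp
 ultimately obtain x where x: "x islimpt T" using infT compact_eq_Bolzano_Weierstrass by blast
 have cdet: "continuous_on UNIV (%A::complex^2^2. det A)" unfolding det_2 by (intro continuous_intros)
 have "closed {A::complex^2^2. det A = 1}" by (rule closed_Collect_eq[OF cdet continuous_on_const])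
 moreover have "T \<subseteq> {A. det A = 1}" using TSL by (auto simp: SL2_def)
 ultimately have dx: "det x = 1" using x closed_limpt islimpt_subset by blast
 have "mat 1 : \<Union>Ga" using G.one_closed by (auto simp: PSL2C_one)
 hence "(mat 1) isolated_in (\<Union>Ga)" using discrete discreteD by (auto simp: discrete_subgroup_def)
 then obtain V where V: "open V" "V \<inter> \<Union>Ga = {mat 1}" by (auto simp: isolated_in_def)
 define ph where "ph z = fst z ** adj2 (snd z)" for z :: "(complex^2^2) \<times> (complex^2^2)"
 have "isCont ph (x, x)" unfolding ph_def
  by (rule continuous_mat_entries; simp add: matrix_matrix_mult_def sum_2 adj2_nth; intro continuous_intros)
 moreover have "ph (x, x) : V" using V by (auto simp: ph_def adj2_mult dx)
 ultimately have "eventually (%z. ph z : V) (nhds (x, x))"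
  using V(1) by (simp add: continuous_at_open eventually_nhds isCont_def)
 then obtain W1 W2 where W: "open W1" "open W2" "x : W1" "x : W2" "!!A B. A : W1 ==> B : W2 ==> ph (A, B) : V" proof -
  assume ev: "eventually (%z. ph z : V) (nhds (x, x))"
  and th: "!!W1 W2. \<lbrakk>open W1; open W2; x : W1; x : W2; (!!A B. A : W1 ==> B : W2 ==> ph (A, B) : V)\<rbrakk> \<Longrightarrow> thesis"
  obtain Q where Q: "open Q" "(x, x) : Q" "!!z. z : Q ==> ph z : V" using ev unfolding eventually_nhds by blast
  obtain W1 W2 where W: "open W1" "open W2" "(x, x) : W1 \<times> W2" "W1 \<times> W2 \<subseteq> Q"
  using open_prod_elim[OF Q(1,2)] .
  show thesis by (rule th[of W1 W2]) (use W Q(3) in auto)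
 qed
 have acc: "!!U. x : U ==> open U ==> infinite (U \<inter> T)" using x unfolding islimpt_eq_acc_point by blast
 have i1: "infinite ((W1 \<inter> W2) \<inter> T)" by (rule acc) (use W(1-4) in auto)
 then obtain A where A: "A : (W1 \<inter> W2) \<inter> T" by (metis equals0I finite.emptyI)
 have "infinite ((W1 \<inter> W2) \<inter> T - {A})" using i1 by simp
 then obtain B where B: "B : (W1 \<inter> W2) \<inter> T - {A}" by (metis equals0I finite.emptyI)
 have AB: "A : T \<inter> (W1 \<inter> W2)" "B : T \<inter> (W1 \<inter> W2)" "A ~= B" using A B by auto
 have "A ** adj2 B : V" using W(5)[of A B] AB by (simp add: ph_def)
 moreover have "A ** adj2 B : \<Union>Ga" by (rule adj2_in) (use AB(1,2) TG in blast)+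
 ultimately have AB1: "A ** adj2 B = mat 1" using V(2) by blast
 have "det B = 1" using AB(2) TSL by (auto simp: SL2_def)
 hence "B ** adj2 B = mat 1" by (simp add: adj2_mult)
 hence BB: "adj2 B ** B = mat 1" by (simp add: matrix_left_right_inverse)
 have "A = A ** (adj2 B ** B)" unfolding BB by simp
 also have "... = B" unfolding matrix_mul_assoc AB1 by simp
 finally have "A = B" .
 thus False using AB by simp
qed

end

section \<open>Uniform bounds for orbits\<close>

context cocompact_group
begin

text \<open>Uniformity comes from cocompactness: translating by \<open>al\<close> brings
  \<open>p\<close> into \<open>K\<close>, and dividing by one fixed element \<open>ga0\<close> of
  the set removes \<open>q\<close>. The elements that result move the origin by a bounded amount and
  lie in the fixed finite set \<open>G0\<close>.\<close>

lemma uniform_count: "\<exists>B::nat. ALL p:H3. ALL q:H3.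
  finite {ga : Ga. wd p (act ga q) <= R} & card {ga : Ga. wd p (act ga q) <= R} <= B" proof -
 obtain K where K: "compact K" "K \<subseteq> H3" "(\<Union>ga\<in>Ga. act ga ` K) = H3"
  using cocompact by (auto simp: cocompact_def)
 have "bounded (wd og ` K)"
  using K(1,2) continuous_on_wd[OF og] by (meson compact_continuous_image compact_imp_bounded continuous_on_subset)
 then obtain RK where RK': "ALL x:wd og ` K. norm x <= RK" unfolding bounded_iff by blast
 have RK: "wd og k <= RK" if "k : K" for k using RK'[rule_format, OF imageI[OF that]] by (simp add: abs_le_iff)
 define R1 where "R1 = 8 * RK * R"
 define G0 where "G0 = {ga : Ga. wd og (act ga og) <= 64 * R1 * (8 * R * R) * R1}"
 have fG0: "finite G0" unfolding G0_def by (rule finite_origin)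
 have "finite {ga : Ga. wd p (act ga q) <= R} & card {ga : Ga. wd p (act ga q) <= R} <= card G0"
  if p: "p : H3" and q: "q : H3" for p q proof (cases "{ga : Ga. wd p (act ga q) <= R} = {}")
  case True
  show ?thesis unfolding True by simp
 next
  case False
  define S where "S = {ga : Ga. wd p (act ga q) <= R}"
  obtain ga0 where g0: "ga0 : Ga" "wd p (act ga0 q) <= R" using False by blast
  obtain al k where a: "al : Ga" and k: "k : K" "p = act al k" using K(3) p by blast
  have kH: "k : H3" using k K(2) by blast
  have ai: "ginv al : Ga" and g0i: "ginv ga0 : Ga" using a g0 by auto
  have q0: "act ga0 q : H3" using act_H3[OF gc[OF g0(1)] q] .
  define m where "m = act (ginv al) (act ga0 q)"
  have m: "m : H3" using act_H3[OF gc[OF ai] q0] by (simp add: m_def)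
  have R1: "R >= 1" using g0(2) wd_ge_1[OF p q0] by simp
  have km: "wd k m <= R" using act_wd[OF gc[OF ai] p q0] g0(2) act_inv(1)[OF gc[OF a] kH] by (simp add: k(2) m_def)
  have RKp: "RK >= 1" using RK[OF k(1)] wd_ge_1[OF og kH] by simp
  have om: "wd og m <= R1" proof -
  have "wd og m <= 8 * wd og k * wd k m" by (rule wd_quasi_triangle[OF og kH m])
  also have "... <= 8 * RK * R" using RK[OF k(1)] km wd_ge_1[OF og kH] wd_ge_1[OF kH m] by (intro mult_mono) auto
  finally show ?thesis by (simp add: R1_def)
  qed
  have R1p: "R1 >= 1" using om wd_ge_1[OF og m] by simp
  define \<Phi> where "\<Phi> ga = ginv al \<otimes>\<^bsub>PSL2C\<^esub> (ga \<otimes>\<^bsub>PSL2C\<^esub> (ginv ga0 \<otimes>\<^bsub>PSL2C\<^esub> al))" for ga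
  have inj: "inj_on \<Phi> S" unfolding \<Phi>_def S_def using gc a g0 ai g0i by (intro inj_onI) simp
  have "\<Phi> ga : G0" if "ga : S" for ga proof -
  have g: "ga : Ga" "wd p (act ga q) <= R" using that by (auto simp: S_def)
  have d: "\<Phi> ga : Ga" using g a g0 ai g0i by (simp add: \<Phi>_def)
  have gq: "act ga q : H3" using act_H3[OF gc[OF g(1)] q] .
  have am: "act al m = act ga0 q" unfolding m_def by (rule act_inv(2)[OF gc[OF a] q0])
  have "act (\<Phi> ga) m = act (ginv al) (act ga (act (ginv ga0) (act al m)))"
  unfolding \<Phi>_def using g a g0 ai g0i m gc act_H3 by (simp add: act_mult)
  also have "... = act (ginv al) (act ga q)" unfolding am using act_inv(1)[OF gc[OF g0(1)] q] by simp
  finally have dm: "act (\<Phi> ga) m = act (ginv al) (act ga q)" .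
  have "wd m (act (\<Phi> ga) m) = wd (act ga0 q) (act ga q)"
  unfolding dm unfolding m_def by (rule act_wd[OF gc[OF ai] q0 gq])
  also have "... <= 8 * wd (act ga0 q) p * wd p (act ga q)" by (rule wd_quasi_triangle[OF q0 p gq])
  also have "... <= 8 * R * R"
  using g0(2) g(2) wd_ge_1[OF p q0] wd_ge_1[OF p gq] by (intro mult_mono) (auto simp: wd_commute)
  finally have mm: "wd m (act (\<Phi> ga) m) <= 8 * R * R" .
  have dH: "act (\<Phi> ga) m : H3" "act (\<Phi> ga) og : H3" using act_H3[OF gc[OF d]] m og by auto
  have "wd og (act (\<Phi> ga) og) <= 8 * wd og m * wd m (act (\<Phi> ga) og)"
  by (rule wd_quasi_triangle[OF og m dH(2)])
  also have "... <= 8 * R1 * (8 * (8 * R * R) * R1)" proof (rule mult_mono)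
  have "wd m (act (\<Phi> ga) og) <= 8 * wd m (act (\<Phi> ga) m) * wd (act (\<Phi> ga) m) (act (\<Phi> ga) og)"
  by (rule wd_quasi_triangle[OF m dH])
  also have "wd (act (\<Phi> ga) m) (act (\<Phi> ga) og) = wd og m"
  using act_wd[OF gc[OF d] m og] by (simp add: wd_commute)
  also have "8 * wd m (act (\<Phi> ga) m) * wd og m <= 8 * (8 * R * R) * R1"
  using mm om wd_ge_1[OF og m] wd_ge_1[OF m dH(1)] R1 by (intro mult_mono) auto
  finally show "wd m (act (\<Phi> ga) og) <= 8 * (8 * R * R) * R1" .
  qed (use om wd_ge_1[OF m dH(2)] R1p in auto)
  also have "... = 64 * R1 * (8 * R * R) * R1" by simp
  finally show ?thesis using d by (simp add: G0_def)
  qed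
  hence sub: "\<Phi> ` S \<subseteq> G0" by blast
  have "finite S" using finite_subset[OF sub fG0] inj by (rule finite_imageD)
  moreover have "card S <= card G0" using card_inj_on_le[OF inj sub fG0] .
  ultimately show ?thesis by (simp add: S_def)
 qed
 thus ?thesis by blast
qed

text \<open>Chosen once for \<open>Ga\<close> and \<open>R\<close>: the constants of the theorem may
  not depend on the points, the fundamental domains or the eigenfunctions.\<close>

definition CB :: "real => real" where
 "CB R = real (SOME B::nat. ALL p:H3. ALL q:H3.
  finite {ga : Ga. wd p (act ga q) <= R} & card {ga : Ga. wd p (act ga q) <= R} <= B)"

lemma CB:
 assumes "p : H3" "q : H3"
 shows "finite {ga : Ga. wd p (act ga q) <= R}" "real (card {ga : Ga. wd p (act ga q) <= R}) <= CB R"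
 using someI_ex[OF uniform_count[of R]] assms unfolding CB_def of_nat_le_iff by blast+

lemma CB_nonneg: "CB R >= 0" by (simp add: CB_def)

lemma countable_Ga: "countable Ga" proof -
 have "Ga = (\<Union>n::nat. {ga : Ga. wd og (act ga og) <= real n})" using real_arch_simple by auto
 moreover have "countable (\<Union>n::nat. {ga : Ga. wd og (act ga og) <= real n})"
  using finite_origin by (intro countable_UN) (auto intro: countable_finite)
 ultimately show ?thesis by simp
qed

section \<open>The stabiliser of the plane\<close>

definition H :: "(complex^2^2) set set" where
 "H = plane_stab Ga"

lemma H_def': "H = {ga : Ga. ga : stab_plane}" using gc by (auto simp: H_def plane_stab_def stab_plane_def)

lemma subH: "subgroup H PSL2C" proof (rule P.subgroupI)
 show "H \<subseteq> carrier PSL2C" using gc by (auto simp: H_def')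
 have "act \<one>\<^bsub>PSL2C\<^esub> ` plane = plane" using act_one plane_H3 by (force simp: image_iff)
 hence "\<one>\<^bsub>PSL2C\<^esub> : H" by (simp add: H_def' stab_plane_def)
 thus "H ~= {}" by blast
 show "ginv a : H" if "a : H" for a using that stab_plane_inv by (auto simp: H_def')
 show "a \<otimes>\<^bsub>PSL2C\<^esub> b : H" if "a : H" "b : H" for a b proof -
  have ac: "a : carrier PSL2C" "b : carrier PSL2C" "act a ` plane = plane" "act b ` plane = plane" "a : Ga" "b : Ga"
  using that by (auto simp: H_def' stab_plane_def)
  have "act (a \<otimes>\<^bsub>PSL2C\<^esub> b) ` plane = act a ` act b ` plane"
  unfolding image_image by (rule image_cong) (use plane_H3 ac act_mult in auto)
  thus ?thesis using ac by (simp add: H_def' stab_plane_def)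
 qed
qed

lemma H_sub: "H \<subseteq> Ga" by (auto simp: H_def')

lemma countable_H: "countable H" using countable_subset[OF H_sub countable_Ga] .

text \<open>\<open>tau q\<close> is the minimum of \<open>wd q\<close> over the plane, and
  \<open>h\<close> preserves both the plane and \<open>wd\<close>. One inequality suffices; the
  other is the same for the inverse.\<close>

lemma tau_invariant:
 assumes h: "h : stab_plane" and q: "q : H3" shows "tau (act h q) = tau q" proof -
 have le: "tau (act h q) <= tau q" if h: "h : stab_plane" and q: "q : H3" for h q proof -
  obtain x1 x2 y where qe: "q = (x1, x2, y)" by (cases q)
  have y: "y > 0" using q by (simp add: qe H3_def)
  have hc: "h : carrier PSL2C" using h by (simp add: stab_plane_def)
  define s where "s = sqrt (x2^2 + y^2)"
  have s: "s > 0" "s^2 = x2^2 + y^2" using y by (auto simp: s_def add_nonneg_pos)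
  have z: "(x1, s) : S2" using s by (simp add: S2_def)
  have w: "wd q (iota (x1, s)) = tau q" proof -
  have "wd q (iota (x1, s)) = (s^2 + s^2) / (2 * y * s)" by (simp add: qe wd_def iota_def s(2))
  also have "... = s / y" using s(1) y by (simp add: field_simps power2_eq_square)
  finally show ?thesis by (simp add: qe tau_def s_def)
  qed
  have "act h (iota (x1, s)) : plane" using h z iota_plane by (auto simp: stab_plane_def)
  then obtain z' where z': "z' : S2" "act h (iota (x1, s)) = iota z'" using iota_plane by blast
  have "tau (act h q) <= wd (act h q) (iota z')" by (rule wd_ge_tau[OF act_H3[OF hc q] z'(1)])
  also have "... = wd q (iota (x1, s))" unfolding z'(2)[symmetric] by (rule act_wd[OF hc q iota_H3[THEN iffD1, OF z]])
  finally show ?thesis by (simp add: w)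
 qed
 have hc: "h : carrier PSL2C" using h by (simp add: stab_plane_def)
 have "tau q = tau (act (ginv h) (act h q))" using act_inv(1)[OF hc q] by simp
 also have "... <= tau (act h q)" by (rule le[OF stab_plane_inv[OF h] act_H3[OF hc q]])
 finally show ?thesis using le[OF h q] by simp
qed

end

lemma cos_angle: "q : H3 ==> inverse (cos (angle q)) = tau q" proof -
 assume q: "q : H3"
 obtain x1 x2 y where qe: "q = (x1, x2, y)" by (cases q)
 have y: "y > 0" using q by (simp add: qe H3_def)
 have "sqrt (1 + (x2 / y)^2) = sqrt (x2^2 + y^2) / y" proof -
  have "1 + (x2 / y)^2 = (x2^2 + y^2) / y^2" using y by (simp add: power_divide field_simps)
  thus ?thesis using y by (simp add: real_sqrt_divide)
 qed
 thus ?thesis by (simp add: qe angle_def tau_def cos_arctan)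
qed

section \<open>Parseval's identity\<close>

lemma prod_L2:
 fixes f g :: "'a => real" assumes [measurable]: "f : borel_measurable M" "g : borel_measurable M"
  and "integrable M (%x. (f x)^2)" "integrable M (%x. (g x)^2)" shows "integrable M (%x. f x * g x)"
proof (rule Bochner_Integration.integrable_bound)
 show "integrable M (%x. (f x)^2 + (g x)^2)" using assms by simp
 show "AE x in M. norm (f x * g x) <= norm ((f x)^2 + (g x)^2)" proof (rule AE_I2)
  fix x
  have "2 * \<bar>f x\<bar> * \<bar>g x\<bar> <= \<bar>f x\<bar>^2 + \<bar>g x\<bar>^2" by (rule sum_squares_bound)
  moreover have "0 <= \<bar>f x\<bar> * \<bar>g x\<bar>" by simp
  ultimately have "\<bar>f x\<bar> * \<bar>g x\<bar> <= (f x)^2 + (g x)^2" unfolding power2_abs by linarith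
  thus "norm (f x * g x) <= norm ((f x)^2 + (g x)^2)" by (simp add: abs_mult)
 qed
qed measurable

lemma lincomb_L2:
 fixes f g :: "'a => real" assumes m: "f : borel_measurable M" "g : borel_measurable M"
  and i: "integrable M (%x. (f x)^2)" "integrable M (%x. (g x)^2)" shows "integrable M (%x. (f x + c * g x)^2)"
  and "(LINT x|M. (f x + c * g x)^2) = (LINT x|M. (f x)^2) + 2 * c * (LINT x|M. f x * g x) + c^2 * (LINT x|M. (g x)^2)"
proof -
 have e: "(%x. (f x + c * g x)^2) = (%x. (f x)^2 + 2 * c * (f x * g x) + c^2 * (g x)^2)"
  by (auto simp: fun_eq_iff power2_eq_square algebra_simps)
 note p = prod_L2[OF m i]
 show "integrable M (%x. (f x + c * g x)^2)" unfolding e using i p by simp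
 show "(LINT x|M. (f x + c * g x)^2) = (LINT x|M. (f x)^2) + 2 * c * (LINT x|M. f x * g x) + c^2 * (LINT x|M. (g x)^2)"
  unfolding e using i p by simp
qed

lemma cauchy_schwarz_integral:
 fixes f g :: "'a => real" assumes m: "f : borel_measurable M" "g : borel_measurable M"
  and i: "integrable M (%x. (f x)^2)" "integrable M (%x. (g x)^2)"
 shows "(LINT x|M. f x * g x)^2 <= (LINT x|M. (f x)^2) * (LINT x|M. (g x)^2)" proof -
 define a b c where "a = (LINT x|M. (f x)^2)" and "b = (LINT x|M. f x * g x)" and "c = (LINT x|M. (g x)^2)"
 have pos: "0 <= a + 2 * t * b + t^2 * c" for t unfolding a_def b_def c_def lincomb_L2(2)[OF m i, symmetric] by simp
 have c0: "c >= 0" by (simp add: c_def)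
 have "b^2 <= a * c" proof (cases "c = 0")
  case True
  have "b = 0" proof (rule ccontr)
  assume b: "b ~= 0"
  have "0 <= a + 2 * (- (a + 1) / (2 * b)) * b" using pos[of "- (a + 1) / (2 * b)"] True by simp
  also have "a + 2 * (- (a + 1) / (2 * b)) * b = - 1" using b by (simp add: field_simps)
  finally show False by simp
  qed
  thus ?thesis using True by simp
 next
  case False
  have "0 <= (a + 2 * (- b / c) * b + (- b / c)^2 * c) * c" using pos[of "- b / c"] c0 by (rule mult_nonneg_nonneg)
  also have "... = a * c - b^2" using False by (simp add: field_simps power2_eq_square)
  finally show ?thesis by simp
 qed
 thus ?thesis by (simp add: a_def b_def c_def)
qed

locale orthonormal_system =
 fixes M :: "'a measure" and e :: "nat => 'a => real" assumes fin: "finite_measure M"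
  and em [measurable]: "!!j. e j : borel_measurable M"
  and orth: "!!i j. (LINT x|M. e i x * e j x) = (if i = j then 1 else 0)"
begin

text \<open>A non-integrable function has integral 0 by convention, so the normalisation itself
  forces square integrability.\<close>

lemma e_sq: "integrable M (%x. (e j x)^2)" proof (rule ccontr)
 assume "~ integrable M (%x. (e j x)^2)"
 hence "(LINT x|M. e j x * e j x) = 0" by (simp add: not_integrable_integral_eq power2_eq_square)
 thus False using orth[of j j] by simp
qed

lemma lin_m [measurable]: "(%x. SUM j:J. c j * e j x) : borel_measurable M" by measurable

lemma lin_sq:
 assumes J: "finite J"
 shows "integrable M (%x. (SUM j:J. c j * e j x)^2)" and "(LINT x|M. (SUM j:J. c j * e j x)^2) = (SUM j:J. (c j)^2)"
proof -
 have "integrable M (%x. (SUM j:J. c j * e j x)^2) & (LINT x|M. (SUM j:J. c j * e j x)^2) = (SUM j:J. (c j)^2)"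
  using J proof (induction J rule: finite_induct)
  case (insert i J)
  note l = lincomb_L2[OF lin_m em conjunct1[OF insert.IH] e_sq, of "c i" i]
  have ie: "integrable M (%x. e j x * e i x)" for j by (rule prod_L2[OF em em e_sq e_sq])
  have z: "(LINT x|M. (SUM j:J. c j * e j x) * e i x) = 0" proof -
  have "(LINT x|M. (SUM j:J. c j * e j x) * e i x) = (LINT x|M. (SUM j:J. c j * (e j x * e i x)))"
  by (simp add: sum_distrib_right mult.assoc)
  also have "... = (SUM j:J. c j * (LINT x|M. e j x * e i x))" using ie by simp
  also have "... = 0" using insert.hyps by (intro sum.neutral) (auto simp: orth)
  finally show ?thesis .
  qed
  have s: "(SUM j:insert i J. c j * e j x) = (SUM j:J. c j * e j x) + c i * e i x" for x using insert.hyps by simp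
  have o1: "(LINT x|M. (e i x)^2) = 1" using orth[of i i] by (simp add: power2_eq_square)
  show ?case unfolding s using l insert z o1 by simp
 qed simp
 thus "integrable M (%x. (SUM j:J. c j * e j x)^2)" "(LINT x|M. (SUM j:J. c j * e j x)^2) = (SUM j:J. (c j)^2)" by auto
qed

lemma lin_prod:
 assumes J: "finite J" and [measurable]: "f : borel_measurable M" and f: "integrable M (%x. (f x)^2)"
 shows "(LINT x|M. f x * (SUM j:J. c j * e j x)) = (SUM j:J. c j * (LINT x|M. f x * e j x))" proof -
 have ie: "integrable M (%x. f x * e j x)" for j by (rule prod_L2[OF _ em f e_sq]) simp
 have "(LINT x|M. f x * (SUM j:J. c j * e j x)) = (LINT x|M. (SUM j:J. c j * (f x * e j x)))"
  by (simp add: sum_distrib_left mult.left_commute)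
 also have "... = (SUM j:J. c j * (LINT x|M. f x * e j x))" using ie by simp
 finally show ?thesis .
qed

lemma bessel:
 assumes J: "finite J" and f: "f : borel_measurable M" "integrable M (%x. (f x)^2)"
 shows "(SUM j:J. (LINT x|M. f x * e j x)^2) <= (LINT x|M. (f x)^2)" proof -
 define c where "c j = (LINT x|M. f x * e j x)" for j
 have "0 <= (LINT x|M. (f x + (- 1) * (SUM j:J. c j * e j x))^2)" by simp
 also have "... = (LINT x|M. (f x)^2) - (SUM j:J. (c j)^2)"
  unfolding lincomb_L2(2)[OF f(1) lin_m f(2) lin_sq(1)[OF J]] lin_sq(2)[OF J] lin_prod[OF J f]
  by (simp add: c_def power2_eq_square)
 finally show ?thesis by (simp add: c_def)
qed

text \<open>\<open>I\<close> is the class in which completeness may be tested, later the invariant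
  functions. The sum of the Fourier series must again lie in \<open>I\<close>; it is therefore built
  as the pointwise limit of a subsequence, and \<open>I\<close> need only be closed under linear
  combinations and such limits. The difference of \<open>f\<close> and this limit has all
  coefficients zero.\<close>

theorem parseval:
 fixes I :: "('a => real) set" assumes I: "!!f. f : I ==> f : borel_measurable M"
  and lin: "!!f g c. f : I ==> g : I ==> (%x. f x + c * g x) : I"
  and lim: "!!fs. (!!n::nat. fs n : I) ==> (%x. if convergent (%n. fs n x) then lim (%n. fs n x) else 0) : I"
  and eI: "!!j. e j : I"
  and complete: "!!f. f : I ==> integrable M (%x. (f x)^2) ==> (!!j. (LINT x|M. f x * e j x) = 0) ==> AE x in M. f x = 0"
  and f: "f : I" "integrable M (%x. (f x)^2)" and g: "g : borel_measurable M" "integrable M (%x. (g x)^2)"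
 shows "(%j. (LINT x|M. f x * e j x) * (LINT x|M. g x * e j x)) sums (LINT x|M. f x * g x)" proof -
 interpret finite_measure M by (rule fin)
 have fm [measurable]: "f : borel_measurable M" by (rule I[OF f(1)])
 define c where "c j = (LINT x|M. f x * e j x)" for j
 define S where "S n x = (\<Sum>j<n. c j * e j x)" for n x
 have zI: "(%x. 0) : I" using lin[OF f(1) f(1), of "- 1"] by simp
 have SI: "S n : I" for n proof (induction n)
  case 0 thus ?case using zI by (simp add: S_def[abs_def])
 next
  case (Suc n)
  have "S (Suc n) = (%x. S n x + c n * e n x)" by (simp add: S_def fun_eq_iff)
  thus ?case using lin[OF Suc eI] by simp
 qed
 have Sm [measurable]: "S n : borel_measurable M" for n by (rule I[OF SI])
 have Ssq: "integrable M (%x. (S n x)^2)" for n unfolding S_def by (rule lin_sq(1)) simp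
 have sumc: "summable (%j. (c j)^2)" proof (rule summableI_nonneg_bounded)
  show "(\<Sum>j<n. (c j)^2) <= (LINT x|M. (f x)^2)" for n unfolding c_def by (rule bessel[OF _ fm f(2)]) simp
 qed simp
 define T where "T n = (\<Sum>j. (c (j + n))^2)" for n
 have T0: "T \<longlonglongrightarrow> 0" unfolding T_def by (rule suminf_exist_split2[OF sumc])
 have Tn: "T n >= 0" for n unfolding T_def by (intro suminf_nonneg summable_ignore_initial_segment[OF sumc]) simp
 have diff: "integrable M (%x. (S m x - S n x)^2)" "(LINT x|M. (S m x - S n x)^2) <= T n" if mn: "n <= m" for m n
 proof -
  have e: "S m x - S n x = (SUM j:{n..<m}. c j * e j x)" for x
  unfolding S_def lessThan_atLeast0 using sum_diff_nat_ivl[of 0 n m "%j. c j * e j x"] mn by simp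
  show "integrable M (%x. (S m x - S n x)^2)" unfolding e by (rule lin_sq(1)) simp
  have "(LINT x|M. (S m x - S n x)^2) = (SUM j:{n..<m}. (c j)^2)" unfolding e by (rule lin_sq(2)) simp
  also have "... = (\<Sum>j<m - n. (c (j + n))^2)"
  using sum.shift_bounds_nat_ivl[of "%j. (c j)^2" 0 n "m - n"] mn by (simp add: lessThan_atLeast0)
  also have "... <= T n" unfolding T_def by (rule sum_le_suminf[OF summable_ignore_initial_segment[OF sumc]]) auto
  finally show "(LINT x|M. (S m x - S n x)^2) <= T n" .
 qed
 have S1: "integrable M (S n)" for n proof -
  have "integrable M (%x. 1 * S n x)" by (rule prod_L2) (use Ssq in auto)
  thus ?thesis by simp
 qed
 define V where "V = measure M (space M)"
 \<comment> \<open>The inequality \<open>2 d a \<le> d^2 + a^2\<close> with a free parameter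
   \<open>d\<close> turns the bound in mean square into one in mean, from which a subsequence
   converging almost everywhere is extracted.\<close>
 have L1: "(LINT x|M. norm (S i x - S j x)) <= d * V / 2 + T n / (2 * d)" if ij: "n <= i" "n <= j" and d: "d > 0" for n i j d
 proof -
  have main: "(LINT x|M. norm (S i x - S j x)) <= d * V / 2 + T j / (2 * d)" if ij: "j <= i" for i j proof -
  have "(LINT x|M. norm (S i x - S j x)) <= (LINT x|M. d / 2 + (S i x - S j x)^2 / (2 * d))"
  proof (rule integral_mono)
  show "integrable M (%x. norm (S i x - S j x))" using S1 by simp
  show "integrable M (%x. d / 2 + (S i x - S j x)^2 / (2 * d))" using diff(1)[OF ij] by simp
  fix x
  have "2 * d * \<bar>S i x - S j x\<bar> <= d^2 + \<bar>S i x - S j x\<bar>^2" by (rule sum_squares_bound)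
  thus "norm (S i x - S j x) <= d / 2 + (S i x - S j x)^2 / (2 * d)"
  using d by (simp add: field_simps power2_eq_square)
  qed
  also have "... = d / 2 * V + (LINT x|M. (S i x - S j x)^2) / (2 * d)" using diff(1)[OF ij] by (simp add: V_def)
  also have "... <= d / 2 * V + T j / (2 * d)" using diff(2)[OF ij] d by (simp add: divide_right_mono)
  finally show ?thesis by simp
  qed
  have Tmono: "T j <= T n" if "n <= j" for j proof -
  have "T n = (\<Sum>k. (c ((k + (j - n)) + n))^2) + (\<Sum>k<j - n. (c (k + n))^2)"
  unfolding T_def by (rule suminf_split_initial_segment[OF summable_ignore_initial_segment[OF sumc]])
  also have "(\<Sum>k. (c ((k + (j - n)) + n))^2) = T j" unfolding T_def using that by (simp add: add.assoc)
  finally show ?thesis by (simp add: sum_nonneg)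
  qed
  show ?thesis proof (cases "j <= i")
  case True
  thus ?thesis using main[OF True] Tmono[OF ij(2)] d by (smt (verit) divide_right_mono)
  next
  case False
  hence "i <= j" by simp
  from main[OF this] show ?thesis using Tmono[OF ij(1)] d
  by (smt (verit, ccfv_SIG) divide_right_mono norm_minus_commute Bochner_Integration.integral_cong)
  qed
 qed
 obtain r where r: "strict_mono r" "AE x in M. Cauchy (%i. S (r i) x)" proof (rule cauchy_L1_AE_cauchy_subseq[OF S1])
  fix ep :: real assume e: "ep > 0"
  define d where "d = ep / (V + 1)"
  have V0: "V >= 0" by (simp add: V_def)
  have d: "d > 0" using e V0 by (simp add: d_def)
  have dV: "d * V / 2 < ep / 2" using e V0 by (simp add: d_def field_simps)
  have "eventually (%n. T n < d * ep) sequentially" using T0 d e by (intro order_tendstoD(2)) auto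
  then obtain n where n: "T n < d * ep" by (auto simp: eventually_sequentially)
  have "T n / (2 * d) < ep / 2" using n d by (simp add: field_simps)
  thus "\<exists>N. \<forall>i\<ge>N. \<forall>j\<ge>N. (LINT x|M. norm (S i x - S j x)) < ep"
  proof (intro exI[of _ n] allI impI)
  fix i j assume "n <= i" "n <= j"
  from L1[OF this d] dV \<open>T n / (2 * d) < ep / 2\<close>
  show "(LINT x|M. norm (S i x - S j x)) < ep" by linarith
  qed
 qed blast
 define G where "G x = (if convergent (%n. S (r n) x) then lim (%n. S (r n) x) else 0)" for x
 have GI: "G : I" unfolding G_def[abs_def] by (rule lim) (rule SI)
 have Gm [measurable]: "G : borel_measurable M" by (rule I[OF GI])
 have Glim: "AE x in M. (%i. S (r i) x) \<longlonglongrightarrow> G x"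
  using r(2) by eventually_elim (simp add: G_def Cauchy_convergent convergent_LIMSEQ_iff[symmetric])
 \<comment> \<open>Fatou's lemma along the subsequence bounds the distance from \<open>G\<close> to
   each partial sum by the tail \<open>T n\<close>.\<close>
 have GS: "integrable M (%x. (G x - S n x)^2) & (LINT x|M. (G x - S n x)^2) <= T n" for n proof -
  have "(nn_integral M (%x. ennreal ((G x - S n x)^2))) = (nn_integral M (%x. liminf (%i. ennreal ((S (r i) x - S n x)^2))))"
  proof (rule nn_integral_cong_AE)
  show "AE x in M. ennreal ((G x - S n x)^2) = liminf (%i. ennreal ((S (r i) x - S n x)^2))" using Glim
  proof eventually_elim
  case (elim x)
  have "(%i. ennreal ((S (r i) x - S n x)^2)) \<longlonglongrightarrow> ennreal ((G x - S n x)^2)"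
  by (intro tendsto_intros elim)
  thus ?case using lim_imp_Liminf[of sequentially] by fastforce
  qed
  qed
  also have "... <= liminf (%i. \<integral>\<^sup>+x. ennreal ((S (r i) x - S n x)^2) \<partial>M)"
  by (rule nn_integral_liminf) measurable
  also have "... <= ennreal (T n)" proof (rule Liminf_le)
  have "eventually (%i. n <= r i) sequentially" using filterlim_subseq[OF r(1)] by (auto simp: filterlim_at_top)
  thus "\<forall>\<^sub>F i in sequentially. (nn_integral M (%x. ennreal ((S (r i) x - S n x)^2))) <= ennreal (T n)"
  proof eventually_elim
  case (elim i)
  show ?case using diff[OF elim] by (subst nn_integral_eq_integral) (auto simp: ennreal_leI)
  qed
  qed simp
  finally have le: "(nn_integral M (%x. ennreal ((G x - S n x)^2))) <= ennreal (T n)" .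
  have i: "integrable M (%x. (G x - S n x)^2)" by (rule integrableI_nonneg) (use le in "auto simp: le_less_trans")
  thus ?thesis using le Tn by (simp add: nn_integral_eq_integral)
 qed
 have Gsq: "integrable M (%x. (G x)^2)" using lincomb_L2(1)[of "%x. G x - S 0 x" M "S 0" 1] GS[of 0] Ssq[of 0] by simp
 have coef: "(LINT x|M. G x * e j x) = c j" for j proof -
  have bnd: "((LINT x|M. G x * e j x) - c j)^2 <= T n" if "n > j" for n proof -
  have "(LINT x|M. (G x - S n x) * e j x)^2 <= (LINT x|M. (G x - S n x)^2) * (LINT x|M. (e j x)^2)"
  by (rule cauchy_schwarz_integral) (use GS e_sq in auto)
  also have "... <= T n" using GS[of n] orth[of j j] by (simp add: power2_eq_square)
  also have "(LINT x|M. (G x - S n x) * e j x) = (LINT x|M. G x * e j x) - (LINT x|M. S n x * e j x)"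
  using prod_L2[OF Gm em Gsq e_sq] prod_L2[OF Sm em Ssq e_sq] by (simp add: left_diff_distrib)
  also have "(LINT x|M. S n x * e j x) = c j" proof -
  have "(LINT x|M. S n x * e j x) = (LINT x|M. e j x * (\<Sum>i<n. c i * e i x))" by (simp add: S_def mult.commute)
  also have "... = (\<Sum>i<n. c i * (LINT x|M. e j x * e i x))" by (rule lin_prod[OF _ em e_sq]) simp
  also have "... = c j" using that by (simp add: orth if_distrib cong: if_cong)
  finally show ?thesis .
  qed
  finally show ?thesis .
  qed
  have "((LINT x|M. G x * e j x) - c j)^2 <= 0"
  by (rule LIMSEQ_le_const[OF T0]) (use bnd in \<open>auto intro!: exI[of _ "Suc j"]\<close>)
  thus ?thesis by simp
 qed
 have fG: "AE x in M. f x + (- 1) * G x = 0" proof (rule complete[OF lin[OF f(1) GI]])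
  show "integrable M (%x. (f x + (- 1) * G x)^2)" by (rule lincomb_L2(1)[OF fm Gm f(2) Gsq])
  show "(LINT x|M. (f x + (- 1) * G x) * e j x) = 0" for j
  using prod_L2[OF Gm em Gsq e_sq, of j] prod_L2[OF fm em f(2) e_sq, of j] coef[of j]
  by (simp add: left_diff_distrib c_def)
 qed
 have fS: "integrable M (%x. (f x - S n x)^2)" "(LINT x|M. (f x - S n x)^2) <= T n" for n proof -
  show "integrable M (%x. (f x - S n x)^2)" using lincomb_L2(1)[OF fm Sm f(2) Ssq, of "- 1"] by simp
  have "(LINT x|M. (f x - S n x)^2) = (LINT x|M. (G x - S n x)^2)"
  by (rule integral_cong_AE) (use fG in "auto elim!: eventually_mono")
  thus "(LINT x|M. (f x - S n x)^2) <= T n" using GS by simp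
 qed
 define g2 where "g2 = (LINT x|M. (g x)^2)"
 have g20: "g2 >= 0" by (simp add: g2_def)
 have close: "\<bar>(\<Sum>j<n. c j * (LINT x|M. g x * e j x)) - (LINT x|M. f x * g x)\<bar> <= sqrt (T n * g2)" for n
 proof -
  have "(LINT x|M. (f x - S n x) * g x)^2 <= (LINT x|M. (f x - S n x)^2) * g2"
  unfolding g2_def by (rule cauchy_schwarz_integral) (use fS(1) g in auto)
  also have "... <= T n * g2" by (rule mult_right_mono[OF fS(2) g20])
  also have "(LINT x|M. (f x - S n x) * g x) = (LINT x|M. f x * g x) - (LINT x|M. S n x * g x)"
  using prod_L2[OF fm g(1) f(2) g(2)] prod_L2[OF Sm g(1) Ssq g(2)] by (simp add: left_diff_distrib)
  also have "(LINT x|M. S n x * g x) = (\<Sum>j<n. c j * (LINT x|M. g x * e j x))" proof -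
  have "(LINT x|M. S n x * g x) = (LINT x|M. g x * (\<Sum>i<n. c i * e i x))" by (simp add: S_def mult.commute)
  thus ?thesis using lin_prod[OF _ g, of "{..<n}" c] by simp
  qed
  finally have "\<bar>(LINT x|M. f x * g x) - (\<Sum>j<n. c j * (LINT x|M. g x * e j x))\<bar> <= sqrt (T n * g2)"
  by (intro real_le_rsqrt) simp
  thus ?thesis by (simp add: abs_minus_commute)
 qed
 have "(%n. sqrt (T n * g2)) \<longlonglongrightarrow> sqrt (0 * g2)" by (intro tendsto_intros T0)
 hence "(%n. sqrt (T n * g2)) \<longlonglongrightarrow> 0" by simp
 hence "(%n. (\<Sum>j<n. c j * (LINT x|M. g x * e j x)) - (LINT x|M. f x * g x)) \<longlonglongrightarrow> 0"
  by (rule Lim_null_comparison[rotated]) (use close in auto)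
 hence "(%n. \<Sum>j<n. c j * (LINT x|M. g x * e j x)) \<longlonglongrightarrow> (LINT x|M. f x * g x)" by (rule LIM_zero_cancel)
 thus ?thesis by (simp add: sums_def c_def)
qed

end

section \<open>Automorphic kernels\<close>

definition kern :: "(real => real) => real => real => bool" where
 "kern k R B \<longleftrightarrow> k : borel_measurable borel & (\<forall>w>R. k w = 0) & (\<forall>w. \<bar>k w\<bar> <= B)"

lemma kern_ind: "kern (indicator {..R}) R 1" by (auto simp: kern_def indicator_def)

lemma wd_measurable_pair:
 "(%z. wd (fst z) (snd z)) : borel_measurable (hv \<Otimes>\<^sub>M hv)" proof -
 have c: "fst : borel_measurable (borel :: point measure)" "(%q. fst (snd q)) : borel_measurable (borel :: point measure)"
  "ht : borel_measurable borel" by (intro borel_measurable_continuous_onI continuous_intros)+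
 note c' = c[THEN hv_measurableI_borel]
 have [measurable]: "(%z. fst (fst z)) : borel_measurable (hv \<Otimes>\<^sub>M hv)" "(%z. fst (snd (fst z))) : borel_measurable (hv \<Otimes>\<^sub>M hv)"
  "(%z. ht (fst z)) : borel_measurable (hv \<Otimes>\<^sub>M hv)"
  "(%z. fst (snd z)) : borel_measurable (hv \<Otimes>\<^sub>M hv)" "(%z. fst (snd (snd z))) : borel_measurable (hv \<Otimes>\<^sub>M hv)"
  "(%z. ht (snd z)) : borel_measurable (hv \<Otimes>\<^sub>M hv)"
  using measurable_compose[OF measurable_fst c'(1)] measurable_compose[OF measurable_fst c'(2)] measurable_compose[OF measurable_fst c'(3)]
  measurable_compose[OF measurable_snd c'(1)] measurable_compose[OF measurable_snd c'(2)] measurable_compose[OF measurable_snd c'(3)]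
  by blast+
 show ?thesis unfolding wd_def split_beta by measurable
qed

context cocompact_group
begin

lemma act_hv_meas: "ga : Ga ==> act ga : measurable hv hv" "ga : Ga ==> distr hv hv (act ga) = hv"
 using act_preserves_volume gc by blast+

text \<open>An integral over counting measure, so that the unfolding lemmas apply; for kernels of
  bounded support it is a finite sum by \<open>AK_eq\<close>.\<close>

definition AK :: "(real => real) => point => point => real" where
 "AK k p q = (\<integral>ga. k (wd p (act ga q)) \<partial>count_space Ga)"

lemma AK_eq:
 assumes k: "kern k R B" and pq: "p : H3" "q : H3"
 shows "AK k p q = (SUM ga:{ga : Ga. wd p (act ga q) <= R}. k (wd p (act ga q)))" proof -
 have sub: "{ga : Ga. k (wd p (act ga q)) ~= 0} \<subseteq> {ga : Ga. wd p (act ga q) <= R}"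
  using k by (force simp: kern_def)
 have fin: "finite {ga : Ga. k (wd p (act ga q)) ~= 0}" using finite_subset[OF sub CB(1)[OF pq]] .
 have "AK k p q = (\<Sum>ga | ga : Ga & k (wd p (act ga q)) ~= 0. k (wd p (act ga q)))"
  unfolding AK_def by (rule lebesgue_integral_count_space_finite_support[OF fin])
 also have "... = (SUM ga:{ga : Ga. wd p (act ga q) <= R}. k (wd p (act ga q)))"
  by (rule sum.mono_neutral_left[OF CB(1)[OF pq] sub]) auto
 finally show ?thesis .
qed

lemma AK_bound:
 assumes k: "kern k R B" and pq: "p : H3" "q : H3" shows "\<bar>AK k p q\<bar> <= CB R * B" proof -
 have B: "B >= 0" using k unfolding kern_def by (metis abs_ge_zero order_trans)
 have "\<bar>AK k p q\<bar> <= (SUM ga:{ga : Ga. wd p (act ga q) <= R}. \<bar>k (wd p (act ga q))\<bar>)"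
  unfolding AK_eq[OF assms] by (rule sum_abs)
 also have "... <= (SUM ga:{ga : Ga. wd p (act ga q) <= R}. B)" by (rule sum_mono) (use k in "auto simp: kern_def")
 also have "... = real (card {ga : Ga. wd p (act ga q) <= R}) * B" by simp
 also have "... <= CB R * B" by (rule mult_right_mono[OF CB(2)[OF pq] B])
 finally show ?thesis .
qed

text \<open>Cauchy-Schwarz over the at most \<open>CB R\<close> non-zero terms. Integrated over
  \<open>F\<close>, it bounds the square norm of an automorphic kernel by the unfolded integral of
  \<open>k^2\<close>.\<close>

lemma AK_sq:
 assumes k: "kern k R B" and pq: "p : H3" "q : H3" shows "(AK k p q)^2 <= CB R * AK (%w. (k w)^2) p q" proof -
 have k2: "kern (%w. (k w)^2) R (B^2)" using k unfolding kern_def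
  by (intro conjI) (auto intro!: borel_measurable_power simp: abs_le_square_iff[symmetric] intro: order_trans[OF _ abs_ge_self])
 let ?S = "{ga : Ga. wd p (act ga q) <= R}"
 have "(SUM ga:?S. 1 * k (wd p (act ga q)))^2 <= (SUM ga:?S. 1^2) * (SUM ga:?S. (k (wd p (act ga q)))^2)"
  by (rule Cauchy_Schwarz_ineq_sum)
 hence "(AK k p q)^2 <= real (card ?S) * AK (%w. (k w)^2) p q" unfolding AK_eq[OF k pq] AK_eq[OF k2 pq] by simp
 also have "... <= CB R * AK (%w. (k w)^2) p q"
  by (rule mult_right_mono[OF CB(2)[OF pq]]) (simp add: AK_eq[OF k2 pq] sum_nonneg)
 finally show ?thesis .
qed

lemma AK_inv:
 assumes d: "de : Ga" and q: "q : H3" shows "AK k p (act de q) = AK k p q" proof -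
 have b: "bij_betw (%ga. ga \<otimes>\<^bsub>PSL2C\<^esub> de) Ga Ga"
 proof (rule bij_betwI[where g = "%ga. ga \<otimes>\<^bsub>PSL2C\<^esub> ginv de"])
  show "x \<otimes>\<^bsub>PSL2C\<^esub> de \<otimes>\<^bsub>PSL2C\<^esub> ginv de = x" "x \<otimes>\<^bsub>PSL2C\<^esub> ginv de \<otimes>\<^bsub>PSL2C\<^esub> de = x" if "x : Ga" for x
  using gc[OF d] gc[OF that] by (auto simp: P.m_assoc)
 qed (use d in auto)
 have "AK k p (act de q) = (\<integral>ga. k (wd p (act (ga \<otimes>\<^bsub>PSL2C\<^esub> de) q)) \<partial>count_space Ga)"
  unfolding AK_def by (rule Bochner_Integration.integral_cong) (use act_mult gc d q in auto)
 also have "... = AK k p q" unfolding AK_def by (rule integral_bij_count_space[OF b])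
 finally show ?thesis .
qed

lemma AK_measurable:
 assumes k: "k : borel_measurable borel"
 shows "(%z. AK k (fst z) (snd z)) : borel_measurable (hv \<Otimes>\<^sub>M hv)" proof -
 interpret C: sigma_finite_measure "count_space Ga" by (rule sigma_finite_measure_count_space_countable[OF countable_Ga])
 have "(%z. k (wd (fst (fst z)) (act (snd z) (snd (fst z))))) : borel_measurable ((hv \<Otimes>\<^sub>M hv) \<Otimes>\<^sub>M count_space Ga)"
 proof (rule measurable_compose_countable'[where f = "%ga z. k (wd (fst (fst z)) (act ga (snd (fst z))))" and g = snd and I = Ga])
  fix ga assume g: "ga : Ga"
  have "(%z. (fst z, act ga (snd z))) : measurable (hv \<Otimes>\<^sub>M hv) (hv \<Otimes>\<^sub>M hv)"
  using measurable_compose[OF measurable_snd act_hv_meas(1)[OF g]] by measurable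
  from measurable_compose[OF this wd_measurable_pair]
  have "(%z. k (wd (fst z) (act ga (snd z)))) : borel_measurable (hv \<Otimes>\<^sub>M hv)"
  using k by (auto intro: measurable_compose)
  from measurable_compose[OF measurable_fst this]
  show "(%z. k (wd (fst (fst z)) (act ga (snd (fst z))))) : borel_measurable ((hv \<Otimes>\<^sub>M hv) \<Otimes>\<^sub>M count_space Ga)" .
 qed (use countable_Ga in auto)
 thus ?thesis unfolding AK_def
  using C.borel_measurable_lebesgue_integral[of "%z ga. k (wd (fst z) (act ga (snd z)))" "hv \<Otimes>\<^sub>M hv"]
  by (simp add: case_prod_unfold)
qed

end

lemma restrict_hv: "A : sets hv ==> restrict_space hv A = restrict_space hyp_vol A" proof -
 assume "A : sets hv"
 hence A: "A : sets borel" "A \<subseteq> H3" by (auto simp: in_sets_hv)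
 have "restrict_space hv A = restrict_space hyp_vol (H3 \<inter> A)"
  unfolding hv_def by (rule restrict_restrict_space) (use A in auto)
 thus ?thesis using A by (simp add: Int_absorb1)
qed

lemma restrict_har: "A : sets har ==> restrict_space har A = restrict_space hyp_area A" proof -
 assume "A : sets har"
 hence A: "A : sets borel" "A \<subseteq> plane" by (auto simp: in_sets_har)
 have "restrict_space har A = restrict_space hyp_area (plane \<inter> A)"
  unfolding har_def by (rule restrict_restrict_space) (use A in auto)
 thus ?thesis using A by (simp add: Int_absorb1)
qed

section \<open>Fundamental domains and automorphic functions\<close>

locale spectral = cocompact_group +
 fixes F D :: "point set" and u :: "nat => point => real" and lam :: "nat => real" and s :: "nat => complex"
 assumes FD: "fundamental_domain Ga H3 hyp_vol F" and DD: "fundamental_domain (plane_stab Ga) plane hyp_area D"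
  and Dfin: "emeasure hyp_area D < \<infinity>" and ES: "eigen_system Ga F u lam s"
begin

lemma Fh: "F : sets hv" "F \<subseteq> H3" "(\<Union>ga\<in>Ga. act ga ` F) = H3"
 and Fnull: "!!ga. ga : Ga ==> ga ~= \<one>\<^bsub>PSL2C\<^esub> ==> F \<inter> act ga ` F : null_sets hv" proof -
 show F: "F \<subseteq> H3" "(\<Union>ga\<in>Ga. act ga ` F) = H3" using FD by (auto simp: fundamental_domain_def)
 thus "F : sets hv" using FD by (auto simp: fundamental_domain_def in_sets_hv)
 fix ga assume "ga : Ga" "ga ~= \<one>\<^bsub>PSL2C\<^esub>"
 hence "F \<inter> act ga ` F : null_sets hyp_vol" using FD by (auto simp: fundamental_domain_def)
 thus "F \<inter> act ga ` F : null_sets hv" unfolding hv_def using F by (subst null_sets_restrict_space) auto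
qed

lemma Dh: "D : sets har" "D \<subseteq> plane" "(\<Union>ga\<in>H. act ga ` D) = plane"
 and Dnull: "!!ga. ga : H ==> ga ~= \<one>\<^bsub>PSL2C\<^esub> ==> D \<inter> act ga ` D : null_sets har" proof -
 show D: "D \<subseteq> plane" "(\<Union>ga\<in>H. act ga ` D) = plane" using DD by (auto simp: fundamental_domain_def H_def)
 thus "D : sets har" using DD by (auto simp: fundamental_domain_def in_sets_har)
 fix ga assume "ga : H" "ga ~= \<one>\<^bsub>PSL2C\<^esub>"
 hence "D \<inter> act ga ` D : null_sets hyp_area" using DD by (auto simp: fundamental_domain_def H_def)
 thus "D \<inter> act ga ` D : null_sets har" unfolding har_def using D by (subst null_sets_restrict_space) auto
qed

lemma act_har_meas: "ga : H ==> act ga : measurable har har" "ga : H ==> distr har har (act ga) = har"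
 using act_preserves_area by (auto simp: H_def')

definition MF :: "point measure" where "MF = restrict_space hv F"
definition MD :: "point measure" where "MD = restrict_space har D"

lemma space_MF [simp]: "space MF = F" using Fh(2) by (auto simp: MF_def space_restrict_space)
lemma space_MD [simp]: "space MD = D" using Dh(2) by (auto simp: MD_def space_restrict_space)

lemma nn_unfold_F:
 assumes "f : borel_measurable hv"
 shows "(nn_integral MF (%x. (nn_integral (count_space Ga) (%ga. f (act ga x))))) = (nn_integral hv (%x. f x))"
 unfolding MF_def
 by (rule nn_integral_unfold[OF subG countable_Ga _ act_hv_meas Fh(1) _ Fnull assms]) (use Fh in auto)

lemma nn_unfold_D:
 assumes "f : borel_measurable har"
 shows "(nn_integral MD (%x. (nn_integral (count_space H) (%ga. f (act ga x))))) = (nn_integral har (%x. f x))"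
 unfolding MD_def
 by (rule nn_integral_unfold[OF subH countable_H _ act_har_meas Dh(1) _ Dnull assms]) (use Dh plane_H3 in auto)

text \<open>Every point of \<open>F\<close> lies in a translate of the compact set \<open>K\<close>,
  so unfolding bounds the volume of \<open>F\<close> by that of \<open>K\<close>.\<close>

lemma emeasure_F_finite: "emeasure hv F < \<infinity>" proof -
 obtain K where K: "compact K" "K \<subseteq> H3" "(\<Union>ga\<in>Ga. act ga ` K) = H3"
  using cocompact by (auto simp: cocompact_def)
 have Kh: "K : sets hv" using K by (auto simp: in_sets_hv compact_imp_closed)
 have "bounded (wd og ` K)"
  using K(1,2) continuous_on_wd[OF og] by (meson compact_continuous_image compact_imp_bounded continuous_on_subset)
 then obtain RK where RK': "ALL x:wd og ` K. norm x <= RK" unfolding bounded_iff by blast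
 have sub: "K \<subseteq> hball og RK" using RK' K(2) by (fastforce simp: hball_def)
 have "emeasure hv F = (nn_integral MF (%x. 1))" proof -
  have "emeasure MF (space MF) = emeasure hv F"
  unfolding space_MF unfolding MF_def by (rule emeasure_restrict_space) (use Fh in "auto simp: Int_absorb2")
  thus ?thesis by simp
 qed
 also have "... <= (nn_integral MF (%x. (nn_integral (count_space Ga) (%ga. indicator K (act ga x)))))"
 proof (rule nn_integral_mono)
  fix x assume "x : space MF"
  hence x: "x : H3" using Fh(2) by auto
  then obtain ga k where g: "ga : Ga" "k : K" "x = act ga k" using K(3) by blast
  have kH: "k : H3" using g K by blast
  have gi: "ginv ga : Ga" using g by simp
  have "act (ginv ga) x : K" using act_inv(1)[OF gc[OF g(1)] kH] g by simp
  hence "(1::ennreal) = indicator K (act (ginv ga) x)" by simp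
  also have "... <= (nn_integral (count_space Ga) (%ga. indicator K (act ga x)))"
  by (rule nn_integral_ge_point[OF gi])
  finally show "1 <= (nn_integral (count_space Ga) (%ga. indicator K (act ga x)))" .
 qed
 also have "... = (nn_integral hv (%x. indicator K x))" by (rule nn_unfold_F) (use Kh in simp)
 also have "... = emeasure hv K" using Kh by simp
 also have "... <= emeasure hv (hball og RK)" by (rule emeasure_mono[OF sub]) (use og in simp)
 also have "... < \<infinity>" by (rule hball_finite[OF og])
 finally show ?thesis .
qed

lemma unfold_F:
 fixes f :: "point => real" assumes "integrable hv f"
 shows "(LINT x|MF. (\<integral>ga. f (act ga x) \<partial>count_space Ga)) = (LINT x|hv. f x)" unfolding MF_def
 by (rule integral_unfold(1)[OF subG countable_Ga _ act_hv_meas Fh(1) _ Fnull emeasure_F_finite assms]) (use Fh in auto)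

sublocale MF: finite_measure MF proof
 have "emeasure MF (space MF) = emeasure hv F"
  unfolding space_MF unfolding MF_def by (rule emeasure_restrict_space) (use Fh in "auto simp: Int_absorb2")
 thus "emeasure MF (space MF) ~= \<infinity>" using emeasure_F_finite by simp
qed

lemma emeasure_har_D: "emeasure har D = emeasure hyp_area D"
 unfolding har_def by (rule emeasure_restrict_space) (use Dh in auto)

sublocale MD: finite_measure MD proof
 have "emeasure MD (space MD) = emeasure har D"
  unfolding space_MD unfolding MD_def by (rule emeasure_restrict_space) (use Dh in "auto simp: Int_absorb2")
 thus "emeasure MD (space MD) ~= \<infinity>" using Dfin emeasure_har_D by simp
qed

definition vol :: real where "vol = measure hyp_vol F"
definition area :: real where "area = measure hyp_area D"

lemma vol_eq: "vol = measure MF F" proof -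
 have "emeasure MF F = emeasure hyp_vol F"
  unfolding MF_def restrict_hv[OF Fh(1)] by (rule emeasure_restrict_space) (use Fh in "auto simp: in_sets_hv")
 thus ?thesis by (simp add: vol_def measure_def)
qed

lemma area_eq: "area = measure MD D" proof -
 have "emeasure MD D = emeasure hyp_area D"
  unfolding MD_def restrict_har[OF Dh(1)] by (rule emeasure_restrict_space) (use Dh in "auto simp: in_sets_har")
 thus ?thesis by (simp add: area_def measure_def)
qed

lemma area_nonneg: "area >= 0" by (simp add: area_def)

lemma MF_int: "(LINT q:F|hyp_vol. g q) = (LINT q|MF. g q)" for g :: "point => real"
 unfolding MF_def restrict_hv[OF Fh(1)] set_lebesgue_integral_def
 by (rule integral_restrict_space[symmetric]) (use Fh in "auto simp: in_sets_hv")

lemma MD_int: "(LINT q:D|hyp_area. g q) = (LINT q|MD. g q)" for g :: "point => real"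
 unfolding MD_def restrict_har[OF Dh(1)] set_lebesgue_integral_def
 by (rule integral_restrict_space[symmetric]) (use Dh in "auto simp: in_sets_har")

lemma hv_MF: "f : measurable hv N ==> f : measurable MF N" unfolding MF_def by (rule measurable_restrict_space1)

lemma id_har_hv: "(%x. x) : measurable har hv" proof -
 have "(%x. x) : measurable har hyp_vol"
  unfolding har_def by (rule measurable_restrict_space1) (simp add: measurable_def)
 hence "(%x. x) : measurable har (restrict_space hyp_vol H3)"
  by (rule measurable_restrict_space2[rotated]) (use plane_H3 in auto)
 thus ?thesis by (simp add: hv_def)
qed

lemma hv_MD: "f : measurable hv N ==> f : measurable MD N" proof -
 assume "f : measurable hv N"
 from measurable_compose[OF id_har_hv this] have "f : measurable har N" by simp
 thus ?thesis unfolding MD_def by (rule measurable_restrict_space1)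
qed

lemma id_MF_hv: "(%x. x) : measurable MF hv" by (rule hv_MF) simp
lemma id_MD_hv: "(%x. x) : measurable MD hv" by (rule hv_MD) simp

definition autom :: "(point => real) => bool" where
 "autom v \<longleftrightarrow> v : borel_measurable hv & invariant Ga v & (\<exists>M. ALL q:H3. \<bar>v q\<bar> <= M)"

lemma autom_one: "autom (%_. 1)" by (auto simp: autom_def invariant_def)

lemma autom_MF: "autom v ==> v : borel_measurable MF" "autom v ==> integrable MF v" "autom v ==> integrable MF (%q. (v q)^2)"
proof -
 assume a: "autom v"
 thus m: "v : borel_measurable MF" using hv_MF by (auto simp: autom_def)
 obtain M where M: "ALL q:H3. \<bar>v q\<bar> <= M" using a by (auto simp: autom_def)
 show "integrable MF v" by (rule MF.integrable_const_bound[of _ M], rule AE_I2) (use M m Fh(2) in auto)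
 show "integrable MF (%q. (v q)^2)" proof (rule MF.integrable_const_bound[of _ "M^2"])
  show "AE q in MF. norm ((v q)^2) <= M^2" proof (rule AE_I2)
  fix q assume "q : space MF"
  hence "\<bar>v q\<bar> <= M" using M Fh(2) by auto
  hence "\<bar>v q\<bar>^2 <= M^2" by (intro power_mono) auto
  thus "norm ((v q)^2) <= M^2" by simp
  qed
 qed (use m in measurable)
qed

lemma autom_MD: "autom v ==> v : borel_measurable MD" "autom v ==> integrable MD v" proof -
 assume a: "autom v"
 thus m: "v : borel_measurable MD" using hv_MD by (auto simp: autom_def)
 obtain M where M: "ALL q:H3. \<bar>v q\<bar> <= M" using a by (auto simp: autom_def)
 show "integrable MD v" by (rule MD.integrable_const_bound[of _ M], rule AE_I2) (use M m Dh(2) plane_H3 in auto)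
qed

lemma AK_autom:
 assumes k: "kern k R B" and p: "p : H3" shows "autom (AK k p)" proof -
 have "(%q. (p, q)) : measurable hv (hv \<Otimes>\<^sub>M hv)" using p by (auto intro!: measurable_Pair)
 from measurable_compose[OF this AK_measurable[of k]]
 have "AK k p : borel_measurable hv" using k by (simp add: kern_def)
 moreover have "invariant Ga (AK k p)" by (auto simp: invariant_def AK_inv)
 ultimately show ?thesis using AK_bound[OF k p] unfolding autom_def by blast
qed

text \<open>An invariant \<open>v\<close> can be moved inside the sum over the group, after which
  the integral over \<open>F\<close> unfolds to all of \<open>H3\<close>.\<close>

lemma AK_pair:
 assumes k: "kern k R B" and p: "p : H3" and v: "autom v"
 shows "(LINT q|MF. AK k p q * v q) = (LINT q|hv. k (wd p q) * v q)" proof -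
 obtain M where M: "!!q. q : H3 ==> \<bar>v q\<bar> <= M" using v by (auto simp: autom_def)
 have M0: "M >= 0" using M[OF p] by linarith
 have vm: "v : borel_measurable hv" using v by (simp add: autom_def)
 have km: "(%q. k (wd p q)) : borel_measurable hv"
  using k measurable_compose[OF hv_measurableI_borel[OF wd_borel[of p]], of k borel] by (simp add: kern_def)
 have i: "integrable hv (%q. k (wd p q) * v q)" proof (rule integrable_hv_hball[OF p, of _ R "B * M"])
  show "(%q. k (wd p q) * v q) : borel_measurable hv" using km vm by measurable
  show "\<bar>k (wd p q) * v q\<bar> <= B * M" if "q : hball p R" for q proof -
  have "\<bar>k (wd p q)\<bar> <= B" using k by (simp add: kern_def)
  thus ?thesis unfolding abs_mult using M[of q] that by (intro mult_mono) (auto simp: hball_def)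
  qed
  show "k (wd p q) * v q = 0" if "q : H3" "q ~: hball p R" for q using that k by (auto simp: hball_def kern_def)
 qed
 have "(LINT q|MF. AK k p q * v q) = (LINT q|MF. (\<integral>ga. k (wd p (act ga q)) * v (act ga q) \<partial>count_space Ga))"
 proof (rule integral_cong')
  fix q assume "q : space MF"
  hence q: "q : H3" using Fh(2) by auto
  have "(\<integral>ga. k (wd p (act ga q)) * v (act ga q) \<partial>count_space Ga) = (\<integral>ga. k (wd p (act ga q)) * v q \<partial>count_space Ga)"
  by (rule Bochner_Integration.integral_cong) (use v q in "auto simp: autom_def invariant_def")
  thus "AK k p q * v q = (\<integral>ga. k (wd p (act ga q)) * v (act ga q) \<partial>count_space Ga)"
  by (simp add: AK_def)
 qed
 also have "... = (LINT q|hv. k (wd p q) * v q)" by (rule unfold_F[OF i])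
 finally show ?thesis .
qed

text \<open>The central object with two readings: a sum over the cosets of \<open>H\<close> by
  \<open>PP_cosets\<close>, and a function with known spectral coefficients by
  \<open>PP_pair\<close>.\<close>

definition PP :: "real => point => real" where
 "PP W q = (LINT z|MD. AK (indicator {..W}) z q)"

lemma AK_sym_integrable:
 assumes k: "kern k R B" and q: "q : H3" shows "integrable MD (%z. AK k z q)"
proof (rule MD.integrable_const_bound[of _ "CB R * B"])
 show "AE z in MD. norm (AK k z q) <= CB R * B" using AK_bound[OF k _ q] Dh(2) plane_H3 by (intro AE_I2) auto
 have "(%z. (z, q)) : measurable MD (hv \<Otimes>\<^sub>M hv)" using q id_MD_hv by (auto intro!: measurable_Pair)
 from measurable_compose[OF this AK_measurable[of k]]
 show "(%z. AK k z q) : borel_measurable MD" using k by (simp add: kern_def)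
qed

lemma PP_autom: "autom (PP W)" and PP_bounds: "q : H3 ==> 0 <= PP W q & PP W q <= CB W * area" proof -
 have m: "PP W : borel_measurable hv" proof -
  have "(%z. (snd z, fst z)) : measurable (hv \<Otimes>\<^sub>M MD) (hv \<Otimes>\<^sub>M hv)"
  using measurable_compose[OF measurable_snd id_MD_hv] by measurable
  from measurable_compose[OF this AK_measurable[of "indicator {..W}"]]
  have "(%z. AK (indicator {..W}) (snd z) (fst z)) : borel_measurable (hv \<Otimes>\<^sub>M MD)" by simp
  thus ?thesis unfolding PP_def
  using MD.borel_measurable_lebesgue_integral[of "%q z. AK (indicator {..W}) z q" hv] by (simp add: case_prod_unfold)
 qed
 have b: "0 <= PP W q & PP W q <= CB W * area" if q: "q : H3" for q proof
  have zH: "z : H3" if "z : space MD" for z using that Dh(2) plane_H3 by auto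
  show "0 <= PP W q" unfolding PP_def proof (rule Bochner_Integration.integral_nonneg)
  fix z assume "z : space MD"
  from zH[OF this] have "z : H3" .
  from AK_eq[OF kern_ind this q, of W] show "0 <= AK (indicator {..W}) z q" by (simp add: sum_nonneg)
  qed
  have "PP W q <= (LINT z|MD. CB W * 1)" unfolding PP_def
  proof (rule integral_mono[OF AK_sym_integrable[OF kern_ind q]])
  fix z assume "z : space MD"
  from AK_bound[OF kern_ind zH[OF this] q, of W] show "AK (indicator {..W}) z q <= CB W * 1" by simp
  qed simp
  thus "PP W q <= CB W * area" by (simp add: area_eq mult.commute)
 qed
 have "invariant Ga (PP W)" by (auto simp: invariant_def PP_def AK_inv)
 thus "autom (PP W)" using m b by (auto simp: autom_def abs_le_iff intro!: exI[of _ "CB W * area"])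
 show "q : H3 ==> 0 <= PP W q & PP W q <= CB W * area" by (rule b)
qed

text \<open>Stated for a general measure \<open>N\<close> because it is used twice: over
  \<open>D\<close> in \<open>PP_pair\<close>, and over \<open>F\<close> for the mean of an
  eigenfunction.\<close>

lemma AK_fubini:
 assumes N: "finite_measure N" "(%x. x) : measurable N hv" "space N \<subseteq> H3" "v : borel_measurable N"
  and v: "autom v" and h: "!!z. z : H3 ==> (LINT q|MF. AK (indicator {..W}) z q * v q) = h * v z"
 shows "(LINT q|MF. (LINT z|N. AK (indicator {..W}) z q) * v q) = h * (LINT z|N. v z)" proof -
 interpret N: finite_measure N by (rule N)
 interpret pair_sigma_finite N MF ..
 obtain M where M: "!!q. q : H3 ==> \<bar>v q\<bar> <= M" using v by (auto simp: autom_def)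
 have zH: "z : H3" if "z : space N" for z using that N(3) by auto
 have qH: "q : H3" if "q : space MF" for q using that Fh(2) by auto
 interpret P: finite_measure "N \<Otimes>\<^sub>M MF" by (rule finite_measure_pair_measure) unfold_locales
 have i: "integrable (N \<Otimes>\<^sub>M MF) (case_prod (%z q. AK (indicator {..W}) z q * v q))"
 proof (rule P.integrable_const_bound[of _ "CB W * M"])
  show "AE x in N \<Otimes>\<^sub>M MF. norm (case x of (z, q) => AK (indicator {..W}) z q * v q) <= CB W * M"
  proof (rule AE_I2)
  fix x assume x: "x : space (N \<Otimes>\<^sub>M MF)"
  obtain z q where xe: "x = (z, q)" by (cases x)
  have "z : space N" "q : space MF" using x by (auto simp: xe space_pair_measure)
  hence zq: "z : H3" "q : H3" using zH qH by blast+
  have "\<bar>AK (indicator {..W}) z q\<bar> <= CB W" using AK_bound[OF kern_ind zq] by simp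
  thus "norm (case x of (z, q) => AK (indicator {..W}) z q * v q) <= CB W * M"
  unfolding xe prod.case real_norm_def abs_mult using M[OF zq(2)] CB_nonneg by (intro mult_mono) auto
  qed
  have a: "(%z. (fst z, snd z)) : measurable (N \<Otimes>\<^sub>M MF) (hv \<Otimes>\<^sub>M hv)"
  by (intro measurable_Pair measurable_compose[OF measurable_fst N(2)] measurable_compose[OF measurable_snd id_MF_hv])
  from measurable_compose[OF this AK_measurable[of "indicator {..W}"]]
  have b: "(%z. AK (indicator {..W}) (fst z) (snd z)) : borel_measurable (N \<Otimes>\<^sub>M MF)" by simp
  have c: "(%z. v (snd z)) : borel_measurable (N \<Otimes>\<^sub>M MF)"
  using measurable_compose[OF measurable_snd autom_MF(1)[OF v]] .
  show "case_prod (%z q. AK (indicator {..W}) z q * v q) : borel_measurable (N \<Otimes>\<^sub>M MF)"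
  unfolding case_prod_unfold using b c by measurable
 qed
 have "(LINT q|MF. (LINT z|N. AK (indicator {..W}) z q) * v q) = (LINT q|MF. (LINT z|N. AK (indicator {..W}) z q * v q))"
  by simp
 also have "... = (LINT z|N. (LINT q|MF. AK (indicator {..W}) z q * v q))" by (rule Fubini_integral[OF i])
 also have "... = (LINT z|N. h * v z)" by (rule integral_cong') (use h zH in blast)
 finally show ?thesis by simp
qed

lemma PP_pair:
 assumes v: "autom v" and h: "!!z. z : H3 ==> (LINT q|MF. AK (indicator {..W}) z q * v q) = h * v z"
 shows "(LINT q|MF. PP W q * v q) = h * (LINT z|MD. v z)" unfolding PP_def
 by (rule AK_fubini[OF MD.finite_measure_axioms id_MD_hv _ autom_MD(1)[OF v] v h]) (use Dh(2) plane_H3 in auto)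

end

section \<open>Eigenfunctions\<close>

lemma mono_from_deriv:
 fixes f g :: "real => real"
 assumes "!!x. (f has_real_derivative f' x) (at x)" "!!x. (g has_real_derivative g' x) (at x)"
  and "!!x. x >= 0 ==> f' x <= g' x" "f 0 = g 0" "s >= 0" shows "f s <= g s" proof -
 have "g 0 - f 0 <= g s - f s" proof (rule DERIV_nonneg_imp_nondecreasing[OF assms(5)])
  fix x :: real assume "0 <= x" "x <= s"
  thus "\<exists>y. ((%x. g x - f x) has_real_derivative y) (at x) & 0 <= y"
  using DERIV_diff[OF assms(2) assms(1), of x] assms(3)[of x] by (intro exI[of _ "g' x - f' x"]) auto
 qed
 thus ?thesis using assms(4) by simp
qed

lemma strict_mono_from_deriv:
 fixes f g :: "real => real"
 assumes "!!x. (f has_real_derivative f' x) (at x)" "!!x. (g has_real_derivative g' x) (at x)"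
  and "!!x. x > 0 ==> f' x < g' x" "f 0 = g 0" "s > 0" shows "f s < g s" proof -
 have "g 0 - f 0 < g s - f s" proof (rule DERIV_pos_imp_increasing_open[OF assms(5)])
  fix x :: real assume "0 < x" "x < s"
  thus "\<exists>y. ((%x. g x - f x) has_real_derivative y) (at x) & 0 < y"
  using DERIV_diff[OF assms(2) assms(1), of x] assms(3)[of x] by (intro exI[of _ "g' x - f' x"]) auto
 next
  show "continuous_on {0..s} (%x. g x - f x)"
  by (intro continuous_on_diff DERIV_continuous_on[of _ g g'] DERIV_continuous_on[of _ f f']
  has_field_derivative_at_within[OF assms(1)] has_field_derivative_at_within[OF assms(2)])
 qed
 thus ?thesis using assms(4) by simp
qed

lemma Sf_0: "Sf 0 s = sinh s" by (simp add: Sf_def)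

lemma DERIV_sinh': "(sinh has_real_derivative cosh (x::real)) (at x)" by (auto intro!: derivative_eq_intros)

lemma Sf_gt_sinh:
 assumes "l < 0" "s > 0" shows "sinh s < Sf l s"
proof (rule strict_mono_from_deriv[OF DERIV_sinh' DERIV_Sf _ _ assms(2)])
 fix x :: real assume x: "x > 0"
 have "1 < sqrt (1 - l)" using assms by simp
 hence "1 * x < sqrt (1 - l) * x" using x by (intro mult_strict_right_mono)
 thus "cosh x < Cf l x" using assms x by (simp add: Cf_def cosh_real_nonneg_less_iff)
qed simp

lemma Cf_le_cosh: "l >= 0 ==> x >= 0 ==> \<bar>Cf l x\<bar> <= cosh x" proof -
 assume l: "l >= 0" and x: "x >= 0"
 have c1: "1 <= cosh x" by (rule cosh_real_ge_1)
 show ?thesis proof (cases "l < 1")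
  case True
  have "sqrt (1 - l) <= 1" using l by simp
  hence "sqrt (1 - l) * x <= 1 * x" using x by (intro mult_right_mono)
  moreover have "0 <= sqrt (1 - l) * x" using True x by simp
  ultimately show ?thesis using True x by (simp add: Cf_def cosh_real_nonneg_le_iff)
 next
  case False
  have "\<bar>cos (sqrt (l - 1) * x)\<bar> <= 1" by (rule abs_cos_le_one)
  hence "\<bar>cos (sqrt (l - 1) * x)\<bar> <= cosh x" using c1 by linarith
  thus ?thesis using False c1 by (auto simp: Cf_def)
 qed
qed

lemma Sf_le_sinh: "l >= 0 ==> s >= 0 ==> \<bar>Sf l s\<bar> <= sinh s" proof -
 assume l: "l >= 0" and s: "s >= 0"
 have "Sf l s <= sinh s"
  by (rule mono_from_deriv[OF DERIV_Sf DERIV_sinh' _ _ s]) (use Cf_le_cosh[OF l] in "auto simp: abs_le_iff")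
 moreover have "- Sf l s <= sinh s"
  by (rule mono_from_deriv[OF DERIV_minus[OF DERIV_Sf] DERIV_sinh' _ _ s]) (use Cf_le_cosh[OF l] in "auto simp: abs_le_iff")
 ultimately show ?thesis by (simp add: abs_le_iff)
qed

lemma Sf_less_sinh: "l > 0 ==> s > 0 ==> Sf l s < sinh s" proof -
 assume l: "l > 0" and s: "s > 0"
 show ?thesis proof (rule strict_mono_from_deriv[OF DERIV_Sf DERIV_sinh' _ _ s])
  fix x :: real assume x: "x > 0"
  show "Cf l x < cosh x" proof (cases "l < 1")
  case True
  have "sqrt (1 - l) < 1" using l by simp
  hence "sqrt (1 - l) * x < 1 * x" using x by (intro mult_strict_right_mono)
  moreover have "0 <= sqrt (1 - l) * x" using True x by simp
  ultimately show ?thesis using True x by (simp add: Cf_def cosh_real_nonneg_less_iff)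
  next
  case False
  have "cosh x > 1" by (rule cosh_gt_1[OF x])
  moreover have "cos (sqrt (l - 1) * x) <= 1" by (rule cos_le_one)
  ultimately have "cos (sqrt (l - 1) * x) < cosh x" by linarith
  thus ?thesis using False \<open>cosh x > 1\<close> by (simp add: Cf_def)
  qed
 qed simp
qed

text \<open>The factor by which the ball kernel of radius \<open>R\<close> acts on eigenfunctions of
  eigenvalue \<open>l\<close>, that is the Selberg transform of the ball. \<open>mm 0\<close> is the
  volume, and the sign of \<open>l\<close> decides on which side of it \<open>mm l\<close>
  lies.\<close>

definition mm :: "real => real => real" where
 "mm l R = 4 * pi * integral {0..R} (%s. Sf l s * sinh s)"

lemma Sf_sinh_integrable: "(%s. Sf l s * sinh s) integrable_on {0..R}"
 by (intro integrable_continuous_real continuous_intros)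

lemma mm_0: "mm 0 R = hvol R" by (simp add: mm_def hvol_def Sf_0 power2_eq_square)

lemma integral_strict_less:
 fixes f g :: "real => real" assumes cf: "continuous_on UNIV f" and cg: "continuous_on UNIV g" and R: "R > 0"
  and less: "!!x. x > 0 ==> f x < g x" shows "integral {0..R} f < integral {0..R} g" proof -
 have d: "((%r. integral {0..r} g - integral {0..r} f) has_real_derivative g r - f r) (at r)" if "r > 0" for r
  by (intro DERIV_diff DERIV_integral_upper cf cg that)
 have i: "f integrable_on {0..R}" "g integrable_on {0..R}"
  using cf cg by (meson continuous_on_subset integrable_continuous_real subset_UNIV)+
 have "integral {0..0} g - integral {0..0} f < integral {0..R} g - integral {0..R} f"
 proof (rule DERIV_pos_imp_increasing_open[OF R])
  show "continuous_on {0..R} (%r. integral {0..r} g - integral {0..r} f)"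
  by (intro continuous_intros indefinite_integral_continuous_1 i)
  show "\<exists>y. ((%r. integral {0..r} g - integral {0..r} f) has_real_derivative y) (at x) & 0 < y" if "0 < x" "x < R" for x
  using d[OF that(1)] less[OF that(1)] by (intro exI[of _ "g x - f x"]) auto
 qed
 thus ?thesis by simp
qed

lemma mm_less: "l > 0 ==> R > 0 ==> mm l R < hvol R" unfolding mm_0[symmetric] unfolding mm_def
 by (intro mult_strict_left_mono integral_strict_less continuous_intros mult_strict_right_mono)
  (auto simp: Sf_0 Sf_less_sinh)

lemma mm_greater: "l < 0 ==> R > 0 ==> hvol R < mm l R" unfolding mm_0[symmetric] unfolding mm_def
 by (intro mult_strict_left_mono integral_strict_less continuous_intros mult_strict_right_mono)
  (auto simp: Sf_0 Sf_gt_sinh)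

lemma hvol_pos: "R > 0 ==> hvol R > 0" proof -
 assume R: "R > 0"
 have "integral {0..R} (%s. 0::real) < integral {0..R} (%s. (sinh s)^2)"
  by (rule integral_strict_less[OF _ _ R]) (auto intro!: continuous_intros)
 thus ?thesis by (simp add: hvol_def)
qed

lemma mm_abs_le: "l >= 0 ==> \<bar>mm l R\<bar> <= hvol R" proof -
 assume l: "l >= 0"
 have "\<bar>integral {0..R} (%s. Sf l s * sinh s)\<bar> <= integral {0..R} (%s. (sinh s)^2)"
 proof (rule integral_norm_bound_integral[where 'a = real, unfolded real_norm_def])
  show "(%s. Sf l s * sinh s) integrable_on {0..R}" by (rule Sf_sinh_integrable)
  show "(%s. (sinh s)^2) integrable_on {0..R}" by (intro integrable_continuous_real continuous_intros)
  fix s assume "s : {0..R}"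
  hence s: "s >= 0" by simp
  thus "\<bar>Sf l s * sinh s\<bar> <= (sinh s)^2"
  using Sf_le_sinh[OF l s] by (simp add: abs_mult power2_eq_square mult_right_mono)
 qed
 thus ?thesis by (simp add: mm_def hvol_def abs_mult mult_left_mono)
qed

section \<open>The bottom of the spectrum\<close>

context spectral
begin

lemma eigen_cont: "eigenfunction Ga l v ==> continuous_on H3 v"
 by (auto simp: eigenfunction_def C2_on_def intro: differentiable_imp_continuous_on)

lemma eigen_autom:
 assumes v: "eigenfunction Ga l v" shows "autom v" proof -
 obtain K where K: "compact K" "K \<subseteq> H3" "(\<Union>ga\<in>Ga. act ga ` K) = H3"
  using cocompact by (auto simp: cocompact_def)
 have "bounded (v ` K)"
  using K(1,2) eigen_cont[OF v] by (meson compact_continuous_image compact_imp_bounded continuous_on_subset)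
 then obtain M where M: "ALL x:v ` K. norm x <= M" unfolding bounded_iff by blast
 have "\<bar>v q\<bar> <= M" if qH: "q : H3" for q proof -
  obtain ga k where g: "ga : Ga" "k : K" "q = act ga k" using K(3) qH by blast
  have "v q = v k" using v g K(2) by (auto simp: eigenfunction_def invariant_def)
  thus ?thesis using M[rule_format, OF imageI[OF g(2)]] by simp
 qed
 moreover have "v : borel_measurable hv" by (rule hv_measurableI_continuous[OF eigen_cont[OF v]])
 moreover have "invariant Ga v" using v by (simp add: eigenfunction_def)
 ultimately show ?thesis unfolding autom_def by blast
qed

lemma eigen_at: "eigenfunction Ga l v ==> p : H3 ==> eig_at v l p" by (auto simp: eigenfunction_def eig_at_def)

lemma eigen_ball:
 assumes v: "eigenfunction Ga l v" and p: "p : H3" and R: "R > 0"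
 shows "(LINT q|hv. indicator {..cosh R} (wd p q) * v q) = mm l R * v p" proof -
 interpret eig_at v l p by (rule eigen_at[OF v p])
 have "(LINT q|hv. indicator {..cosh R} (wd p q) * v q) = MM (cosh R)"
  unfolding MM_def by (rule Bochner_Integration.integral_cong) (auto simp: indicator_def hball_def)
 thus ?thesis using ball_mean[OF R] by (simp add: mm_def)
qed

lemma ball_pair:
 assumes v: "eigenfunction Ga l v" and p: "p : H3" and R: "R > 0"
 shows "(LINT q|MF. AK (indicator {..cosh R}) p q * v q) = mm l R * v p"
 unfolding AK_pair[OF kern_ind p eigen_autom[OF v]] by (rule eigen_ball[OF v p R])

lemma one_eigen: "eigenfunction Ga 0 (%_. 1)"
 using eig_at_const[OF og] by (auto simp: eig_at_def eigenfunction_def invariant_def)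

text \<open>For \<open>l < 0\<close> the value \<open>mm l 1 * v p\<close> is an integral of
  \<open>v\<close> over a ball of the smaller volume \<open>hvol 1\<close>, so the finite supremum
  of the absolute value of \<open>v\<close> would be smaller than itself. This takes the place of an
  integration by parts on the quotient.\<close>

lemma eigenvalue_nonneg:
 assumes v: "eigenfunction Ga l v" and nz: "q0 : H3" "v q0 ~= 0" shows "l >= 0" proof (rule ccontr)
 assume "~ l >= 0"
 hence l: "l < 0" by simp
 obtain M0 where M0: "ALL q:H3. \<bar>v q\<bar> <= M0" using eigen_autom[OF v] by (auto simp: autom_def)
 define M where "M = (SUP q\<in>H3. \<bar>v q\<bar>)"
 have bdd: "bdd_above ((%q. \<bar>v q\<bar>) ` H3)" using M0 by (auto simp: bdd_above_def)
 have M: "\<bar>v q\<bar> <= M" if "q : H3" for q unfolding M_def by (rule cSUP_upper[OF that bdd])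
 have Mp: "M > 0" using M[OF nz(1)] nz(2) by simp
 have mg: "hvol 1 < mm l 1" by (rule mm_greater[OF l]) simp
 have hp: "hvol 1 > 0" by (rule hvol_pos) simp
 have "\<bar>v p\<bar> <= hvol 1 * M / mm l 1" if p: "p : H3" for p proof -
  have i1: "integrable hv (%q. (indicator {..cosh 1} (wd p q) :: real) * 1)"
  by (rule eig_at.integ[OF eig_at_const[OF p], of "indicator {..cosh 1}" "cosh 1" 1]) auto
  have iv: "integrable hv (%q. indicator {..cosh 1} (wd p q) * v q)"
  by (rule eig_at.integ[OF eigen_at[OF v p], of "indicator {..cosh 1}" "cosh 1" 1]) auto
  have "\<bar>mm l 1 * v p\<bar> = \<bar>\<integral>q. indicator {..cosh 1} (wd p q) * v q \<partial>hv\<bar>"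
  using eigen_ball[OF v p, of 1] by simp
  also have "... <= (LINT q|hv. M * (indicator {..cosh 1} (wd p q) * 1))"
  proof (rule integral_abs_bound[THEN order_trans], rule integral_mono)
  show "integrable hv (%q. \<bar>indicator {..cosh 1} (wd p q) * v q\<bar>)" using iv by (rule integrable_abs)
  show "integrable hv (%q. M * (indicator {..cosh 1} (wd p q) * 1))" using i1 by (rule integrable_mult_right)
  fix q assume "q : space hv"
  thus "\<bar>indicator {..cosh 1} (wd p q) * v q\<bar> <= M * (indicator {..cosh 1} (wd p q) * 1)"
  using M[of q] by (auto simp: indicator_def)
  qed
  also have "... = M * (mm 0 1 * 1)" using eigen_ball[OF one_eigen p, of 1] by simp
  finally show ?thesis using mg hp by (simp add: mm_0 abs_mult field_simps)
 qed
 hence "M <= hvol 1 * M / mm l 1" unfolding M_def using nz(1) by (intro cSUP_least) auto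
 hence "mm l 1 * M <= hvol 1 * M" using mg hp by (simp add: field_simps)
 thus False using mg Mp by simp
qed

lemma open_hv_pos:
 assumes U: "open U" "U \<subseteq> H3" "q : U" shows "emeasure hv U > 0" proof -
 obtain r where r: "r > 0" "cball q r \<subseteq> U" using U open_contains_cball by blast
 obtain p R where p: "p : H3" "R > 0" "cball q r = hball p (cosh R)" using cball_in_H3[OF r(1), of q] r U by blast
 have "0 < emeasure hv (hball p (cosh R))" using emeasure_hball[OF p(1,2)] hvol_pos[OF p(2)] by simp
 also have "... <= emeasure hv U" by (rule emeasure_mono) (use r p U in "auto simp: in_sets_hv")
 finally show ?thesis .
qed

text \<open>A maximum principle. The maximum is attained by cocompactness, and by the mean value
  property the non-negative difference to it integrates to zero over every ball around the maximum
  point.\<close>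

lemma zero_eigen_const:
 assumes v: "eigenfunction Ga 0 v" shows "\<exists>c. ALL q:H3. v q = c" proof -
 obtain K where K: "compact K" "K \<subseteq> H3" "(\<Union>ga\<in>Ga. act ga ` K) = H3"
  using cocompact by (auto simp: cocompact_def)
 have cv: "continuous_on H3 v" by (rule eigen_cont[OF v])
 have "K ~= {}" using K(3) og by auto
 then obtain p0 where p0: "p0 : K" "!!k. k : K ==> v k <= v p0"
  using continuous_attains_sup[OF K(1) _ continuous_on_subset[OF cv K(2)]] by blast
 have p0H: "p0 : H3" using p0 K by blast
 have mx: "v q <= v p0" if qH: "q : H3" for q proof -
  obtain ga k where g: "ga : Ga" "k : K" "q = act ga k" using K(3) qH by blast
  have "v q = v k" using v g K(2) by (auto simp: eigenfunction_def invariant_def)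
  thus ?thesis using p0(2) g(2) by simp
 qed
 have "v q1 = v p0" if q1: "q1 : H3" for q1 proof (rule ccontr)
  assume "v q1 ~= v p0"
  hence lt: "v q1 < v p0" using mx[OF q1] by simp
  define R where "R = arcosh (wd p0 q1 + 1)"
  have w1: "wd p0 q1 >= 1" by (rule wd_ge_1[OF p0H q1])
  have R: "R > 0" "cosh R = wd p0 q1 + 1" using w1 by (auto simp: R_def)
  let ?i = "%q. indicator {..cosh R} (wd p0 q) :: real"
  have i1: "integrable hv (%q. ?i q * 1)"
  by (rule eig_at.integ[OF eig_at_const[OF p0H], of "indicator {..cosh R}" "cosh R" 1]) auto
  have iv: "integrable hv (%q. ?i q * v q)"
  by (rule eig_at.integ[OF eigen_at[OF v p0H], of "indicator {..cosh R}" "cosh R" 1]) auto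
  have id: "integrable hv (%q. ?i q * (v p0 - v q))"
  using Bochner_Integration.integrable_diff[OF integrable_mult_right[OF i1, of "v p0"] iv]
  by (simp add: algebra_simps)
  have "(LINT q|hv. ?i q * (v p0 - v q)) = v p0 * (LINT q|hv. ?i q * 1) - (LINT q|hv. ?i q * v q)" proof -
  have "(LINT q|hv. ?i q * (v p0 - v q)) = (LINT q|hv. v p0 * (?i q * 1) - ?i q * v q)"
  by (rule integral_cong') (simp add: algebra_simps)
  also have "... = (LINT q|hv. v p0 * (?i q * 1)) - (LINT q|hv. ?i q * v q)"
  by (rule Bochner_Integration.integral_diff[OF integrable_mult_right[OF i1] iv])
  finally show ?thesis by simp
  qed
  also have "... = 0" using eigen_ball[OF v p0H R(1)] eigen_ball[OF one_eigen p0H R(1)] by simp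
  finally have "AE q in hv. ?i q * (v p0 - v q) = 0" proof -
  have "AE q in hv. 0 <= ?i q * (v p0 - v q)" proof (rule AE_I2)
  fix q assume "q : space hv"
  hence "v q <= v p0" using mx by simp
  thus "0 <= ?i q * (v p0 - v q)" by simp
  qed
  from integral_nonneg_eq_0_iff_AE[OF id this] show "(LINT q|hv. ?i q * (v p0 - v q)) = 0 ==> ?thesis" by blast
  qed
  hence ae: "AE q in hv. q ~: {q : H3. wd p0 q < cosh R} \<inter> {q : H3. v q < v p0}" by eventually_elim auto
  have op: "open ({q : H3. wd p0 q < cosh R} \<inter> {q : H3. v q < v p0})" proof (rule open_Int)
  show "open {q : H3. wd p0 q < cosh R}" by (rule open_sublevel[OF open_H3 continuous_on_wd[OF p0H]])
  show "open {q : H3. v q < v p0}" by (rule open_sublevel[OF open_H3 cv])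
  qed
  have q1U: "q1 : {q : H3. wd p0 q < cosh R} \<inter> {q : H3. v q < v p0}" using q1 lt R by simp
  have "emeasure hv ({q : H3. wd p0 q < cosh R} \<inter> {q : H3. v q < v p0}) = 0" proof -
  let ?U = "{q : H3. wd p0 q < cosh R} \<inter> {q : H3. v q < v p0}"
  have "?U : sets hv" using op by (auto simp: in_sets_hv)
  hence "(AE q in hv. q ~: ?U) \<longleftrightarrow> ?U : null_sets hv" by (intro AE_iff_null_sets[symmetric])
  thus ?thesis using ae by auto
  qed
  thus False using open_hv_pos[OF op _ q1U] by auto
 qed
 thus ?thesis by blast
qed

lemma AK_sym:
 assumes p: "p : H3" and q: "q : H3" shows "AK k p q = AK k q p" proof -
 have b: "bij_betw (%ga. ginv ga) Ga Ga" by (rule bij_betwI[where g = "%ga. ginv ga"]) (use gc in auto)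
 have "AK k q p = (\<integral>ga. k (wd q (act (ginv ga) p)) \<partial>count_space Ga)"
  unfolding AK_def by (rule integral_bij_count_space[OF b, symmetric])
 also have "... = AK k p q" unfolding AK_def proof (rule integral_cong')
  fix ga assume "ga : space (count_space Ga)"
  hence g: "ga : carrier PSL2C" "ginv ga : carrier PSL2C" using gc by auto
  have "wd q (act (ginv ga) p) = wd (act ga q) (act ga (act (ginv ga) p))"
  by (rule act_wd[OF g(1) q act_H3[OF g(2) p], symmetric])
  also have "... = wd p (act ga q)" using act_inv(2)[OF g(1) p] by (simp add: wd_commute)
  finally show "k (wd q (act (ginv ga) p)) = k (wd p (act ga q))" by simp
 qed
 finally show ?thesis ..
qed

text \<open>The ball kernel is integrated against \<open>v\<close> over both variables: one order
  gives the mean times \<open>hvol 1\<close>, the other the mean times \<open>mm l 1\<close>, and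
  these factors differ for \<open>l > 0\<close>.\<close>

lemma pos_eigen_mean_zero:
 assumes v: "eigenfunction Ga l v" and l: "l > 0" shows "(LINT q|MF. v q) = 0" proof -
 have sp: "space MF \<subseteq> H3" using Fh(2) by simp
 have "(LINT q|MF. (LINT z|MF. AK (indicator {..cosh 1}) z q) * v q) = mm l 1 * (LINT z|MF. v z)"
  by (rule AK_fubini[OF MF.finite_measure_axioms id_MF_hv sp autom_MF(1)[OF eigen_autom[OF v]] eigen_autom[OF v] ball_pair[OF v]]) auto
 moreover have "(LINT q|MF. (LINT z|MF. AK (indicator {..cosh 1}) z q) * v q) = (LINT q|MF. hvol 1 * v q)"
 proof (rule integral_cong')
  fix q assume "q : space MF"
  hence q: "q : H3" using sp by blast
  have "(LINT z|MF. AK (indicator {..cosh 1}) z q) = (LINT z|MF. AK (indicator {..cosh 1}) q z * 1)"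
  by (rule integral_cong') (use AK_sym[OF q] sp in auto)
  thus "(LINT z|MF. AK (indicator {..cosh 1}) z q) * v q = hvol 1 * v q"
  using ball_pair[OF one_eigen q, of 1] by (simp add: mm_0)
 qed
 ultimately have "hvol 1 * (LINT q|MF. v q) = mm l 1 * (LINT q|MF. v q)" by simp
 hence "(hvol 1 - mm l 1) * (LINT q|MF. v q) = 0" by (simp add: left_diff_distrib)
 moreover have "hvol 1 - mm l 1 ~= 0" using mm_less[OF l, of 1] by simp
 ultimately show ?thesis unfolding mult_eq_0_iff by blast
qed

lemma u_eig: "eigenfunction Ga (lam j) (u j)" using ES by (simp add: eigen_system_def)

lemma u_orth: "(LINT q|MF. u i q * u j q) = (if i = j then 1 else 0)"
 using ES MF_int[of "%q. u i q * u j q"] by (simp add: eigen_system_def)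

sublocale O: orthonormal_system MF u
 by standard (use MF.finite_measure_axioms autom_MF(1)[OF eigen_autom[OF u_eig]] u_orth in auto)

lemma lam_nonneg: "lam j >= 0" proof -
 have "EX q:H3. u j q ~= 0" proof (rule ccontr)
  assume a: "~ (EX q:H3. u j q ~= 0)"
  have "(LINT q|MF. u j q * u j q) = (LINT q|MF. 0)" by (rule integral_cong') (use a Fh(2) in auto)
  thus False using u_orth[of j j] by simp
 qed
 thus ?thesis using eigenvalue_nonneg[OF u_eig] by blast
qed

lemma spectral_parseval:
 assumes f: "autom f" and g: "autom g"
 shows "(%j. (LINT q|MF. f q * u j q) * (LINT q|MF. g q * u j q)) sums (LINT q|MF. f q * g q)" proof -
 \<comment> \<open>Completeness in \<open>eigen_system\<close> speaks of functions on all of space,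
   whereas \<open>autom\<close> controls them on \<open>H3\<close>; extension by zero passes between
   the two.\<close>
 define cut where "cut v q = (if q : H3 then v q else 0)" for v :: "point => real" and q
 define I where "I = {f. f : borel_measurable borel & invariant Ga f & (\<forall>q. q ~: H3 --> f q = (0::real))}"
 have cutI: "cut v : I" if "autom v" for v proof -
  have "v : borel_measurable hv" using that by (simp add: autom_def)
  hence "(%q. v q * indicator H3 q) : borel_measurable borel"
  unfolding measurable_hv_eq by (subst (asm) borel_measurable_restrict_space_iff) (auto simp: mult.commute)
  moreover have "(%q. v q * indicator H3 q) = cut v" by (auto simp: cut_def indicator_def fun_eq_iff)
  moreover have "invariant Ga (cut v)" using that act_H3[OF gc] by (auto simp: autom_def invariant_def cut_def)
  ultimately show ?thesis by (auto simp: I_def cut_def)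
 qed
 have cint: "(LINT q|MF. cut v q * cut w q) = (LINT q|MF. v q * w q)" for v w
  by (rule integral_cong') (use Fh(2) in "auto simp: cut_def")
 have csq: "integrable MF (%q. (cut v q)^2)" if "autom v" for v
  by (rule Bochner_Integration.integrable_cong[THEN iffD2, OF refl _ autom_MF(3)[OF that]]) (use Fh(2) in "auto simp: cut_def")
 have bm: "f : borel_measurable MF" if "f : borel_measurable borel" for f :: "point => real"
  using that hv_measurableI_borel hv_MF by blast
 interpret C: orthonormal_system MF "%j. cut (u j)" proof (rule orthonormal_system.intro[OF MF.finite_measure_axioms])
  show "cut (u j) : borel_measurable MF" for j proof -
  have "cut (u j) : borel_measurable borel" using cutI[OF eigen_autom[OF u_eig[of j]]] unfolding I_def by blast
  thus ?thesis by (rule bm)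
  qed
  show "(LINT x|MF. cut (u i) x * cut (u j) x) = (if i = j then 1 else 0)" for i j using u_orth by (simp add: cint)
 qed
 have "(%j. (LINT q|MF. cut f q * cut (u j) q) * (LINT q|MF. cut g q * cut (u j) q)) sums (LINT q|MF. cut f q * cut g q)"
 proof (rule C.parseval[where I = I])
  show "f : borel_measurable MF" if "f : I" for f proof -
  have "f : borel_measurable borel" using that unfolding I_def by blast
  thus ?thesis by (rule bm)
  qed
  show "(%x. f x + c * g x) : I" if "f : I" "g : I" for f g c using that by (auto simp: I_def invariant_def)
  show "cut (u j) : I" "cut f : I" for j using cutI eigen_autom[OF u_eig] f by auto
  show "integrable MF (%q. (cut f q)^2)" "integrable MF (%q. (cut g q)^2)" using csq f g by auto
  show "cut g : borel_measurable MF" proof -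
  have "cut g : borel_measurable borel" using cutI[OF g] unfolding I_def by blast
  thus ?thesis by (rule bm)
  qed
  fix fs :: "nat => point => real" assume fs: "!!n. fs n : I"
  have [measurable]: "fs n : borel_measurable borel" for n using fs by (auto simp: I_def)
  have "(%x. if Cauchy (%n. fs n x) then lim (%n. fs n x) else 0) : borel_measurable borel" by measurable
  moreover have "invariant Ga (%x. if convergent (%n. fs n x) then lim (%n. fs n x) else 0)"
  using fs by (simp add: I_def invariant_def)
  moreover have "(if convergent (%n. fs n q) then lim (%n. fs n q) else 0) = 0" if "q ~: H3" for q proof -
  have "fs n q = 0" for n using fs[of n] that unfolding I_def by blast
  thus ?thesis by simp
  qed
  ultimately show "(%x. if convergent (%n. fs n x) then lim (%n. fs n x) else 0) : I"
  by (simp add: I_def Cauchy_convergent_iff)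
 next
  fix f assume f: "f : I" "integrable MF (%x. (f x)^2)" and o: "!!j. (LINT x|MF. f x * cut (u j) x) = 0"
  have "f : borel_measurable hyp_vol" using f by (auto simp: I_def cong: measurable_cong_sets)
  moreover have "invariant Ga f" using f by (auto simp: I_def)
  moreover have "set_integrable hyp_vol F (%q. (f q)^2)" proof -
  have "F : sets hyp_vol" using Fh(1) by (simp add: in_sets_hv)
  thus ?thesis using f(2) unfolding MF_def restrict_hv[OF Fh(1)] set_integrable_def
  by (subst (asm) integrable_restrict_space) auto
  qed
  moreover have "(LINT q:F|hyp_vol. f q * u j q) = 0" for j proof -
  have "(LINT x|MF. f x * cut (u j) x) = (LINT x|MF. f x * u j x)"
  by (rule integral_cong') (use Fh(2) in "auto simp: cut_def")
  thus ?thesis unfolding MF_int using o by simp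
  qed
  ultimately have "AE q in hyp_vol. f q = 0" using ES unfolding eigen_system_def by blast
  thus "AE x in MF. f x = 0" unfolding MF_def restrict_hv[OF Fh(1)]
  by (subst AE_restrict_space_iff) (use Fh(1) in "auto simp: in_sets_hv elim: eventually_mono")
 qed
 thus ?thesis by (simp add: cint)
qed

lemma vol_pos: "vol > 0" proof (rule ccontr)
 assume "~ vol > 0"
 hence v0: "vol = 0" by (simp add: vol_def less_le)
 have "measure MF (space MF) = 0" using v0 vol_eq by simp
 hence "emeasure MF (space MF) = 0" by (simp add: MF.emeasure_eq_measure)
 hence "AE q in MF. False" using sets.top[of MF] by (intro AE_I[of _ _ "space MF"]) auto
 hence "(LINT q|MF. u 0 q * u 0 q) = (LINT q|MF. 0)"
  by (intro integral_cong_AE) (auto intro: autom_MF(1)[OF eigen_autom[OF u_eig]] elim: eventually_mono)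
 thus False using u_orth[of 0 0] by simp
qed

text \<open>If all eigenvalues were positive, the constant 1 would be orthogonal to every
  \<open>u j\<close>, against Parseval's identity. Constancy and orthogonality leave a single index,
  which yields the leading coefficient of the main term.\<close>

lemma zero_mode: "\<exists>j0. lam j0 = 0 & (\<forall>j. lam j = 0 --> j = j0) & (ALL q:H3. (LINT z|MD. u j0 z) * u j0 q = area / vol)"
proof -
 have ex: "\<exists>j. lam j = 0" proof (rule ccontr)
  assume "\<nexists>j. lam j = 0"
  hence "lam j > 0" for j using lam_nonneg[of j] by (metis less_eq_real_def)
  hence z: "(LINT q|MF. 1 * u j q) = 0" for j using pos_eigen_mean_zero[OF u_eig] by simp
  have "(%j. (LINT q|MF. 1 * u j q) * (LINT q|MF. 1 * u j q)) sums (LINT q|MF. 1 * 1)"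
  by (rule spectral_parseval[OF autom_one autom_one])
  hence "(%j. 0::real) sums (LINT q|MF. 1 * (1::real))" by (simp only: z mult_zero_left)
  hence "(LINT q|MF. 1 * 1) = (0::real)" by (rule sums_unique2[OF _ sums_zero])
  thus False using vol_pos vol_eq by simp
 qed
 have cst: "\<exists>c. c^2 * vol = 1 & (ALL q:H3. u j q = c)" if "lam j = 0" for j proof -
  have "eigenfunction Ga 0 (u j)" using u_eig[of j] that by simp
  from zero_eigen_const[OF this] obtain c where c: "!!q. q : H3 ==> u j q = c" by blast
  have "(LINT q|MF. u j q * u j q) = (LINT q|MF. c^2)"
  by (rule integral_cong') (use c Fh(2) in "auto simp: power2_eq_square")
  hence "c^2 * vol = 1" using u_orth[of j j] vol_eq by (simp add: mult.commute)
  thus ?thesis using c by blast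
 qed
 obtain j0 where j0: "lam j0 = 0" using ex by blast
 obtain c where c: "c^2 * vol = 1" "!!q. q : H3 ==> u j0 q = c" using cst[OF j0] by blast
 have "j = j0" if "lam j = 0" for j proof (rule ccontr)
  assume ne: "j ~= j0"
  from cst[OF that] obtain d where d: "d^2 * vol = 1" "!!q. q : H3 ==> u j q = d" by blast
  have "(LINT q|MF. u j q * u j0 q) = (LINT q|MF. d * c)" by (rule integral_cong') (use c d Fh(2) in auto)
  hence "d * c * vol = 0" using u_orth[of j j0] ne vol_eq by (auto simp: mult.commute)
  moreover have "c ~= 0" "d ~= 0" using c(1) d(1) by auto
  ultimately show False using vol_pos by (auto simp only: mult_eq_0_iff)
 qed
 moreover have "(LINT z|MD. u j0 z) * u j0 q = area / vol" if q: "q : H3" for q proof -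
  have "(LINT z|MD. u j0 z) = (LINT z|MD. c)" by (rule integral_cong') (use c Dh(2) plane_H3 in auto)
  hence "(LINT z|MD. u j0 z) * u j0 q = c^2 * area" using c(2)[OF q] area_eq by (simp add: power2_eq_square)
  also have "... = area / vol" using c(1) vol_pos by (simp add: field_simps)
  finally show ?thesis .
 qed
 ultimately show ?thesis using j0 by blast
qed

end

section \<open>Counting cosets\<close>

text \<open>The hypothesis says that the Euclidean distance is at most \<open>e\<close> times the
  geometric mean of the heights. With \<open>x\<close> the square root of their ratio this implies
  \<open>x^2 \<le> 1 + e x\<close>, whence \<open>x \<le> 1 + e\<close>. Moreover \<open>tau\<close>
  is the norm of the last two coordinates divided by the height.\<close>

lemma tau_close:
 assumes p: "p : H3" and q: "q : H3" and e: "0 < e" "e <= 1" and w: "wd p q <= 1 + e^2 / 2"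
 shows "tau q <= (1 + 5 * e) * tau p" proof -
 have hp: "ht p > 0" "ht q > 0" using p q by (auto simp: H3_iff)
 define S T where "S = sqrt (ht p)" and "T = sqrt (ht q)"
 have ST: "S > 0" "T > 0" "S^2 = ht p" "T^2 = ht q" using hp by (auto simp: S_def T_def)
 have "(norm (p - q))^2 <= (e * S * T)^2" proof -
  have "(norm (p - q))^2 = 2 * ht p * ht q * (wd p q - 1)" by (rule norm_diff_wd[OF p q])
  also have "... <= 2 * ht p * ht q * (e^2 / 2)" using w hp by (intro mult_left_mono) auto
  also have "... = (e * S * T)^2" by (simp add: power_mult_distrib ST)
  finally show ?thesis .
 qed
 hence n: "norm (p - q) <= e * S * T" by (rule power2_le_imp_le) (use ST e in auto)
 define n2 where "n2 = norm (snd (p - q))"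
 have n2: "n2 <= norm (p - q)" unfolding n2_def by (metis norm_snd_le prod.collapse)
 have "\<bar>ht (p - q)\<bar> <= n2" unfolding n2_def by (metis norm_snd_le prod.collapse real_norm_def)
 hence "ht p - ht q <= e * S * T" using n n2 by (simp add: snd_diff)
 hence d: "S^2 <= T^2 + e * S * T" by (simp add: ST)
 define x where "x = S / T"
 have x: "x > 0" using ST by (simp add: x_def)
 have xe: "x * x <= 1 + e * x" proof -
  have "S^2 / T^2 <= (T^2 + e * S * T) / T^2" using d by (intro divide_right_mono) auto
  thus ?thesis using ST(2) by (simp add: x_def power2_eq_square add_divide_distrib)
 qed
 have x1: "x <= 1 + e" proof (rule ccontr)
  assume "~ x <= 1 + e"
  hence "x > 1 + e" by simp
  hence "(1 + e) * 1 < x * (x - e)" using e by (intro mult_strict_mono) auto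
  thus False using xe e by (simp add: algebra_simps)
 qed
 have nt: "norm (snd p) = tau p * S^2" "norm (snd q) = tau q * T^2" using hp by (auto simp: tau_def ST norm_prod_def)
 have "norm (snd q) <= norm (snd p) + n2"
  unfolding n2_def using norm_triangle_ineq3[of "snd p" "snd q"] by (simp add: snd_diff)
 hence "tau q * T^2 <= tau p * S^2 + e * S * T" using n n2 by (simp add: nt)
 hence "tau q * T^2 / T^2 <= (tau p * S^2 + e * S * T) / T^2" by (intro divide_right_mono) auto
 hence "tau q <= tau p * (x * x) + e * x" using ST(2) by (simp add: x_def power2_eq_square add_divide_distrib)
 also have "... <= tau p * (x * x) + tau p * (e * x)" using mult_right_mono[OF tau_ge_1[OF p], of "e * x"] e x by simp
 also have "... = tau p * (x * (x + e))" by (simp add: algebra_simps)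
 also have "... <= tau p * ((1 + e) * (1 + 2 * e))"
  using x1 x e tau_ge_1[OF p] by (intro mult_left_mono mult_mono) auto
 also have "(1 + e) * (1 + 2 * e) <= 1 + 5 * e" using e mult_left_mono[of e 1 e] by (simp add: algebra_simps)
 finally show ?thesis using tau_ge_1[OF p] by (simp add: mult.commute mult_left_mono)
qed

section \<open>Cosets and the weighted count\<close>

context spectral
begin

definition cosets :: "(complex^2^2) set set set" where
 "cosets = (%ga. H #>\<^bsub>PSL2C\<^esub> ga) ` Ga"

definition rep :: "(complex^2^2) set set => (complex^2^2) set" where
 "rep C = (SOME ga. ga : Ga & C = H #>\<^bsub>PSL2C\<^esub> ga)"

lemma rep: "C : cosets ==> rep C : Ga & C = H #>\<^bsub>PSL2C\<^esub> rep C"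
 unfolding rep_def cosets_def by (rule someI_ex) blast

definition tq :: "(complex^2^2) set set => point => real" where
 "tq C q = tau (act (rep C) q)"

lemma tq_ge_1: "C : cosets ==> q : H3 ==> tq C q >= 1"
 unfolding tq_def by (intro tau_ge_1 act_H3 gc) (use rep in auto)

lemma tq_coset:
 assumes g: "ga : Ga" and q: "q : H3" shows "tq (H #>\<^bsub>PSL2C\<^esub> ga) q = tau (act ga q)" proof -
 let ?C = "H #>\<^bsub>PSL2C\<^esub> ga"
 have C: "?C : cosets" using g by (simp add: cosets_def)
 have "rep ?C : ?C" using rep[OF C] P.rcos_self[OF gc subH, of "rep ?C"] by auto
 then obtain h where h: "h : H" "rep ?C = h \<otimes>\<^bsub>PSL2C\<^esub> ga" by (auto simp: r_coset_def)
 have hs: "h : stab_plane" "h : carrier PSL2C" using h(1) by (auto simp: H_def' stab_plane_def)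
 show ?thesis unfolding tq_def h(2) act_mult[OF hs(2) gc[OF g] q]
  by (rule tau_invariant[OF hs(1) act_H3[OF gc[OF g] q]])
qed

lemma count_N_eq:
 assumes q: "q : H3" shows "count_N Ga q X = card {C : cosets. tq C q <= X}" proof -
 have "{plane_stab Ga #>\<^bsub>PSL2C\<^esub> ga |ga. ga : Ga & inverse (cos (angle (act ga q))) <= X} = {C : cosets. tq C q <= X}"
  unfolding H_def[symmetric] proof (intro equalityI subsetI)
  fix C assume "C : {H #>\<^bsub>PSL2C\<^esub> ga |ga. ga : Ga & inverse (cos (angle (act ga q))) <= X}"
  then obtain ga where g: "ga : Ga" "C = H #>\<^bsub>PSL2C\<^esub> ga" "inverse (cos (angle (act ga q))) <= X" by blast
  thus "C : {C : cosets. tq C q <= X}"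
  using tq_coset[OF g(1) q] cos_angle[OF act_H3[OF gc[OF g(1)] q]] by (simp add: cosets_def)
 next
  fix C assume "C : {C : cosets. tq C q <= X}"
  hence C: "C : cosets" "tq C q <= X" by auto
  have "rep C : Ga" "C = H #>\<^bsub>PSL2C\<^esub> rep C" using rep[OF C(1)] by auto
  moreover have "inverse (cos (angle (act (rep C) q))) <= X"
  using C(2) cos_angle[OF act_H3[OF gc[OF calculation(1)] q]] by (simp add: tq_def)
  ultimately show "C : {H #>\<^bsub>PSL2C\<^esub> ga |ga. ga : Ga & inverse (cos (angle (act ga q))) <= X}" by blast
 qed
 thus ?thesis by (simp add: count_N_def)
qed

text \<open>Splits a sum over the group into a sum over cosets of sums over \<open>H\<close>; each
  inner sum will unfold \<open>D\<close> to the whole plane.\<close>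

lemma H_cosets_bij: "bij_betw (%(h, C). h \<otimes>\<^bsub>PSL2C\<^esub> rep C) (H \<times> cosets) Ga" proof -
 have hc: "h : carrier PSL2C" "h : Ga" if "h : H" for h using that H_sub gc by auto
 have same: "H #>\<^bsub>PSL2C\<^esub> (h \<otimes>\<^bsub>PSL2C\<^esub> rep C) = C" if "h : H" "C : cosets" for h C
 proof -
  have "h \<otimes>\<^bsub>PSL2C\<^esub> rep C : H #>\<^bsub>PSL2C\<^esub> rep C" using that by (auto simp: r_coset_def)
  hence "H #>\<^bsub>PSL2C\<^esub> rep C = H #>\<^bsub>PSL2C\<^esub> (h \<otimes>\<^bsub>PSL2C\<^esub> rep C)"
  by (rule P.repr_independence[OF _ gc subH]) (use rep[OF that(2)] in simp)
  thus ?thesis using rep[OF that(2)] by simp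
 qed
 show ?thesis unfolding bij_betw_def proof
  show "inj_on (%(h, C). h \<otimes>\<^bsub>PSL2C\<^esub> rep C) (H \<times> cosets)" proof (rule inj_onI, clarify)
  fix h C h' C' assume a: "h : H" "C : cosets" "h' : H" "C' : cosets" "h \<otimes>\<^bsub>PSL2C\<^esub> rep C = h' \<otimes>\<^bsub>PSL2C\<^esub> rep C'"
  have CC: "C = C'" using same[OF a(1,2)] same[OF a(3,4)] a(5) by simp
  moreover have "h = h'" using a(5) hc(1)[OF a(1)] hc(1)[OF a(3)] gc rep[OF a(2)] by (simp add: CC)
  ultimately show "h = h' & C = C'" by simp
  qed
  show "(%(h, C). h \<otimes>\<^bsub>PSL2C\<^esub> rep C) ` (H \<times> cosets) = Ga" proof (intro equalityI subsetI)
  fix ga assume "ga : (%(h, C). h \<otimes>\<^bsub>PSL2C\<^esub> rep C) ` (H \<times> cosets)"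
  thus "ga : Ga" using hc rep by auto
  next
  fix ga assume g: "ga : Ga"
  let ?C = "H #>\<^bsub>PSL2C\<^esub> ga"
  have C: "?C : cosets" using g by (simp add: cosets_def)
  have "ga : H #>\<^bsub>PSL2C\<^esub> rep ?C" using rep[OF C] P.rcos_self[OF gc[OF g] subH] by auto
  then obtain h where "h : H" "ga = h \<otimes>\<^bsub>PSL2C\<^esub> rep ?C" by (auto simp: r_coset_def)
  thus "ga : (%(h, C). h \<otimes>\<^bsub>PSL2C\<^esub> rep C) ` (H \<times> cosets)" using C by (auto intro!: image_eqI[of _ _ "(h, ?C)"])
  qed
 qed
qed

lemma countable_cosets: "countable cosets" unfolding cosets_def using countable_Ga by simp

text \<open>For a fixed coset the sum over \<open>H\<close> turns the integral over \<open>D\<close>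
  into one over the plane, namely the area that the ball around \<open>act (rep C) q\<close> cuts
  out of the plane.\<close>

lemma PP_cosets:
 assumes q: "q : H3"
 shows "ennreal (PP W q) = (nn_integral (count_space cosets) (%C. ennreal (2 * pi * max 0 (W / tq C q - 1))))" proof -
 have DH: "z : H3" if "z : D" for z using that Dh(2) plane_H3 by blast
 define a where "a ga = (nn_integral MD (%z. indicator (hball (act ga q) W) z))" for ga
 have hm: "(indicator (hball r W) :: point => ennreal) : borel_measurable hv" if "r : H3" for r using that by simp
 have hmD: "(indicator (hball r W) :: point => ennreal) : borel_measurable MD" if "r : H3" for r
  by (rule hv_MD[OF hm[OF that]])
 have gq: "act ga q : H3" if "ga : Ga" for ga using act_H3[OF gc[OF that] q] .
 have "ennreal (PP W q) = (nn_integral MD (%z. ennreal (AK (indicator {..W}) z q)))" unfolding PP_def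
 proof (rule nn_integral_eq_integral[symmetric, OF AK_sym_integrable[OF kern_ind q]], rule AE_I2)
  fix z assume "z : space MD"
  hence "z : H3" using DH by simp
  from AK_eq[OF kern_ind this q, of W] show "0 <= AK (indicator {..W}) z q" by (simp add: sum_nonneg)
 qed
 also have "... = (nn_integral MD (%z. (nn_integral (count_space Ga) (%ga. indicator (hball (act ga q) W) z))))"
 proof (rule nn_integral_cong)
  fix z assume "z : space MD"
  hence z: "z : H3" using DH by simp
  let ?S = "{ga : Ga. wd z (act ga q) <= W}"
  have "AK (indicator {..W}) z q = real (card ?S)" unfolding AK_eq[OF kern_ind z q] by simp
  hence "ennreal (AK (indicator {..W}) z q) = emeasure (count_space Ga) ?S"
  using CB(1)[OF z q, of W] by (subst emeasure_count_space_finite) (auto simp: ennreal_of_nat_eq_real_of_nat)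
  also have "... = (nn_integral (count_space Ga) (%ga. indicator ?S ga))" by simp
  also have "... = (nn_integral (count_space Ga) (%ga. indicator (hball (act ga q) W) z))"
  by (rule nn_integral_cong) (use z in "auto simp: indicator_def hball_def wd_commute")
  finally show "ennreal (AK (indicator {..W}) z q) = (nn_integral (count_space Ga) (%ga. indicator (hball (act ga q) W) z))" .
 qed
 also have "... = (nn_integral (count_space Ga) (%ga. a ga))"
  unfolding a_def by (rule nn_integral_count_space_nn_integral[OF countable_Ga]) (rule hmD[OF gq])
 also have "... = (nn_integral (count_space (H \<times> cosets)) (%x. a (case x of (h, C) => h \<otimes>\<^bsub>PSL2C\<^esub> rep C)))"
  by (rule nn_integral_bij_count_space[OF H_cosets_bij, symmetric])
 also have "... = (nn_integral (count_space H \<Otimes>\<^sub>M count_space cosets) (%x. a (case x of (h, C) => h \<otimes>\<^bsub>PSL2C\<^esub> rep C)))"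
  by (simp add: pair_measure_countable[OF countable_H countable_cosets])
 also have "... = (nn_integral (count_space cosets) (%C. (nn_integral (count_space H) (%h. a (h \<otimes>\<^bsub>PSL2C\<^esub> rep C)))))"
 proof -
  interpret pair_sigma_finite "count_space H" "count_space cosets" unfolding pair_sigma_finite_def
  by (intro conjI sigma_finite_measure_count_space_countable countable_H countable_cosets)
  have "(%x. a (case x of (h, C) => h \<otimes>\<^bsub>PSL2C\<^esub> rep C)) : borel_measurable (count_space H \<Otimes>\<^sub>M count_space cosets)"
  by (simp add: pair_measure_countable[OF countable_H countable_cosets])
  from nn_integral_snd[OF this] show ?thesis by simp
 qed
 also have "... = (nn_integral (count_space cosets) (%C. ennreal (2 * pi * max 0 (W / tq C q - 1))))"
 proof (rule nn_integral_cong)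
  fix C assume "C : space (count_space cosets)"
  hence C: "C : cosets" by simp
  have gC: "rep C : Ga" using rep[OF C] by simp
  define r where "r = act (rep C) q"
  have r: "r : H3" unfolding r_def by (rule gq[OF gC])
  define b where "b h = (nn_integral MD (%z. indicator (hball r W) (act h z)))" for h
  have bi: "bij_betw (%h. ginv h) H H" by (rule bij_betwI[where g = "%h. ginv h"])
  (use subgroup.m_inv_closed[OF subH] gc H_sub in auto)
  have ab: "a (h \<otimes>\<^bsub>PSL2C\<^esub> rep C) = b (ginv h)" if h: "h : H" for h proof -
  have hc: "h : carrier PSL2C" "ginv h : carrier PSL2C" using h H_sub gc by auto
  have e: "act (h \<otimes>\<^bsub>PSL2C\<^esub> rep C) q = act h r" unfolding r_def by (rule act_mult[OF hc(1) gc[OF gC] q])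
  have "indicator (hball (act h r) W) z = (indicator (hball r W) (act (ginv h) z) :: ennreal)" if "z : D" for z
  proof -
  have "wd r (act (ginv h) z) = wd (act h r) (act h (act (ginv h) z))"
  by (rule act_wd[OF hc(1) r act_H3[OF hc(2) DH[OF that]], symmetric])
  also have "act h (act (ginv h) z) = z" by (rule act_inv(2)[OF hc(1) DH[OF that]])
  finally show ?thesis using DH[OF that] act_H3[OF hc(2) DH[OF that]] by (simp add: hball_def indicator_def)
  qed
  thus ?thesis unfolding a_def b_def e by (intro nn_integral_cong) simp
  qed
  have "(nn_integral (count_space H) (%h. a (h \<otimes>\<^bsub>PSL2C\<^esub> rep C))) = (nn_integral (count_space H) (%h. b (ginv h)))"
  by (rule nn_integral_cong) (simp add: ab)
  also have "... = (nn_integral (count_space H) (%h. b h))" by (rule nn_integral_bij_count_space[OF bi])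
  also have "... = (nn_integral MD (%z. (nn_integral (count_space H) (%h. indicator (hball r W) (act h z)))))"
  unfolding b_def proof (rule nn_integral_count_space_nn_integral[OF countable_H, symmetric])
  fix h assume "h : H"
  from measurable_compose[OF act_hv_meas(1) hm[OF r]] this H_sub
  show "(%z. indicator (hball r W) (act h z) :: ennreal) : borel_measurable MD" by (intro hv_MD) blast
  qed
  also have "... = (nn_integral har (%z. indicator (hball r W) z))"
  by (rule nn_unfold_D) (use measurable_compose[OF id_har_hv hm[OF r]] in simp)
  also have "... = (nn_integral har (%z. indicator (hball r W \<inter> plane) z))"
  by (rule nn_integral_cong) (simp add: indicator_def)
  also have "... = emeasure har (hball r W \<inter> plane)"
  using hball_borel[OF r, of W] by (intro nn_integral_indicator) (simp add: in_sets_har)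
  also have "... = ennreal (2 * pi * max 0 (W / tau r - 1))" by (rule emeasure_har_hball[OF r])
  finally show "(nn_integral (count_space H) (%h. a (h \<otimes>\<^bsub>PSL2C\<^esub> rep C))) = ennreal (2 * pi * max 0 (W / tq C q - 1))"
  by (simp add: tq_def r_def)
 qed
 finally show ?thesis .
qed

text \<open>Doubling the radius makes \<open>2 W / tq C q - 1 \<ge> 1\<close>, so each counted coset
  contributes at least \<open>2 \<pi>\<close> to \<open>PP (2 * W) q\<close>. Finiteness of the
  count is read off from that of \<open>PP\<close>.\<close>

lemma finite_tq:
 assumes q: "q : H3"
 shows "finite {C : cosets. tq C q <= W}" "2 * pi * real (card {C : cosets. tq C q <= W}) <= PP (2 * W) q" proof -
 let ?S = "{C : cosets. tq C q <= W}"
 have "ennreal (2 * pi) * emeasure (count_space cosets) ?S = (nn_integral (count_space cosets) (%C. ennreal (2 * pi) * indicator ?S C))"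
  by (rule nn_integral_cmult_indicator[symmetric]) auto
 also have "... <= (nn_integral (count_space cosets) (%C. ennreal (2 * pi * max 0 (2 * W / tq C q - 1))))"
 proof (rule nn_integral_mono)
  fix C assume "C : space (count_space cosets)"
  hence t1: "tq C q >= 1" using tq_ge_1[OF _ q] by simp
  show "ennreal (2 * pi) * indicator ?S C <= ennreal (2 * pi * max 0 (2 * W / tq C q - 1))" proof (cases "C : ?S")
  case True
  hence "2 * W / tq C q >= 2" using t1 by (simp add: field_simps)
  thus ?thesis using True by (simp add: ennreal_leI)
  qed simp
 qed
 also have "... = ennreal (PP (2 * W) q)" by (rule PP_cosets[OF q, symmetric])
 finally have le: "ennreal (2 * pi) * emeasure (count_space cosets) ?S <= ennreal (PP (2 * W) q)" .
 show fin: "finite ?S" proof (rule ccontr)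
  assume "infinite ?S"
  hence "emeasure (count_space cosets) ?S = \<infinity>" by (intro emeasure_count_space_infinite) auto
  hence "ennreal (2 * pi) * emeasure (count_space cosets) ?S = \<infinity>" by (simp add: ennreal_mult_top)
  thus False using le by (simp add: top_unique)
 qed
 have "ennreal (2 * pi * real (card ?S)) <= ennreal (PP (2 * W) q)"
  using le fin by (simp add: emeasure_count_space_finite ennreal_of_nat_eq_real_of_nat ennreal_mult)
 thus "2 * pi * real (card ?S) <= PP (2 * W) q" using PP_bounds[OF q, of "2 * W"] by (simp add: ennreal_le_iff)
qed

lemma PP_sum:
 assumes q: "q : H3" and W: "W <= W'"
 shows "PP W q = (SUM C:{C : cosets. tq C q <= W'}. 2 * pi * max 0 (W / tq C q - 1))" proof -
 let ?S = "{C : cosets. tq C q <= W'}"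
 have fin: "finite ?S" by (rule finite_tq(1)[OF q])
 have "ennreal (PP W q) = (nn_integral (count_space cosets) (%C. ennreal (2 * pi * max 0 (W / tq C q - 1)) * indicator ?S C))"
  unfolding PP_cosets[OF q] proof (rule nn_integral_cong)
  fix C assume C: "C : space (count_space cosets)"
  hence t1: "tq C q >= 1" using tq_ge_1[OF _ q] by simp
  show "ennreal (2 * pi * max 0 (W / tq C q - 1)) = ennreal (2 * pi * max 0 (W / tq C q - 1)) * indicator ?S C"
  proof (cases "C : ?S")
  case False
  hence "W / tq C q <= 1" using C t1 W by simp
  thus ?thesis by (simp add: max_def)
  qed simp
 qed
 also have "... = (SUM C:?S. ennreal (2 * pi * max 0 (W / tq C q - 1)) * indicator ?S C)"
  by (rule nn_integral_count_space'[OF fin]) auto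
 also have "... = (SUM C:?S. ennreal (2 * pi * max 0 (W / tq C q - 1)))" by (rule sum.cong[OF refl]) simp
 also have "... = ennreal (SUM C:?S. 2 * pi * max 0 (W / tq C q - 1))" by (rule sum_ennreal) simp
 finally show ?thesis using PP_bounds[OF q, of W] by (subst (asm) ennreal_inj) (auto intro!: sum_nonneg)
qed

text \<open>Only cosets with \<open>tq C q \<le> 2\<close> can contribute, each at most
  \<open>2 \<pi> th\<close> because \<open>tq \<ge> 1\<close>, and their number is bounded through
  \<open>PP 4\<close>. The factor \<open>th\<close> saves two powers of \<open>et\<close> in
  \<open>period_bessel\<close>.\<close>

lemma PP_small:
 assumes q: "q : H3" and th: "0 <= th" "th <= 1" shows "PP (1 + th) q <= th * (CB 4 * area)" proof -
 have "PP (1 + th) q = (SUM C:{C : cosets. tq C q <= 2}. 2 * pi * max 0 ((1 + th) / tq C q - 1))"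
  by (rule PP_sum[OF q]) (use th in simp)
 also have "... <= (SUM C:{C : cosets. tq C q <= 2}. 2 * pi * th)" proof (rule sum_mono)
  fix C assume "C : {C : cosets. tq C q <= 2}"
  hence "tq C q >= 1" using tq_ge_1[OF _ q] by simp
  hence "(1 + th) / tq C q <= (1 + th) / 1" using th by (intro divide_left_mono) auto
  thus "2 * pi * max 0 ((1 + th) / tq C q - 1) <= 2 * pi * th" using th by simp
 qed
 also have "... = th * (2 * pi * real (card {C : cosets. tq C q <= 2}))" by simp
 also have "... <= th * PP 4 q" using finite_tq(2)[OF q, of 2] th by (intro mult_left_mono) auto
 also have "... <= th * (CB 4 * area)" using PP_bounds[OF q, of 4] th by (intro mult_left_mono) auto
 finally show ?thesis .
qed

text \<open>The coefficients \<open>a = Y / de\<close> and \<open>b = - (Y / de + 1)\<close> solve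
  \<open>a ((Y + de) / t - 1) + b (Y / t - 1) = 1\<close> for every \<open>t\<close>: the terms in
  \<open>1 / t\<close> cancel and \<open>- a - b = 1\<close>.\<close>

definition NN :: "real => real => point => real" where
 "NN Y de q = (Y / de * PP (Y + de) q - (Y / de + 1) * PP Y q) / (2 * pi)"

text \<open>The two balls combine to a weight that is \<open>1\<close> for \<open>tq C q <= Y\<close>, decreases, and vanishes
 for \<open>tq C q >= Y + de\<close>.\<close>

lemma NN_bounds:
 assumes q: "q : H3" and Y: "Y > 0" and d: "de > 0"
 shows "real (count_N Ga q Y) <= NN Y de q" "NN Y de q <= real (count_N Ga q (Y + de))" proof -
 let ?S = "{C : cosets. tq C q <= Y + de}"
 define \<Omega> where "\<Omega> t = Y / de * max 0 ((Y + de) / t - 1) - (Y / de + 1) * max 0 (Y / t - 1)" for t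
 have fin: "finite ?S" by (rule finite_tq(1)[OF q])
 have NN: "NN Y de q = (SUM C:?S. \<Omega> (tq C q))" proof -
  have "Y / de * PP (Y + de) q - (Y / de + 1) * PP Y q = (SUM C:?S. 2 * pi * \<Omega> (tq C q))" proof -
  have le: "Y <= Y + de" using d by simp
  show ?thesis unfolding PP_sum[OF q le] PP_sum[OF q order_refl, of "Y + de"]
  unfolding sum_distrib_left sum_subtractf[symmetric]
  by (rule sum.cong[OF refl]) (simp add: \<Omega>_def algebra_simps)
  qed
  thus ?thesis unfolding NN_def by (simp add: sum_distrib_left[symmetric])
 qed
 have O1: "\<Omega> t = 1" if t: "t >= 1" "t <= Y" for t proof -
  have "(Y + de) / t - 1 >= 0" "Y / t - 1 >= 0" using t d by auto
  hence "\<Omega> t = Y / de * ((Y + de) / t - 1) - (Y / de + 1) * (Y / t - 1)" by (simp add: \<Omega>_def)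
  also have "... = 1" using t d by (simp add: field_simps)
  finally show ?thesis .
 qed
 \<comment> \<open>In this range only the larger ball contributes, and the weight is a product of
   two factors in \<open>[0, 1]\<close>.\<close>
 have O2: "0 <= \<Omega> t & \<Omega> t <= 1" if t: "t >= 1" "Y < t" "t <= Y + de" for t proof -
  have "(Y + de) / t - 1 >= 0" "Y / t - 1 <= 0" using t d Y by auto
  hence e: "\<Omega> t = Y / t * ((Y + de - t) / de)" using t d by (simp add: \<Omega>_def field_simps)
  have "0 <= Y / t" "Y / t <= 1" "0 <= (Y + de - t) / de" "(Y + de - t) / de <= 1" using t d Y by auto
  thus ?thesis unfolding e by (intro conjI mult_nonneg_nonneg mult_le_one)
 qed
 have t1: "tq C q >= 1" if "C : ?S" for C using that tq_ge_1[OF _ q] by simp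
 have "real (card {C : cosets. tq C q <= Y}) = (SUM C:{C : cosets. tq C q <= Y}. 1)" by simp
 also have "... = (SUM C:{C : cosets. tq C q <= Y}. \<Omega> (tq C q))"
  by (rule sum.cong) (use O1 tq_ge_1[OF _ q] in auto)
 also have "... <= (SUM C:?S. \<Omega> (tq C q))" proof (rule sum_mono2[OF fin])
  show "0 <= \<Omega> (tq C q)" if "C : ?S - {C : cosets. tq C q <= Y}" for C
  using O2[of "tq C q"] that t1[of C] by auto
 qed (use d in auto)
 finally show "real (count_N Ga q Y) <= NN Y de q" unfolding NN count_N_eq[OF q] .
 have "(SUM C:?S. \<Omega> (tq C q)) <= (SUM C:?S. 1)" proof (rule sum_mono)
  fix C assume C: "C : ?S"
  show "\<Omega> (tq C q) <= 1" using O1[OF t1[OF C]] O2[OF t1[OF C]] C by (cases "tq C q <= Y") auto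
 qed
 thus "NN Y de q <= real (count_N Ga q (Y + de))" unfolding NN count_N_eq[OF q] by simp
qed

lemma count_N_mono: "q : H3 ==> X <= X' ==> count_N Ga q X <= count_N Ga q X'"
 unfolding count_N_eq by (rule card_mono[OF finite_tq(1)]) auto

lemma count_N_close:
 assumes p: "p : H3" and q: "q : H3" and e: "0 < e" "e <= 1" and w: "wd p q <= 1 + e^2 / 2"
 shows "count_N Ga p X <= count_N Ga q ((1 + 5 * e) * X)" unfolding count_N_eq[OF p] count_N_eq[OF q]
proof (rule card_mono[OF finite_tq(1)[OF q]], rule subsetI)
 fix C assume "C : {C : cosets. tq C p <= X}"
 hence C: "C : cosets" "tq C p <= X" by auto
 have g: "rep C : carrier PSL2C" using rep[OF C(1)] gc by blast
 have "tq C q <= (1 + 5 * e) * tq C p"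
  unfolding tq_def by (rule tau_close[OF act_H3[OF g p] act_H3[OF g q] e]) (simp add: act_wd[OF g p q] w)
 also have "... <= (1 + 5 * e) * X" using C e by (intro mult_left_mono) auto
 finally show "C : {C : cosets. tq C q <= (1 + 5 * e) * X}" using C by simp
qed

end

section \<open>The spectral weights\<close>

text \<open>\<open>GG\<close> and \<open>HH\<close> are the factors of the periods in the spectral
  coefficients of \<open>PP / (2 \<pi>)\<close> and of \<open>NN\<close>, see
  \<open>NN_coeff\<close>. Radii are given by their hyperbolic cosines.\<close>

definition GG :: "real => real => real" where
 "GG l Y = mm l (arcosh Y) / (2 * pi)"

definition HH :: "real => real => real => real" where
 "HH l Y de = Y / de * GG l (Y + de) - (Y / de + 1) * GG l Y"

text \<open>With \<open>l = s (2 - s)\<close> this is \<open>2\<^sup>s\<^sup>-\<^sup>1 Y\<^sup>s / s\<close>.\<close>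
definition mj :: "real => real => real" where
 "mj l Y = (if l < 1 then 2 powr sqrt (1 - l) / (1 + sqrt (1 - l)) * Y powr (1 + sqrt (1 - l)) else 0)"

definition hh :: "real => real => real" where
 "hh l et = mm l et / hvol et"

lemma arcosh_pos: "y > 1 ==> arcosh y > (0::real)"
 by (metis arcosh_1 arcosh_less_iff_real order_refl less_eq_real_def)

lemma GG_alt: "GG l Y = 2 * integral {0..arcosh Y} (%s. Sf l s * sinh s)" by (simp add: GG_def mm_def)

lemma GG_deriv: "y > 1 ==> (GG l has_real_derivative 2 * Sf l (arcosh y)) (at y)" proof -
 assume y: "y > 1"
 have s: "sqrt (y^2 - 1) > 0" using sq_gt_1[OF y] by simp
 have "((%r. 2 * integral {0..r} (%s. Sf l s * sinh s)) has_real_derivative 2 * (Sf l (arcosh y) * sinh (arcosh y))) (at (arcosh y))"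
  by (intro DERIV_cmult DERIV_integral_upper continuous_intros arcosh_pos[OF y])
 from DERIV_chain2[OF this arcosh_real_has_field_derivative[OF y]]
 have "((%y. 2 * integral {0..arcosh y} (%s. Sf l s * sinh s)) has_real_derivative
  2 * (Sf l (arcosh y) * sinh (arcosh y)) * (1 / sqrt (y^2 - 1))) (at y)" .
 moreover have "2 * (Sf l (arcosh y) * sinh (arcosh y)) * (1 / sqrt (y^2 - 1)) = 2 * Sf l (arcosh y)" proof -
  have "sinh (arcosh y) = sqrt (y^2 - 1)" using y by (simp add: sinh_arcosh_real)
  thus ?thesis using s by (simp only:) (simp add: field_simps)
 qed
 ultimately show ?thesis by (simp add: GG_alt[abs_def])
qed

lemma Cf_over_sinh:
 assumes l: "l >= 0" and y: "y >= 11/10" shows "\<bar>Cf l (arcosh y) / sqrt (y^2 - 1)\<bar> <= 3" proof -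
 have y1: "y > 1" using y by simp
 have c: "\<bar>Cf l (arcosh y)\<bar> <= y" using Cf_le_cosh[OF l, of "arcosh y"] arcosh_pos[OF y1] y1 by simp
 have "(11/10)^2 <= y^2" using y by (intro power_mono) auto
 hence "y^2 <= 9 * (y^2 - 1)" by (simp add: power2_eq_square)
 hence "sqrt (y^2) <= sqrt (3^2 * (y^2 - 1))" by (intro real_sqrt_le_mono) simp
 hence "y <= 3 * sqrt (y^2 - 1)" using y1 unfolding real_sqrt_mult by simp
 hence "\<bar>Cf l (arcosh y)\<bar> <= 3 * sqrt (y^2 - 1)" using c by linarith
 moreover have "sqrt (y^2 - 1) > 0" using sq_gt_1[OF y1] by simp
 ultimately show ?thesis by (simp add: abs_divide divide_le_eq)
qed

lemma Sf_arcosh_deriv: "y > 1 ==> ((%y. Sf l (arcosh y)) has_real_derivative Cf l (arcosh y) / sqrt (y^2 - 1)) (at y)"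
 using DERIV_chain2[OF DERIV_Sf arcosh_real_has_field_derivative, of y l] by simp

text \<open>The divided difference is replaced by the derivative \<open>2 Sf l (arcosh Y)\<close>,
  with an error governed by the second derivative. The restriction to \<open>Y \<ge> 11/10\<close>
  keeps \<open>sqrt (Y^2 - 1)\<close> away from zero.\<close>

lemma GG_increment:
 assumes l: "l >= 0" and Y: "Y >= 11/10" and d: "de > 0"
 shows "\<bar>Y / de * (GG l (Y + de) - GG l Y) - 2 * Y * Sf l (arcosh Y)\<bar> <= 6 * Y * de" proof -
 obtain z where z: "Y < z" "z < Y + de" "GG l (Y + de) - GG l Y = (Y + de - Y) * (2 * Sf l (arcosh z))"
  using MVT2[of Y "Y + de" "GG l" "%y. 2 * Sf l (arcosh y)"] GG_deriv Y d by force
 obtain x where x: "Y < x" "x < z" "Sf l (arcosh z) - Sf l (arcosh Y) = (z - Y) * (Cf l (arcosh x) / sqrt (x^2 - 1))"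
  using MVT2[of Y z "%y. Sf l (arcosh y)" "%x. Cf l (arcosh x) / sqrt (x^2 - 1)"] Sf_arcosh_deriv Y z(1) by force
 have "\<bar>Sf l (arcosh z) - Sf l (arcosh Y)\<bar> <= de * 3"
  unfolding x(3) abs_mult using Cf_over_sinh[OF l, of x] x z Y by (intro mult_mono) auto
 moreover have "Y / de * (GG l (Y + de) - GG l Y) - 2 * Y * Sf l (arcosh Y) = 2 * Y * (Sf l (arcosh z) - Sf l (arcosh Y))"
  unfolding z(3) using d by (simp add: field_simps)
 ultimately show ?thesis using Y by (simp add: abs_mult)
qed

lemma int_by_parts:
 assumes R: "R >= 0"
 shows "((%s. cosh s * Cf l s) has_integral (cosh R * Sf l R - integral {0..R} (%s. Sf l s * sinh s))) {0..R}" proof -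
 have "((%s. sinh s * Sf l s + Cf l s * cosh s) has_integral (cosh R * Sf l R - cosh 0 * Sf l 0)) {0..R}"
 proof (rule ftc[OF R])
  fix x
  have "((%s. cosh s * Sf l s) has_real_derivative sinh x * Sf l x + Cf l x * cosh x) (at x)"
  by (rule DERIV_cong[OF DERIV_mult[OF _ DERIV_Sf, of cosh "sinh x"]]) (auto intro!: derivative_eq_intros)
  thus "((%s. cosh s * Sf l s) has_vector_derivative sinh x * Sf l x + Cf l x * cosh x) (at x within {0..R})"
  by (simp add: real_vector_deriv has_vector_derivative_at_within)
 qed
 from has_integral_diff[OF this integrable_integral[OF Sf_sinh_integrable[of l]]]
 show ?thesis by (simp add: algebra_simps)
qed

lemma integral_cosh_scaled:
 fixes b R :: real assumes "b ~= 0" "R >= 0" shows "((%s. cosh (b * s)) has_integral (sinh (b * R) / b)) {0..R}"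
proof -
 have "((%s. cosh (b * s)) has_integral (sinh (b * R) / b - sinh (b * 0) / b)) {0..R}" proof (rule ftc[OF assms(2)])
  fix x
  have "((%s. sinh (b * s) / b) has_real_derivative cosh (b * x)) (at x)"
  using assms by (auto intro!: derivative_eq_intros)
  thus "((%s. sinh (b * s) / b) has_vector_derivative cosh (b * x)) (at x within {0..R})"
  by (simp add: real_vector_deriv has_vector_derivative_at_within)
 qed
 thus ?thesis by simp
qed

text \<open>\<open>sinh (s R)\<close> is \<open>exp (s R) / 2\<close> up to 1/2, and
  \<open>exp R\<close> differs from \<open>2 cosh R\<close> by at most 1; the mean value theorem
  bounds the effect on the power \<open>s \<le> 2\<close>.\<close>

lemma sinh_exp_approx:
 fixes s R :: real assumes s: "1 <= s" "s <= 2" and R: "R >= 0"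
 shows "\<bar>sinh (s * R) - (2 * cosh R) powr s / 2\<bar> <= 2 * cosh R + 1 / 2" proof -
 have e: "exp (- R) <= 1" using R by simp
 have c: "2 * cosh R = exp R + exp (- R)" by (simp add: cosh_def)
 have c2: "2 * cosh R > 0" using cosh_real_pos[of R] by linarith
 have er: "exp (s * R) = exp R powr s" by (simp add: powr_def mult.commute)
 have "exp R powr s <= (2 * cosh R) powr s" using s c by (intro powr_mono2) auto
 moreover have "(2 * cosh R) powr s - exp R powr s <= 4 * cosh R" proof -
  have "\<exists>z. exp R < z & z < 2 * cosh R & (2 * cosh R) powr s - exp R powr s = (2 * cosh R - exp R) * (s * z powr (s - 1))"
  by (rule MVT2) (auto simp: c intro!: has_real_derivative_powr less_trans[OF exp_gt_zero] less_le_trans[OF exp_gt_zero])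
  then obtain z where z: "exp R < z" "z < 2 * cosh R" "(2 * cosh R) powr s - exp R powr s = (2 * cosh R - exp R) * (s * z powr (s - 1))" by blast
  have z1: "z >= 1" using z(1) R one_le_exp_iff[of R] by linarith
  have "z powr (s - 1) <= z powr 1" using s z1 by (intro powr_mono) auto
  hence sz: "s * z powr (s - 1) <= 2 * z" using s z1 by (intro mult_mono) auto
  have "(2 * cosh R - exp R) * (s * z powr (s - 1)) <= 1 * (2 * z)" by (rule mult_mono) (use sz e c s z1 in auto)
  thus ?thesis using z by simp
 qed
 moreover have "sinh (s * R) = exp R powr s / 2 - exp (- (s * R)) / 2" by (simp add: sinh_def er diff_divide_distrib)
 moreover have "0 <= exp (- (s * R))" "exp (- (s * R)) <= 1" using s R by auto
 ultimately show ?thesis by linarith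
qed

text \<open>By parts, \<open>2 Y Sf - GG\<close> is the integral of \<open>2 cosh s Cf l s\<close>.
  For \<open>l < 1\<close> this splits into two hyperbolic cosines: the faster one gives
  \<open>mj\<close>, the slower one is \<open>O(Y)\<close>, uniformly also as \<open>l\<close> tends
  to 1. For \<open>l \<ge> 1\<close> everything is \<open>O(Y)\<close>.\<close>

lemma H0_bound:
 assumes l: "l >= 0" and Y: "Y >= 1" shows "\<bar>2 * Y * Sf l (arcosh Y) - GG l Y - mj l Y\<bar> <= 4 * Y" proof -
 define R where "R = arcosh Y"
 have R: "R >= 0" "cosh R = Y" using Y by (auto simp: R_def)
 have shR: "sinh R <= Y" using R(2) cosh_square_eq[of R] by (smt (verit) sinh_less_cosh_real)
 have hi: "((%s. 2 * (cosh s * Cf l s)) has_integral (2 * Y * Sf l R - GG l Y)) {0..R}"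
  using has_integral_mult_right[OF int_by_parts[OF R(1), of l], of 2] R by (simp add: GG_alt R_def algebra_simps)
 have ic: "(cosh has_integral sinh R) {0..R}" using integral_cosh_scaled[of 1 R] R by simp
 show ?thesis proof (cases "l < 1")
  case False
  have "norm (2 * Y * Sf l R - GG l Y) <= integral {0..R} (%s. 2 * cosh s)"
  unfolding integral_unique[OF hi, symmetric] proof (rule integral_norm_bound_integral)
  show "(%s. 2 * (cosh s * Cf l s)) integrable_on {0..R}" using hi by blast
  show "(%s. 2 * cosh s) integrable_on {0..R}" using has_integral_mult_right[OF ic, of 2] by blast
  fix s
  have "\<bar>Cf l s\<bar> <= 1" using False by (simp add: Cf_def)
  thus "norm (2 * (cosh s * Cf l s)) <= 2 * cosh s" by (simp add: abs_mult)
  qed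
  also have "... = 2 * sinh R" by (rule integral_unique[OF has_integral_mult_right[OF ic, of 2]])
  finally show ?thesis using False shR Y by (simp add: mj_def R_def)
 next
  case True
  define a where "a = sqrt (1 - l)"
  have a: "0 < a" "a <= 1" using True l by (auto simp: a_def)
  have e: "2 * (cosh s * Cf l s) = cosh ((1 + a) * s) + cosh ((1 - a) * s)" for s
  using True by (simp add: Cf_def a_def[symmetric] distrib_right left_diff_distrib cosh_add cosh_diff)
  have i1: "((%s. cosh ((1 + a) * s)) has_integral (sinh ((1 + a) * R) / (1 + a))) {0..R}"
  by (rule integral_cosh_scaled) (use a R in auto)
  have i2: "((%s. cosh ((1 - a) * s)) has_integral (2 * Y * Sf l R - GG l Y - sinh ((1 + a) * R) / (1 + a))) {0..R}"
  using has_integral_diff[OF hi i1] unfolding e by simp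
  have "0 <= 2 * Y * Sf l R - GG l Y - sinh ((1 + a) * R) / (1 + a)" by (rule has_integral_nonneg[OF i2]) simp
  moreover have "2 * Y * Sf l R - GG l Y - sinh ((1 + a) * R) / (1 + a) <= sinh R"
  proof (rule has_integral_le[OF i2 ic])
  fix s assume s: "s : {0..R}"
  have "(1 - a) * s <= 1 * s" using a s by (intro mult_right_mono) auto
  thus "cosh ((1 - a) * s) <= cosh s" using a s by (simp add: cosh_real_nonneg_le_iff)
  qed
  moreover have "\<bar>sinh ((1 + a) * R) / (1 + a) - mj l Y\<bar> <= 2 * Y + 1 / 2" proof -
  have "mj l Y = (2 * Y) powr (1 + a) / 2 / (1 + a)"
  using True Y by (simp add: mj_def a_def[symmetric] powr_mult powr_add)
  hence "sinh ((1 + a) * R) / (1 + a) - mj l Y = (sinh ((1 + a) * R) - (2 * cosh R) powr (1 + a) / 2) / (1 + a)"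
  by (simp add: R diff_divide_distrib)
  also have "\<bar>...\<bar> <= \<bar>sinh ((1 + a) * R) - (2 * cosh R) powr (1 + a) / 2\<bar> / 1"
  unfolding abs_divide using a by (intro divide_left_mono) auto
  also have "... <= 2 * Y + 1 / 2" using sinh_exp_approx[of "1 + a" R] a R by simp
  finally show ?thesis .
  qed
  ultimately show ?thesis using shR Y unfolding R_def[symmetric] by linarith
 qed
qed

lemma HH_small:
 assumes l: "l >= 0" and Y: "Y >= 11/10" and d: "de > 0" shows "\<bar>HH l Y de - mj l Y\<bar> <= 4 * Y + 6 * Y * de"
proof -
 have "HH l Y de = Y / de * (GG l (Y + de) - GG l Y) - GG l Y" by (simp add: HH_def algebra_simps)
 thus ?thesis using GG_increment[OF assms] H0_bound[OF l, of Y] Y by linarith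
qed

lemma mj_nonneg: "mj l Y >= 0" and mj_le: "l >= 0 ==> Y >= 1 ==> mj l Y <= 2 * Y^2" proof -
 show "mj l Y >= 0" by (simp add: mj_def)
 assume l: "l >= 0" and Y: "Y >= 1"
 show "mj l Y <= 2 * Y^2" proof (cases "l < 1")
  case True
  define a where "a = sqrt (1 - l)"
  have a: "0 < a" "a <= 1" using True l by (auto simp: a_def)
  have "2 powr a / (1 + a) <= 2 powr 1 / 1" using a by (intro frac_le powr_mono) auto
  moreover have "Y powr (1 + a) <= Y powr 2" using a Y by (intro powr_mono) auto
  ultimately have "2 powr a / (1 + a) * Y powr (1 + a) <= (2 powr 1 / 1) * Y powr 2" by (intro mult_mono) auto
  thus ?thesis using True Y by (simp add: mj_def a_def[symmetric] powr_numeral)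
 qed (simp add: mj_def)
qed

lemma mj_diff:
 assumes l: "l >= 0" and x: "1 <= x" "x <= M" "1 <= Y" "Y <= M"
 shows "\<bar>mj l Y - mj l x\<bar> <= 2 * M * \<bar>Y - x\<bar>" proof -
 have main: "\<bar>mj l Y - mj l x\<bar> <= 2 * M * \<bar>Y - x\<bar>" if xY: "1 <= x" "x < Y" "Y <= M" for x Y
 proof (cases "l < 1")
  case True
  define a where "a = sqrt (1 - l)"
  have a: "0 < a" "a <= 1" using True l by (auto simp: a_def)
  have "\<exists>z. x < z & z < Y & mj l Y - mj l x = (Y - x) * (2 powr a * z powr a)" proof (rule MVT2[OF xY(2)])
  fix z assume "x <= z" "z <= Y"
  hence z: "z > 0" using xY by simp
  have "mj l = (%Y. 2 powr a / (1 + a) * Y powr (1 + a))" using True by (simp add: mj_def a_def fun_eq_iff)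
  thus "(mj l has_real_derivative 2 powr a * z powr a) (at z)"
  using DERIV_cmult[OF has_real_derivative_powr[OF z, of "1 + a"], of "2 powr a / (1 + a)"] a by simp
  qed
  then obtain z where z: "x < z" "z < Y" "mj l Y - mj l x = (Y - x) * (2 powr a * z powr a)" by blast
  have "2 powr a <= 2 powr 1" by (rule powr_mono) (use a in auto)
  moreover have "z powr a <= z powr 1" by (rule powr_mono) (use a z xY in auto)
  ultimately have "2 powr a * z powr a <= 2 * M" using z xY by (intro mult_mono) auto
  thus ?thesis using xY unfolding z(3) abs_mult by (simp add: mult.commute mult_right_mono)
 qed (use xY in "simp add: mj_def")
 consider "x < Y" | "Y < x" | "x = Y" by linarith
 thus ?thesis proof cases
  case 1 thus ?thesis using main[of x Y] x by simp
 next
  case 2 thus ?thesis using main[of Y x] x by (simp add: abs_minus_commute)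
 qed simp
qed

lemma hh_abs_le: "l >= 0 ==> et > 0 ==> \<bar>hh l et\<bar> <= 1"
 using mm_abs_le[of l et] hvol_pos[of et] by (simp add: hh_def abs_divide divide_le_eq)

lemma cosh_le_quad: "0 <= x ==> x <= 1 ==> cosh x <= 1 + (x::real)^2" proof -
 assume x: "0 <= x" "x <= (1::real)"
 have "exp x <= 1 + x + x^2" by (rule exp_bound) (use x in auto)
 moreover have "exp (- x) <= 1 / (1 + x + x^2 / 2)"
  using exp_lower_Taylor_quadratic[of x] x by (simp add: exp_minus inverse_eq_divide frac_le add_pos_nonneg)
 moreover have "1 / (1 + x + x^2 / 2) <= 1 - x + x^2" proof -
  have "1 <= (1 - x + x^2) * (1 + x + x^2 / 2)" proof -
  have "(1 - x + x^2) * (1 + x + x^2 / 2) = 1 + x^2 / 2 * (1 + x + x^2)" by (simp add: field_simps power2_eq_square)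
  thus ?thesis using x by simp
  qed
  thus ?thesis using x by (simp add: divide_le_eq add_pos_nonneg)
 qed
 ultimately show ?thesis by (simp add: cosh_def)
qed

lemma sinh_ge_self: "x >= 0 ==> x <= sinh (x::real)"
 by (rule mono_from_deriv[of "%x. x" "%_. 1" sinh cosh]) (auto intro!: derivative_eq_intros simp: cosh_real_ge_1)

lemma sinh_le_cubic: "0 <= x ==> x <= 1 ==> sinh x <= x + (x::real) ^ 3" proof -
 assume x: "0 <= x" "x <= (1::real)"
 have "(0 + 0 ^ 3) - sinh 0 <= (x + x ^ 3) - sinh x" proof (rule DERIV_nonneg_imp_nondecreasing[OF x(1)])
  fix y assume y: "0 <= y" "y <= x"
  have "((%x. (x + x ^ 3) - sinh x) has_real_derivative 1 + 3 * y^2 - cosh y) (at y)"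
  by (auto intro!: derivative_eq_intros)
  moreover have "0 <= 1 + 3 * y^2 - cosh y" using cosh_le_quad[of y] x y zero_le_power2[of y] by linarith
  ultimately show "\<exists>z. ((%x. (x + x ^ 3) - sinh x) has_real_derivative z) (at y) & 0 <= z" by blast
 qed
 thus ?thesis by simp
qed

lemma Sf_ge_self: "l <= 1 ==> s >= 0 ==> s <= Sf l s"
 by (rule mono_from_deriv[OF DERIV_ident DERIV_Sf]) (auto simp: Cf_def cosh_real_ge_1)

text \<open>For \<open>l \<le> 1\<close> one has \<open>s \<le> Sf l s \<le> sinh s\<close>, and
  \<open>sinh s\<close> exceeds \<open>s\<close> by a factor \<open>1 + O(et^2)\<close> only. So the
  smoothing at \<open>p\<close> hardly changes the terms of the small eigenvalues.\<close>

lemma hh_near_1: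
 assumes l: "0 <= l" "l <= 1" and e: "0 < et" "et <= 1" shows "\<bar>hh l et - 1\<bar> <= et^2" proof -
 have "integral {0..et} (%s. (1 - et^2) * (sinh s)^2) <= integral {0..et} (%s. Sf l s * sinh s)"
 proof (rule integral_le)
  fix s assume s: "s : {0..et}"
  have s2: "s^2 <= et^2" using s by (intro power_mono) auto
  have sl: "sinh s <= s + s ^ 3" using sinh_le_cubic[of s] s e by simp
  have "s ^ 3 = s * s^2" by (simp add: power3_eq_cube power2_eq_square)
  also have "... <= sinh s * et^2" using s s2 sinh_ge_self[of s] by (intro mult_mono) auto
  finally have "(1 - et^2) * sinh s <= s" using sl by (simp add: algebra_simps)
  also have "... <= Sf l s" using Sf_ge_self[OF l(2)] s by simp
  finally show "(1 - et^2) * (sinh s)^2 <= Sf l s * sinh s"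
  using s by (simp add: power2_eq_square mult.assoc[symmetric] mult_right_mono)
 qed (intro integrable_continuous_real continuous_intros)+
 hence "(1 - et^2) * hvol et <= mm l et" by (simp add: mm_def hvol_def)
 hence "1 - et^2 <= hh l et" using hvol_pos[OF e(1)] by (simp add: hh_def le_divide_eq)
 moreover have "hh l et <= 1" using hh_abs_le[OF l(1) e(1)] by simp
 ultimately show ?thesis by simp
qed

lemma hvol_ge: "R >= 0 ==> R ^ 3 <= hvol R" proof -
 assume R: "R >= 0"
 have i: "((%s::real. s^2) has_integral (R ^ 3 / 3 - 0 ^ 3 / 3)) {0..R}" by (rule ftc[OF R])
  (auto intro!: derivative_eq_intros simp: real_vector_deriv[symmetric] power2_eq_square)
 have "R ^ 3 / 3 - 0 ^ 3 / 3 <= integral {0..R} (%s. (sinh s)^2)" unfolding integral_unique[OF i, symmetric]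
  by (rule integral_le) (auto intro!: integrable_continuous_real continuous_intros power_mono sinh_ge_self)
 hence "4 * pi * (R ^ 3 / 3) <= hvol R" by (simp add: hvol_def)
 moreover have "3 * R ^ 3 <= 4 * pi * R ^ 3" using R pi_gt3 by (intro mult_right_mono) auto
 ultimately show ?thesis by linarith
qed

section \<open>Mean squares of trigonometric sums\<close>

text \<open>A tent that is at least 1/2 within distance 2 of \<open>r0\<close>. Its transform decays
  like \<open>1 / ta^2\<close>; a sharp cutoff would leave \<open>1 / ta\<close>, which is not
  summable over the unit windows of \<open>QQ_window\<close>.\<close>

definition hat :: "real => real => real" where
 "hat r0 r = max 0 (1 - \<bar>r - r0\<bar> / 4)"

lemma hat_left: "r0 - 4 <= r ==> r <= r0 ==> hat r0 r = 1 + 1 * (r - r0) / 4"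
 and hat_right: "r0 <= r ==> r <= r0 + 4 ==> hat r0 r = 1 + (- 1) * (r - r0) / 4"
 by (simp_all add: hat_def abs_if max_def field_simps)

lemma hat_cos:
 "\<exists>I. ((%r. hat r0 r * cos (ta * r + ps)) has_integral I) {r0 - 4..r0 + 4} & \<bar>I\<bar> <= 8 / (1 + ta^2)"
proof -
 have i: "(%r. hat r0 r * cos (ta * r + ps)) integrable_on {r0 - 4..r0 + 4}"
  unfolding hat_def by (intro integrable_continuous_real continuous_intros) auto
 define I where "I = integral {r0 - 4..r0 + 4} (%r. hat r0 r * cos (ta * r + ps))"
 have hI: "((%r. hat r0 r * cos (ta * r + ps)) has_integral I) {r0 - 4..r0 + 4}" unfolding I_def using i by blast
 have b8: "\<bar>I\<bar> <= 4" proof -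
  have h1: "((%r. 1 + 1 * (r - r0) / 4) has_integral (2::real)) {r0 - 4..r0}" proof -
  have "((%r. 1 + 1 * (r - r0) / 4) has_integral (r0 + (r0 - r0)^2 / 8 - ((r0 - 4) + (r0 - 4 - r0)^2 / 8))) {r0 - 4..r0}"
  by (rule ftc)
  (auto intro!: derivative_eq_intros simp: real_vector_deriv[symmetric] diff_divide_distrib)
  thus ?thesis by simp
  qed
  have h2: "((%r. 1 + (- 1) * (r - r0) / 4) has_integral (2::real)) {r0..r0 + 4}" proof -
  have "((%r. 1 + (- 1) * (r - r0) / 4) has_integral ((r0 + 4) - (r0 + 4 - r0)^2 / 8 - (r0 - (r0 - r0)^2 / 8))) {r0..r0 + 4}"
  by (rule ftc)
  (auto intro!: derivative_eq_intros simp: real_vector_deriv[symmetric] diff_divide_distrib)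
  thus ?thesis by simp
  qed
  have "(hat r0 has_integral 2 + 2) {r0 - 4..r0 + 4}" proof (rule has_integral_combine[of "r0 - 4" r0])
  show "(hat r0 has_integral 2) {r0 - 4..r0}" by (rule has_integral_eq[OF _ h1], rule hat_left[symmetric]) auto
  show "(hat r0 has_integral 2) {r0..r0 + 4}" by (rule has_integral_eq[OF _ h2], rule hat_right[symmetric]) auto
  qed auto
  hence w: "(hat r0 has_integral 4) {r0 - 4..r0 + 4}" by simp
  have "norm I <= integral {r0 - 4..r0 + 4} (hat r0)" unfolding I_def proof (rule integral_norm_bound_integral[OF i])
  show "hat r0 integrable_on {r0 - 4..r0 + 4}" using w by blast
  show "norm (hat r0 r * cos (ta * r + ps)) <= hat r0 r" for r
  using abs_cos_le_one[of "ta * r + ps"] by (simp add: abs_mult hat_def mult_left_le)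
  qed
  thus ?thesis using integral_unique[OF w] by simp
 qed
 have bt: "\<bar>I\<bar> <= 1 / ta^2" if t: "ta ~= 0" proof -
  define F where "F ep r = (1 + ep * (r - r0) / 4) * sin (ta * r + ps) / ta + ep * cos (ta * r + ps) / (4 * ta^2)" for ep r :: real
  have dF: "(F ep has_vector_derivative (1 + ep * (r - r0) / 4) * cos (ta * r + ps)) (at r within S)" for ep r S
  proof -
  have "(F ep has_real_derivative (1 + ep * (r - r0) / 4) * cos (ta * r + ps)) (at r within S)"
  unfolding F_def[abs_def] using t by (auto intro!: derivative_eq_intros simp: field_simps power2_eq_square)
  thus ?thesis by (simp add: real_vector_deriv)
  qed
  have h1: "((%r. (1 + 1 * (r - r0) / 4) * cos (ta * r + ps)) has_integral F 1 r0 - F 1 (r0 - 4)) {r0 - 4..r0}"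
  by (rule ftc[OF _ dF]) simp
  have h2: "((%r. (1 + (- 1) * (r - r0) / 4) * cos (ta * r + ps)) has_integral F (- 1) (r0 + 4) - F (- 1) r0) {r0..r0 + 4}"
  by (rule ftc[OF _ dF]) simp
  have "((%r. hat r0 r * cos (ta * r + ps)) has_integral (F 1 r0 - F 1 (r0 - 4)) + (F (- 1) (r0 + 4) - F (- 1) r0)) {r0 - 4..r0 + 4}"
  proof (rule has_integral_combine[of "r0 - 4" r0])
  show "((%r. hat r0 r * cos (ta * r + ps)) has_integral F 1 r0 - F 1 (r0 - 4)) {r0 - 4..r0}"
  proof (rule has_integral_eq[OF _ h1])
  fix r assume "r : {r0 - 4..r0}"
  hence "hat r0 r = 1 + 1 * (r - r0) / 4" by (intro hat_left) auto
  thus "(1 + 1 * (r - r0) / 4) * cos (ta * r + ps) = hat r0 r * cos (ta * r + ps)" by simp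
  qed
  show "((%r. hat r0 r * cos (ta * r + ps)) has_integral F (- 1) (r0 + 4) - F (- 1) r0) {r0..r0 + 4}"
  proof (rule has_integral_eq[OF _ h2])
  fix r assume "r : {r0..r0 + 4}"
  hence "hat r0 r = 1 + (- 1) * (r - r0) / 4" by (intro hat_right) auto
  thus "(1 + (- 1) * (r - r0) / 4) * cos (ta * r + ps) = hat r0 r * cos (ta * r + ps)" by simp
  qed
  qed auto
  from has_integral_unique[OF hI this]
  have "I = (2 * cos (ta * r0 + ps) - cos (ta * (r0 - 4) + ps) - cos (ta * (r0 + 4) + ps)) / (4 * ta^2)"
  by (simp add: F_def diff_divide_distrib add_divide_distrib)
  hence "\<bar>I\<bar> = \<bar>2 * cos (ta * r0 + ps) - cos (ta * (r0 - 4) + ps) - cos (ta * (r0 + 4) + ps)\<bar> / (4 * ta^2)"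
  by (simp add: abs_divide)
  also have "... <= 4 / (4 * ta^2)"
  using abs_cos_le_one[of "ta * r0 + ps"] abs_cos_le_one[of "ta * (r0 - 4) + ps"] abs_cos_le_one[of "ta * (r0 + 4) + ps"]
  by (intro divide_right_mono) (unfold abs_le_iff, linarith, simp)
  finally show ?thesis by simp
 qed
 have "\<bar>I\<bar> <= 8 / (1 + ta^2)" proof (cases "ta^2 <= 1")
  case True
  hence "8 / (1 + 1) <= 8 / (1 + ta^2)" by (intro divide_left_mono) (auto simp: add_pos_nonneg)
  thus ?thesis using b8 by simp
 next
  case False
  hence t: "ta ~= 0" "ta^2 > 1" by auto
  have "1 / ta^2 <= 8 / (1 + ta^2)" using t by (simp add: field_simps)
  thus ?thesis using bt[OF t(1)] by linarith
 qed
 thus ?thesis using hI by blast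
qed

text \<open>Products of cosines become cosines of differences and of sums of the frequencies. As
  frequencies are non-negative, a sum dominates the difference in absolute value, so both kinds of
  terms obey the same bound.\<close>

lemma hat_trig_square:
 assumes J: "finite J" and t0: "!!j. j : J ==> t j >= (0::real)"
 shows "integral {r0 - 4..r0 + 4} (%r. hat r0 r * (SUM j:J. b j * cos (t j * r + ph))^2)
  <= 8 * (SUM j:J. SUM k:J. \<bar>b j * b k\<bar> / (1 + (t j - t k)^2))" proof -
 have "\<forall>ta ps. \<exists>I. ((%r. hat r0 r * cos (ta * r + ps)) has_integral I) {r0 - 4..r0 + 4} & \<bar>I\<bar> <= 8 / (1 + ta^2)"
  using hat_cos by blast
 then obtain I where I: "!!ta ps. ((%r. hat r0 r * cos (ta * r + ps)) has_integral I ta ps) {r0 - 4..r0 + 4}"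
  "!!ta ps. \<bar>I ta ps\<bar> <= 8 / (1 + ta^2)" by metis
 have e: "hat r0 r * (SUM j:J. b j * cos (t j * r + ph))^2 =
  (SUM j:J. SUM k:J. b j * b k / 2 * (hat r0 r * cos ((t j - t k) * r + 0) + hat r0 r * cos ((t j + t k) * r + 2 * ph)))" for r
 proof -
  have "cos (t j * r + ph) * cos (t k * r + ph) = (cos ((t j - t k) * r + 0) + cos ((t j + t k) * r + 2 * ph)) / 2" for j k
  proof -
  have "(t j * r + ph) - (t k * r + ph) = (t j - t k) * r + 0" "(t j * r + ph) + (t k * r + ph) = (t j + t k) * r + 2 * ph"
  by (simp_all add: algebra_simps)
  thus ?thesis unfolding cos_times_cos by (simp only:)
  qed
  note cc = this
  have "b j * cos (t j * r + ph) * (b k * cos (t k * r + ph)) = b j * b k / 2 * (cos ((t j - t k) * r + 0) + cos ((t j + t k) * r + 2 * ph))" for j k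
  proof -
  have "b j * cos (t j * r + ph) * (b k * cos (t k * r + ph)) = b j * b k * (cos (t j * r + ph) * cos (t k * r + ph))" by (simp only: mult_ac)
  thus ?thesis unfolding cc by simp
  qed
  note m = this
  show ?thesis unfolding power2_eq_square sum_product unfolding sum_distrib_left proof (intro sum.cong refl)
  fix j k
  show "hat r0 r * (b j * cos (t j * r + ph) * (b k * cos (t k * r + ph))) =
  b j * b k / 2 * (hat r0 r * cos ((t j - t k) * r + 0) + hat r0 r * cos ((t j + t k) * r + 2 * ph))"
  unfolding m distrib_left[symmetric] by (simp only: mult_ac)
  qed
 qed
 have hi: "((%r. hat r0 r * (SUM j:J. b j * cos (t j * r + ph))^2) has_integral
  (SUM j:J. SUM k:J. b j * b k / 2 * (I (t j - t k) 0 + I (t j + t k) (2 * ph)))) {r0 - 4..r0 + 4}"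
  unfolding e by (intro has_integral_sum J has_integral_mult_right has_integral_add I)
 show ?thesis unfolding integral_unique[OF hi] sum_distrib_left proof (intro sum_mono)
  fix j k assume jk: "j : J" "k : J"
  have sq: "(t j - t k)^2 <= (t j + t k)^2" using t0[OF jk(1)] t0[OF jk(2)] by (intro power2_le_iff_abs_le[THEN iffD2]) auto
  have "\<bar>I (t j + t k) (2 * ph)\<bar> <= 8 / (1 + (t j + t k)^2)" by (rule I(2))
  also have "... <= 8 / (1 + (t j - t k)^2)" using sq by (intro divide_left_mono) (auto simp: add_pos_nonneg)
  finally have i2: "\<bar>I (t j + t k) (2 * ph)\<bar> <= 8 / (1 + (t j - t k)^2)" .
  have "b j * b k / 2 * (I (t j - t k) 0 + I (t j + t k) (2 * ph)) <= \<bar>b j * b k / 2\<bar> * \<bar>I (t j - t k) 0 + I (t j + t k) (2 * ph)\<bar>"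
  by (metis abs_ge_self abs_mult)
  also have "... <= \<bar>b j * b k / 2\<bar> * (16 / (1 + (t j - t k)^2))"
  using i2 I(2)[of "t j - t k" 0] by (intro mult_left_mono) auto
  finally show "b j * b k / 2 * (I (t j - t k) 0 + I (t j + t k) (2 * ph)) <= 8 * (\<bar>b j * b k\<bar> / (1 + (t j - t k)^2))"
  by (simp add: abs_mult)
 qed
qed

definition QQ :: "nat set => (nat => real) => (nat => real) => real" where
 "QQ J b t = (SUM j:J. SUM k:J. \<bar>b j * b k\<bar> / (1 + (t j - t k)^2))"

lemma QQ_mono: "(!!j. j : J ==> \<bar>b j\<bar> <= \<bar>c j\<bar>) ==> QQ J b t <= QQ J c t"
 unfolding QQ_def by (intro sum_mono divide_right_mono) (auto simp: abs_mult intro!: mult_mono)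

lemma arcosh_exp_bounds:
 assumes "y >= (1::real)" shows "exp (arcosh y) <= 2 * y" "y <= exp (arcosh y)" proof -
 have e: "exp (arcosh y) = y + sqrt (y^2 - 1)" using cosh_plus_sinh[of "arcosh y"] assms by (simp add: sinh_arcosh_real)
 have "sqrt (y^2 - 1) <= sqrt (y^2)" by (intro real_sqrt_le_mono) simp
 thus "exp (arcosh y) <= 2 * y" "y <= exp (arcosh y)" using assms by (auto simp: e)
qed

text \<open>The substitution \<open>y = cosh r\<close> maps \<open>[X/2, 4 X]\<close> into an interval of fixed length.\<close>

lemma trig_mean_square:
 assumes J: "finite J" and t0: "!!j. j : J ==> t j >= (0::real)" and X: "X > 0"
  and A: "1 < A" "X / 2 <= A" "A <= B" "B <= 4 * X"
 shows "integral {A..B} (%y. (SUM j:J. b j * cos (t j * arcosh y + ph))^2) <= 128 * X * QQ J b t" proof -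
 define f where "f y = (SUM j:J. b j * cos (t j * arcosh y + ph))^2" for y
 define g where "g r = (SUM j:J. b j * cos (t j * r + ph))^2" for r
 \<comment> \<open>\<open>r0 = ln (2 X)\<close> centres the tent: \<open>arcosh\<close> maps the
   points of \<open>[X/2, 4 X]\<close> above 1 into \<open>[r0 - 2, r0 + 2]\<close>, because
   \<open>y \<le> exp (arcosh y) \<le> 2 y\<close> and \<open>exp 2 \<ge> 4\<close>.\<close>
 define a1 a2 r0 where "a1 = arcosh A" and "a2 = arcosh B" and "r0 = ln (2 * X)"
 have B1: "B > 1" using A by simp
 have ch: "cosh a1 = A" "cosh a2 = B" using A B1 by (auto simp: a1_def a2_def)
 have a12: "0 <= a1" "a1 <= a2" using A B1 arcosh_less_iff_real[of A B] by (auto simp: a1_def a2_def le_less)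
 have cf: "continuous_on {A..B} f" unfolding f_def by (intro continuous_intros) (use A in auto)
 have sub: "((%r. sinh r *\<^sub>R f (cosh r)) has_integral integral {A..B} f) {a1..a2}" proof -
  have "((%r. sinh r *\<^sub>R f (cosh r)) has_integral integral {cosh a1..cosh a2} f) {a1..a2}"
  proof (rule has_integral_substitution[OF a12(2) _ _ cf])
  show "cosh a1 <= cosh a2" using A by (simp add: ch)
  show "cosh ` {a1..a2} \<subseteq> {A..B}" proof
  fix y assume "y : cosh ` {a1..a2}"
  then obtain r where r: "a1 <= r" "r <= a2" "y = cosh r" by auto
  thus "y : {A..B}" using a12 cosh_real_nonneg_le_iff[of a1 r] cosh_real_nonneg_le_iff[of r a2] by (simp add: ch)
  qed
  show "(cosh has_real_derivative sinh r) (at r within {a1..a2})" for r by (auto intro!: derivative_eq_intros)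
  qed
  thus ?thesis by (simp add: ch)
 qed
 have r0e: "exp r0 = 2 * X" using X by (simp add: r0_def)
 have a1r: "r0 - 2 <= a1" proof -
  have "exp (r0 - 2) = 2 * X / exp 2" by (simp add: exp_diff r0e)
  also have "... <= 2 * X / 4" using exp_ge_add_one_self[of 1] X proof -
  have "2 <= exp (1::real)" using exp_ge_add_one_self[of "1::real"] by simp
  hence "2 * 2 <= exp 1 * exp (1::real)" by (intro mult_mono) auto
  hence "4 <= exp (2::real)" by (simp flip: exp_add)
  thus ?thesis using X by (intro divide_left_mono) auto
  qed
  also have "... <= exp a1" using A arcosh_exp_bounds(2)[of A] by (simp add: a1_def)
  finally show ?thesis by simp
 qed
 have a2r: "a2 <= r0 + 2" proof -
  have "exp a2 <= 8 * X" using A arcosh_exp_bounds(1)[of B] B1 by (simp add: a2_def)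
  also have "... <= 2 * X * exp 2" proof -
  have "2 <= exp (1::real)" using exp_ge_add_one_self[of "1::real"] by simp
  hence "2 * 2 <= exp 1 * exp (1::real)" by (intro mult_mono) auto
  hence "4 <= exp (2::real)" by (simp flip: exp_add)
  thus ?thesis using X by simp
  qed
  also have "... = exp (r0 + 2)" by (simp add: exp_add r0e)
  finally show ?thesis by simp
 qed
 have cg: "continuous_on S g" for S unfolding g_def by (intro continuous_intros)
 have gi: "(%r. 16 * X * (hat r0 r * g r)) integrable_on S" if "S = {u..v}" for S u v
  unfolding that hat_def by (intro integrable_continuous_real continuous_intros cg) auto
 have g0: "g r >= 0" for r by (simp add: g_def)
 have "integral {A..B} f = integral {a1..a2} (%r. sinh r * f (cosh r))" using integral_unique[OF sub] by simp
 also have "... <= integral {a1..a2} (%r. 16 * X * (hat r0 r * g r))" proof (rule integral_le)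
  show "(%r. sinh r * f (cosh r)) integrable_on {a1..a2}" using sub by (auto simp: integrable_on_def)
  show "(%r. 16 * X * (hat r0 r * g r)) integrable_on {a1..a2}" by (rule gi[OF refl])
  fix r assume r: "r : {a1..a2}"
  hence r0: "r >= 0" using a12 by simp
  have fg: "f (cosh r) = g r" using r0 by (simp add: f_def g_def arcosh_cosh_real)
  have h: "hat r0 r >= 1 / 2" using r a1r a2r by (auto simp: hat_def)
  have "sinh r <= sinh a2" using r by simp
  also have "... <= B" using sinh_less_cosh_real[of a2] ch by simp
  also have "... <= 8 * X" using A X by simp
  finally have "sinh r <= 16 * X * (1 / 2)" by simp
  also have "... <= 16 * X * hat r0 r" using h X by (intro mult_left_mono) auto
  finally have "sinh r * g r <= 16 * X * hat r0 r * g r" using g0 by (intro mult_right_mono)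
  thus "sinh r * f (cosh r) <= 16 * X * (hat r0 r * g r)" by (simp add: fg mult.assoc)
 qed
 also have "... <= integral {r0 - 4..r0 + 4} (%r. 16 * X * (hat r0 r * g r))"
  by (rule integral_subset_le[OF _ gi[OF refl] gi[OF refl]]) (use a1r a2r g0 X in "auto simp: hat_def")
 also have "... = 16 * X * integral {r0 - 4..r0 + 4} (%r. hat r0 r * g r)" by simp
 also have "... <= 16 * X * (8 * QQ J b t)"
  unfolding g_def QQ_def by (intro mult_left_mono hat_trig_square J t0) (use X in auto)
 finally show ?thesis by (simp add: f_def[abs_def] mult.assoc)
qed

text \<open>Exchanging the order of integration, every point is met by windows of total length at
  most \<open>de\<close>. Together with \<open>integral_cs\<close> this shows that averaging over
  \<open>[Y, Y + de]\<close> does not increase a mean square beyond the integral over the enlarged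
  interval.\<close>

lemma sliding_average:
 fixes f :: "real => real"
 assumes AB: "A <= B" and d: "de > 0" and f: "continuous_on {A..B + de} f" and f0: "!!y. f y >= 0"
 shows "integral {A..B} (%Y. integral {Y..Y + de} f) <= de * integral {A..B + de} f"
  "(%Y. integral {Y..Y + de} f) integrable_on {A..B}" proof -
 have sub: "integral {Y..Y + de} f = integral {0..de} (%s. f (Y + s))" for Y
  using integral_shift_Icc_real[of 0 de f Y] by (simp add: o_def add.commute)
 have c2: "continuous_on (cbox (A, 0) (B, de)) (%(Y, s). f (Y + s))" unfolding case_prod_unfold
  by (rule continuous_on_compose2[OF f]) (auto intro!: continuous_intros simp: cbox_Pair_eq)
 have "integral (cbox A B) (%Y. integral (cbox 0 de) (%s. f (Y + s))) = integral (cbox 0 de) (%s. integral (cbox A B) (%Y. f (Y + s)))"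
  by (rule integral_swap_continuous[OF c2])
 hence "integral {A..B} (%Y. integral {Y..Y + de} f) = integral {0..de} (%s. integral {A..B} (%Y. f (Y + s)))"
  by (simp add: sub)
 also have "... <= integral {0..de} (%s. integral {A..B + de} f)" proof (rule integral_le)
  have "continuous_on (cbox 0 de) (%s. integral (cbox A B) (%Y. f (Y + s)))" proof (rule integral_continuous_on_param)
  show "continuous_on (cbox 0 de \<times> cbox A B) (%(s, Y). f (Y + s))"
  unfolding case_prod_unfold by (rule continuous_on_compose2[OF f]) (auto intro!: continuous_intros)
  qed
  thus "(%s. integral {A..B} (%Y. f (Y + s))) integrable_on {0..de}" by (intro integrable_continuous_real) simp
  fix s assume s: "s : {0..de}"
  have "integral {A..B} (%Y. f (Y + s)) = integral {A + s..B + s} f"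
  using integral_shift_Icc_real[of A B f s] by (simp add: o_def add.commute)
  also have "... <= integral {A..B + de} f"
  using s by (intro integral_subset_le integrable_continuous_real continuous_on_subset[OF f]) (auto simp: f0)
  finally show "integral {A..B} (%Y. f (Y + s)) <= integral {A..B + de} f" .
 qed auto
 finally show "integral {A..B} (%Y. integral {Y..Y + de} f) <= de * integral {A..B + de} f" using d by simp
 have "continuous_on (cbox A B) (%Y. integral (cbox 0 de) (%s. f (Y + s)))" proof (rule integral_continuous_on_param)
  show "continuous_on (cbox A B \<times> cbox 0 de) (%(Y, s). f (Y + s))"
  unfolding case_prod_unfold by (rule continuous_on_compose2[OF f]) (auto intro!: continuous_intros)
 qed
 thus "(%Y. integral {Y..Y + de} f) integrable_on {A..B}" unfolding sub by (intro integrable_continuous_real) simp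
qed

lemma integral_cs:
 fixes f :: "real => real" assumes d: "de > 0" and f: "continuous_on {Y..Y + de} f"
 shows "(integral {Y..Y + de} f)^2 <= de * integral {Y..Y + de} (%y. (f y)^2)" proof -
 define m where "m = integral {Y..Y + de} f / de"
 have i: "f integrable_on {Y..Y + de}" "(%y. (f y)^2) integrable_on {Y..Y + de}"
  using f by (intro integrable_continuous_real continuous_intros; assumption)+
 have "0 <= integral {Y..Y + de} (%y. (f y - m)^2)" by (rule integral_nonneg) (auto intro!: integrable_continuous_real continuous_intros f)
 also have "(%y. (f y - m)^2) = (%y. (f y)^2 - (2 * m) * f y + m^2)"
  by (auto simp: fun_eq_iff power2_eq_square algebra_simps)
 also have "integral {Y..Y + de} ... = integral {Y..Y + de} (%y. (f y)^2) - 2 * m * integral {Y..Y + de} f + m^2 * de"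
 proof -
  have "((%y. (f y)^2 - (2 * m) * f y + m^2) has_integral
  integral {Y..Y + de} (%y. (f y)^2) - 2 * m * integral {Y..Y + de} f + Henstock_Kurzweil_Integration.content {Y..Y + de} *\<^sub>R m^2) {Y..Y + de}"
  by (intro has_integral_add has_integral_diff has_integral_mult_right integrable_integral i has_integral_const_real)
  thus ?thesis using d by (simp add: integral_unique mult.commute)
 qed
 also have "... = integral {Y..Y + de} (%y. (f y)^2) - (integral {Y..Y + de} f)^2 / de"
  using d by (simp add: m_def power2_eq_square field_simps)
 finally show ?thesis using d by (simp add: field_simps)
qed

section \<open>Local bounds for the spectral coefficients\<close>

text \<open>Comparison with the arctangent over the symmetric interval
  \<open>[x - 1, x + 1]\<close>. It has length 2, so the telescoping function \<open>g\<close> is a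
  sum of two neighbouring arctangents.\<close>

lemma sum_inverse_quadratic: "(\<Sum>n<M. 1 / (1 + (real n - ta)^2)) <= 3 * pi" proof -
 have step: "2 / 3 * (1 / (1 + x^2)) <= arctan (x + 1) - arctan (x - 1)" for x :: real proof -
  obtain z where z: "x - 1 < z" "z < x + 1" "arctan (x + 1) - arctan (x - 1) = ((x + 1) - (x - 1)) * inverse (1 + z^2)"
  using MVT2[of "x - 1" "x + 1" arctan "%z. inverse (1 + z^2)"] DERIV_arctan by force
  have "\<bar>z\<bar> <= \<bar>x\<bar> + 1" using z by linarith
  hence "\<bar>z\<bar>^2 <= (\<bar>x\<bar> + 1)^2" by (intro power_mono) auto
  also have "(\<bar>x\<bar> + 1)^2 <= 2 * x^2 + 2" using sum_squares_bound[of "\<bar>x\<bar>" 1] by (simp add: power2_sum)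
  finally have "1 + z^2 <= 3 * (1 + x^2)" unfolding power2_abs using zero_le_power2[of x] unfolding distrib_left by linarith
  hence "2 / (3 * (1 + x^2)) <= 2 / (1 + z^2)" by (intro divide_left_mono) (auto intro!: mult_pos_pos add_pos_nonneg)
  moreover have "2 / 3 * (1 / (1 + x^2)) = 2 / (3 * (1 + x^2))" by (simp only: times_divide_times_eq mult_1_right)
  moreover have "((x + 1) - (x - 1)) * inverse (1 + z^2) = 2 / (1 + z^2)" by (simp only: divide_inverse) simp
  ultimately show ?thesis unfolding z(3) by (simp only:)
 qed
 define g where "g n = arctan (real n - ta) + arctan (real n - 1 - ta)" for n
 have "2 / 3 * (\<Sum>n<M. 1 / (1 + (real n - ta)^2)) = (\<Sum>n<M. 2 / 3 * (1 / (1 + (real n - ta)^2)))"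
  by (rule sum_distrib_left)
 also have "... <= (\<Sum>n<M. g (Suc n) - g n)" proof (rule sum_mono)
  fix n
  have "g (Suc n) - g n = arctan (real n - ta + 1) - arctan (real n - ta - 1)" by (simp add: g_def algebra_simps)
  thus "2 / 3 * (1 / (1 + (real n - ta)^2)) <= g (Suc n) - g n" using step by simp
 qed
 also have "... = g M - g 0" by (rule sum_lessThan_telescope)
 also have "... <= 2 * pi" unfolding g_def
  using arctan_bounded[of "real M - ta"] arctan_bounded[of "real M - 1 - ta"] arctan_bounded[of "real 0 - ta"] arctan_bounded[of "real 0 - 1 - ta"]
  by linarith
 finally show ?thesis by simp
qed

text \<open>The inequality \<open>2 a b \<le> a^2 + b^2\<close> is applied crosswise, pairing
  \<open>x j\<close> with \<open>y k / t k\<close>. For fixed \<open>j\<close> the sum over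
  \<open>k\<close> then contains only the \<open>y k\<close>, where a unit window contributes
  \<open>O(C)\<close> by assumption, and the weights \<open>1 / (1 + (t j - n)^2)\<close> are
  summable. No logarithm appears.\<close>

lemma QQ_window:
 assumes J: "finite J" and t1: "!!j. j : J ==> t j >= 1" and C: "C >= 0"
  and win: "!!n::nat. n >= 1 ==> (SUM k:{k : J. real n <= t k & t k < real n + 1}. (y k)^2) <= C * (real n)^2"
 shows "QQ J (%j. x j * y j / t j) t <= 9 * pi * C * (SUM j:J. (x j)^2)" proof -
 define A where "A j k = (x j)^2 * ((y k / t k)^2 / (1 + (t j - t k)^2))" for j k
 have "QQ J (%j. x j * y j / t j) t <= (SUM j:J. SUM k:J. A j k / 2 + A k j / 2)" unfolding QQ_def
 proof (intro sum_mono)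
  fix j k
  have "2 * \<bar>x j * (y k / t k)\<bar> * \<bar>x k * (y j / t j)\<bar> <= \<bar>x j * (y k / t k)\<bar>^2 + \<bar>x k * (y j / t j)\<bar>^2"
  by (rule sum_squares_bound)
  moreover have "\<bar>x j * y j / t j * (x k * y k / t k)\<bar> = \<bar>x j * (y k / t k)\<bar> * \<bar>x k * (y j / t j)\<bar>"
  by (simp add: abs_mult abs_divide mult_ac)
  ultimately have "\<bar>x j * y j / t j * (x k * y k / t k)\<bar> <= ((x j * (y k / t k))^2 + (x k * (y j / t j))^2) / 2"
  proof -
  have half: "c <= P / 2" if "2 * a * b <= P" "c = a * b" for a b c P :: real using that by simp
  assume "2 * \<bar>x j * (y k / t k)\<bar> * \<bar>x k * (y j / t j)\<bar> <= \<bar>x j * (y k / t k)\<bar>^2 + \<bar>x k * (y j / t j)\<bar>^2"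
  "\<bar>x j * y j / t j * (x k * y k / t k)\<bar> = \<bar>x j * (y k / t k)\<bar> * \<bar>x k * (y j / t j)\<bar>"
  from half[OF this] show ?thesis unfolding power2_abs .
  qed
  hence "\<bar>x j * y j / t j * (x k * y k / t k)\<bar> / (1 + (t j - t k)^2) \<le>
  ((x j * (y k / t k))^2 + (x k * (y j / t j))^2) / 2 / (1 + (t j - t k)^2)" by (intro divide_right_mono) auto
  also have "... = A j k / 2 + A k j / 2"
  unfolding A_def power_mult_distrib[of "x j"] power_mult_distrib[of "x k"] power2_commute[of "t k" "t j"]
  by (simp add: add_divide_distrib mult.commute)
  finally show "\<bar>x j * y j / t j * (x k * y k / t k)\<bar> / (1 + (t j - t k)^2) <= A j k / 2 + A k j / 2" .
 qed
 also have "... = (SUM j:J. SUM k:J. A j k / 2) + (SUM j:J. SUM k:J. A k j / 2)" by (simp add: sum.distrib)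
 also have "(SUM j:J. SUM k:J. A k j / 2) = (SUM j:J. SUM k:J. A j k / 2)" by (rule sum.swap)
 also have "(SUM j:J. SUM k:J. A j k / 2) + (SUM j:J. SUM k:J. A j k / 2) = (SUM j:J. (x j)^2 * (SUM k:J. (y k / t k)^2 / (1 + (t j - t k)^2)))"
  unfolding sum.distrib[symmetric] field_sum_of_halves sum_distrib_left A_def ..
 also have "... <= (SUM j:J. (x j)^2 * (9 * pi * C))" proof (intro sum_mono mult_left_mono)
  fix j assume j: "j : J"
  define g where "g k = nat \<lfloor>t k\<rfloor>" for k
  obtain M where M: "ALL n:g ` J. n < M" using finite_nat_set_iff_bounded[of "g ` J"] J by auto
  define h where "h k = (y k / t k)^2 / (1 + (t j - t k)^2)" for k
  have gk: "g k = n \<longleftrightarrow> real n <= t k & t k < real n + 1" if "k : J" for k n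
  using t1[OF that] unfolding g_def by linarith
  have "(SUM k:J. h k) = (\<Sum>n<M. SUM k:{k : J. g k = n}. h k)"
  by (rule sum.group[symmetric, OF J]) (use M in auto)
  also have "... <= (\<Sum>n<M. 3 * C * (1 / (1 + (real n - t j)^2)))" proof (rule sum_mono)
  fix n
  show "(SUM k:{k : J. g k = n}. h k) <= 3 * C * (1 / (1 + (real n - t j)^2))" proof (cases "n >= 1")
  case False
  hence "{k : J. g k = n} = {}" using gk t1 by fastforce
  thus ?thesis using C by (simp only: sum.empty) (simp add: add_nonneg_nonneg)
  next
  case True
  have "(SUM k:{k : J. g k = n}. h k) <= (SUM k:{k : J. g k = n}. (y k)^2 * (3 / (1 + (real n - t j)^2) / (real n)^2))"
  proof (rule sum_mono)
  fix k assume "k : {k : J. g k = n}"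
  hence k: "k : J" "real n <= t k" "t k < real n + 1" using gk by auto
  have "\<bar>real n - t j\<bar> <= \<bar>t j - t k\<bar> + 1" using k by linarith
  hence "\<bar>real n - t j\<bar>^2 <= (\<bar>t j - t k\<bar> + 1)^2" by (intro power_mono) auto
  also have "... <= 2 * (t j - t k)^2 + 2" using sum_squares_bound[of "\<bar>t j - t k\<bar>" 1] by (simp add: power2_sum)
  finally have le: "(real n - t j)^2 <= 2 * (t j - t k)^2 + 2" unfolding power2_abs .
  have ar: "(1 + P) / 3 <= 1 + Q" if "P <= 2 * Q + 2" "0 <= Q" for P Q :: real using that by simp
  have "(1 + (real n - t j)^2) / 3 <= 1 + (t j - t k)^2" by (rule ar[OF le zero_le_power2])
  moreover have "(y k / t k)^2 <= (y k)^2 / (real n)^2"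
  unfolding power_divide using k True by (intro divide_left_mono power_mono) auto
  ultimately have "h k <= (y k)^2 / (real n)^2 / ((1 + (real n - t j)^2) / 3)"
  unfolding h_def by (intro frac_le) (auto simp: add_pos_nonneg)
  thus "h k <= (y k)^2 * (3 / (1 + (real n - t j)^2) / (real n)^2)" by (simp add: mult_ac)
  qed
  also have "... = (SUM k:{k : J. g k = n}. (y k)^2) * (3 / (1 + (real n - t j)^2) / (real n)^2)"
  by (rule sum_distrib_right[symmetric])
  also have "(SUM k:{k : J. g k = n}. (y k)^2) = (SUM k:{k : J. real n <= t k & t k < real n + 1}. (y k)^2)"
  by (rule sum.cong) (use gk in auto)
  also have "(SUM k:{k : J. real n <= t k & t k < real n + 1}. (y k)^2) * (3 / (1 + (real n - t j)^2) / (real n)^2)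
  <= C * (real n)^2 * (3 / (1 + (real n - t j)^2) / (real n)^2)"
  by (rule mult_right_mono[OF win[OF True]]) (simp add: add_nonneg_nonneg)
  also have "... = 3 * C * (1 / (1 + (real n - t j)^2))" using True by simp
  finally show ?thesis .
  qed
  qed
  also have "... = 3 * C * (\<Sum>n<M. 1 / (1 + (real n - t j)^2))" by (rule sum_distrib_left[symmetric])
  also have "... <= 3 * C * (3 * pi)" using C sum_inverse_quadratic by (intro mult_left_mono) auto
  finally show "(SUM k:J. (y k / t k)^2 / (1 + (t j - t k)^2)) <= 9 * pi * C" by (simp add: h_def mult_ac)
 qed simp
 also have "... = 9 * pi * C * (SUM j:J. (x j)^2)" by (simp add: sum_distrib_right[symmetric] mult.commute)
 finally show ?thesis .
qed

lemma sin_ge_half: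
 assumes x: "0 <= x" "x <= (1::real)" shows "x / 2 <= sin x" proof -
 have "sin 0 - 0 / 2 <= sin x - x / 2" proof (rule DERIV_nonneg_imp_nondecreasing[OF x(1)])
  fix y assume y: "0 <= y" "y <= x"
  have "cos (pi / 3) <= cos y" using x y pi_gt3 by (intro cos_monotone_0_pi_le) auto
  hence "0 <= cos y - 1 / 2" by (simp add: cos_60)
  moreover have "((%y. sin y - y / 2) has_real_derivative cos y - 1 / 2) (at y)" by (auto intro!: derivative_eq_intros)
  ultimately show "\<exists>z. ((%y. sin y - y / 2) has_real_derivative z) (at y) & 0 <= z" by blast
 qed
 thus ?thesis by simp
qed

lemma sin_ge_eighth:
 assumes "1 / 4 <= x" "x <= pi - 1 / (4::real)" shows "1 / 8 <= sin x" proof -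
 have main: "1 / 8 <= sin x" if "1 / 4 <= x" "x <= pi / 2" for x :: real proof -
  have "sin (1 / 4) <= sin x" using that by (intro sin_monotone_2pi_le) auto
  thus ?thesis using sin_ge_half[of "1 / 4"] by simp
 qed
 show ?thesis proof (cases "x <= pi / 2")
  case False
  thus ?thesis using main[of "pi - x"] assms by simp
 qed (use main assms in blast)
qed

lemma mm_diff:
 assumes "0 <= a" "a <= b" shows "mm l b - mm l a = 4 * pi * integral {a..b} (%s. Sf l s * sinh s)"
 using Henstock_Kurzweil_Integration.integral_combine[OF assms Sf_sinh_integrable[of l b]]
 unfolding mm_def right_diff_distrib[symmetric] by (intro arg_cong[where f = "(*) (4 * pi)"]) linarith

text \<open>\<open>37 = 1 + 6^2\<close>: for radius \<open>1/6\<close> the argument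
  \<open>sqrt (l - 1) s\<close> stays below 1, where the sine is at least half its argument.
  Frequencies from 6 on are left to \<open>window_bound\<close>.\<close>

lemma mm_ge_cube:
 assumes l: "l <= 37" shows "1 / 216 <= mm l (1 / 6)" proof -
 have Sf: "s / 2 <= Sf l s" if s: "0 <= s" "s <= 1 / 6" for s proof (cases "l <= 1")
  case True thus ?thesis using Sf_ge_self[OF True s(1)] s by simp
 next
  case False
  have "sqrt (l - 1) <= 6" using l by (intro real_le_lsqrt) auto
  hence "sqrt (l - 1) * s <= 6 * (1 / 6)" using s False by (intro mult_mono) auto
  hence "sqrt (l - 1) * s / 2 <= sin (sqrt (l - 1) * s)" using s False by (intro sin_ge_half) auto
  thus ?thesis using False by (simp add: Sf_def field_simps)
 qed
 have i: "((%s::real. s^2 / 2) has_integral ((1 / 6) ^ 3 / 6 - 0 ^ 3 / 6)) {0..1 / 6}" by (rule ftc)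
  (auto intro!: derivative_eq_intros simp: real_vector_deriv[symmetric] power2_eq_square)
 have "(1 / 6) ^ 3 / 6 - 0 ^ 3 / 6 <= integral {0..1 / 6} (%s. Sf l s * sinh s)"
  unfolding integral_unique[OF i, symmetric] proof (rule integral_le)
  show "(%s. s^2 / 2) integrable_on {0..1 / (6::real)}" using i by blast
  fix s :: real assume s: "s : {0..1 / 6}"
  have "s / 2 * s <= Sf l s * sinh s" proof (rule mult_mono)
  show "0 <= Sf l s" using Sf[of s] s by simp
  qed (use Sf[of s] s sinh_ge_self[of s] in auto)
  thus "s^2 / 2 <= Sf l s * sinh s" by (simp add: power2_eq_square)
 qed (rule Sf_sinh_integrable)
 hence "4 * pi * ((1 / 6) ^ 3 / 6) <= mm l (1 / 6)" by (simp add: mm_def)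
 moreover have "4 * 3 * ((1 / 6) ^ 3 / 6) <= 4 * pi * ((1 / 6 :: real) ^ 3 / 6)" using pi_gt3 by (intro mult_right_mono) auto
 ultimately show ?thesis by (simp add: power3_eq_cube)
qed

section \<open>Bessel's inequality for values at a point\<close>

context spectral
begin

lemma ball_integrable: "eigenfunction Ga l v ==> p : H3 ==> integrable hv (%q. (indicator {..W} (wd p q) :: real) * v q)"
 by (rule eig_at.integ[OF eigen_at, of _ _ _ "indicator {..W}" W 1]) auto

text \<open>Bessel's inequality for an automorphic kernel. \<open>AK_sq\<close> reduces its square
  norm to the integral of the kernel of \<open>k^2\<close>, which unfolds to an integral over
  \<open>H3\<close>.\<close>

lemma kernel_bessel:
 assumes k: "kern k R B" and p: "p : H3" and J: "finite J"
 shows "(SUM j:J. (LINT q|MF. AK k p q * u j q)^2) <= CB R * (LINT q|MF. AK (%w. (k w)^2) p q * 1)" proof -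
 have "kern (%w. (k w)^2) R (B^2)" using k unfolding kern_def
  by (intro conjI) (auto intro!: borel_measurable_power simp: abs_le_square_iff[symmetric] intro: order_trans[OF _ abs_ge_self])
 note a = AK_autom[OF k p] AK_autom[OF this p]
 have "(SUM j:J. (LINT q|MF. AK k p q * u j q)^2) <= (LINT q|MF. (AK k p q)^2)" by (intro O.bessel J autom_MF a)
 also have "... <= (LINT q|MF. CB R * AK (%w. (k w)^2) p q)"
  by (intro integral_mono autom_MF(3) a integrable_mult_right autom_MF(2)) (use AK_sq[OF k p] Fh(2) in auto)
 finally show ?thesis by simp
qed

text \<open>The kernel is a combination of indicators of disjoint shells, so its square is the
  combination with squared coefficients and the right-hand side is a sum of shell volumes.\<close>

lemma shell_bessel:
 fixes al be c :: "nat => real"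
 assumes p: "p : H3" and J: "finite J" and ab: "!!i. i < m ==> 0 < al i & al i <= be i & be i <= 1"
  and disj: "!!i k. i < k ==> k < m ==> be i <= al k"
 shows "(SUM j:J. ((\<Sum>i<m. c i * (mm (lam j) (be i) - mm (lam j) (al i))) * u j p)^2)
  <= CB (cosh 1) * (\<Sum>i<m. (c i)^2 * (hvol (be i) - hvol (al i)))" proof -
 define x where "x i w = (indicator {..cosh (be i)} w - indicator {..cosh (al i)} w :: real)" for i w
 define K where "K c w = (\<Sum>i<m. c i * x i w)" for c :: "nat => real" and w
 have x1: "\<bar>x i w\<bar> <= 1" for i w by (auto simp: x_def indicator_def)
 have kern: "kern (K c) (cosh 1) (\<Sum>i<m. \<bar>c i\<bar>)" for c unfolding kern_def proof (intro conjI allI impI)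
  show "K c : borel_measurable borel" unfolding K_def[abs_def] x_def by measurable
  show "K c w = 0" if "w > cosh 1" for w unfolding K_def proof (intro sum.neutral ballI)
  fix i assume "i : {..<m}"
  hence "cosh (be i) <= cosh 1" "cosh (al i) <= cosh 1" using ab[of i] by (auto simp: cosh_real_nonneg_le_iff)
  thus "c i * x i w = 0" using that by (simp add: x_def)
  qed
  show "\<bar>K c w\<bar> <= (\<Sum>i<m. \<bar>c i\<bar>)" for w
  unfolding K_def using x1 by (intro order_trans[OF sum_abs] sum_mono) (simp add: abs_mult mult_left_le)
 qed
 have pair: "(LINT q|MF. AK (K c) p q * v q) = (\<Sum>i<m. c i * (mm l (be i) - mm l (al i))) * v p"
  if v: "eigenfunction Ga l v" for v l c proof -
  note bi = ball_integrable[OF v p]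
  have "(LINT q|MF. AK (K c) p q * v q) = (LINT q|hv. K c (wd p q) * v q)"
  by (rule AK_pair[OF kern p eigen_autom[OF v]])
  also have "... = (LINT q|hv. (\<Sum>i<m. c i * (indicator {..cosh (be i)} (wd p q) * v q - indicator {..cosh (al i)} (wd p q) * v q)))"
  by (simp add: K_def x_def sum_distrib_right left_diff_distrib mult.assoc right_diff_distrib)
  also have "... = (\<Sum>i<m. c i * ((LINT q|hv. indicator {..cosh (be i)} (wd p q) * v q) - (LINT q|hv. indicator {..cosh (al i)} (wd p q) * v q)))"
  using bi by simp
  also have "... = (\<Sum>i<m. c i * (mm l (be i) * v p - mm l (al i) * v p))" proof (rule sum.cong[OF refl])
  fix i assume "i : {..<m}"
  thus "c i * ((LINT q|hv. indicator {..cosh (be i)} (wd p q) * v q) - (LINT q|hv. indicator {..cosh (al i)} (wd p q) * v q))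
  = c i * (mm l (be i) * v p - mm l (al i) * v p)"
  using eigen_ball[OF v p, of "be i"] eigen_ball[OF v p, of "al i"] ab[of i] by simp
  qed
  also have "... = (\<Sum>i<m. c i * (mm l (be i) - mm l (al i))) * v p"
  by (simp add: sum_distrib_right left_diff_distrib mult.assoc)
  finally show ?thesis .
 qed
 have sq: "(K c w)^2 = K (%i. (c i)^2) w" for w proof -
  have xx: "c i * x i w * (c k * x k w) = (if i = k then (c i)^2 * x i w else 0)" if ik: "i < m" "k < m" for i k
  proof (cases "i = k")
  case True
  have "cosh (al i) <= cosh (be i)" using ab[OF ik(1)] by (simp add: cosh_real_nonneg_le_iff)
  hence "x i w * x i w = x i w" by (auto simp: x_def indicator_def)
  hence "c i * x i w * (c i * x i w) = (c i)^2 * x i w" by (simp add: power2_eq_square mult_ac)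
  thus ?thesis using True by simp
  next
  case False
  have z: "x i w * x k w = 0" if "i < k" "k < m" for i k proof -
  have "cosh (al i) <= cosh (be i)" "cosh (be i) <= cosh (al k)" "cosh (al k) <= cosh (be k)"
  using ab[of i] ab[of k] disj[OF that] that by (simp_all add: cosh_real_nonneg_le_iff)
  thus ?thesis by (auto simp: x_def indicator_def)
  qed
  have "x i w * x k w = 0" using False z[of i k] z[of k i] ik by (cases "i < k") (auto simp: mult.commute)
  thus ?thesis using False by auto
  qed
  have "(K c w)^2 = (\<Sum>i<m. \<Sum>k<m. c i * x i w * (c k * x k w))"
  unfolding K_def power2_eq_square sum_product ..
  also have "... = (\<Sum>i<m. \<Sum>k<m. if i = k then (c i)^2 * x i w else 0)"
  by (intro sum.cong refl) (use xx in auto)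
  also have "... = K (%i. (c i)^2) w" by (simp add: K_def)
  finally show ?thesis .
 qed
 have "(SUM j:J. ((\<Sum>i<m. c i * (mm (lam j) (be i) - mm (lam j) (al i))) * u j p)^2) = (SUM j:J. (LINT q|MF. AK (K c) p q * u j q)^2)"
  by (simp add: pair[OF u_eig])
 also have "... <= CB (cosh 1) * (LINT q|MF. AK (K (%i. (c i)^2)) p q * 1)"
  using kernel_bessel[OF kern p J, of c] unfolding sq by simp
 also have "... = CB (cosh 1) * (\<Sum>i<m. (c i)^2 * (hvol (be i) - hvol (al i)))"
  unfolding pair[OF one_eigen] mm_0 by simp
 finally show ?thesis .
qed

lemma ball_bessel:
 assumes p: "p : H3" and J: "finite J" and R: "R > 0"
 shows "(SUM j:J. (mm (lam j) R * u j p)^2) <= CB (cosh R) * hvol R" proof -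
 have sq: "(%w. (indicator {..cosh R} w :: real)^2) = indicator {..cosh R}" by (auto simp: indicator_def)
 have "(SUM j:J. (mm (lam j) R * u j p)^2) = (SUM j:J. (LINT q|MF. AK (indicator {..cosh R}) p q * u j q)^2)"
  by (simp add: ball_pair[OF u_eig p R])
 also have "... <= CB (cosh R) * (LINT q|MF. AK (indicator {..cosh R}) p q * 1)"
  using kernel_bessel[OF kern_ind p J, of "cosh R"] unfolding sq .
 also have "... = CB (cosh R) * hvol R" unfolding ball_pair[OF one_eigen p R] mm_0 by simp
 finally show ?thesis .
qed

end

context spectral
begin

definition CL :: real where "CL = CB (cosh (1 / 6)) * hvol (1 / 6) * 216^2"
text \<open>\<open>8192 = 32^2 * 8\<close>: the lower bound \<open>1 / (32 n)\<close> for the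
  kernel's transform and the upper bound 8 for its norm in \<open>window_bound\<close>.\<close>

definition CW :: real where "CW = 8192 * CB (cosh 1)"

definition tt :: "nat => real" where "tt j = sqrt (lam j - 1)"

lemma CL_nonneg: "CL >= 0" and CW_nonneg: "CW >= 0" using hvol_pos[of "1 / 6"] CB_nonneg by (auto simp: CL_def CW_def)

lemma low_bound:
 assumes p: "p : H3" and J: "finite J" and l: "!!j. j : J ==> lam j <= 37" shows "(SUM j:J. (u j p)^2) <= CL" proof -
 have "(SUM j:J. (u j p)^2) <= (SUM j:J. 216^2 * (mm (lam j) (1 / 6) * u j p)^2)" proof (rule sum_mono)
  fix j assume "j : J"
  from mm_ge_cube[OF l[OF this]] have "1 <= 216 * mm (lam j) (1 / 6)" by simp
  hence "1^2 <= (216 * mm (lam j) (1 / 6))^2" by (intro power_mono) auto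
  hence "1 * (u j p)^2 <= (216 * mm (lam j) (1 / 6))^2 * (u j p)^2" by (intro mult_right_mono) auto
  thus "(u j p)^2 <= 216^2 * (mm (lam j) (1 / 6) * u j p)^2" by (simp add: power_mult_distrib mult.assoc)
 qed
 also have "... = 216^2 * (SUM j:J. (mm (lam j) (1 / 6) * u j p)^2)" by (rule sum_distrib_left[symmetric])
 also have "... <= 216^2 * (CB (cosh (1 / 6)) * hvol (1 / 6))" by (intro mult_left_mono ball_bessel p J) auto
 finally show ?thesis by (simp add: CL_def mult_ac)
qed

text \<open>The test kernel is supported on the shells where \<open>sin (n' r)\<close>, \<open>n' = n + 1/2\<close>, is large in
 absolute value; there \<open>sin (t r)\<close> has the same sign for all \<open>t : [n, n + 1)\<close>.\<close>

lemma window_bound: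
 assumes p: "p : H3" and J: "finite J" and n: "n >= 6"
  and t: "!!j. j : J ==> lam j > 37 & real n <= tt j & tt j < real n + 1"
 shows "(SUM j:J. (u j p)^2) <= CW * (real n)^2" proof -
 define n' where "n' = real n + 1 / 2"
 have n'6: "n' >= 13 / 2" using n by (simp add: n'_def)
 have n'0: "n' > 0" using n'6 by simp
 \<comment> \<open>The number of half periods of \<open>sin (n' r)\<close> in the unit ball, so that
   all shells end before radius 1.\<close>
 define m where "m = nat \<lfloor>n' / pi\<rfloor>"
 have m: "real m <= n' / pi" "n' / pi - 1 <= real m" using n'6 by (auto simp: m_def)
 define al be where "al i = (real i * pi + pi / 4) / n'" and "be i = (real i * pi + 3 * pi / 4) / n'" for i
 \<comment> \<open>The sign makes every shell contribute positively, and the division by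
   \<open>sinh (be i)\<close> compensates the growth of the weight \<open>sinh s\<close>, so that
   all shells contribute comparably.\<close>
 define c where "c i = (- 1) ^ i / sinh (be i)" for i
 have ba: "be i - al i = pi / (2 * n')" for i unfolding al_def be_def using n'0 by (simp add: field_simps)
 have be1: "be i <= 1" if "i < m" for i proof -
  have "real i + 1 <= n' / pi" using m(1) that by linarith
  hence "(real i + 1) * pi <= n'" by (simp add: field_simps)
  hence "real i * pi + 3 * pi / 4 <= n'" using pi_gt_zero unfolding distrib_right by linarith
  thus ?thesis using n'0 by (simp add: be_def)
 qed
 have al0: "al i > 0" for i unfolding al_def using n'0 by (intro divide_pos_pos add_nonneg_pos) auto
 have albe: "al i <= be i" for i proof -
  have "0 <= pi / (2 * n')" using n'0 by simp
  thus ?thesis using ba[of i] by linarith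
 qed
 have albe3: "be i <= 3 * al i" for i
  unfolding al_def be_def times_divide_eq_right using n'0 by (intro divide_right_mono) auto
 have be0: "be i > 0" for i using al0[of i] albe[of i] by linarith
 have sb: "sinh (be i) > 0" for i using be0 by simp
 have disj: "be i <= al k" if "i < k" for i k proof -
  have "real i + 1 <= real k" using that by linarith
  hence "(real i + 1) * pi <= real k * pi" by (intro mult_right_mono) auto
  hence "real i * pi + 3 * pi / 4 <= real k * pi + pi / 4" using pi_gt_zero unfolding distrib_right by linarith
  thus ?thesis unfolding al_def be_def using n'0 by (intro divide_right_mono) auto
 qed
 define S where "S j = (\<Sum>i<m. c i * (mm (lam j) (be i) - mm (lam j) (al i)))" for j
 have h: "1 / (32 * real n) <= S j" if j: "j : J" for j proof -
  define T where "T = tt j"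
  have T: "real n <= T" "T < real n + 1" "lam j > 37" using t[OF j] by (auto simp: T_def)
  have T0: "T > 0" using T n by linarith
  have Tn: "\<bar>T - n'\<bar> <= 1 / 2" using T unfolding n'_def by linarith
  have each: "pi^2 / (24 * T * n') <= c i * (mm (lam j) (be i) - mm (lam j) (al i))" if i: "i < m" for i proof -
  have pw: "1 / (48 * T) <= c i * (Sf (lam j) s * sinh s)" if s: "s : {al i..be i}" for s proof -
  have s1: "0 < s" "s <= 1" using s al0[of i] be1[OF i] by auto
  \<comment> \<open>As \<open>T\<close> is within 1/2 of \<open>n'\<close> and
    \<open>s \<le> 1\<close>, the phase moves by at most 1/2. The shell keeps a margin
    \<open>\<pi>/4\<close> from the zeros of the sine, of which at least 1/4 remains.\<close>
  have "\<bar>(T - n') * s\<bar> <= 1 / 2 * 1" unfolding abs_mult using Tn s1 by (intro mult_mono) auto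
  hence d: "\<bar>T * s - n' * s\<bar> <= 1 / 2" by (simp add: left_diff_distrib)
  have ns: "real i * pi + pi / 4 <= n' * s" "n' * s <= real i * pi + 3 * pi / 4"
  using s n'0 by (auto simp: al_def be_def divide_le_eq le_divide_eq mult.commute)
  have "1 / 4 <= T * s - real i * pi" "T * s - real i * pi <= pi - 1 / 4" using d ns pi_gt3 by linarith+
  hence s8: "1 / 8 <= sin (T * s - real i * pi)" by (rule sin_ge_eighth)
  have "sin (T * s - real i * pi) = (- 1) ^ i * sin (T * s)"
  by (simp add: sin_diff cos_npi sin_npi mult.commute[of "real i"])
  hence s8': "1 / 8 <= (- 1) ^ i * sin (T * s)" using s8 by simp
  have r6: "1 / 6 <= sinh s / sinh (be i)" proof -
  have "be i ^ 3 <= be i" using be0[of i] be1[OF i] power_decreasing[of 1 3 "be i"] by simp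
  hence "sinh (be i) <= 2 * be i" using sinh_le_cubic[of "be i"] be0[of i] be1[OF i] by linarith
  also have "... <= 6 * al i" using albe3[of i] by simp
  also have "... <= 6 * s" using s by simp
  also have "... <= 6 * sinh s" using sinh_ge_self[of s] s1 by simp
  finally show ?thesis using sb[of i] by (simp add: field_simps)
  qed
  have "1 / (48 * T) = (1 / 8) / T * (1 / 6)" by simp
  also have "... <= ((- 1) ^ i * sin (T * s)) / T * (sinh s / sinh (be i))"
  using s8' r6 T0 by (intro mult_mono divide_right_mono divide_nonneg_pos) auto
  also have "... = c i * (Sf (lam j) s * sinh s)" using T(3) by (simp add: c_def Sf_def T_def tt_def mult_ac)
  finally show ?thesis .
  qed
  have "1 / (48 * T) * (be i - al i) = integral {al i..be i} (%s. 1 / (48 * T))" using albe[of i] by simp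
  also have "... <= integral {al i..be i} (%s. c i * (Sf (lam j) s * sinh s))"
  by (rule integral_le) (use pw in "auto intro!: integrable_continuous_real continuous_intros")
  also have "... = c i * integral {al i..be i} (%s. Sf (lam j) s * sinh s)" by simp
  finally have "4 * pi * (1 / (48 * T) * (pi / (2 * n'))) <= 4 * pi * (c i * integral {al i..be i} (%s. Sf (lam j) s * sinh s))"
  unfolding ba by (intro mult_left_mono) auto
  also have "... = c i * (mm (lam j) (be i) - mm (lam j) (al i))"
  using mm_diff[OF less_imp_le[OF al0] albe, of "lam j" i] by simp
  finally show ?thesis by (simp add: power2_eq_square)
  qed
  \<comment> \<open>About \<open>n\<close> shells, each contributing at least of order
    \<open>1 / n^2\<close>, make the transform at least of order \<open>1 / n\<close>, while the
    square norm of the kernel stays bounded. This is the origin of \<open>n^2\<close>.\<close>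
  have "n' / (2 * pi) <= real m" proof -
  have "pi <= 13 / 4" using pi_less_4 pi_approx by simp
  hence "1 <= n' / (2 * pi)" using n'6 pi_gt_zero by (simp add: le_divide_eq)
  thus ?thesis using m(2) by (simp add: field_simps)
  qed
  hence "n' / (2 * pi) * (pi^2 / (24 * T * n')) <= real m * (pi^2 / (24 * T * n'))"
  using T0 n'0 by (intro mult_right_mono) auto
  also have "... <= S j" unfolding S_def using sum_mono[of "{..<m}" "%_. pi^2 / (24 * T * n')", OF each] by simp
  finally have "pi / (48 * T) <= S j" using n'0 T0 by (simp add: power2_eq_square)
  moreover have "1 / (32 * real n) <= pi / (48 * T)" proof -
  have "48 * T <= 96 * real n" using T n by linarith
  also have "... <= pi * (32 * real n)" using pi_gt3 n mult_right_mono[of 3 pi "32 * real n"] by simp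
  finally show ?thesis using T0 n by (simp add: divide_le_eq le_divide_eq mult.commute)
  qed
  ultimately show ?thesis by linarith
 qed
 have "(SUM j:J. (u j p)^2) <= (SUM j:J. (32 * real n)^2 * (S j * u j p)^2)" proof (rule sum_mono)
  fix j assume "j : J"
  from h[OF this] have "1 <= 32 * real n * S j"  using n by (simp add: divide_le_eq mult.commute)
  hence "1^2 <= (32 * real n * S j)^2" by (intro power_mono) auto
  hence "1 * (u j p)^2 <= (32 * real n * S j)^2 * (u j p)^2" by (intro mult_right_mono) auto
  thus "(u j p)^2 <= (32 * real n)^2 * (S j * u j p)^2" by (simp add: power_mult_distrib mult.assoc)
 qed
 also have "... = (32 * real n)^2 * (SUM j:J. (S j * u j p)^2)" by (rule sum_distrib_left[symmetric])
 also have "... <= (32 * real n)^2 * (CB (cosh 1) * (\<Sum>i<m. (c i)^2 * (hvol (be i) - hvol (al i))))"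
  unfolding S_def by (intro mult_left_mono shell_bessel p J) (use al0 albe be1 disj in auto)
 also have "... <= (32 * real n)^2 * (CB (cosh 1) * 8)" proof (intro mult_left_mono)
  have "(c i)^2 * (hvol (be i) - hvol (al i)) <= 4 * pi * (pi / (2 * n'))" for i proof -
  have "hvol (be i) - hvol (al i) = 4 * pi * integral {al i..be i} (%s. Sf 0 s * sinh s)"
  unfolding mm_0[symmetric] by (rule mm_diff[OF less_imp_le[OF al0] albe])
  also have "... <= 4 * pi * integral {al i..be i} (%s. (sinh (be i))^2)" proof (intro mult_left_mono integral_le)
  fix s assume s: "s : {al i..be i}"
  hence "(sinh s)^2 <= (sinh (be i))^2" using al0[of i] by (intro power_mono) auto
  thus "Sf 0 s * sinh s <= (sinh (be i))^2" by (simp add: Sf_0 power2_eq_square)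
  qed (auto intro!: integrable_continuous_real continuous_intros)
  also have "... = 4 * pi * ((be i - al i) * (sinh (be i))^2)" using albe[of i] by simp
  finally have "(c i)^2 * (hvol (be i) - hvol (al i)) <= (c i)^2 * (4 * pi * ((be i - al i) * (sinh (be i))^2))"
  by (intro mult_left_mono) auto
  also have "... = 4 * pi * (pi / (2 * n'))" proof -
  have "(c i)^2 * (sinh (be i))^2 = 1"
  using sb[of i] by (simp add: c_def power_divide power_mult_distrib[symmetric] power_mult[symmetric] mult.commute[of i])
  thus ?thesis unfolding ba by (simp add: mult_ac)
  qed
  finally show ?thesis .
  qed
  hence "(\<Sum>i<m. (c i)^2 * (hvol (be i) - hvol (al i))) <= (\<Sum>i<m. 4 * pi * (pi / (2 * n')))" by (intro sum_mono)
  also have "... = real m * (4 * pi * (pi / (2 * n')))" by simp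
  also have "... <= n' / pi * (4 * pi * (pi / (2 * n')))" using m n'0 by (intro mult_right_mono) auto
  also have "... = 2 * pi" using n'0 by simp
  also have "... <= 8" using pi_less_4 by simp
  finally show "(\<Sum>i<m. (c i)^2 * (hvol (be i) - hvol (al i))) <= 8" .
 qed (use CB_nonneg in auto)
 finally show ?thesis by (simp add: CW_def power_mult_distrib mult_ac)
qed

text \<open>The pointwise bound, integrated over \<open>F\<close>, bounds the number of orthonormal
  functions by \<open>CL * vol\<close>.\<close>

lemma finite_low: "finite {j. lam j <= 37}" proof (rule ccontr)
 assume "infinite {j. lam j <= 37}"
 from infinite_arbitrarily_large[OF this, of "nat \<lceil>CL * vol\<rceil> + 1"]
 obtain J where J: "finite J" "card J = nat \<lceil>CL * vol\<rceil> + 1" "J \<subseteq> {j. lam j <= 37}" by blast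
 have i: "integrable MF (%q. u j q * u j q)" for j
  using autom_MF(3)[OF eigen_autom[OF u_eig]] by (simp add: power2_eq_square)
 have "real (card J) = (SUM j:J. (LINT q|MF. u j q * u j q))" by (simp add: u_orth)
 also have "... = (LINT q|MF. (SUM j:J. u j q * u j q))" using i by simp
 also have "... <= (LINT q|MF. CL * 1)" proof (rule integral_mono)
  show "integrable MF (%q. (SUM j:J. u j q * u j q))" using i by simp
  fix q assume "q : space MF"
  hence "q : H3" using Fh(2) by auto
  from low_bound[OF this J(1)] J(3) show "(SUM j:J. u j q * u j q) <= CL * 1" by (auto simp: power2_eq_square)
 qed simp
 also have "... = CL * vol" using vol_eq by simp
 finally show False using J(2) by linarith
qed

section \<open>Periods over the plane\<close>

definition per :: "nat => real" where "per j = (LINT q|MD. u j q)"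

text \<open>\<open>2 a b \<le> a^2 + b^2\<close> under the integral over \<open>D\<close> reduces
  the products to \<open>low_bound\<close> at the points of \<open>D\<close> and at
  \<open>p\<close>, without a bound for single periods.\<close>

lemma low_period:
 assumes p: "p : H3" and J: "J \<subseteq> {j. lam j <= 37}" shows "(SUM j:J. \<bar>per j * u j p\<bar>) <= area * CL"
proof -
 have fJ: "finite J" by (rule finite_subset[OF J finite_low])
 have lJ: "lam j <= 37" if "j : J" for j using J that by blast
 have i: "integrable MD (%q. \<bar>u j q\<bar> * \<bar>u j p\<bar>)" for j
  using autom_MD(2)[OF eigen_autom[OF u_eig[of j]]] by simp
 have "(SUM j:J. \<bar>per j * u j p\<bar>) <= (SUM j:J. (LINT q|MD. \<bar>u j q\<bar> * \<bar>u j p\<bar>))"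
 proof (rule sum_mono)
  fix j
  have "\<bar>per j * u j p\<bar> <= (LINT q|MD. \<bar>u j q\<bar>) * \<bar>u j p\<bar>"
  unfolding abs_mult per_def by (intro mult_right_mono integral_abs_bound) auto
  thus "\<bar>per j * u j p\<bar> <= (LINT q|MD. \<bar>u j q\<bar> * \<bar>u j p\<bar>)" by simp
 qed
 also have "... = (LINT q|MD. (SUM j:J. \<bar>u j q\<bar> * \<bar>u j p\<bar>))" using i by simp
 also have "... <= (LINT q|MD. CL * 1)" proof (rule integral_mono)
  show "integrable MD (%q. (SUM j:J. \<bar>u j q\<bar> * \<bar>u j p\<bar>))" using i by simp
  fix q assume "q : space MD"
  hence q: "q : H3" using Dh(2) plane_H3 by auto
  have "(SUM j:J. \<bar>u j q\<bar> * \<bar>u j p\<bar>) <= (SUM j:J. (u j q)^2 / 2 + (u j p)^2 / 2)"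
  proof (rule sum_mono)
  fix j
  show "\<bar>u j q\<bar> * \<bar>u j p\<bar> <= (u j q)^2 / 2 + (u j p)^2 / 2"
  using sum_squares_bound[of "\<bar>u j q\<bar>" "\<bar>u j p\<bar>"] unfolding power2_abs by linarith
  qed
  also have "... = (SUM j:J. (u j q)^2) / 2 + (SUM j:J. (u j p)^2) / 2" by (simp add: sum.distrib sum_divide_distrib)
  also have "... <= CL / 2 + CL / 2" using low_bound[OF q fJ lJ] low_bound[OF p fJ lJ] by simp
  finally show "(SUM j:J. \<bar>u j q\<bar> * \<bar>u j p\<bar>) <= CL * 1" by simp
 qed simp
 also have "... = area * CL" by (simp add: area_eq mult.commute)
 finally show ?thesis .
qed

text \<open>Bessel's inequality for \<open>PP (cosh et)\<close>, whose coefficients are the periods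
  times \<open>mm\<close>. Its supremum is \<open>O(et^2)\<close> by \<open>PP_small\<close> and its
  integral is \<open>hvol et * area\<close>; division by the square of
  \<open>hvol et \<ge> et^3\<close> leaves \<open>1 / et\<close>.\<close>

lemma period_bessel:
 assumes J: "finite J" and e: "0 < et" "et <= 1" shows "(SUM j:J. (hh (lam j) et * per j)^2) <= CB 4 * area^2 / et"
proof -
 have hv: "hvol et > 0" by (rule hvol_pos[OF e(1)])
 define th where "th = cosh et - 1"
 have th: "0 <= th" "th <= et^2" "th <= 1" proof -
  have "et^2 <= 1^2" using e by (intro power_mono) auto
  thus "0 <= th" "th <= et^2" "th <= 1" using cosh_le_quad[of et] cosh_real_ge_1[of et] e by (auto simp: th_def)
 qed
 have c: "cosh et = 1 + th" by (simp add: th_def)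
 have pp: "(LINT q|MF. PP (cosh et) q * v q) = mm l et * (LINT z|MD. v z)" if "eigenfunction Ga l v" for l v
  by (rule PP_pair[OF eigen_autom[OF that] ball_pair[OF that _ e(1)]])
 have "(SUM j:J. (mm (lam j) et * per j)^2) = (SUM j:J. (LINT q|MF. PP (cosh et) q * u j q)^2)"
  by (simp add: pp[OF u_eig] per_def)
 also have "... <= (LINT q|MF. (PP (cosh et) q)^2)" by (intro O.bessel J autom_MF PP_autom)
 also have "... <= (LINT q|MF. et^2 * (CB 4 * area) * (PP (cosh et) q * 1))" proof (rule integral_mono)
  show "integrable MF (%q. (PP (cosh et) q)^2)" by (rule autom_MF(3)[OF PP_autom])
  show "integrable MF (%q. et^2 * (CB 4 * area) * (PP (cosh et) q * 1))" using autom_MF(2)[OF PP_autom] by simp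
  fix q assume "q : space MF"
  hence q: "q : H3" using Fh(2) by auto
  have "PP (cosh et) q <= th * (CB 4 * area)" unfolding c by (rule PP_small[OF q th(1,3)])
  also have "... <= et^2 * (CB 4 * area)" using th CB_nonneg area_nonneg by (intro mult_right_mono) auto
  finally show "(PP (cosh et) q)^2 <= et^2 * (CB 4 * area) * (PP (cosh et) q * 1)"
  unfolding power2_eq_square[of "PP (cosh et) q"] using PP_bounds[OF q, of "cosh et"] by (simp add: mult_right_mono)
 qed
 also have "... = et^2 * (CB 4 * area) * (LINT q|MF. PP (cosh et) q * 1)" by simp
 also have "(LINT q|MF. PP (cosh et) q * 1) = hvol et * area" using pp[OF one_eigen] area_eq by (simp add: mm_0)
 finally have le: "(SUM j:J. (mm (lam j) et * per j)^2) <= et^2 * (CB 4 * area) * (hvol et * area)" .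
 have "(SUM j:J. (hh (lam j) et * per j)^2) = (SUM j:J. (mm (lam j) et * per j)^2) / (hvol et)^2"
  by (simp add: hh_def sum_divide_distrib power_divide power_mult_distrib)
 also have "... <= et^2 * (CB 4 * area) * (hvol et * area) / (hvol et)^2" using le by (intro divide_right_mono) auto
 also have "... = CB 4 * area^2 * (et^2 / hvol et)" using hv by (simp add: power2_eq_square)
 also have "... <= CB 4 * area^2 * (1 / et)" proof (intro mult_left_mono)
  have "et^2 * et <= hvol et" using hvol_ge[of et] e by (simp add: power3_eq_cube power2_eq_square)
  thus "et^2 / hvol et <= 1 / et" using hv e by (simp add: field_simps)
 qed (use CB_nonneg in auto)
 finally show ?thesis by simp
qed

text \<open>Unfolding gives an inequality for every measurable set whose translates cover the plane.
  Applied both ways it shows that fundamental domains have equal area, see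
  \<open>area_unique\<close>.\<close>

lemma area_minimal:
 assumes E: "E : sets har" "(\<Union>ga\<in>H. act ga ` E) = plane" shows "emeasure har D <= emeasure har E" proof -
 have Ep: "E \<subseteq> plane" using E(1) by (simp add: in_sets_har)
 have "emeasure har D = (nn_integral MD (%x. 1))" proof -
  have "emeasure MD (space MD) = emeasure har D"
  unfolding space_MD unfolding MD_def by (rule emeasure_restrict_space) (use Dh in "auto simp: Int_absorb2")
  thus ?thesis by simp
 qed
 also have "... <= (nn_integral MD (%x. (nn_integral (count_space H) (%ga. indicator E (act ga x)))))"
 proof (rule nn_integral_mono)
  fix x assume "x : space MD"
  hence x: "x : plane" using Dh(2) by auto
  then obtain ga k where g: "ga : H" "k : E" "x = act ga k" using E(2) by blast
  have kH: "k : H3" using g Ep plane_H3 by blast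
  have gi: "ginv ga : H" using g subgroup.m_inv_closed[OF subH] by simp
  have "ga : carrier PSL2C" using g H_sub gc by blast
  from act_inv(1)[OF this kH] g have "act (ginv ga) x : E" by simp
  hence "(1::ennreal) = indicator E (act (ginv ga) x)" by simp
  also have "... <= (nn_integral (count_space H) (%ga. indicator E (act ga x)))" by (rule nn_integral_ge_point[OF gi])
  finally show "1 <= (nn_integral (count_space H) (%ga. indicator E (act ga x)))" .
 qed
 also have "... = (nn_integral har (%x. indicator E x))" by (rule nn_unfold_D) (use E in simp)
 also have "... = emeasure har E" using E by simp
 finally show ?thesis .
qed

end

section \<open>The smoothed count and its remainder\<close>

lemma GG_closed:
 assumes l: "l ~= 0" and Y: "Y >= 1" shows "GG l Y = 2 * (Y * Sf l (arcosh Y) - sqrt (Y^2 - 1) * Cf l (arcosh Y)) / l"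
proof -
 define R where "R = arcosh Y"
 have R: "R >= 0" "cosh R = Y" "sinh R = sqrt (Y^2 - 1)" using Y by (auto simp: R_def sinh_arcosh_real)
 define f where "f s = (cosh s * Sf l s - sinh s * Cf l s) / l" for s
 have "((%s. Sf l s * sinh s) has_integral f R - f 0) {0..R}" proof (rule ftc[OF R(1)])
  fix x
  have ch: "(cosh has_real_derivative sinh x) (at x)" by (auto intro!: derivative_eq_intros)
  have "((%s. (cosh s * Sf l s - sinh s * Cf l s) / l) has_real_derivative
  ((sinh x * Sf l x + Cf l x * cosh x) - (cosh x * Cf l x + (1 - l) * Sf l x * sinh x)) / l) (at x)"
  by (intro DERIV_cdivide DERIV_diff DERIV_mult DERIV_Sf DERIV_Cf DERIV_sinh' ch)
  moreover have "((sinh x * Sf l x + Cf l x * cosh x) - (cosh x * Cf l x + (1 - l) * Sf l x * sinh x)) / l = Sf l x * sinh x"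
  using l by (simp add: field_simps)
  ultimately show "(f has_vector_derivative Sf l x * sinh x) (at x within {0..R})"
  unfolding f_def[abs_def] by (simp add: real_vector_deriv has_vector_derivative_at_within)
 qed
 hence "integral {0..R} (%s. Sf l s * sinh s) = f R - f 0" by (rule integral_unique)
 thus ?thesis unfolding GG_alt R_def[symmetric] by (simp add: f_def R)
qed

lemma GG_diff:
 assumes "Y > 1" "de > 0" shows "((%y. 2 * Sf l (arcosh y)) has_integral GG l (Y + de) - GG l Y) {Y..Y + de}"
proof (rule ftc)
 fix y assume "y : {Y..Y + de}"
 hence "y > 1" using assms by simp
 from GG_deriv[OF this]
 show "(GG l has_vector_derivative 2 * Sf l (arcosh y)) (at y within {Y..Y + de})"
  unfolding real_vector_deriv by (rule has_vector_derivative_at_within)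
qed (use assms in simp)

text \<open>The large factor \<open>Y / de\<close> stands only before an integral of
  \<open>Sf\<close> over \<open>[Y, Y + de]\<close>, so that \<open>Y\<close> times an average
  results, of size independent of \<open>de\<close>. The other \<open>GG l Y\<close> is in closed
  form and carries \<open>1 / l\<close>. The phase \<open>- \<pi>/2\<close> writes sines as cosines,
  so that \<open>trig_mean_square\<close> covers all three terms.\<close>

lemma HH_trig:
 assumes l: "l > 37" and Y: "Y > 1" and d: "de > 0"
 defines "t \<equiv> sqrt (l - 1)"
 shows "HH l Y de = 2 * Y / de * integral {Y..Y + de} (%y. 1 / t * cos (t * arcosh y + - pi / 2))
  - 2 * Y * (1 / (t * l) * cos (t * arcosh Y + - pi / 2)) + 2 * sqrt (Y^2 - 1) * (1 / l * cos (t * arcosh Y + 0))"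
proof -
 have Sf: "Sf l r = 1 / t * cos (t * r + - pi / 2)" for r using l by (simp add: Sf_def t_def cos_diff)
 have Cf: "Cf l r = cos (t * r + 0)" for r using l by (simp add: Cf_def t_def)
 have "integral {Y..Y + de} (%y. 2 * Sf l (arcosh y)) = GG l (Y + de) - GG l Y"
  by (rule integral_unique[OF GG_diff[OF Y d]])
 hence a: "GG l (Y + de) - GG l Y = 2 * integral {Y..Y + de} (%y. 1 / t * cos (t * arcosh y + - pi / 2))"
  unfolding Sf by simp
 have b: "GG l Y = 2 * (Y * (1 / t * cos (t * arcosh Y + - pi / 2)) - sqrt (Y^2 - 1) * cos (t * arcosh Y + 0)) / l"
  unfolding Sf[symmetric] Cf[symmetric] by (rule GG_closed) (use l Y in auto)
 have "HH l Y de = Y / de * (GG l (Y + de) - GG l Y) - GG l Y" by (simp add: HH_def algebra_simps)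
 thus ?thesis unfolding a unfolding b by (simp add: diff_divide_distrib right_diff_distrib mult_ac)
qed

lemma continuous_on_GG: "continuous_on {1<..} (GG l)"
 by (rule DERIV_continuous_on[of _ "GG l" "%y. 2 * Sf l (arcosh y)"])
  (auto intro: has_field_derivative_at_within GG_deriv)

lemma continuous_on_HH: "de > 0 ==> A > 1 ==> continuous_on {A..B} (%Y. HH l Y de)" unfolding HH_def
 by (intro continuous_intros continuous_on_compose2[OF continuous_on_GG]) auto

text \<open>Each of the three sums from \<open>HH_trig\<close> has coefficients bounded by
  \<open>a j / t j\<close> and a factor of size \<open>X\<close> in front. The constant is
  \<open>192 * 3 * 128\<close>.\<close>

lemma HH_sum_mean_square:
 assumes J: "finite J" and l: "!!j. j : J ==> l j > 37" and X: "X > 0"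
  and A: "1 < A" "X / 2 <= A" "A <= B" "B + de <= 4 * X" and d: "de > 0"
 defines "t \<equiv> %j. sqrt (l j - 1)"
 shows "integral {A..B} (%Y. (SUM j:J. a j * HH (l j) Y de)^2) <= 73728 * X ^ 3 * QQ J (%j. a j / t j) t" proof -
 define cs where "cs j y = cos (t j * arcosh y + - pi / 2)" for j y
 define Ij where "Ij j Y = integral {Y..Y + de} (%y. 1 / t j * cs j y)" for j Y
 define S1 S2 S3 where "S1 y = (SUM j:J. a j / t j * cs j y)" and "S2 y = (SUM j:J. a j / (t j * l j) * cs j y)"
  and "S3 y = (SUM j:J. a j / l j * cos (t j * arcosh y + 0))" for y
 have t: "t j >= 1" "l j >= t j" "l j >= 1" if "j : J" for j proof -
  have "l j > 37" using l[OF that] .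
  moreover from this have "(t j)^2 = l j - 1" by (simp add: t_def)
  moreover show "t j >= 1" using l[OF that] by (simp add: t_def)
  moreover from this have "t j * 1 <= t j * t j" by (intro mult_left_mono) auto
  ultimately show "l j >= t j" "l j >= 1" by (auto simp: power2_eq_square)
 qed
 have cS: "continuous_on {A..C} S1" "continuous_on {A..C} S2" "continuous_on {A..C} S3" for C
  unfolding S1_def S2_def S3_def cs_def by (intro continuous_intros; use A in auto)+
 have Z: "(SUM j:J. a j * HH (l j) Y de) = 2 * Y / de * integral {Y..Y + de} S1 - 2 * Y * S2 Y + 2 * sqrt (Y^2 - 1) * S3 Y"
  if Y: "Y > 1" for Y proof -
  have "integral {Y..Y + de} S1 = (SUM j:J. integral {Y..Y + de} (%y. a j / t j * cs j y))"
  unfolding S1_def cs_def using Y by (intro integral_sum J integrable_continuous_real continuous_intros) auto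
  also have "... = (SUM j:J. a j * Ij j Y)" proof (rule sum.cong[OF refl])
  fix j
  have "integral {Y..Y + de} (%y. a j * (1 / t j * cs j y)) = a j * Ij j Y"
  unfolding Ij_def by (rule integral_mult_right)
  thus "integral {Y..Y + de} (%y. a j / t j * cs j y) = a j * Ij j Y" by simp
  qed
  finally have i1: "integral {Y..Y + de} S1 = (SUM j:J. a j * Ij j Y)" .
  have "(SUM j:J. a j * HH (l j) Y de) = (SUM j:J. 2 * Y / de * (a j * Ij j Y)
  - 2 * Y * (a j / (t j * l j) * cs j Y) + 2 * sqrt (Y^2 - 1) * (a j / l j * cos (t j * arcosh Y + 0)))"
  proof (rule sum.cong[OF refl])
  fix j assume j: "j : J"
  show "a j * HH (l j) Y de = 2 * Y / de * (a j * Ij j Y)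
  - 2 * Y * (a j / (t j * l j) * cs j Y) + 2 * sqrt (Y^2 - 1) * (a j / l j * cos (t j * arcosh Y + 0))" proof -
  have tj: "sqrt (l j - 1) = t j" by (simp add: t_def)
  show ?thesis
  unfolding HH_trig[OF l[OF j] Y d] tj cs_def[symmetric] Ij_def[symmetric] distrib_left right_diff_distrib by (simp add: mult_ac)
  qed
  qed
  also have "... = 2 * Y / de * integral {Y..Y + de} S1 - 2 * Y * S2 Y + 2 * sqrt (Y^2 - 1) * S3 Y"
  unfolding i1 S2_def S3_def by (simp only: sum.distrib sum_subtractf sum_distrib_left)
  finally show ?thesis .
 qed
 define W where "W Y = integral {Y..Y + de} (%y. (S1 y)^2)" for Y
 have pw: "(SUM j:J. a j * HH (l j) Y de)^2 <= 192 * X^2 * (1 / de * W Y + (S2 Y)^2 + (S3 Y)^2)"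
  if Y: "Y : {A..B}" for Y proof -
  have Y1: "Y > 1" "Y <= 4 * X" using Y A d by auto
  have YX: "Y^2 <= 16 * X^2" using power_mono[OF Y1(2), of 2] Y1 by (simp add: power_mult_distrib)
  have three: "(u - v + w)^2 <= 3 * (u^2 + v^2 + w^2)" for u v w :: real proof -
  have "3 * (u^2 + v^2 + w^2) - (u - v + w)^2 = (u + v)^2 + (u - w)^2 + (v + w)^2" by (simp add: power2_eq_square algebra_simps)
  thus ?thesis by (metis diff_ge_0_iff_ge add_nonneg_nonneg zero_le_power2)
  qed
  have c1: "(2 * Y / de * integral {Y..Y + de} S1)^2 <= 64 * X^2 * (1 / de * W Y)" proof -
  have c: "continuous_on {Y..Y + de} S1" using cS(1)[of "Y + de"] by (rule continuous_on_subset) (use Y in auto)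
  have i0: "0 <= W Y"
  unfolding W_def by (rule integral_nonneg) (auto intro!: integrable_continuous_real continuous_intros c)
  have "(2 * Y / de * integral {Y..Y + de} S1)^2 = 4 * Y^2 / de^2 * (integral {Y..Y + de} S1)^2"
  by (simp add: power_mult_distrib power_divide)
  also have "... <= 4 * Y^2 / de^2 * (de * W Y)" unfolding W_def by (intro mult_left_mono integral_cs d c) auto
  also have "... = 4 * Y^2 * (1 / de * W Y)" using d by (simp add: power2_eq_square)
  also have "... <= 64 * X^2 * (1 / de * W Y)" using YX d i0 by (intro mult_right_mono) auto
  finally show ?thesis .
  qed
  have c2: "(2 * Y * S2 Y)^2 <= 64 * X^2 * (S2 Y)^2"
  unfolding power_mult_distrib using YX by (intro mult_right_mono) auto
  have c3: "(2 * sqrt (Y^2 - 1) * S3 Y)^2 <= 64 * X^2 * (S3 Y)^2"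
  unfolding power_mult_distrib using YX sq_gt_1[OF Y1(1)] by (intro mult_right_mono) auto
  have "(SUM j:J. a j * HH (l j) Y de)^2 <= 3 * ((2 * Y / de * integral {Y..Y + de} S1)^2 + (2 * Y * S2 Y)^2 + (2 * sqrt (Y^2 - 1) * S3 Y)^2)"
  unfolding Z[OF Y1(1)] by (rule three)
  also have "... <= 3 * (64 * X^2 * (1 / de * W Y) + 64 * X^2 * (S2 Y)^2 + 64 * X^2 * (S3 Y)^2)"
  by (intro mult_left_mono add_mono c1 c2 c3) auto
  also have "... = 192 * X^2 * (1 / de * W Y + (S2 Y)^2 + (S3 Y)^2)" unfolding distrib_left by simp
  finally show ?thesis .
 qed
 have sa: "integral {A..B} W <= de * integral {A..B + de} (%y. (S1 y)^2)"
  "W integrable_on {A..B}" using sliding_average[OF A(3) d, of "%y. (S1 y)^2"] cS(1)[of "B + de"]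
  unfolding W_def[abs_def] by (auto intro!: continuous_intros)
 have i2: "(%Y. (S2 Y)^2) integrable_on {A..B}" "(%Y. (S3 Y)^2) integrable_on {A..B}"
  by (intro integrable_continuous_real continuous_intros cS)+
 have hi: "((%Y. 192 * X^2 * (1 / de * W Y + (S2 Y)^2 + (S3 Y)^2)) has_integral
  192 * X^2 * (1 / de * integral {A..B} W + integral {A..B} (%Y. (S2 Y)^2) + integral {A..B} (%Y. (S3 Y)^2))) {A..B}"
  by (intro has_integral_mult_right has_integral_add integrable_integral sa(2) i2)
 let ?Q = "128 * X * QQ J (%j. a j / t j) t"
 have q: "128 * X * QQ J b t <= ?Q" if "!!j. j : J ==> \<bar>b j\<bar> <= \<bar>a j / t j\<bar>" for b
  using X QQ_mono[OF that] by (intro mult_left_mono) auto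
 have "integral {A..B} (%Y. (SUM j:J. a j * HH (l j) Y de)^2) \<le>
  192 * X^2 * (1 / de * integral {A..B} W + integral {A..B} (%Y. (S2 Y)^2) + integral {A..B} (%Y. (S3 Y)^2))"
 proof (rule integral_le[where g = "%Y. 192 * X^2 * (1 / de * W Y + (S2 Y)^2 + (S3 Y)^2)" and S = "{A..B}", THEN order_trans])
  show "(%Y. (SUM j:J. a j * HH (l j) Y de)^2) integrable_on {A..B}"
  by (intro integrable_continuous_real continuous_intros continuous_on_HH d A)
  show "(%Y. 192 * X^2 * (1 / de * W Y + (S2 Y)^2 + (S3 Y)^2)) integrable_on {A..B}"
  using hi by (auto simp: integrable_on_def)
 qed (use pw integral_unique[OF hi] in auto)
 also have "... <= 192 * X^2 * (?Q + ?Q + ?Q)" proof (intro mult_left_mono add_mono)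
  have t0: "t j >= 0" if "j : J" for j using t(1)[OF that] by simp
  have "1 / de * integral {A..B} W <= 1 / de * (de * integral {A..B + de} (%y. (S1 y)^2))"
  using d by (intro mult_left_mono sa(1)) auto
  also have "... = integral {A..B + de} (%y. (S1 y)^2)" using d by simp
  also have "... <= ?Q" unfolding S1_def cs_def by (rule trig_mean_square[OF J t0 X]) (use A d in auto)
  finally show "1 / de * integral {A..B} W <= ?Q" .
  have "integral {A..B} (%y. (S2 y)^2) <= 128 * X * QQ J (%j. a j / (t j * l j)) t"
  unfolding S2_def cs_def by (rule trig_mean_square[OF J t0 X]) (use A d in auto)
  also have "... <= ?Q" proof (rule q)
  fix j assume j: "j : J"
  have "t j * 1 <= t j * l j" using t[OF j] by (intro mult_left_mono) auto
  thus "\<bar>a j / (t j * l j)\<bar> <= \<bar>a j / t j\<bar>" unfolding abs_divide using t[OF j] by (intro divide_left_mono) auto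
  qed
  finally show "integral {A..B} (%y. (S2 y)^2) <= ?Q" .
  have "integral {A..B} (%y. (S3 y)^2) <= 128 * X * QQ J (%j. a j / l j) t"
  unfolding S3_def by (rule trig_mean_square[OF J t0 X]) (use A d in auto)
  also have "... <= ?Q" proof (rule q)
  fix j assume j: "j : J"
  show "\<bar>a j / l j\<bar> <= \<bar>a j / t j\<bar>" unfolding abs_divide using t[OF j] by (intro divide_left_mono) auto
  qed
  finally show "integral {A..B} (%y. (S3 y)^2) <= ?Q" .
 qed auto
 also have "... = 73728 * X ^ 3 * QQ J (%j. a j / t j) t" by (simp add: power2_eq_square power3_eq_cube)
 finally show ?thesis .
qed

section \<open>The smoothed count and its expansion\<close>

context spectral
begin

lemma autom_lincomb: "autom f ==> autom g ==> autom (%q. a * f q + b * g q)" proof -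
 assume f: "autom f" and g: "autom g"
 obtain M N where M: "ALL q:H3. \<bar>f q\<bar> <= M" and N: "ALL q:H3. \<bar>g q\<bar> <= N" using f g by (auto simp: autom_def)
 have "\<bar>a * f q + b * g q\<bar> <= \<bar>a\<bar> * M + \<bar>b\<bar> * N" if "q : H3" for q
  using M N that by (intro abs_triangle_ineq[THEN order_trans] add_mono) (auto simp: abs_mult mult_left_mono)
 hence "\<exists>M. ALL q:H3. \<bar>a * f q + b * g q\<bar> <= M" by blast
 moreover have "(%q. a * f q + b * g q) : borel_measurable hv" using f g by (auto simp: autom_def)
 moreover have "invariant Ga (%q. a * f q + b * g q)" using f g by (simp add: autom_def invariant_def)
 ultimately show ?thesis unfolding autom_def by blast
qed

lemma NN_form: "NN Y de = (%q. Y / de / (2 * pi) * PP (Y + de) q + (- ((Y / de + 1) / (2 * pi))) * PP Y q)"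
 by (rule ext) (simp add: NN_def diff_divide_distrib)

lemma NN_autom: "autom (NN Y de)" unfolding NN_form by (rule autom_lincomb[OF PP_autom PP_autom])

text \<open>The average of \<open>NN Y de\<close> over the ball of radius \<open>et\<close> around
  \<open>p\<close>, folded to \<open>F\<close>.\<close>

definition BB :: "point => real => real => real => real" where
 "BB p de et Y = (LINT q|MF. NN Y de q * AK (indicator {..cosh et}) p q) / hvol et"

text \<open>Points of the ball satisfy \<open>wd \<le> cosh et \<le> 1 + (2 et)^2 / 2\<close>, so
  \<open>count_N_close\<close> applies with \<open>e = 2 et\<close> and stretches the radius by
  \<open>1 + 10 et\<close>. The kernel is a non-negative weight of total mass
  \<open>hvol et\<close>.\<close>

lemma BB_sandwich:
 assumes p: "p : H3" and Y: "Y > 0" and d: "de > 0" and e: "0 < et" "et <= 1 / 2"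
 shows "real (count_N Ga p (Y / (1 + 10 * et))) <= BB p de et Y"
  "BB p de et Y <= real (count_N Ga p ((1 + 10 * et) * (Y + de)))" proof -
 let ?K = "AK (indicator {..cosh et}) p"
 define L U where "L = real (count_N Ga p (Y / (1 + 10 * et)))" and "U = real (count_N Ga p ((1 + 10 * et) * (Y + de)))"
 have hv: "hvol et > 0" by (rule hvol_pos[OF e(1)])
 have kK: "autom ?K" by (rule AK_autom[OF kern_ind p])
 have pw: "L * ?K q <= NN Y de q * ?K q & NN Y de q * ?K q <= U * ?K q" if q: "q : H3" for q proof -
  have K0: "?K q >= 0" unfolding AK_eq[OF kern_ind p q] by (simp add: sum_nonneg)
  show ?thesis proof (cases "{ga : Ga. wd p (act ga q) <= cosh et} = {}")
  case True
  hence "?K q = 0" unfolding AK_eq[OF kern_ind p q] by (simp only: sum.empty)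
  thus ?thesis by simp
  next
  case False
  then obtain ga where g: "ga : Ga" "wd p (act ga q) <= cosh et" by blast
  define r where "r = act ga q"
  have r: "r : H3" unfolding r_def by (rule act_H3[OF gc[OF g(1)] q])
  have "cosh et <= 1 + et^2" using cosh_le_quad[of et] e by simp
  also have "... <= 1 + (2 * et)^2 / 2" by (simp add: power_mult_distrib)
  finally have w: "wd p r <= 1 + (2 * et)^2 / 2" "wd r p <= 1 + (2 * et)^2 / 2" using g(2) by (auto simp: r_def wd_commute)
  have Nr: "NN Y de q = NN Y de r" using NN_autom g(1) q by (simp add: autom_def invariant_def r_def)
  have "L <= real (count_N Ga r Y)"
  using count_N_close[OF p r _ _ w(1), of "Y / (1 + 10 * et)"] e by (simp add: L_def)
  hence "L <= NN Y de q" using NN_bounds(1)[OF r Y d] Nr by linarith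
  moreover have "real (count_N Ga r (Y + de)) <= U"
  using count_N_close[OF r p _ _ w(2), of "Y + de"] e by (simp add: U_def)
  hence "NN Y de q <= U" using NN_bounds(2)[OF r Y d] Nr by linarith
  ultimately show ?thesis using K0 by (auto intro: mult_right_mono)
  qed
 qed
 have sp: "q : H3" if "q : space MF" for q using that Fh(2) by auto
 have iK: "integrable MF ?K" by (rule autom_MF(2)[OF kK])
 have iN: "integrable MF (%q. NN Y de q * ?K q)" by (intro prod_L2 autom_MF NN_autom kK)
 have K1: "(LINT q|MF. ?K q) = hvol et" using ball_pair[OF one_eigen p e(1)] by (simp add: mm_0)
 have "(LINT q|MF. L * ?K q) <= (LINT q|MF. NN Y de q * ?K q)" by (rule integral_mono) (use iK iN pw sp in auto)
 thus "real (count_N Ga p (Y / (1 + 10 * et))) <= BB p de et Y"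
  using hv by (simp add: BB_def K1 L_def[symmetric] le_divide_eq)
 have "(LINT q|MF. NN Y de q * ?K q) <= (LINT q|MF. U * ?K q)" by (rule integral_mono) (use iK iN pw sp in auto)
 thus "BB p de et Y <= real (count_N Ga p ((1 + 10 * et) * (Y + de)))"
  using hv by (simp add: BB_def K1 U_def[symmetric] divide_le_eq)
qed

definition aa :: "point => real => nat => real" where
 "aa p et j = hh (lam j) et * per j * u j p"

lemma NN_coeff:
 assumes Y: "Y > 1" and d: "de > 0" shows "(LINT q|MF. NN Y de q * u j q) = HH (lam j) Y de * per j" proof -
 have c: "(LINT q|MF. PP W q * u j q) = 2 * pi * GG (lam j) W * per j" if "W > 1" for W proof -
  have "(LINT q|MF. PP (cosh (arcosh W)) q * u j q) = mm (lam j) (arcosh W) * per j"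
  unfolding per_def by (rule PP_pair[OF eigen_autom[OF u_eig] ball_pair[OF u_eig _ arcosh_pos[OF that]]])
  thus ?thesis using that by (simp add: GG_def)
 qed
 have i: "integrable MF (%q. PP W q * u j q)" for W by (intro prod_L2 autom_MF PP_autom eigen_autom[OF u_eig])
 have "(LINT q|MF. NN Y de q * u j q) =
  (LINT q|MF. Y / de / (2 * pi) * (PP (Y + de) q * u j q) + (- ((Y / de + 1) / (2 * pi))) * (PP Y q * u j q))"
  unfolding NN_form distrib_right mult.assoc ..
 also have "... = Y / de / (2 * pi) * (LINT q|MF. PP (Y + de) q * u j q) + (- ((Y / de + 1) / (2 * pi))) * (LINT q|MF. PP Y q * u j q)"
  by (subst Bochner_Integration.integral_add) (use i in auto)
 also have "... = HH (lam j) Y de * per j" proof -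
  have "Y + de > 1" using Y d by simp
  thus ?thesis unfolding c[OF Y] c[OF \<open>Y + de > 1\<close>] by (simp add: HH_def left_diff_distrib right_diff_distrib mult_ac)
 qed
 finally show ?thesis .
qed

text \<open>\<open>BB\<close> is a pairing of two bounded invariant functions, so Parseval's
  identity gives the expansion for every single \<open>Y\<close>.\<close>

lemma BB_sums:
 assumes p: "p : H3" and Y: "Y > 1" and d: "de > 0" and e: "0 < et"
 shows "(%j. aa p et j * HH (lam j) Y de) sums BB p de et Y" proof -
 have "(%j. (LINT q|MF. NN Y de q * u j q) * (LINT q|MF. AK (indicator {..cosh et}) p q * u j q)) sums
  (LINT q|MF. NN Y de q * AK (indicator {..cosh et}) p q)"
  by (rule spectral_parseval[OF NN_autom AK_autom[OF kern_ind p]])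
 from sums_divide[OF this, of "hvol et"]
 show ?thesis unfolding NN_coeff[OF Y d] ball_pair[OF u_eig p e] BB_def aa_def hh_def by (simp add: mult_ac)
qed

definition low :: "nat set" where "low = {j. lam j <= 37}"

text \<open>All eigenvalues up to 37 are removed, not only those below 1: the remaining frequencies
  are at least 6, where \<open>window_bound\<close> holds and the division by \<open>tt j\<close> is
  harmless.\<close>

definition ZZ :: "point => real => real => real => real" where
 "ZZ p de et Y = BB p de et Y - (SUM j:low. aa p et j * HH (lam j) Y de)"

lemma ZZ_limit:
 assumes p: "p : H3" and Y: "Y > 1" and d: "de > 0" and e: "0 < et"
 shows "(%n. SUM j:{..<n} - low. aa p et j * HH (lam j) Y de) \<longlonglongrightarrow> ZZ p de et Y" proof -
 let ?f = "%j. aa p et j * HH (lam j) Y de"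
 have fl: "finite low" using finite_low by (simp add: low_def)
 obtain N where N: "ALL j:low. j < N" using finite_nat_set_iff_bounded[of low] fl by auto
 have "(%n. (\<Sum>j<n. ?f j) - (SUM j:low. ?f j)) \<longlonglongrightarrow> ZZ p de et Y"
  unfolding ZZ_def using BB_sums[OF assms] by (intro tendsto_diff tendsto_const) (simp add: sums_def)
 moreover have "eventually (%n. (\<Sum>j<n. ?f j) - (SUM j:low. ?f j) = (SUM j:{..<n} - low. ?f j)) sequentially"
  unfolding eventually_sequentially proof (intro exI[of _ N] allI impI)
  fix n assume "N <= n"
  hence "low \<subseteq> {..<n}" using N by force
  thus "(\<Sum>j<n. ?f j) - (SUM j:low. ?f j) = (SUM j:{..<n} - low. ?f j)" by (simp add: sum_diff)
 qed
 ultimately show ?thesis by (rule Lim_transform_eventually)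
qed

definition KZ :: real where "KZ = 73728 * (9 * pi * CW) * CB 4"

text \<open>The bounds for partial sums do not depend on their length, and Fatou's lemma passes to
  the limit. The radius \<open>et\<close> enters through \<open>period_bessel\<close> only.\<close>

lemma ZZ_mean_square:
 assumes p: "p : H3" and d: "de > 0" and e: "0 < et" "et <= 1" and X: "X > 0"
  and A: "1 < A" "X / 2 <= A" "A <= B" "B + de <= 4 * X"
 shows "(nn_integral lborel (%Y. ennreal ((ZZ p de et Y)^2) * indicator {A..B} Y)) <= ennreal (KZ * area^2 * X ^ 3 / et)"
  "(%Y. ennreal ((ZZ p de et Y)^2) * indicator {A..B} Y) : borel_measurable borel" proof -
 define f where "f n Y = (SUM j:{..<n} - low. aa p et j * HH (lam j) Y de)" for n Y
 have cf: "continuous_on {A..B} (f n)" for n unfolding f_def by (intro continuous_intros continuous_on_HH d A)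
 have lim: "(%n. ennreal ((f n Y)^2) * indicator {A..B} Y) \<longlonglongrightarrow> ennreal ((ZZ p de et Y)^2) * indicator {A..B} Y" for Y
 proof (cases "Y : {A..B}")
  case True
  hence Y: "Y > 1" using A by simp
  have "(%n. ennreal ((f n Y)^2)) \<longlonglongrightarrow> ennreal ((ZZ p de et Y)^2)"
  unfolding f_def by (intro tendsto_intros ZZ_limit p Y d e)
  thus ?thesis using True by simp
 qed simp
 have fm: "(%Y. ennreal ((f n Y)^2) * indicator {A..B} Y) : borel_measurable borel" for n proof -
  have "(%Y. indicator {A..B} Y *\<^sub>R (f n Y)^2) : borel_measurable borel"
  by (intro borel_measurable_continuous_on_indicator continuous_intros cf) auto
  hence "(%Y. ennreal (indicator {A..B} Y *\<^sub>R (f n Y)^2)) : borel_measurable borel" by measurable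
  moreover have "(%Y. ennreal (indicator {A..B} Y *\<^sub>R (f n Y)^2)) = (%Y. ennreal ((f n Y)^2) * indicator {A..B} Y)"
  by (auto simp: indicator_def fun_eq_iff)
  ultimately show ?thesis by (simp only:)
 qed
 show "(%Y. ennreal ((ZZ p de et Y)^2) * indicator {A..B} Y) : borel_measurable borel"
  by (rule borel_measurable_LIMSEQ_order[OF lim fm])
 have bound: "(nn_integral lborel (%Y. ennreal ((f n Y)^2) * indicator {A..B} Y)) <= ennreal (KZ * area^2 * X ^ 3 / et)" for n
 proof -
  define J where "J = {..<n} - low"
  have J: "finite J" "lam j > 37" if "j : J" for j using that by (auto simp: J_def low_def)
  have fJ: "finite J" by (simp add: J_def)
  have tj: "tt j >= 6" if "j : J" for j using J(2)[OF that] unfolding tt_def by (intro real_le_rsqrt) simp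
  have Qe: "(%j. aa p et j / tt j) = (%j. hh (lam j) et * per j * u j p / tt j)" by (simp add: aa_def)
  have "QQ J (%j. aa p et j / tt j) tt <= 9 * pi * CW * (SUM j:J. (hh (lam j) et * per j)^2)" unfolding Qe
  proof (rule QQ_window[OF fJ _ CW_nonneg])
  show "tt j >= 1" if "j : J" for j using tj[OF that] by simp
  fix m :: nat assume m: "m >= 1"
  show "(SUM k:{k : J. real m <= tt k & tt k < real m + 1}. (u k p)^2) <= CW * (real m)^2" proof (cases "m >= 6")
  case True
  show ?thesis by (rule window_bound[OF p _ True]) (use fJ J(2) in auto)
  next
  case False
  hence "real m + 1 <= 6" by linarith
  hence "{k : J. real m <= tt k & tt k < real m + 1} = {}" using tj by force
  thus ?thesis using CW_nonneg by (simp only: sum.empty) simp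
  qed
  qed
  also have "... <= 9 * pi * CW * (CB 4 * area^2 / et)"
  using CW_nonneg by (intro mult_left_mono period_bessel fJ e) auto
  finally have Q: "QQ J (%j. aa p et j / tt j) tt <= 9 * pi * CW * (CB 4 * area^2 / et)" .
  have "integral {A..B} (%Y. (f n Y)^2) <= 73728 * X ^ 3 * QQ J (%j. aa p et j / tt j) tt"
  unfolding f_def J_def[symmetric] tt_def by (rule HH_sum_mean_square[OF fJ _ X A d]) (use J(2) in auto)
  also have "... <= 73728 * X ^ 3 * (9 * pi * CW * (CB 4 * area^2 / et))" using X by (intro mult_left_mono Q) auto
  also have "... = KZ * area^2 * X ^ 3 / et" by (simp add: KZ_def mult_ac)
  finally have le: "integral {A..B} (%Y. (f n Y)^2) <= KZ * area^2 * X ^ 3 / et" .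
  have "(nn_integral lborel (%Y. ennreal ((f n Y)^2) * indicator {A..B} Y)) = ennreal (integral {A..B} (%Y. (f n Y)^2))"
  by (rule nn_integral_has_integral_lebesgue') (auto intro!: integrable_integral integrable_continuous_real continuous_intros cf)
  thus ?thesis using le by (simp add: ennreal_leI)
 qed
 have "(nn_integral lborel (%Y. ennreal ((ZZ p de et Y)^2) * indicator {A..B} Y)) =
  (nn_integral lborel (%Y. liminf (%n. ennreal ((f n Y)^2) * indicator {A..B} Y)))"
  by (intro nn_integral_cong lim_imp_Liminf[symmetric] lim) simp
 also have "... <= liminf (%n. \<integral>\<^sup>+Y. ennreal ((f n Y)^2) * indicator {A..B} Y \<partial>lborel)"
  by (rule nn_integral_liminf) (use fm in simp)
 also have "... <= ennreal (KZ * area^2 * X ^ 3 / et)" by (rule Liminf_le) (auto intro!: always_eventually bound)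
 finally show "(nn_integral lborel (%Y. ennreal ((ZZ p de et Y)^2) * indicator {A..B} Y)) <= ennreal (KZ * area^2 * X ^ 3 / et)" .
qed

text \<open>The main term. Summing over all of \<open>low\<close> adds nothing to it, since
  \<open>mj\<close> vanishes for eigenvalues from 1 on.\<close>

definition MJ :: "point => real => real" where
 "MJ p Y = (SUM j:low. mj (lam j) Y * (per j * u j p))"

lemma low_weighted:
 assumes p: "p : H3" and c: "!!j. j : low ==> \<bar>c j\<bar> <= K" and K: "K >= 0"
 shows "\<bar>SUM j:low. c j * (per j * u j p)\<bar> <= K * (area * CL)" proof -
 have "\<bar>SUM j:low. c j * (per j * u j p)\<bar> <= (SUM j:low. K * \<bar>per j * u j p\<bar>)"
  by (rule sum_abs[THEN order_trans], rule sum_mono) (use c in "auto simp: abs_mult intro!: mult_right_mono")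
 also have "... = K * (SUM j:low. \<bar>per j * u j p\<bar>)" by (rule sum_distrib_left[symmetric])
 also have "... <= K * (area * CL)" using K by (intro mult_left_mono low_period p) (auto simp: low_def)
 finally show ?thesis .
qed

text \<open>\<open>HH_small\<close> accounts for the smoothing of the radius and
  \<open>hh_near_1\<close> for the smoothing at \<open>p\<close>; both are uniform in the
  eigenvalue, so \<open>low_weighted\<close> sums them.\<close>

lemma BB_main:
 assumes p: "p : H3" and Y: "Y >= 11 / 10" and d: "de > 0" and e: "0 < et" "et <= 1"
 shows "\<bar>BB p de et Y - MJ p Y - ZZ p de et Y\<bar> <= (4 * Y + 6 * Y * de + et^2 * (2 * Y^2)) * (area * CL)"
proof -
 have "BB p de et Y - MJ p Y - ZZ p de et Y = (SUM j:low. (hh (lam j) et * HH (lam j) Y de - mj (lam j) Y) * (per j * u j p))"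
  unfolding ZZ_def MJ_def aa_def by (simp add: left_diff_distrib right_diff_distrib sum_subtractf mult_ac)
 also have "\<bar>...\<bar> <= (4 * Y + 6 * Y * de + et^2 * (2 * Y^2)) * (area * CL)" proof (rule low_weighted[OF p])
  fix j
  have l: "lam j >= 0" by (rule lam_nonneg)
  have a: "\<bar>hh (lam j) et * (HH (lam j) Y de - mj (lam j) Y)\<bar> <= 1 * (4 * Y + 6 * Y * de)"
  unfolding abs_mult using hh_abs_le[OF l e(1)] HH_small[OF l Y d] by (intro mult_mono) auto
  have b: "\<bar>(hh (lam j) et - 1) * mj (lam j) Y\<bar> <= et^2 * (2 * Y^2)" proof (cases "lam j < 1")
  case True
  have "\<bar>mj (lam j) Y\<bar> <= 2 * Y^2" using mj_nonneg[of "lam j" Y] mj_le[OF l, of Y] Y by simp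
  thus ?thesis unfolding abs_mult using hh_near_1[OF l _ e] True by (intro mult_mono) auto
  qed (simp add: mj_def)
  have "hh (lam j) et * HH (lam j) Y de - mj (lam j) Y =
  hh (lam j) et * (HH (lam j) Y de - mj (lam j) Y) + (hh (lam j) et - 1) * mj (lam j) Y" by (simp add: algebra_simps)
  thus "\<bar>hh (lam j) et * HH (lam j) Y de - mj (lam j) Y\<bar> <= 4 * Y + 6 * Y * de + et^2 * (2 * Y^2)" proof -
  have add: "\<bar>z\<bar> <= P + Q" if "z = v + w" "\<bar>v\<bar> <= 1 * P" "\<bar>w\<bar> <= Q" for v w z P Q :: real using that by linarith
  assume "hh (lam j) et * HH (lam j) Y de - mj (lam j) Y =
  hh (lam j) et * (HH (lam j) Y de - mj (lam j) Y) + (hh (lam j) et - 1) * mj (lam j) Y"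
  from add[OF this a b] show ?thesis .
  qed
 qed (use Y d in auto)
 finally show ?thesis .
qed

lemma MJ_diff:
 assumes p: "p : H3" and x: "1 <= x" "x <= M" "1 <= Y" "Y <= M"
 shows "\<bar>MJ p Y - MJ p x\<bar> <= 2 * M * \<bar>Y - x\<bar> * (area * CL)" proof -
 have "MJ p Y - MJ p x = (SUM j:low. (mj (lam j) Y - mj (lam j) x) * (per j * u j p))"
  by (simp add: MJ_def left_diff_distrib sum_subtractf)
 also have "\<bar>...\<bar> <= 2 * M * \<bar>Y - x\<bar> * (area * CL)"
  by (rule low_weighted[OF p mj_diff[OF lam_nonneg x]]) (use x in auto)
 finally show ?thesis .
qed

end

section \<open>The mean square of the error term\<close>

text \<open>The half-open intervals of length \<open>De\<close> that start at the points are
  disjoint, so each \<open>Y\<close> is charged at most once.\<close>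

lemma separated_sum:
 fixes y e :: "nat => real" assumes K: "finite K" and D: "De > 0"
  and sep: "!!k l. k : K ==> l : K ==> k ~= l ==> \<bar>y k - y l\<bar> >= De"
  and le: "!!k Y. k : K ==> y k <= Y ==> Y < y k + De ==> ennreal (e k) <= g Y"
 shows "(SUM k:K. ennreal (e k) * ennreal De) <= (nn_integral lborel (%Y. g Y))" proof -
 have "(SUM k:K. ennreal (e k) * ennreal De) = (SUM k:K. \<integral>\<^sup>+Y. ennreal (e k) * indicator {y k..<y k + De} Y \<partial>lborel)"
  by (rule sum.cong[OF refl]) (use D in "simp add: nn_integral_cmult_indicator")
 also have "... = (nn_integral lborel (%Y. (SUM k:K. ennreal (e k) * indicator {y k..<y k + De} Y)))"
  by (rule nn_integral_sum[symmetric]) simp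
 also have "... <= (nn_integral lborel (%Y. g Y))" proof (rule nn_integral_mono)
  fix Y :: real
  show "(SUM k:K. ennreal (e k) * indicator {y k..<y k + De} Y) <= g Y"
  proof (cases "EX k:K. y k <= Y & Y < y k + De")
  case True
  then obtain k where k: "k : K" "y k <= Y" "Y < y k + De" by blast
  have "(SUM l:K - {k}. ennreal (e l) * indicator {y l..<y l + De} Y) = 0" proof (intro sum.neutral ballI)
  fix l assume "l : K - {k}"
  hence "\<bar>y k - y l\<bar> >= De" using sep[OF k(1)] by auto
  hence "Y ~: {y l..<y l + De}" using k by auto
  thus "ennreal (e l) * indicator {y l..<y l + De} Y = 0" by simp
  qed
  hence "(SUM k:K. ennreal (e k) * indicator {y k..<y k + De} Y) = ennreal (e k)"
  using k by (subst sum.remove[OF K k(1)]) simp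
  thus ?thesis using le[OF k] by simp
  next
  case False
  hence "(SUM k:K. ennreal (e k) * indicator {y k..<y k + De} Y) = 0"
  by (intro sum.neutral ballI) (auto simp: indicator_def)
  thus ?thesis by simp
  qed
 qed
 finally show ?thesis .
qed

context spectral
begin

text \<open>The quadratic equation leaves \<open>1 + r\<close> and \<open>1 - r\<close> with
  \<open>r > 0\<close>; the normalisation \<open>Re (s j) \<ge> 1\<close> selects the first.\<close>

lemma s_real:
 assumes "0 <= lam j" "lam j < 1" shows "s j = complex_of_real (1 + sqrt (1 - lam j))" proof -
 have "complex_of_real (lam j) = s j * (2 - s j)" "Re (s j) >= 1" using ES by (auto simp: eigen_system_def)
 moreover define r where "r = sqrt (1 - lam j)"
 moreover have "r > 0" "r^2 = 1 - lam j" using assms by (auto simp: r_def)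
 ultimately have "(s j - 1 - complex_of_real r) * (s j - 1 + complex_of_real r) = 0" "Re (s j) >= 1" "r > 0" proof -
  assume a: "complex_of_real (lam j) = s j * (2 - s j)" "r^2 = 1 - lam j" "Re (s j) >= 1" "r > 0"
  have "complex_of_real r * complex_of_real r = 1 - complex_of_real (lam j)"
  using a(2) by (metis of_real_1 of_real_diff of_real_mult power2_eq_square)
  thus "(s j - 1 - complex_of_real r) * (s j - 1 + complex_of_real r) = 0" "Re (s j) >= 1" "r > 0"
  using a by (simp_all add: algebra_simps)
 qed
 hence "s j - 1 - complex_of_real r = 0 \<or> s j - 1 + complex_of_real r = 0" "Re (s j) >= 1" "r > 0"
  unfolding mult_eq_0_iff by blast+
 hence "s j = complex_of_real (1 + r) \<or> s j = complex_of_real (1 - r)" "Re (s j) >= 1" "r > 0"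
  by (auto simp: complex_eq_iff)
 thus ?thesis unfolding r_def by auto
qed

text \<open>The eigenvalue 0, that is \<open>s = 2\<close>, gives the term in \<open>X^2\<close> by
  \<open>zero_mode\<close>; exponents strictly between 1 and 2 correspond to eigenvalues strictly
  between 0 and 1.\<close>

lemma main_M_eq:
 assumes p: "p : H3" and X: "X > 0" shows "main_M F D u s p X = MJ p X" proof -
 obtain j0 where j0: "lam j0 = 0" "!!j. lam j = 0 ==> j = j0" "!!q. q : H3 ==> (LINT z|MD. u j0 z) * u j0 q = area / vol"
  using zero_mode by blast
 define S where "S = {j. 0 < lam j & lam j < 1}"
 have S: "{j. s j : \<real> & 1 < Re (s j) & Re (s j) < 2} = S" proof (intro equalityI subsetI)
  fix j assume "j : {j. s j : \<real> & 1 < Re (s j) & Re (s j) < 2}"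
  then obtain a where a: "s j = complex_of_real a" "1 < a" "a < 2" by (auto elim!: Reals_cases)
  have "complex_of_real (lam j) = s j * (2 - s j)" using ES by (auto simp: eigen_system_def)
  hence "complex_of_real (lam j) = complex_of_real (a * (2 - a))" unfolding a(1) by simp
  hence "lam j = a * (2 - a)" by (simp only: of_real_eq_iff)
  moreover have "0 < a * (2 - a)" using a by simp
  moreover have "a * (2 - a) < 1" proof -
  have "1 - a * (2 - a) = (a - 1)^2" by (simp add: power2_eq_square algebra_simps)
  moreover have "(a - 1)^2 > 0" using a by simp
  ultimately show ?thesis by linarith
  qed
  ultimately show "j : S" by (simp add: S_def)
 next
  fix j assume "j : S"
  hence l: "0 < lam j" "lam j < 1" by (auto simp: S_def)
  hence "s j = complex_of_real (1 + sqrt (1 - lam j))" by (intro s_real) auto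
  thus "j : {j. s j : \<real> & 1 < Re (s j) & Re (s j) < 2}" using l by simp
 qed
 have fS: "finite S" by (rule finite_subset[OF _ finite_low]) (auto simp: S_def)
 have fl: "finite low" using finite_low by (simp add: low_def)
 have "MJ p X = (SUM j:insert j0 S. mj (lam j) X * (per j * u j p))" unfolding MJ_def
 proof (rule sum.mono_neutral_right[OF fl])
  show "insert j0 S \<subseteq> low" using j0(1) by (auto simp: S_def low_def)
  show "ALL j:low - insert j0 S. mj (lam j) X * (per j * u j p) = 0" proof
  fix j assume "j : low - insert j0 S"
  hence "~ lam j < 1" using j0(2)[of j] lam_nonneg[of j] by (auto simp: S_def)
  thus "mj (lam j) X * (per j * u j p) = 0" by (simp add: mj_def)
  qed
 qed
 also have "... = mj (lam j0) X * (per j0 * u j0 p) + (SUM j:S. mj (lam j) X * (per j * u j p))"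
  using fS j0(1) by (subst sum.insert) (auto simp: S_def)
 also have "mj (lam j0) X * (per j0 * u j0 p) = area / vol * X^2"
  using j0(1) j0(3)[OF p] X by (simp add: per_def mj_def powr_numeral)
 also have "(SUM j:S. mj (lam j) X * (per j * u j p)) =
  (SUM j:S. 2 powr (Re (s j) - 1) / Re (s j) * period D (u j) * u j p * X powr Re (s j))"
 proof (rule sum.cong[OF refl])
  fix j assume "j : S"
  hence l: "0 <= lam j" "lam j < 1" by (auto simp: S_def)
  have "Re (s j) = 1 + sqrt (1 - lam j)" using s_real[OF l] by simp
  moreover have "period D (u j) = per j" by (simp add: period_def per_def MD_int)
  ultimately show "mj (lam j) X * (per j * u j p) = 2 powr (Re (s j) - 1) / Re (s j) * period D (u j) * u j p * X powr Re (s j)"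
  using l by (simp add: mj_def)
 qed
 finally show ?thesis unfolding main_M_def S area_def vol_def by simp
qed

text \<open>Here \<open>q\<close> is the cube root of \<open>X\<close> and
  \<open>al = 1 + 10 et\<close> the stretch from \<open>BB_sandwich\<close>, with
  \<open>(al - 1) x \<le> q / 4\<close>. Stretch, \<open>de\<close> and the free shift
  \<open>r\<close> together move the radius by at most \<open>q\<close>, hence the main term by
  \<open>O(q^4)\<close>. By monotonicity every \<open>r\<close> in an interval of length
  \<open>q / 16\<close> is admissible: upwards for an excess of the count, downwards for a
  deficit.\<close>

lemma err_pointwise:
 assumes p: "p : H3" and q: "q > 0" "q ^ 3 > 2" and x: "q ^ 3 <= x" "x <= 2 * q ^ 3"
 defines "al \<equiv> 1 + 1 / (8 * q^2)" and "de \<equiv> q / 16" and "et \<equiv> 1 / (80 * q^2)"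
 shows "0 <= r ==> r <= q / 16 ==>
  q ^ 3 / 2 <= al * x + r & al * x + r <= 3 * q ^ 3 &
  real (count_N Ga p x) - main_M F D u s p x <= \<bar>ZZ p de et (al * x + r)\<bar> + 40 * q ^ 4 * (area * CL)"
  "0 <= r ==> r <= q / 16 ==>
  q ^ 3 / 2 <= x / al - de - r & x / al - de - r <= 3 * q ^ 3 &
  main_M F D u s p x - real (count_N Ga p x) <= \<bar>ZZ p de et (x / al - de - r)\<bar> + 40 * q ^ 4 * (area * CL)"
proof -
 have q54: "q >= 5 / 4" proof (rule ccontr)
  assume "~ q >= 5 / 4"
  hence "q ^ 3 <= (5 / 4) ^ 3" using q by (intro power_mono) auto
  thus False using q(2) by (simp add: power3_eq_cube)
 qed
 have q2: "q^2 >= 25 / 16" using power_mono[OF q54, of 2] by (simp add: power2_eq_square)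
 have q3: "q ^ 3 = q^2 * q" by (simp add: power3_eq_cube power2_eq_square)
 have qq3: "q <= q ^ 3" "q ^ 3 >= 25 / 16 * q" unfolding q3 using q2 q(1) mult_right_mono[OF q2, of q] by simp_all
 have q4: "q ^ 4 = q ^ 3 * q" "q ^ 3 <= q ^ 4" "q^2 <= q ^ 4"
  using q54 power_increasing[of 3 4 q] power_increasing[of 2 4 q] by (simp_all add: power_numeral_reduce power2_eq_square)
 have al: "al > 1" "al = 1 + 10 * et" using q by (auto simp: al_def et_def)
 have et: "0 < et" "et <= 1 / 2" proof -
  show "0 < et" using q by (simp add: et_def)
  have "1 / (80 * q^2) <= 1 / 2" using q2 by (intro divide_left_mono) auto
  thus "et <= 1 / 2" by (simp add: et_def)
 qed
 have de: "de > 0" using q by (simp add: de_def)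
 have x0: "x > 0" "x >= 2" using x q by linarith+
 have M: "main_M F D u s p x = MJ p x" by (rule main_M_eq[OF p x0(1)])
 have xa: "(al - 1) * x <= q / 4" proof -
  have "(al - 1) * x <= 1 / (8 * q^2) * (2 * q ^ 3)" unfolding al_def using x q by (intro mult_mono) auto
  also have "... = q / 4" using q by (simp add: q3)
  finally show ?thesis .
 qed
 have a0: "area * CL >= 0" using area_nonneg CL_nonneg by simp
 \<comment> \<open>The pieces are \<open>12 + 2 + 1\<close> from \<open>BB_main\<close> and 6 from
   \<open>MJ_diff\<close>; 40 is a generous bound for their sum 21.\<close>
 have key: "\<bar>BB p de et Y - MJ p x\<bar> <= \<bar>ZZ p de et Y\<bar> + 40 * q ^ 4 * (area * CL)"
  if Y: "11 / 10 <= Y" "Y <= 3 * q ^ 3" "\<bar>Y - x\<bar> <= q" for Y proof -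
  have b1: "4 * Y <= 12 * q ^ 4" using Y(2) q4(2) by linarith
  have b2: "6 * Y * de <= 2 * q ^ 4" proof -
  have "6 * Y * de <= 6 * (3 * q ^ 3) * (q / 16)" unfolding de_def using Y q by (intro mult_mono) auto
  also have "... = 18 / 16 * q ^ 4" by (simp add: q4(1))
  also have "... <= 2 * q ^ 4" using q by (intro mult_right_mono) auto
  finally show ?thesis .
  qed
  have b3: "et^2 * (2 * Y^2) <= q ^ 4" proof -
  have "et^2 * (2 * Y^2) = 2 * (et * Y)^2" by (simp add: power_mult_distrib)
  also have "... <= 2 * (q * (3 / 80))^2" proof (intro mult_left_mono power_mono)
  have "et * Y <= et * (3 * q ^ 3)" using Y et by (intro mult_left_mono) auto
  also have "... = q * (3 / 80)" using q by (simp add: et_def q3)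
  finally show "et * Y <= q * (3 / 80)" .
  qed (use et Y in auto)
  also have "... <= q^2" using zero_le_power2[of q] by (simp add: power_mult_distrib power2_eq_square)
  finally show ?thesis using q4(3) by linarith
  qed
  have b4: "2 * (3 * q ^ 3) * \<bar>Y - x\<bar> <= 6 * q ^ 4" proof -
  have "2 * (3 * q ^ 3) * \<bar>Y - x\<bar> <= 2 * (3 * q ^ 3) * q" using Y(3) q by (intro mult_left_mono) auto
  thus ?thesis by (simp add: q4(1))
  qed
  have c1: "\<bar>BB p de et Y - MJ p Y - ZZ p de et Y\<bar> <= 15 * q ^ 4 * (area * CL)"
  by (rule BB_main[OF p Y(1) de et(1), THEN order_trans]) (use et b1 b2 b3 a0 in "auto intro!: mult_right_mono")
  have c2: "\<bar>MJ p Y - MJ p x\<bar> <= 6 * q ^ 4 * (area * CL)"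
  by (rule order_trans[OF MJ_diff[OF p, of x "3 * q ^ 3" Y] mult_right_mono[OF b4 a0]]) (use x x0 Y q in auto)
  have c3: "21 * q ^ 4 * (area * CL) <= 40 * q ^ 4 * (area * CL)" using a0 q by (intro mult_right_mono) auto
  have comb: "\<bar>b - m\<bar> <= \<bar>z\<bar> + 40 * e" if "\<bar>b - n - z\<bar> <= 15 * e" "\<bar>n - m\<bar> <= 6 * e" "21 * e <= 40 * e" for b m n z e :: real
  using that by linarith
  show ?thesis
  using comb[of "BB p de et Y" "MJ p Y" "ZZ p de et Y" "q ^ 4 * (area * CL)" "MJ p x"] c1 c2 c3 by (simp add: mult.assoc)
 qed
 show "q ^ 3 / 2 <= al * x + r & al * x + r <= 3 * q ^ 3 &
  real (count_N Ga p x) - main_M F D u s p x <= \<bar>ZZ p de et (al * x + r)\<bar> + 40 * q ^ 4 * (area * CL)"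
  if r: "0 <= r" "r <= q / 16" proof -
  define Y where "Y = al * x + r"
  have Yx: "Y - x = (al - 1) * x + r" by (simp add: Y_def left_diff_distrib)
  have ax: "(al - 1) * x >= 0" using al x0 by simp
  have d: "0 <= Y - x" "Y - x <= q" unfolding Yx using ax xa r q by linarith+
  have Y: "11 / 10 <= Y" "Y <= 3 * q ^ 3" "\<bar>Y - x\<bar> <= q" "q ^ 3 / 2 <= Y" using d x x0 qq3 q by linarith+
  have "x <= Y / al" using al(1) r(1) by (simp add: Y_def le_divide_eq mult.commute)
  hence "real (count_N Ga p x) <= real (count_N Ga p (Y / (1 + 10 * et)))"
  unfolding al(2) using count_N_mono[OF p] by simp
  also have "... <= BB p de et Y" by (rule BB_sandwich(1)[OF p _ de et]) (use Y in simp)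
  finally have "real (count_N Ga p x) - MJ p x <= \<bar>ZZ p de et Y\<bar> + 40 * q ^ 4 * (area * CL)"
  using key[OF Y(1-3)] by linarith
  thus ?thesis using Y unfolding M Y_def by simp
 qed
 show "q ^ 3 / 2 <= x / al - de - r & x / al - de - r <= 3 * q ^ 3 &
  main_M F D u s p x - real (count_N Ga p x) <= \<bar>ZZ p de et (x / al - de - r)\<bar> + 40 * q ^ 4 * (area * CL)"
  if r: "0 <= r" "r <= q / 16" proof -
  define Y where "Y = x / al - de - r"
  have "x / al * al = x" using al by simp
  have xd: "x / al <= x" using al x0 by (simp add: divide_le_eq)
  have "x - x / al = (al - 1) * (x / al)"
  using \<open>x / al * al = x\<close> unfolding left_diff_distrib by (simp only: mult.commute[of al] mult_1)
  also have "... <= (al - 1) * x" using al xd by (intro mult_left_mono) auto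
  finally have xd2: "x - x / al <= q / 4" using xa by linarith
  have d: "0 <= x - Y" "x - Y <= 3 / 8 * q" unfolding Y_def using xd xd2 r de by (auto simp: de_def)
  have "25 / 16 * q - 3 / 8 * q >= 11 / 10" using q54 by simp
  hence Y: "11 / 10 <= Y" "Y <= 3 * q ^ 3" "\<bar>Y - x\<bar> <= q" "q ^ 3 / 2 <= Y" using d x x0 qq3 q by linarith+
  have "BB p de et Y <= real (count_N Ga p ((1 + 10 * et) * (Y + de)))"
  by (rule BB_sandwich(2)[OF p _ de et]) (use Y in simp)
  also have "... <= real (count_N Ga p x)" proof -
  have "al * (Y + de) = x - al * r" using al(1) by (simp add: Y_def right_diff_distrib)
  also have "... <= x" using al r by simp
  finally show ?thesis unfolding al(2) using count_N_mono[OF p] by simp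
  qed
  finally have "MJ p x - real (count_N Ga p x) <= \<bar>ZZ p de et Y\<bar> + 40 * q ^ 4 * (area * CL)"
  using key[OF Y(1-3)] by linarith
  thus ?thesis using Y unfolding M Y_def by simp
 qed
qed

end

lemma cube_root_powers:
 fixes X :: real assumes X: "X > 2"
 defines "q \<equiv> X powr (1 / 3)"
 shows "q > 0" "q ^ 3 = X" "q^2 = X powr (2 / 3)" "q ^ 8 = X powr (2 + 2 / 3)" "1 <= 2 * ln X" proof -
 show "q > 0" using X by (simp add: q_def)
 show "q ^ 3 = X" "q^2 = X powr (2 / 3)" "q ^ 8 = X powr (2 + 2 / 3)"
  using X by (simp_all add: q_def powr_powr flip: powr_realpow)
 have "ln 2 < ln X" using X by simp
 moreover have "1 / 2 <= ln (2::real)" using ln2_ge_two_thirds by linarith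
 ultimately show "1 <= 2 * ln X" by linarith
qed

section \<open>Mean squares over separated points and over an interval\<close>

context spectral
begin

abbreviation "err \<equiv> err_E Ga F D u s"

text \<open>Besides \<open>Ga\<close> and \<open>c\<close> only \<open>area\<close> enters, which is
  the same for all admissible \<open>D\<close> by \<open>area_unique\<close>. The minimum reflects
  the two cases for the length \<open>De\<close> of the intervals.\<close>

definition C1 :: "real => real" where
 "C1 c = 3200 * (area * CL)^2 + 320 * KZ * area^2 / min (c / 2) (1 / 16)"

definition C2 :: real where
 "C2 = 3200 * (area * CL)^2 + 640 * KZ * area^2"

lemma KZ_nonneg: "KZ >= 0" unfolding KZ_def by (intro mult_nonneg_nonneg CW_nonneg CB_nonneg) auto

lemma ZZ_total:
 assumes p: "p : H3" and q: "q > 0" "q ^ 3 > 2"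
 shows "(nn_integral lborel (%Y. ennreal ((ZZ p (q / 16) (1 / (80 * q^2)) Y)^2) * indicator {q ^ 3 / 2..3 * q ^ 3} Y)) <= ennreal (80 * KZ * area^2 * q ^ 11)"
  "(%Y. ennreal ((ZZ p (q / 16) (1 / (80 * q^2)) Y)^2) * indicator {q ^ 3 / 2..3 * q ^ 3} Y) : borel_measurable borel"
proof -
 have q1: "q >= 1" proof (rule ccontr)
  assume "~ q >= 1"
  hence "q ^ 3 <= 1 ^ 3" using q by (intro power_mono) auto
  thus False using q by simp
 qed
 hence q2: "q^2 >= 1" by (rule one_le_power)
 have qq: "q <= q ^ 3" using q1 power_increasing[of 1 3 q] by simp
 have et: "0 < 1 / (80 * q^2)" "1 / (80 * q^2) <= 1" using q q2 by (auto simp: divide_le_eq)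
 have eq: "KZ * area^2 * (q ^ 3) ^ 3 / (1 / (80 * q^2)) = 80 * KZ * area^2 * q ^ 11"
  by (simp flip: power_mult power_add)
 note main = ZZ_mean_square[OF p _ et, of "q / 16" "q ^ 3" "q ^ 3 / 2" "3 * q ^ 3"]
 show "(nn_integral lborel (%Y. ennreal ((ZZ p (q / 16) (1 / (80 * q^2)) Y)^2) * indicator {q ^ 3 / 2..3 * q ^ 3} Y)) <= ennreal (80 * KZ * area^2 * q ^ 11)"
  unfolding eq[symmetric] by (rule main(1)) (use q qq in auto)
 show "(%Y. ennreal ((ZZ p (q / 16) (1 / (80 * q^2)) Y)^2) * indicator {q ^ 3 / 2..3 * q ^ 3} Y) : borel_measurable borel"
  by (rule main(2)) (use q qq in auto)
qed

lemma sq_le_of_bound: "E^2 - 2 * B^2 <= 2 * z^2" if "0 <= E" "E <= \<bar>z\<bar> + B" for E B z :: real proof -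
 have "E^2 <= (\<bar>z\<bar> + B)^2" using that by (intro power_mono) auto
 moreover have "2 * \<bar>z\<bar> * B <= \<bar>z\<bar>^2 + B^2" by (rule sum_squares_bound)
 ultimately show ?thesis by (simp add: power2_sum)
qed

lemma discrete_mean_square:
 assumes p: "p : H3" and X: "X > 2" and c: "c > 0" and eps: "ep > 0" and x: "!!k. k : {1..R} ==> x k : {X..2 * X}"
  and sep: "!!k l. k : {1..R} ==> l : {1..R} ==> k ~= l ==> \<bar>x k - x l\<bar> > ep"
  and R: "real R * ep >= c * X" "real R > X powr (2 / 3)"
 shows "1 / real R * (\<Sum>k = 1..R. \<bar>err p (x k)\<bar>^2) <= 2 * C1 c * X powr (2 + 2 / 3) * ln X" proof -
 define q where "q = X powr (1 / 3)"
 have q: "q > 0" "q ^ 3 = X" "q^2 = X powr (2 / 3)" "q ^ 8 = X powr (2 + 2 / 3)" "1 <= 2 * ln X"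
  unfolding q_def using cube_root_powers[OF X] by auto
 have q32: "q ^ 3 > 2" using q X by simp
 define al where "al = 1 + 1 / (8 * q^2)"
 define Z where "Z = ZZ p (q / 16) (1 / (80 * q^2))"
 define B where "B = 40 * q ^ 4 * (area * CL)"
 define W where "W = 80 * KZ * area^2 * q ^ 11"
 \<comment> \<open>Half the separation, because division by \<open>al \<le> 2\<close> may halve
   distances, and at most the length \<open>q / 16\<close> available in
   \<open>err_pointwise\<close>.\<close>
 define De where "De = min (ep / 2) (q / 16)"
 define e where "e k = (err p (x k))^2 - 2 * B^2" for k
 define g where "g Y = ennreal (2 * (Z Y)^2) * indicator {q ^ 3 / 2..3 * q ^ 3} Y" for Y
 have W0: "W >= 0" unfolding W_def using KZ_nonneg q by (intro mult_nonneg_nonneg) auto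
 have De: "De > 0" "De <= ep / 2" "De <= q / 16" using eps q by (auto simp: De_def)
 have al: "1 < al" "al <= 2" proof -
  show "1 < al" unfolding al_def using q(1) by simp
  have "1 <= q^2" unfolding q(3) using X by (intro ge_one_powr_ge_zero) auto
  hence "1 / (8 * q^2) <= 1" by (simp add: divide_le_eq)
  thus "al <= 2" by (simp add: al_def)
 qed
 have xq: "q ^ 3 <= x k" "x k <= 2 * q ^ 3" if "k : {1..R}" for k using x[OF that] q by auto
 note pw = err_pointwise[OF p q(1) q32 xq, folded al_def Z_def B_def]
 have g2: "(nn_integral lborel (%Y. g Y)) <= ennreal (2 * W)" proof -
  have "(nn_integral lborel (%Y. g Y)) = (nn_integral lborel (%Y. 2 * (ennreal ((Z Y)^2) * indicator {q ^ 3 / 2..3 * q ^ 3} Y)))"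
  by (simp add: g_def ennreal_mult mult.assoc)
  also have "... = 2 * (nn_integral lborel (%Y. ennreal ((Z Y)^2) * indicator {q ^ 3 / 2..3 * q ^ 3} Y))"
  by (rule nn_integral_cmult) (use ZZ_total(2)[OF p q(1) q32] in "simp add: Z_def")
  also have "... <= 2 * ennreal W" unfolding Z_def W_def by (intro mult_left_mono ZZ_total p q q32) auto
  also have "... = ennreal (2 * W)" using W0 by (simp add: ennreal_mult)
  finally show ?thesis .
 qed
 have half: "(SUM k:K. max 0 (e k)) * De <= 2 * W"
  if K: "K \<subseteq> {1..R}" and sepy: "!!k l. k : K ==> l : K ==> k ~= l ==> \<bar>y k - y l\<bar> >= De"
  and le: "!!k Y. k : K ==> y k <= Y ==> Y < y k + De ==> Y : {q ^ 3 / 2..3 * q ^ 3} & e k <= 2 * (Z Y)^2" for K and y :: "nat => real"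
 proof -
  have fK: "finite K" using K finite_subset by blast
  have "ennreal ((SUM k:K. max 0 (e k)) * De) = (SUM k:K. ennreal (max 0 (e k) * De))"
  unfolding sum_distrib_right using De by (intro sum_ennreal[symmetric]) simp
  also have "... = (SUM k:K. ennreal (e k) * ennreal De)" proof (rule sum.cong[OF refl])
  fix k
  have "ennreal (max 0 (e k)) = ennreal (e k)" by (simp add: max_def ennreal_neg)
  thus "ennreal (max 0 (e k) * De) = ennreal (e k) * ennreal De" using De(1) by (simp add: ennreal_mult)
  qed
  also have "... <= (nn_integral lborel (%Y. g Y))"
  by (rule separated_sum[OF fK De(1) sepy]) (use le in "auto simp: g_def intro!: ennreal_leI")
  also note g2
  finally show ?thesis using W0 by (simp add: ennreal_le_iff)
 qed
 \<comment> \<open>Positive errors are charged to intervals to the right of \<open>al x\<close>,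
   negative ones to intervals to the left of \<open>x / al - q / 16\<close>. Disjointness is needed
   only within each class.\<close>
 define K1 K2 where "K1 = {k : {1..R}. err p (x k) >= 0}" and "K2 = {k : {1..R}. ~ err p (x k) >= 0}"
 have h1: "(SUM k:K1. max 0 (e k)) * De <= 2 * W" proof (rule half[where y = "%k. al * x k"])
  show "K1 \<subseteq> {1..R}" by (auto simp: K1_def)
  show "\<bar>al * x k - al * x l\<bar> >= De" if "k : K1" "l : K1" "k ~= l" for k l proof -
  have "De <= 1 * \<bar>x k - x l\<bar>" using sep[of k l] that De eps by (auto simp: K1_def)
  also have "... <= al * \<bar>x k - x l\<bar>" using al by (intro mult_right_mono) auto
  also have "... = \<bar>al * x k - al * x l\<bar>" using al by (simp add: abs_mult flip: right_diff_distrib)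
  finally show ?thesis .
  qed
  fix k Y assume k: "k : K1" and Y: "al * x k <= Y" "Y < al * x k + De"
  have k': "k : {1..R}" "err p (x k) >= 0" using k by (auto simp: K1_def)
  have "0 <= Y - al * x k" "Y - al * x k <= q / 16" using Y De by auto
  from pw(1)[OF k'(1) k'(1) this] have "Y : {q ^ 3 / 2..3 * q ^ 3}" "err p (x k) <= \<bar>Z Y\<bar> + B"
  by (auto simp: err_E_def)
  thus "Y : {q ^ 3 / 2..3 * q ^ 3} & e k <= 2 * (Z Y)^2" unfolding e_def using sq_le_of_bound[OF k'(2)] by blast
 qed
 have h2: "(SUM k:K2. max 0 (e k)) * De <= 2 * W" proof (rule half[where y = "%k. x k / al - q / 16 - De"])
  show "K2 \<subseteq> {1..R}" by (auto simp: K2_def)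
  show "\<bar>(x k / al - q / 16 - De) - (x l / al - q / 16 - De)\<bar> >= De" if "k : K2" "l : K2" "k ~= l" for k l
  proof -
  have "De <= \<bar>x k - x l\<bar> / 2" using sep[of k l] that De by (auto simp: K2_def)
  also have "... <= \<bar>x k - x l\<bar> / al" using al by (intro divide_left_mono) auto
  also have "... = \<bar>(x k / al - q / 16 - De) - (x l / al - q / 16 - De)\<bar>"
  using al by (simp add: abs_divide flip: diff_divide_distrib)
  finally show ?thesis .
  qed
  fix k Y assume k: "k : K2" and Y: "x k / al - q / 16 - De <= Y" "Y < x k / al - q / 16 - De + De"
  have k': "k : {1..R}" "- err p (x k) >= 0" using k by (auto simp: K2_def)
  define r where "r = x k / al - q / 16 - Y"
  have r: "0 <= r" "r <= q / 16" "x k / al - q / 16 - r = Y" using Y De(3) unfolding r_def by linarith+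
  from pw(2)[OF k'(1) k'(1) r(1,2)] have "Y : {q ^ 3 / 2..3 * q ^ 3}" "- err p (x k) <= \<bar>Z Y\<bar> + B"
  unfolding r(3) by (auto simp: err_E_def)
  thus "Y : {q ^ 3 / 2..3 * q ^ 3} & e k <= 2 * (Z Y)^2"
  unfolding e_def using sq_le_of_bound[OF k'(2), of "Z Y" B] by simp
 qed
 have R0: "real R > 0" using R(2) powr_ge_zero[of X "2 / 3"] by linarith
 have "(\<Sum>k = 1..R. (err p (x k))^2) = (\<Sum>k = 1..R. e k) + real R * (2 * B^2)"
  by (simp add: e_def sum_subtractf)
 also have "(\<Sum>k = 1..R. e k) <= (\<Sum>k = 1..R. max 0 (e k))" by (rule sum_mono) simp
 also have "... = (SUM k:K1. max 0 (e k)) + (SUM k:K2. max 0 (e k))"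
  unfolding K1_def K2_def by (subst sum.union_disjoint[symmetric]) (auto intro!: sum.cong)
 also have "... <= 4 * W / De" using h1 h2 De(1) by (simp add: le_divide_eq distrib_right)
 finally have S: "(\<Sum>k = 1..R. (err p (x k))^2) <= 4 * W / De + real R * (2 * B^2)" by simp
 define m where "m = min (c / 2) (1 / 16)"
 have m0: "m > 0" using c by (simp add: m_def)
 \<comment> \<open>Both lower bounds for \<open>R\<close> meet here:
   \<open>R \<epsilon> \<ge> c X\<close> if the separation determines \<open>De\<close>, and
   \<open>R > q^2\<close> if \<open>q / 16\<close> does. Either way \<open>R De\<close> is at least
   a fixed multiple of \<open>X\<close>.\<close>
 have RDe: "m * q ^ 3 <= real R * De" proof (cases "ep / 2 <= q / 16")
  case True
  have "m * q ^ 3 <= c / 2 * q ^ 3" using q by (intro mult_right_mono) (auto simp: m_def)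
  also have "... <= real R * (ep / 2)" using R(1) q(2) by simp
  finally show ?thesis using True by (simp add: De_def)
 next
  case False
  have "m * q ^ 3 <= 1 / 16 * q ^ 3" using q by (intro mult_right_mono) (auto simp: m_def)
  also have "... = q^2 * (q / 16)" by (simp add: power2_eq_square power3_eq_cube)
  also have "... <= real R * (q / 16)" using R(2) q by (intro mult_right_mono) auto
  finally show ?thesis using False by (simp add: De_def)
 qed
 have "1 / real R * (\<Sum>k = 1..R. \<bar>err p (x k)\<bar>^2) <= 1 / real R * (4 * W / De + real R * (2 * B^2))"
  unfolding power2_abs using S R0 by (intro mult_left_mono) auto
 also have "... = 4 * W / (real R * De) + 2 * B^2" using R0 by (simp add: distrib_left)
 also have "... <= 4 * W / (m * q ^ 3) + 2 * B^2"
  using RDe m0 q(1) W0 by (intro add_right_mono divide_left_mono) (auto intro!: mult_pos_pos R0 De)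
 also have "4 * W / (m * q ^ 3) = 320 * KZ * area^2 / m * q ^ 8" proof -
  have "q ^ 11 = q ^ 8 * q ^ 3" by (simp flip: power_add)
  hence "4 * W = 320 * KZ * area^2 * q ^ 8 * q ^ 3" by (simp only: W_def)
  moreover have "q ^ 3 ~= 0" using q(1) by simp
  ultimately show ?thesis using m0 by (simp only:) simp
 qed
 also have "2 * B^2 = 3200 * (area * CL)^2 * q ^ 8" by (simp add: B_def power_mult_distrib flip: power_mult)
 finally have "1 / real R * (\<Sum>k = 1..R. \<bar>err p (x k)\<bar>^2) <= C1 c * q ^ 8"
  by (simp add: C1_def m_def distrib_right)
 \<comment> \<open>The mean square is already \<open>O(q^8)\<close>, that is \<open>X\<close> to the
   power \<open>2 + 2/3\<close>; the logarithm enters through \<open>1 \<le> 2 ln X\<close> for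
   \<open>X > 2\<close>.\<close>
 also have "... * 1 <= C1 c * q ^ 8 * (2 * ln X)" proof (rule mult_left_mono[OF q(5)])
  have "0 <= C1 c" unfolding C1_def using KZ_nonneg c by (intro add_nonneg_nonneg divide_nonneg_nonneg mult_nonneg_nonneg) auto
  thus "0 <= C1 c * q ^ 8" using q by simp
 qed
 finally show ?thesis unfolding q(4) by (simp add: mult_ac)
qed

text \<open>Obtained directly from \<open>err_pointwise\<close> instead of from the discrete sum:
  with shift \<open>r = 0\<close> the error at \<open>t\<close> is bounded through the remainder at
  \<open>al t\<close> or at \<open>t / al - q / 16\<close>, and both substitutions have slope at
  least 1/2.\<close>

lemma continuous_mean_square:
 assumes p: "p : H3" and X: "X > 2"
 shows "1 / X * integral {X..2 * X} (%t. \<bar>err p t\<bar>^2) <= 2 * C2 * X powr (2 + 2 / 3) * ln X" proof -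
 define q where "q = X powr (1 / 3)"
 have q: "q > 0" "q ^ 3 = X" "q^2 = X powr (2 / 3)" "q ^ 8 = X powr (2 + 2 / 3)" "1 <= 2 * ln X"
  unfolding q_def using cube_root_powers[OF X] by auto
 have q32: "q ^ 3 > 2" using q X by simp
 define al where "al = 1 + 1 / (8 * q^2)"
 define Z where "Z = ZZ p (q / 16) (1 / (80 * q^2))"
 define B where "B = 40 * q ^ 4 * (area * CL)"
 define W where "W = 80 * KZ * area^2 * q ^ 11"
 define g where "g Y = ennreal ((Z Y)^2) * indicator {q ^ 3 / 2..3 * q ^ 3} Y" for Y
 have W0: "W >= 0" unfolding W_def using KZ_nonneg q by (intro mult_nonneg_nonneg) auto
 have gm [measurable]: "g : borel_measurable borel" unfolding g_def Z_def by (rule ZZ_total(2)[OF p q(1) q32])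
 have gW: "(nn_integral lborel (%Y. g Y)) <= ennreal W"
  unfolding g_def Z_def W_def by (rule ZZ_total(1)[OF p q(1) q32])
 have al: "1 < al" "al <= 2" proof -
  show "1 < al" unfolding al_def using q(1) by simp
  have "1 <= q^2" unfolding q(3) using X by (intro ge_one_powr_ge_zero) auto
  hence "1 / (8 * q^2) <= 1" by (simp add: divide_le_eq)
  thus "al <= 2" by (simp add: al_def)
 qed
 define f where "f t = (err p t)^2" for t
 have C20: "0 <= C2" unfolding C2_def using KZ_nonneg by (intro add_nonneg_nonneg mult_nonneg_nonneg) auto
 have main: "integral {X..2 * X} f <= C2 * q ^ 8 * X" proof (cases "f integrable_on {X..2 * X}")
  \<comment> \<open>A non-integrable function has integral 0 by convention, which is below the
    bound.\<close>
  case False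
  thus ?thesis using C20 q X by (simp add: not_integrable_integral)
 next
  case True
  have pt: "ennreal (f t) * indicator {X..2 * X} t \<le>
  ennreal (2 * B^2) * indicator {X..2 * X} t + (2 * g (0 + al * t) + 2 * g (- (q / 16) + 1 / al * t))" for t
  proof (cases "t : {X..2 * X}")
  case t: True
  have tq: "q ^ 3 <= t" "t <= 2 * q ^ 3" using t q by auto
  note pw = err_pointwise[OF p q(1) q32 tq, of 0, folded al_def Z_def B_def]
  have q0: "(0::real) <= 0" "0 <= q / 16" using q by auto
  have two: "2 * g Y = ennreal (2 * (Z Y)^2)" if "Y : {q ^ 3 / 2..3 * q ^ 3}" for Y
  using that by (simp add: g_def ennreal_mult)
  show ?thesis proof (cases "err p t >= 0")
  case True
  from pw(1)[OF q0] have a: "al * t : {q ^ 3 / 2..3 * q ^ 3}" "err p t <= \<bar>Z (al * t)\<bar> + B" by (auto simp: err_E_def)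
  have "ennreal (f t) <= ennreal (2 * B^2 + 2 * (Z (al * t))^2)"
  unfolding f_def using sq_le_of_bound[OF True a(2)] by (intro ennreal_leI) simp
  also have "... = ennreal (2 * B^2) + 2 * g (0 + al * t)" using two[OF a(1)] by (simp add: ennreal_plus)
  also have "... <= ennreal (2 * B^2) + (2 * g (0 + al * t) + 2 * g (- (q / 16) + 1 / al * t))"
  by (intro add_left_mono) simp
  finally show ?thesis using t by simp
  next
  case False
  have e: "- (q / 16) + 1 / al * t = t / al - q / 16 - 0" by simp
  from pw(2)[OF q0] have a: "t / al - q / 16 - 0 : {q ^ 3 / 2..3 * q ^ 3}" "- err p t <= \<bar>Z (t / al - q / 16 - 0)\<bar> + B"
  by (auto simp: err_E_def)
  have "ennreal (f t) <= ennreal (2 * B^2 + 2 * (Z (t / al - q / 16 - 0))^2)"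
  unfolding f_def using sq_le_of_bound[OF _ a(2)] False by (intro ennreal_leI) simp
  also have "... = ennreal (2 * B^2) + 2 * g (- (q / 16) + 1 / al * t)" unfolding e two[OF a(1)] by (simp add: ennreal_plus)
  also have "... <= ennreal (2 * B^2) + (2 * g (0 + al * t) + 2 * g (- (q / 16) + 1 / al * t))"
  by (intro add_left_mono) simp
  finally show ?thesis using t by simp
  qed
  qed simp
  have aff: "(nn_integral lborel (%t. g (b + a * t))) <= ennreal (2 * W)" if a: "1 / 2 <= a" for a b proof -
  have "ennreal \<bar>a\<bar> * (nn_integral lborel (%t. g (b + a * t))) <= ennreal W"
  using gW nn_integral_real_affine[OF gm, of a b] a by simp
  hence "ennreal 2 * (ennreal \<bar>a\<bar> * (nn_integral lborel (%t. g (b + a * t)))) <= ennreal 2 * ennreal W"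
  by (rule mult_left_mono) simp
  hence "ennreal (2 * \<bar>a\<bar>) * (nn_integral lborel (%t. g (b + a * t))) <= ennreal (2 * W)"
  using W0 by (simp add: ennreal_mult mult.assoc)
  moreover have "1 * (nn_integral lborel (%t. g (b + a * t))) <= ennreal (2 * \<bar>a\<bar>) * (nn_integral lborel (%t. g (b + a * t)))"
  using a by (intro mult_right_mono) (auto simp: ennreal_1[symmetric] simp del: ennreal_1 intro!: ennreal_leI)
  ultimately show ?thesis by simp
  qed
  have "ennreal (integral {X..2 * X} f) = (nn_integral lborel (%t. ennreal (f t) * indicator {X..2 * X} t))"
  by (rule nn_integral_has_integral_lebesgue'[symmetric, OF _ integrable_integral[OF True]]) (simp add: f_def)
  also have "... <= (nn_integral lborel (%t. ennreal (2 * B^2) * indicator {X..2 * X} t + (2 * g (0 + al * t) + 2 * g (- (q / 16) + 1 / al * t))))"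
  by (rule nn_integral_mono) (rule pt)
  also have "... = ennreal (2 * B^2) * ennreal X + (2 * (nn_integral lborel (%t. g (0 + al * t))) + 2 * (nn_integral lborel (%t. g (- (q / 16) + 1 / al * t))))"
  proof -
  have m1: "(%t. g (0 + al * t)) : borel_measurable lborel" "(%t. g (- (q / 16) + 1 / al * t)) : borel_measurable lborel"
  by measurable
  have "(nn_integral lborel (%t. ennreal (2 * B^2) * indicator {X..2 * X} t)) = ennreal (2 * B^2) * ennreal X"
  using X by (subst nn_integral_cmult_indicator) auto
  thus ?thesis using m1 by (simp add: nn_integral_add nn_integral_cmult)
  qed
  also have "... <= ennreal (2 * B^2) * ennreal X + (2 * ennreal (2 * W) + 2 * ennreal (2 * W))"
  using al by (intro add_left_mono add_mono mult_left_mono aff) (auto simp: divide_le_eq le_divide_eq)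
  also have "... = ennreal (2 * B^2 * X + 8 * W)"
  using W0 X by (simp add: ennreal_mult[symmetric] ennreal_plus[symmetric] del: ennreal_plus flip: ennreal_numeral)
  finally have "integral {X..2 * X} f <= 2 * B^2 * X + 8 * W" using W0 X by (subst (asm) ennreal_le_iff) auto
  also have "2 * B^2 = 3200 * (area * CL)^2 * q ^ 8" by (simp add: B_def power_mult_distrib flip: power_mult)
  also have "8 * W = 640 * KZ * area^2 * q ^ 8 * X" proof -
  have "q ^ 11 = q ^ 8 * X" unfolding q(2)[symmetric] by (simp flip: power_add)
  thus ?thesis by (simp add: W_def)
  qed
  finally show ?thesis by (simp add: C2_def distrib_right)
 qed
 have "1 / X * integral {X..2 * X} (%t. \<bar>err p t\<bar>^2) <= 1 / X * (C2 * q ^ 8 * X)"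
  unfolding power2_abs using main X by (intro mult_left_mono) (auto simp: f_def[abs_def])
 also have "... = C2 * q ^ 8 * 1" using X by simp
 also have "... <= C2 * q ^ 8 * (2 * ln X)" by (rule mult_left_mono[OF q(5)]) (use C20 q in simp)
 finally show ?thesis unfolding q(4) by (simp add: mult_ac)
qed

end

lemma area_unique:
 assumes "spectral Ga F D u lam s" "spectral Ga F' D' u' lam' s'" shows "spectral.area D = spectral.area D'" proof -
 interpret A: spectral Ga F D u lam s by (rule assms)
 interpret B: spectral Ga F' D' u' lam' s' by (rule assms)
 have "emeasure har D = emeasure har D'"
  using A.area_minimal[OF B.Dh(1,3)] B.area_minimal[OF A.Dh(1,3)] by (rule antisym)
 thus ?thesis unfolding A.area_def B.area_def measure_def by (simp add: A.emeasure_har_D B.emeasure_har_D)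
qed

theorem theorem4:
  fixes \<Gamma> :: "(complex^2^2) set set" and p :: point
  assumes "discrete_subgroup \<Gamma>" and "cocompact \<Gamma>" and "p \<in> H3"
  shows "\<forall>c::real>0. \<exists>C::real. \<forall>F D u lam s.
    fundamental_domain \<Gamma> H3 hyp_vol F \<and>
    fundamental_domain (plane_stab \<Gamma>) plane hyp_area D \<and> emeasure hyp_area D < \<infinity> \<and>
    eigen_system \<Gamma> F u lam s \<longrightarrow>
      (\<forall>(X::real) (\<epsilon>::real) (R::nat) (x :: nat \<Rightarrow> real).
         X > 2 \<and> \<epsilon> > 0 \<and> (\<forall>k\<in>{1..R}. x k \<in> {X..2 * X}) \<and>
         (\<forall>k\<in>{1..R}. \<forall>l\<in>{1..R}. k \<noteq> l \<longrightarrow> \<bar>x k - x l\<bar> > \<epsilon>) \<and>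
         real R * \<epsilon> \<ge> c * X \<and> real R > X powr (2 / 3) \<longrightarrow>
         1 / real R * (\<Sum>k = 1..R. \<bar>err_E \<Gamma> F D u s p (x k)\<bar>\<^sup>2) \<le> C * X powr (2 + 2 / 3) * ln X) \<and>
      (\<forall>X::real. X > 2 \<longrightarrow>
         1 / X * integral {X..2 * X} (\<lambda>t. \<bar>err_E \<Gamma> F D u s p t\<bar>\<^sup>2) \<le> C * X powr (2 + 2 / 3) * ln X)"
  (is "\<forall>c>0. \<exists>C. \<forall>F D u lam s. ?hyp F D u lam s --> ?A c C F D u s & ?B C F D u s")
proof (intro allI impI)
 fix c :: real assume c: "c > 0"
 have spec: "spectral \<Gamma> F D u lam s" if "?hyp F D u lam s" for F D u lam s
  using that assms(1,2) by (intro spectral.intro cocompact_group.intro spectral_axioms.intro) auto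
 show "\<exists>C. \<forall>F D u lam s. ?hyp F D u lam s --> ?A c C F D u s & ?B C F D u s"
 proof (cases "\<exists>F D u lam s. ?hyp F D u lam s")
  case False
  thus ?thesis by blast
 next
  case True
  then obtain F0 D0 u0 lam0 s0 where "?hyp F0 D0 u0 lam0 s0" by blast
  hence S0: "spectral \<Gamma> F0 D0 u0 lam0 s0" by (rule spec)
  \<comment> \<open>One admissible system fixes the constant for all others, since \<open>C1\<close>
    and \<open>C2\<close> depend on \<open>D\<close> through its area alone.\<close>
  define C where "C = max (2 * spectral.C1 \<Gamma> D0 c) (2 * spectral.C2 \<Gamma> D0)"
  show ?thesis proof (intro exI[of _ C] allI impI)
  fix F D u lam s assume "?hyp F D u lam s"
  hence S: "spectral \<Gamma> F D u lam s" by (rule spec)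
  interpret spectral \<Gamma> F D u lam s by (rule S)
  have a: "spectral.area D0 = area" by (rule area_unique[OF S0 S])
  have C: "2 * C1 c <= C" "2 * C2 <= C"
  unfolding C_def spectral.C1_def[OF S0] spectral.C2_def[OF S0] C1_def C2_def a by simp_all
  have mono: "K * X powr (2 + 2 / 3) * ln X <= C * X powr (2 + 2 / 3) * ln X" if "K <= C" "X > 2" for K X :: real
  using that by (intro mult_right_mono) auto
  show "?A c C F D u s & ?B C F D u s" proof (intro conjI allI impI)
  fix X ep :: real and R :: nat and x :: "nat => real"
  assume h: "X > 2 & ep > 0 & (ALL k:{1..R}. x k : {X..2 * X}) &
  (ALL k:{1..R}. ALL l:{1..R}. k ~= l --> \<bar>x k - x l\<bar> > ep) &
  real R * ep >= c * X & real R > X powr (2 / 3)"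
  have "1 / real R * (\<Sum>k = 1..R. \<bar>err_E \<Gamma> F D u s p (x k)\<bar>^2) <= 2 * C1 c * X powr (2 + 2 / 3) * ln X"
  by (rule discrete_mean_square[OF assms(3) _ c, of X ep]) (use h in auto)
  also have "... <= C * X powr (2 + 2 / 3) * ln X" using mono[OF C(1)] h by blast
  finally show "1 / real R * (\<Sum>k = 1..R. \<bar>err_E \<Gamma> F D u s p (x k)\<bar>^2) <= C * X powr (2 + 2 / 3) * ln X" .
  next
  fix X :: real assume X: "X > 2"
  show "1 / X * integral {X..2 * X} (%t. \<bar>err_E \<Gamma> F D u s p t\<bar>^2) <= C * X powr (2 + 2 / 3) * ln X"
  by (rule order_trans[OF continuous_mean_square[OF assms(3) X] mono[OF C(2) X]])
  qed
  qed
 qed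
qed

end
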